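(* Let $G$ be a non-amenable finitely generated virtually free group acting properly on a tree $X$, and let $g\in G$ fix vertices, but no edges, of $X$ (that is, $g$ fixes at least one vertex of $X$ and fixes no edge of $X$). Then the first delocalised $\ell^2$-Betti number $\beta^{(2)}_{1,\langle g\rangle}(G)$ is non-zero and satisfies $$\beta^{(2)}_{1,\langle g\rangle}(G)\in\mathcal{F}_G.$$
   Context: $\langle g\rangle$ denotes the conjugacy class of $g$ in $G$. $\mathcal{F}_G\subseteq\mathbb{Q}$ is the additive subgroup of $\mathbb{Q}$ generated by $\{1/|F| : F\le G \text{ finite}\}$. Delocalised trace: $\tau_{\langle g\rangle}:\ell^1(G)\to\mathbb{C}$, $\tau_{\langle g\rangle}(f)=\sum_{h\in\langle g\rangle}f(h)$. Finitely generated virtually free groups are hyperbolic, and for a hyperbolic group there is (Puschnigg) a smooth subalgebra $\mathcal{S}\subseteq \mathrm{C}^*_{\mathrm{red}}(G)$ (a dense Banach subalgebra, closed under holomorphic functional calculus, hence with $\mathrm{K}_0(\mathcal{S})\cong \mathrm{K}_0(\mathrm{C}^*_{\mathrm{red}}(G))$) to which $\tau_{\langle g\rangle}$ extends continuously as a trace; this gives $\tau_{\langle g\rangle}:\mathrm{K}_0(\mathrm{C}^*_{\mathrm{red}}(G))\cong \mathrm{K}_0(\mathcal{S})\to\mathbb{C}$. The $n$-th delocalised $\ell^2$-Betti number is $\beta^{(2)}_{n,\langle g\rangle}(G)=\tau_{\langle g\rangle}([p_n])$. Here $p_1$ is the higher Kazhdan projection of degree 1 for the left regular representation: take a resolution of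 the trivial $\mathbb{C}G$-module $\mathbb{C}$ by finitely generated projective modules $N_i\cong\mathbb{C}G^{\oplus k_i}q_i$ (for instance the chain complex $0\to\mathbb{C}[\mathrm{edge}\,Y]\to\mathbb{C}[\mathrm{vert}\,Y]\to\mathbb{C}\to 0$ of the Bass–Serre tree $Y$ of $G$ regarded as the fundamental group of a finite graph of finite groups), apply $\mathrm{Hom}_{\mathbb{C}G}(\cdot,\ell^2(G))$ to get a complex of Hilbert spaces $C^0\xrightarrow{d_0}C^1\xrightarrow{d_1}\cdots$, and let $p_1$ be the orthogonal projection onto $\ker\Delta_1$, $\Delta_1=d_1^*d_1+d_0d_0^*$. For non-amenable finitely generated virtually free $G$, $\Delta_1$ has a spectral gap at $0$, so $p_1$ lies in a matrix algebra over $\mathrm{C}^*_{\mathrm{red}}(G)$ and defines $[p_1]\in \mathrm{K}_0(\mathrm{C}^*_{\mathrm{red}}(G))$. *)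

theory Defs
  imports
    "HOL-Complex_Analysis.Complex_Analysis"
    "HOL-Algebra.Generated_Groups"
    "HOL-Algebra.Group_Action"
    "HOL-Computational_Algebra.Group_Closure"
    "Jordan_Normal_Form.Matrix"
begin

section \<open>The Hilbert space of square-summable functions\<close>

typedef 'a ell2 = "{f :: 'a \<Rightarrow> complex. (\<lambda>x. (cmod (f x))\<^sup>2) summable_on UNIV}"
  morphisms ell2_fun Abs_ell2
  by (rule exI[of _ "\<lambda>_. 0"]) simp

setup_lifting type_definition_ell2

lemma ell2_prod_summable:
  fixes f g :: "'a \<Rightarrow> complex"
  assumes "(\<lambda>x. (cmod (f x))\<^sup>2) summable_on UNIV" "(\<lambda>x. (cmod (g x))\<^sup>2) summable_on UNIV"
  shows "(\<lambda>x. cmod (f x) * cmod (g x)) summable_on UNIV"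
proof (rule summable_on_comparison_test)
  show "(\<lambda>x. (cmod (f x))\<^sup>2 + (cmod (g x))\<^sup>2) summable_on UNIV"
    using assms by (rule summable_on_add)
  fix x
  have "0 \<le> (cmod (f x) - cmod (g x))\<^sup>2" by simp
  moreover have "0 \<le> cmod (f x) * cmod (g x)" by simp
  ultimately show "cmod (f x) * cmod (g x) \<le> (cmod (f x))\<^sup>2 + (cmod (g x))\<^sup>2"
    unfolding power2_diff by linarith
qed simp

lemma ell2_add_summable:
  fixes f g :: "'a \<Rightarrow> complex"
  assumes "(\<lambda>x. (cmod (f x))\<^sup>2) summable_on UNIV" "(\<lambda>x. (cmod (g x))\<^sup>2) summable_on UNIV"
  shows "(\<lambda>x. (cmod (f x + g x))\<^sup>2) summable_on UNIV"
proof (rule summable_on_comparison_test)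
  show "(\<lambda>x. (cmod (f x))\<^sup>2 + (cmod (g x))\<^sup>2 + 2 * (cmod (f x) * cmod (g x))) summable_on UNIV"
    using assms ell2_prod_summable[OF assms] by (intro summable_on_add summable_on_cmult_right)
  fix x
  have "(cmod (f x + g x))\<^sup>2 \<le> (cmod (f x) + cmod (g x))\<^sup>2"
    by (intro power_mono norm_triangle_ineq) simp
  then show "(cmod (f x + g x))\<^sup>2 \<le> (cmod (f x))\<^sup>2 + (cmod (g x))\<^sup>2 + 2 * (cmod (f x) * cmod (g x))"
    unfolding power2_sum by (simp add: mult.assoc)
qed simp

lemma ell2_cinner_summable:
  fixes f g :: "'a \<Rightarrow> complex"
  assumes "(\<lambda>x. (cmod (f x))\<^sup>2) summable_on UNIV" "(\<lambda>x. (cmod (g x))\<^sup>2) summable_on UNIV"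
  shows "(\<lambda>x. cnj (f x) * g x) summable_on UNIV"
  by (rule abs_summable_summable) (use ell2_prod_summable[OF assms] in \<open>simp add: norm_mult\<close>)

instantiation ell2 :: (type) real_vector
begin

lift_definition zero_ell2 :: "'a ell2" is "\<lambda>_. 0" by simp

lift_definition uminus_ell2 :: "'a ell2 \<Rightarrow> 'a ell2" is "\<lambda>f x. - f x" by simp

lift_definition plus_ell2 :: "'a ell2 \<Rightarrow> 'a ell2 \<Rightarrow> 'a ell2" is "\<lambda>f g x. f x + g x"
  by (rule ell2_add_summable)

definition minus_ell2 :: "'a ell2 \<Rightarrow> 'a ell2 \<Rightarrow> 'a ell2" where
  "minus_ell2 \<xi> \<eta> = \<xi> + (- \<eta>)"

lift_definition scaleR_ell2 :: "real \<Rightarrow> 'a ell2 \<Rightarrow> 'a ell2" is "\<lambda>r f x. of_real r * f x"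
  by (simp add: norm_mult power_mult_distrib summable_on_cmult_right)

instance
proof
  fix a b c :: "'a ell2" and r s :: real
  show "a + b + c = a + (b + c)" by transfer (simp add: add.assoc)
  show "a + b = b + a" by transfer (simp add: add.commute)
  show "0 + a = a" by transfer simp
  show "- a + a = 0" by transfer simp
  show "a - b = a + - b" by (simp add: minus_ell2_def)
  show "r *\<^sub>R (a + b) = r *\<^sub>R a + r *\<^sub>R b" by transfer (simp add: algebra_simps)
  show "(r + s) *\<^sub>R a = r *\<^sub>R a + s *\<^sub>R a" by transfer (simp add: algebra_simps)
  show "r *\<^sub>R s *\<^sub>R a = (r * s) *\<^sub>R a" by transfer (simp add: algebra_simps)
  show "1 *\<^sub>R a = a" by transfer simp
qed

end

lift_definition scaleC_ell2 :: "complex \<Rightarrow> 'a ell2 \<Rightarrow> 'a ell2" is "\<lambda>c f x. c * f x"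
  by (simp add: norm_mult power_mult_distrib summable_on_cmult_right)

lift_definition cinner_ell2 :: "'a ell2 \<Rightarrow> 'a ell2 \<Rightarrow> complex" is
  "\<lambda>f g. \<Sum>\<^sub>\<infinity>x. cnj (f x) * g x" .

lift_definition delta_ell2 :: "'a \<Rightarrow> 'a ell2" is "\<lambda>y x. if x = y then 1 else 0"
proof -
  fix y :: 'a
  have "(\<lambda>x. (cmod (if x = y then 1 else 0))\<^sup>2) summable_on {y}" by simp
  then show "(\<lambda>x. (cmod (if x = y then 1 else 0))\<^sup>2) summable_on UNIV"
    by (rule summable_on_cong_neutral[THEN iffD1, rotated -1]) auto
qed

lemma cinner_ell2_self:
  "cinner_ell2 \<xi> \<xi> = of_real (\<Sum>\<^sub>\<infinity>x. (cmod (ell2_fun \<xi> x))\<^sup>2)"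
proof transfer
  fix f :: "'a \<Rightarrow> complex"
  assume "(\<lambda>x. (cmod (f x))\<^sup>2) summable_on UNIV"
  then have "((\<lambda>x. complex_of_real ((cmod (f x))\<^sup>2)) has_sum
      complex_of_real (\<Sum>\<^sub>\<infinity>x. (cmod (f x))\<^sup>2)) UNIV"
    by (intro has_sum_of_real has_sum_infsum)
  then have "(\<Sum>\<^sub>\<infinity>x. complex_of_real ((cmod (f x))\<^sup>2)) = of_real (\<Sum>\<^sub>\<infinity>x. (cmod (f x))\<^sup>2)"
    by (rule infsumI)
  moreover have "cnj (f x) * f x = complex_of_real ((cmod (f x))\<^sup>2)" for x
    by (metis complex_norm_square mult.commute of_real_power)
  ultimately show "(\<Sum>\<^sub>\<infinity>x. cnj (f x) * f x) = of_real (\<Sum>\<^sub>\<infinity>x. (cmod (f x))\<^sup>2)"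
    by simp
qed

lemma cinner_ell2_add_left: "cinner_ell2 (\<xi> + \<eta>) \<zeta> = cinner_ell2 \<xi> \<zeta> + cinner_ell2 \<eta> \<zeta>"
  by transfer (simp add: distrib_right infsum_add ell2_cinner_summable)

lemma cinner_ell2_commute: "cinner_ell2 \<eta> \<xi> = cnj (cinner_ell2 \<xi> \<eta>)"
proof transfer
  fix g f :: "'a \<Rightarrow> complex"
  have "cnj (\<Sum>\<^sub>\<infinity>x. cnj (f x) * g x) = (\<Sum>\<^sub>\<infinity>x. cnj (cnj (f x) * g x))"
    by (rule infsum_cnj[symmetric])
  then show "(\<Sum>\<^sub>\<infinity>x. cnj (g x) * f x) = cnj (\<Sum>\<^sub>\<infinity>x. cnj (f x) * g x)"
    by (simp add: mult.commute)
qed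

instantiation ell2 :: (type) real_inner
begin

definition inner_ell2 :: "'a ell2 \<Rightarrow> 'a ell2 \<Rightarrow> real" where
  "inner_ell2 \<xi> \<eta> = Re (cinner_ell2 \<xi> \<eta>)"

definition norm_ell2 :: "'a ell2 \<Rightarrow> real" where
  "norm_ell2 \<xi> = sqrt (inner \<xi> \<xi>)"

definition sgn_ell2 :: "'a ell2 \<Rightarrow> 'a ell2" where
  "sgn_ell2 \<xi> = \<xi> /\<^sub>R norm \<xi>"

definition dist_ell2 :: "'a ell2 \<Rightarrow> 'a ell2 \<Rightarrow> real" where
  "dist_ell2 \<xi> \<eta> = norm (\<xi> - \<eta>)"

definition uniformity_ell2 :: "('a ell2 \<times> 'a ell2) filter" where
  "uniformity_ell2 = (INF e\<in>{0 <..}. principal {(x, y). dist (x :: 'a ell2) y < e})"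

definition open_ell2 :: "'a ell2 set \<Rightarrow> bool" where
  "open_ell2 U \<longleftrightarrow> (\<forall>x\<in>U. \<forall>\<^sub>F (x', y) in uniformity. x' = x \<longrightarrow> y \<in> U)"

instance
proof
  fix a b c :: "'a ell2" and r :: real and U :: "'a ell2 set"
  show "inner a b = inner b a"
    unfolding inner_ell2_def by (subst cinner_ell2_commute) simp
  show "inner (a + b) c = inner a c + inner b c"
    by (simp add: inner_ell2_def cinner_ell2_add_left)
  have "cinner_ell2 (r *\<^sub>R a) b = of_real r * cinner_ell2 a b"
    by transfer (simp add: mult.assoc infsum_cmult_right')
  then show "inner (r *\<^sub>R a) b = r * inner a b" by (simp add: inner_ell2_def)
  show "0 \<le> inner a a"
    by (simp add: inner_ell2_def cinner_ell2_self infsum_nonneg)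
  show "inner a a = 0 \<longleftrightarrow> a = 0"
  proof
    assume "inner a a = 0"
    then have "(\<Sum>\<^sub>\<infinity>x. (cmod (ell2_fun a x))\<^sup>2) = 0"
      by (simp add: inner_ell2_def cinner_ell2_self)
    moreover have "(\<lambda>x. (cmod (ell2_fun a x))\<^sup>2) summable_on UNIV"
      using ell2_fun by blast
    ultimately have "(cmod (ell2_fun a x))\<^sup>2 = 0" for x
      using nonneg_infsum_le_0D[of "\<lambda>x. (cmod (ell2_fun a x))\<^sup>2" UNIV x] by simp
    then show "a = 0" by transfer auto
  next
    assume "a = 0"
    then show "inner a a = 0" unfolding inner_ell2_def by transfer simp
  qed
  show "norm a = sqrt (inner a a)" by (rule norm_ell2_def)
  show "sgn a = a /\<^sub>R norm a" by (rule sgn_ell2_def)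
  show "dist a b = norm (a - b)" by (rule dist_ell2_def)
  show "uniformity = (INF e\<in>{0 <..}. principal {(x, y). dist (x :: 'a ell2) y < e})"
    by (rule uniformity_ell2_def)
  show "open U = (\<forall>x\<in>U. \<forall>\<^sub>F (x', y) in uniformity. x' = x \<longrightarrow> y \<in> U)"
    by (rule open_ell2_def)
qed

end

lemma scaleC_ell2_add: "scaleC_ell2 c (\<xi> + \<eta>) = scaleC_ell2 c \<xi> + scaleC_ell2 c \<eta>"
  by transfer (simp add: distrib_left)

lemma scaleC_ell2_scaleR: "scaleC_ell2 c (r *\<^sub>R \<xi>) = r *\<^sub>R scaleC_ell2 c \<xi>"
  by transfer (simp add: algebra_simps)

lemma scaleC_ell2_scaleC: "scaleC_ell2 c (scaleC_ell2 d \<xi>) = scaleC_ell2 (c * d) \<xi>"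
  by transfer (simp add: algebra_simps)

lemma scaleC_ell2_zero: "scaleC_ell2 c 0 = 0"
  by transfer simp

lemma scaleC_ell2_minus: "scaleC_ell2 c (- \<xi>) = - scaleC_ell2 c \<xi>"
  by transfer simp

lemma scaleC_ell2_diff: "scaleC_ell2 c (\<xi> - \<eta>) = scaleC_ell2 c \<xi> - scaleC_ell2 c \<eta>"
  unfolding diff_conv_add_uminus by (simp only: scaleC_ell2_add scaleC_ell2_minus)

lemma norm_scaleC_ell2: "norm (scaleC_ell2 c \<xi>) = cmod c * norm \<xi>"
proof -
  have "(\<Sum>\<^sub>\<infinity>x. (cmod (ell2_fun (scaleC_ell2 c \<xi>) x))\<^sup>2)
      = (cmod c)\<^sup>2 * (\<Sum>\<^sub>\<infinity>x. (cmod (ell2_fun \<xi> x))\<^sup>2)"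
    by (simp add: scaleC_ell2.rep_eq norm_mult power_mult_distrib infsum_cmult_right')
  then show ?thesis
    by (simp add: norm_ell2_def inner_ell2_def cinner_ell2_self real_sqrt_mult)
qed

lemma bounded_linear_scaleC_ell2: "bounded_linear (scaleC_ell2 c)"
  by (rule bounded_linear_intro[where K = "cmod c"])
    (simp_all add: scaleC_ell2_add scaleC_ell2_scaleR norm_scaleC_ell2 mult.commute)

lifting_forget ell2.lifting

section \<open>The normed algebra of bounded complex-linear operators\<close>

typedef 'a ell2_op =
  "{T :: 'a ell2 \<Rightarrow>\<^sub>L 'a ell2.
      \<forall>c \<xi>. blinfun_apply T (scaleC_ell2 c \<xi>) = scaleC_ell2 c (blinfun_apply T \<xi>)}"
  morphisms blinfun_of_op Abs_ell2_op
  by (rule exI[of _ 0]) (auto simp: zero_ell2.rep_eq scaleC_ell2.rep_eq ell2_fun_inject[symmetric])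

setup_lifting type_definition_ell2_op

lift_definition op_apply :: "'a ell2_op \<Rightarrow> 'a ell2 \<Rightarrow> 'a ell2" is blinfun_apply .

instantiation ell2_op :: (type) real_vector
begin

lift_definition zero_ell2_op :: "'a ell2_op" is 0
  by (simp add: scaleC_ell2_zero)

lift_definition plus_ell2_op :: "'a ell2_op \<Rightarrow> 'a ell2_op \<Rightarrow> 'a ell2_op" is "(+)"
  by (simp add: blinfun.add_left scaleC_ell2_add)

lift_definition uminus_ell2_op :: "'a ell2_op \<Rightarrow> 'a ell2_op" is uminus
  by (simp add: blinfun.minus_left scaleC_ell2_minus)

lift_definition minus_ell2_op :: "'a ell2_op \<Rightarrow> 'a ell2_op \<Rightarrow> 'a ell2_op" is "(-)"
  by (simp add: blinfun.diff_left scaleC_ell2_diff)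

lift_definition scaleR_ell2_op :: "real \<Rightarrow> 'a ell2_op \<Rightarrow> 'a ell2_op" is "(*\<^sub>R)"
  by (simp add: blinfun.scaleR_left scaleC_ell2_scaleR)

instance
proof
  fix a b c :: "'a ell2_op" and r s :: real
  show "a + b + c = a + (b + c)" by transfer (simp add: add.assoc)
  show "a + b = b + a" by transfer (simp add: add.commute)
  show "0 + a = a" by transfer simp
  show "- a + a = 0" by transfer simp
  show "a - b = a + - b" by transfer simp
  show "r *\<^sub>R (a + b) = r *\<^sub>R a + r *\<^sub>R b" by transfer (simp add: scaleR_add_right)
  show "(r + s) *\<^sub>R a = r *\<^sub>R a + s *\<^sub>R a" by transfer (simp add: scaleR_add_left)
  show "r *\<^sub>R s *\<^sub>R a = (r * s) *\<^sub>R a" by transfer simp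
  show "1 *\<^sub>R a = a" by transfer simp
qed

end

instantiation ell2_op :: (type) real_normed_algebra
begin

lift_definition times_ell2_op :: "'a ell2_op \<Rightarrow> 'a ell2_op \<Rightarrow> 'a ell2_op" is "(o\<^sub>L)"
  by simp

lift_definition norm_ell2_op :: "'a ell2_op \<Rightarrow> real" is norm .

lift_definition sgn_ell2_op :: "'a ell2_op \<Rightarrow> 'a ell2_op" is sgn
  by (simp add: sgn_div_norm blinfun.scaleR_left scaleC_ell2_scaleR)

lift_definition dist_ell2_op :: "'a ell2_op \<Rightarrow> 'a ell2_op \<Rightarrow> real" is dist .

definition uniformity_ell2_op :: "('a ell2_op \<times> 'a ell2_op) filter" where
  "uniformity_ell2_op = (INF e\<in>{0 <..}. principal {(x, y). dist (x :: 'a ell2_op) y < e})"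

definition open_ell2_op :: "'a ell2_op set \<Rightarrow> bool" where
  "open_ell2_op U \<longleftrightarrow> (\<forall>x\<in>U. \<forall>\<^sub>F (x', y) in uniformity. x' = x \<longrightarrow> y \<in> U)"

instance
proof
  fix a b c :: "'a ell2_op" and r s :: real and U :: "'a ell2_op set"
  show "a * b * c = a * (b * c)" by transfer (rule blinfun_eqI, simp)
  show "(a + b) * c = a * c + b * c"
    by transfer (rule blinfun_eqI, simp add: blinfun.add_left)
  show "a * (b + c) = a * b + a * c"
    by transfer (rule blinfun_eqI, simp add: blinfun.add_left blinfun.add_right)
  show "r *\<^sub>R a * b = r *\<^sub>R (a * b)"
    by transfer (rule blinfun_eqI, simp add: blinfun.scaleR_left)
  show "a * r *\<^sub>R b = r *\<^sub>R (a * b)"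
    by transfer (rule blinfun_eqI, simp add: blinfun.scaleR_left blinfun.scaleR_right)
  show "sgn a = a /\<^sub>R norm a" by transfer (rule sgn_div_norm)
  show "dist a b = norm (a - b)" by transfer (rule dist_norm)
  show "norm a = 0 \<longleftrightarrow> a = 0" by transfer simp
  show "norm (a + b) \<le> norm a + norm b" by transfer (rule norm_triangle_ineq)
  show "norm (r *\<^sub>R a) = \<bar>r\<bar> * norm a" by transfer simp
  show "norm (a * b) \<le> norm a * norm b" by transfer (rule norm_blinfun_compose)
  show "uniformity = (INF e\<in>{0 <..}. principal {(x, y). dist (x :: 'a ell2_op) y < e})"
    by (rule uniformity_ell2_op_def)
  show "open U = (\<forall>x\<in>U. \<forall>\<^sub>F (x', y) in uniformity. x' = x \<longrightarrow> y \<in> U)"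
    by (rule open_ell2_op_def)
qed

end

lift_definition scaleC_op :: "complex \<Rightarrow> 'a ell2_op \<Rightarrow> 'a ell2_op" is
  "\<lambda>c T. Blinfun (scaleC_ell2 c) o\<^sub>L T"
  by (simp add: bounded_linear_Blinfun_apply bounded_linear_scaleC_ell2
      scaleC_ell2_scaleC mult.commute)

section \<open>Groups\<close>

definition conj_class :: "('g, 'm) monoid_scheme \<Rightarrow> 'g \<Rightarrow> 'g set" where
  "conj_class G g = {x \<otimes>\<^bsub>G\<^esub> g \<otimes>\<^bsub>G\<^esub> inv\<^bsub>G\<^esub> x | x. x \<in> carrier G}"

definition fin_generated :: "('g, 'm) monoid_scheme \<Rightarrow> bool" where
  "fin_generated G \<longleftrightarrow> (\<exists>B. finite B \<and> B \<subseteq> carrier G \<and> generate G B = carrier G)"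

text \<open>A word is a list of letters \<open>(b, s)\<close>, where \<open>s\<close> tells \<open>b\<close> from its inverse.\<close>

fun letter_value :: "('g, 'm) monoid_scheme \<Rightarrow> 'g \<times> bool \<Rightarrow> 'g" where
  "letter_value G (b, s) = (if s then b else inv\<^bsub>G\<^esub> b)"

definition word_value :: "('g, 'm) monoid_scheme \<Rightarrow> ('g \<times> bool) list \<Rightarrow> 'g" where
  "word_value G w = foldr (\<lambda>l x. letter_value G l \<otimes>\<^bsub>G\<^esub> x) w \<one>\<^bsub>G\<^esub>"

definition reduced_word :: "('g \<times> bool) list \<Rightarrow> bool" where
  "reduced_word w \<longleftrightarrow>
    (\<forall>i. Suc i < length w \<longrightarrow> \<not> (fst (w ! i) = fst (w ! Suc i) \<and> snd (w ! i) \<noteq> snd (w ! Suc i)))"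

definition free_subgroup :: "('g, 'm) monoid_scheme \<Rightarrow> 'g set \<Rightarrow> bool" where
  "free_subgroup G H \<longleftrightarrow> subgroup H G \<and>
    (\<exists>B \<subseteq> H. generate G B = H \<and>
      (\<forall>w. w \<noteq> [] \<and> reduced_word w \<and> fst ` set w \<subseteq> B \<longrightarrow> word_value G w \<noteq> \<one>\<^bsub>G\<^esub>))"

definition virtually_free :: "('g, 'm) monoid_scheme \<Rightarrow> bool" where
  "virtually_free G \<longleftrightarrow> (\<exists>H. free_subgroup G H \<and> finite (rcosets\<^bsub>G\<^esub> H))"

definition amenable :: "('g, 'm) monoid_scheme \<Rightarrow> bool" where
  "amenable G \<longleftrightarrow> (\<exists>\<mu> :: 'g set \<Rightarrow> real.
      (\<forall>A \<subseteq> carrier G. 0 \<le> \<mu> A) \<and> \<mu> (carrier G) = 1 \<and>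
      (\<forall>A \<subseteq> carrier G. \<forall>B \<subseteq> carrier G. A \<inter> B = {} \<longrightarrow> \<mu> (A \<union> B) = \<mu> A + \<mu> B) \<and>
      (\<forall>h \<in> carrier G. \<forall>A \<subseteq> carrier G. \<mu> (h <#\<^bsub>G\<^esub> A) = \<mu> A))"

definition fin_order_rats :: "('g, 'm) monoid_scheme \<Rightarrow> rat set" where
  "fin_order_rats G = group_closure {1 / of_nat (card F) | F. subgroup F G \<and> finite F}"

section \<open>Trees and actions on them\<close>

definition adj_walk :: "'v set set \<Rightarrow> 'v list \<Rightarrow> bool" where
  "adj_walk E vs \<longleftrightarrow> (\<forall>i. Suc i < length vs \<longrightarrow> {vs ! i, vs ! Suc i} \<in> E)"

definition is_tree :: "'v set \<Rightarrow> 'v set set \<Rightarrow> bool" where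
  "is_tree V E \<longleftrightarrow> V \<noteq> {} \<and> (\<forall>e \<in> E. e \<subseteq> V \<and> card e = 2) \<and>
    (\<forall>u \<in> V. \<forall>v \<in> V. \<exists>vs. vs \<noteq> [] \<and> hd vs = u \<and> last vs = v \<and> adj_walk E vs) \<and>
    \<not> (\<exists>vs. 3 \<le> length vs \<and> distinct vs \<and> adj_walk E vs \<and> {last vs, hd vs} \<in> E)"

definition tree_action ::
    "('g, 'm) monoid_scheme \<Rightarrow> 'v set \<Rightarrow> 'v set set \<Rightarrow> ('g \<Rightarrow> 'v \<Rightarrow> 'v) \<Rightarrow> bool" where
  "tree_action G V E \<phi> \<longleftrightarrow>
    is_tree V E \<and> group_action G V \<phi> \<and> (\<forall>h \<in> carrier G. \<forall>e \<in> E. \<phi> h ` e \<in> E)"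

text \<open>\<open>G\<close> is discrete, so its action is proper iff all stabilizers are finite. An edge stabilizer
  has a subgroup of index at most two that is contained in a vertex stabilizer.\<close>

definition proper_action ::
    "('g, 'm) monoid_scheme \<Rightarrow> 'v set \<Rightarrow> ('g \<Rightarrow> 'v \<Rightarrow> 'v) \<Rightarrow> bool" where
  "proper_action G V \<phi> \<longleftrightarrow> (\<forall>v \<in> V. finite (stabilizer G \<phi> v))"

section \<open>The group ring and the reduced group C*-algebra\<close>

text \<open>The carrier of \<open>G\<close> may be a proper subset of the type. Operators on the Hilbert space of \<open>G\<close>
  are extended by zero to functions supported outside the carrier; hence the unit of the algebras
  below is \<open>lam G \<one>\<close>, the projection onto the functions supported on the carrier.\<close>

definition lam :: "('g, 'm) monoid_scheme \<Rightarrow> 'g \<Rightarrow> 'g ell2_op" where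
  "lam G h = (THE a. \<forall>\<xi> x. ell2_fun (op_apply a \<xi>) x =
      (if x \<in> carrier G then ell2_fun \<xi> (inv\<^bsub>G\<^esub> h \<otimes>\<^bsub>G\<^esub> x) else 0))"

lemma lam_apply:
  assumes "group G" and h: "h \<in> carrier G"
  shows "ell2_fun (op_apply (lam G h) \<xi>) x =
    (if x \<in> carrier G then ell2_fun \<xi> (inv\<^bsub>G\<^esub> h \<otimes>\<^bsub>G\<^esub> x) else 0)"
proof -
  interpret group G by fact
  define f where "f \<xi> x = (if x \<in> carrier G then ell2_fun \<xi> (inv\<^bsub>G\<^esub> h \<otimes>\<^bsub>G\<^esub> x) else 0)"
    for \<xi> :: "'a ell2" and x
  let ?m = "\<lambda>x. inv\<^bsub>G\<^esub> h \<otimes>\<^bsub>G\<^esub> x"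
  have inj: "inj_on ?m (carrier G)"
    using h by (auto intro!: inj_onI)
  have sq: "(\<lambda>x. (cmod (ell2_fun \<xi> x))\<^sup>2) summable_on UNIV" for \<xi> :: "'a ell2"
    using ell2_fun by blast
  have carr: "(\<lambda>x. (cmod (ell2_fun \<xi> (?m x)))\<^sup>2) summable_on carrier G \<and>
    (\<Sum>\<^sub>\<infinity>x\<in>carrier G. (cmod (ell2_fun \<xi> (?m x)))\<^sup>2) \<le> (\<Sum>\<^sub>\<infinity>x. (cmod (ell2_fun \<xi> x))\<^sup>2)"
    for \<xi> :: "'a ell2"
  proof -
    let ?g = "\<lambda>x. (cmod (ell2_fun \<xi> x))\<^sup>2"
    have 1: "?g summable_on ?m ` carrier G"
      using sq summable_on_subset_banach by blast
    have "infsum ?g (?m ` carrier G) \<le> infsum ?g UNIV"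
      by (rule infsum_mono_neutral) (use 1 sq in auto)
    then show ?thesis
      using 1 summable_on_reindex[OF inj, of ?g] infsum_reindex[OF inj, of ?g] by (simp add: o_def)
  qed
  have f_sum: "(\<lambda>x. (cmod (f \<xi> x))\<^sup>2) summable_on UNIV" for \<xi>
  proof -
    have "(\<lambda>x. (cmod (f \<xi> x))\<^sup>2) summable_on UNIV \<longleftrightarrow>
        (\<lambda>x. (cmod (ell2_fun \<xi> (?m x)))\<^sup>2) summable_on carrier G"
      by (rule summable_on_cong_neutral) (auto simp: f_def)
    with carr show ?thesis by blast
  qed
  have f_le: "(\<Sum>\<^sub>\<infinity>x. (cmod (f \<xi> x))\<^sup>2) \<le> (\<Sum>\<^sub>\<infinity>x. (cmod (ell2_fun \<xi> x))\<^sup>2)" for \<xi>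
  proof -
    have "(\<Sum>\<^sub>\<infinity>x. (cmod (f \<xi> x))\<^sup>2) = (\<Sum>\<^sub>\<infinity>x\<in>carrier G. (cmod (ell2_fun \<xi> (?m x)))\<^sup>2)"
      by (rule infsum_cong_neutral) (auto simp: f_def)
    with carr show ?thesis by simp
  qed
  define T where "T \<xi> = Abs_ell2 (f \<xi>)" for \<xi>
  have T: "ell2_fun (T \<xi>) = f \<xi>" for \<xi>
    unfolding T_def using f_sum by (intro Abs_ell2_inverse) simp
  have "bounded_linear T"
  proof (rule bounded_linear_intro[where K = 1])
    show "T (\<xi> + \<eta>) = T \<xi> + T \<eta>" for \<xi> \<eta>
      by (auto simp: ell2_fun_inject[symmetric] T plus_ell2.rep_eq f_def)
    show "T (r *\<^sub>R \<xi>) = r *\<^sub>R T \<xi>" for r \<xi>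
      by (auto simp: ell2_fun_inject[symmetric] T scaleR_ell2.rep_eq f_def)
    show "norm (T \<xi>) \<le> norm \<xi> * 1" for \<xi>
      using f_le by (simp add: norm_ell2_def inner_ell2_def cinner_ell2_self T)
  qed
  then have T': "blinfun_apply (Blinfun T) = T" by (rule bounded_linear_Blinfun_apply)
  define a where "a = Abs_ell2_op (Blinfun T)"
  have "blinfun_of_op a = Blinfun T"
    unfolding a_def
    by (rule Abs_ell2_op_inverse)
      (auto simp: T' ell2_fun_inject[symmetric] T scaleC_ell2.rep_eq f_def)
  then have a: "op_apply a = T" by (simp add: op_apply.rep_eq T')
  have "lam G h = a"
    unfolding lam_def
  proof (rule the_equality)
    show "\<forall>\<xi> x. ell2_fun (op_apply a \<xi>) x =
        (if x \<in> carrier G then ell2_fun \<xi> (inv\<^bsub>G\<^esub> h \<otimes>\<^bsub>G\<^esub> x) else 0)"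
      by (simp add: a T f_def)
    fix b
    assume "\<forall>\<xi> x. ell2_fun (op_apply b \<xi>) x =
        (if x \<in> carrier G then ell2_fun \<xi> (inv\<^bsub>G\<^esub> h \<otimes>\<^bsub>G\<^esub> x) else 0)"
    then have "op_apply b = op_apply a"
      by (auto simp: ell2_fun_inject[symmetric] fun_eq_iff a T f_def)
    then show "b = a"
      by (simp add: op_apply.rep_eq blinfun_apply_inject blinfun_of_op_inject)
  qed
  then show ?thesis by (simp add: a T f_def)
qed

text \<open>The complex group ring, identified with its image under the (faithful) left regular
  representation.\<close>

definition group_ring :: "('g, 'm) monoid_scheme \<Rightarrow> 'g ell2_op set" where
  "group_ring G = {\<Sum>h\<in>F. scaleC_op (c h) (lam G h) | F c. finite F \<and> F \<subseteq> carrier G}"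

definition Cred :: "('g, 'm) monoid_scheme \<Rightarrow> 'g ell2_op set" where
  "Cred G = closure (group_ring G)"

text \<open>For \<open>a\<close> the operator of convolution by \<open>f\<close>, \<open>coeff_fun G a\<close> is \<open>f\<close>.\<close>

definition coeff_fun :: "('g, 'm) monoid_scheme \<Rightarrow> 'g ell2_op \<Rightarrow> 'g \<Rightarrow> complex" where
  "coeff_fun G a h = ell2_fun (op_apply a (delta_ell2 \<one>\<^bsub>G\<^esub>)) h"

definition augmentation :: "('g, 'm) monoid_scheme \<Rightarrow> 'g ell2_op \<Rightarrow> complex" where
  "augmentation G a = (\<Sum>h | h \<in> carrier G \<and> coeff_fun G a h \<noteq> 0. coeff_fun G a h)"

definition deloc_trace :: "('g, 'm) monoid_scheme \<Rightarrow> 'g \<Rightarrow> ('g \<Rightarrow> complex) \<Rightarrow> complex" where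
  "deloc_trace G g f = (\<Sum>\<^sub>\<infinity>h\<in>conj_class G g. f h)"

section \<open>K-theory in degree zero\<close>

text \<open>\<open>A\<close> is a set of elements of the ambient ring that is itself a ring with unit, though
  its unit need not be a unit of the ambient ring.\<close>

definition idem_mats :: "'b :: ring set \<Rightarrow> 'b mat set" where
  "idem_mats A = {p. square_mat p \<and> elements_mat p \<subseteq> A \<and> p * p = p}"

definition idem_equiv :: "'b :: ring set \<Rightarrow> 'b mat \<Rightarrow> 'b mat \<Rightarrow> bool" where
  "idem_equiv A p q \<longleftrightarrow>
    (\<exists>x \<in> carrier_mat (dim_row p) (dim_row q). \<exists>y \<in> carrier_mat (dim_row q) (dim_row p).
      elements_mat x \<subseteq> A \<and> elements_mat y \<subseteq> A \<and> p = x * y \<and> q = y * x)"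

definition diag_sum :: "'b :: ring mat \<Rightarrow> 'b mat \<Rightarrow> 'b mat" where
  "diag_sum p q = four_block_mat p (0\<^sub>m (dim_row p) (dim_col q)) (0\<^sub>m (dim_row q) (dim_col p)) q"

text \<open>The pair \<open>(p, q)\<close> stands for the formal difference of the classes of \<open>p\<close> and \<open>q\<close> in the
  Grothendieck group.\<close>

definition K0_rel :: "'b :: ring set \<Rightarrow> (('b mat \<times> 'b mat) \<times> ('b mat \<times> 'b mat)) set" where
  "K0_rel A = {((p, q), (p', q')). p \<in> idem_mats A \<and> q \<in> idem_mats A \<and>
      p' \<in> idem_mats A \<and> q' \<in> idem_mats A \<and>
      (\<exists>r \<in> idem_mats A. idem_equiv A (diag_sum (diag_sum p q') r) (diag_sum (diag_sum p' q) r))}"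

definition K0 :: "'b :: ring set \<Rightarrow> ('b mat \<times> 'b mat) set set" where
  "K0 A = (idem_mats A \<times> idem_mats A) // K0_rel A"

definition K0_class :: "'b :: ring set \<Rightarrow> 'b mat \<Rightarrow> ('b mat \<times> 'b mat) set" where
  "K0_class A p = K0_rel A `` {(p, 0\<^sub>m 0 0)}"

text \<open>The map from the K-group of a subring to that of \<open>A\<close> induced by inclusion.\<close>

definition K0_incl :: "'b :: ring set \<Rightarrow> ('b mat \<times> 'b mat) set \<Rightarrow> ('b mat \<times> 'b mat) set" where
  "K0_incl A X = K0_rel A `` X"

definition mat_trace :: "('b \<Rightarrow> complex) \<Rightarrow> 'b mat \<Rightarrow> complex" where
  "mat_trace t p = (\<Sum>i<dim_row p. t (p $$ (i, i)))"

definition K0_trace :: "('b \<Rightarrow> complex) \<Rightarrow> ('b mat \<times> 'b mat) set \<Rightarrow> complex" where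
  "K0_trace t X = (THE c. \<forall>(p, q) \<in> X. mat_trace t p - mat_trace t q = c)"

section \<open>Smooth subalgebras and the delocalised trace\<close>

definition op_inverse :: "('g, 'm) monoid_scheme \<Rightarrow> 'g ell2_op \<Rightarrow> 'g ell2_op \<Rightarrow> bool" where
  "op_inverse G a b \<longleftrightarrow> b \<in> Cred G \<and> a * b = lam G \<one>\<^bsub>G\<^esub> \<and> b * a = lam G \<one>\<^bsub>G\<^esub>"

definition op_spectrum :: "('g, 'm) monoid_scheme \<Rightarrow> 'g ell2_op \<Rightarrow> complex set" where
  "op_spectrum G a = {z. \<nexists>b. op_inverse G (scaleC_op z (lam G \<one>\<^bsub>G\<^esub>) - a) b}"

definition resolvent :: "('g, 'm) monoid_scheme \<Rightarrow> 'g ell2_op \<Rightarrow> complex \<Rightarrow> 'g ell2_op" where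
  "resolvent G a z = (THE b. op_inverse G (scaleC_op z (lam G \<one>\<^bsub>G\<^esub>) - a) b)"

text \<open>The Riesz-Dunford integral of \<open>f\<close> over the cycle given by the list \<open>\<Gamma>\<close> of closed paths.\<close>

definition riesz_dunford ::
    "('g, 'm) monoid_scheme \<Rightarrow> 'g ell2_op \<Rightarrow> (complex \<Rightarrow> complex) \<Rightarrow> (real \<Rightarrow> complex) list \<Rightarrow> 'g ell2_op"
  where "riesz_dunford G a f \<Gamma> = scaleC_op (1 / (2 * of_real pi * \<i>))
    (\<Sum>\<gamma>\<leftarrow>\<Gamma>. integral {0..1} (\<lambda>s.
      scaleC_op (f (\<gamma> s) * vector_derivative \<gamma> (at s within {0..1})) (resolvent G a (\<gamma> s))))"

definition surrounding_cycle :: "complex set \<Rightarrow> complex set \<Rightarrow> (real \<Rightarrow> complex) list \<Rightarrow> bool" where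
  "surrounding_cycle K U \<Gamma> \<longleftrightarrow>
    (\<forall>\<gamma> \<in> set \<Gamma>. valid_path \<gamma> \<and> pathfinish \<gamma> = pathstart \<gamma> \<and> path_image \<gamma> \<subseteq> U - K) \<and>
    (\<forall>z \<in> K. (\<Sum>\<gamma>\<leftarrow>\<Gamma>. winding_number \<gamma> z) = 1) \<and>
    (\<forall>z. z \<notin> U \<longrightarrow> (\<Sum>\<gamma>\<leftarrow>\<Gamma>. winding_number \<gamma> z) = 0)"

definition hol_calculus_closed :: "('g, 'm) monoid_scheme \<Rightarrow> 'g ell2_op set \<Rightarrow> bool" where
  "hol_calculus_closed G S \<longleftrightarrow> (\<forall>a \<in> S. \<forall>U f \<Gamma>.
      open U \<and> op_spectrum G a \<subseteq> U \<and> f holomorphic_on U \<and> surrounding_cycle (op_spectrum G a) U \<Gamma>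
      \<longrightarrow> riesz_dunford G a f \<Gamma> \<in> S)"

text \<open>\<open>\<nu>\<close> is the Banach algebra norm of \<open>S\<close>.\<close>

definition smooth_subalgebra ::
    "('g, 'm) monoid_scheme \<Rightarrow> 'g ell2_op set \<Rightarrow> ('g ell2_op \<Rightarrow> real) \<Rightarrow> bool" where
  "smooth_subalgebra G S \<nu> \<longleftrightarrow>
    group_ring G \<subseteq> S \<and> S \<subseteq> Cred G \<and> Cred G \<subseteq> closure S \<and>
    (\<forall>a \<in> S. \<forall>b \<in> S. a + b \<in> S \<and> a * b \<in> S) \<and> (\<forall>a \<in> S. \<forall>c. scaleC_op c a \<in> S) \<and>
    (\<forall>a \<in> S. 0 \<le> \<nu> a \<and> (\<nu> a = 0 \<longleftrightarrow> a = 0)) \<and>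
    (\<forall>a \<in> S. \<forall>c. \<nu> (scaleC_op c a) = cmod c * \<nu> a) \<and>
    (\<forall>a \<in> S. \<forall>b \<in> S. \<nu> (a + b) \<le> \<nu> a + \<nu> b \<and> \<nu> (a * b) \<le> \<nu> a * \<nu> b) \<and>
    (\<exists>C. \<forall>a \<in> S. norm a \<le> C * \<nu> a) \<and>
    (\<forall>X :: nat \<Rightarrow> 'g ell2_op. (\<forall>n. X n \<in> S) \<and>
        (\<forall>e>0. \<exists>M. \<forall>m\<ge>M. \<forall>n\<ge>M. \<nu> (X m - X n) < e) \<longrightarrow>
        (\<exists>a \<in> S. (\<lambda>n. \<nu> (X n - a)) \<longlonglongrightarrow> 0)) \<and>
    hol_calculus_closed G S"

definition deloc_trace_extension ::
    "('g, 'm) monoid_scheme \<Rightarrow> 'g \<Rightarrow> 'g ell2_op set \<Rightarrow> ('g ell2_op \<Rightarrow> real) \<Rightarrow>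
      ('g ell2_op \<Rightarrow> complex) \<Rightarrow> bool" where
  "deloc_trace_extension G g S \<nu> t \<longleftrightarrow>
    (\<forall>a \<in> S. \<forall>b \<in> S. t (a + b) = t a + t b \<and> t (a * b) = t (b * a)) \<and>
    (\<forall>a \<in> S. \<forall>c. t (scaleC_op c a) = c * t a) \<and>
    (\<exists>C. \<forall>a \<in> S. cmod (t a) \<le> C * \<nu> a) \<and>
    (\<forall>a \<in> S. (\<lambda>h. cmod (coeff_fun G a h)) summable_on carrier G \<longrightarrow>
      t a = deloc_trace G g (coeff_fun G a))"

text \<open>The map on the K-group of the reduced C*-algebra induced by the trace \<open>t\<close> on \<open>S\<close>.\<close>

definition K0_deloc_trace ::
    "('g, 'm) monoid_scheme \<Rightarrow> 'g ell2_op set \<Rightarrow> ('g ell2_op \<Rightarrow> complex) \<Rightarrow>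
      ('g ell2_op mat \<times> 'g ell2_op mat) set \<Rightarrow> complex" where
  "K0_deloc_trace G S t x = K0_trace t (the_inv_into (K0 S) (K0_incl (Cred G)) x)"

section \<open>Projective resolutions and higher Kazhdan projections\<close>

text \<open>The module in degree \<open>i\<close> consists of the row vectors \<open>x\<close> of length \<open>res_rank N i\<close> over the
  group ring with \<open>x * res_idem N i = x\<close>, and the differential from degree \<open>i + 1\<close> to degree \<open>i\<close> is
  \<open>x \<mapsto> x * res_diff N i\<close>. Any module homomorphism from the module in degree \<open>0\<close> to the trivial
  module extends to all row vectors; \<open>res_aug N j\<close> is the value of such an extension of the
  augmentation at the \<open>j\<close>-th unit vector.\<close>

record 'g proj_complex =
  res_rank :: "nat \<Rightarrow> nat"
  res_idem :: "nat \<Rightarrow> 'g ell2_op mat"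
  res_diff :: "nat \<Rightarrow> 'g ell2_op mat"
  res_aug :: "nat \<Rightarrow> complex"

definition chain_module :: "('g, 'm) monoid_scheme \<Rightarrow> 'g proj_complex \<Rightarrow> nat \<Rightarrow> 'g ell2_op mat set"
  where "chain_module G N i =
    {x \<in> carrier_mat 1 (res_rank N i). elements_mat x \<subseteq> group_ring G \<and> x * res_idem N i = x}"

definition chain_aug :: "('g, 'm) monoid_scheme \<Rightarrow> 'g proj_complex \<Rightarrow> 'g ell2_op mat \<Rightarrow> complex" where
  "chain_aug G N x = (\<Sum>j<res_rank N 0. augmentation G (x $$ (0, j)) * res_aug N j)"

definition proj_resolution :: "('g, 'm) monoid_scheme \<Rightarrow> 'g proj_complex \<Rightarrow> bool" where
  "proj_resolution G N \<longleftrightarrow>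
    (\<forall>i. res_idem N i \<in> carrier_mat (res_rank N i) (res_rank N i) \<and>
      elements_mat (res_idem N i) \<subseteq> group_ring G \<and> res_idem N i * res_idem N i = res_idem N i) \<and>
    (\<forall>i. res_diff N i \<in> carrier_mat (res_rank N (Suc i)) (res_rank N i) \<and>
      elements_mat (res_diff N i) \<subseteq> group_ring G \<and>
      res_idem N (Suc i) * res_diff N i = res_diff N i \<and> res_diff N i * res_idem N i = res_diff N i) \<and>
    chain_aug G N ` chain_module G N 0 = UNIV \<and>
    (\<lambda>x. x * res_diff N 0) ` chain_module G N 1 = {x \<in> chain_module G N 0. chain_aug G N x = 0} \<and>
    (\<forall>i. (\<lambda>x. x * res_diff N (Suc i)) ` chain_module G N (Suc (Suc i)) =
      {x \<in> chain_module G N (Suc i). x * res_diff N i = 0\<^sub>m 1 (res_rank N i)})"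

definition mat_apply :: "'g ell2_op mat \<Rightarrow> 'g ell2 vec \<Rightarrow> 'g ell2 vec" where
  "mat_apply p \<xi> = vec (dim_row p) (\<lambda>i. \<Sum>j<dim_col p. op_apply (p $$ (i, j)) (vec_index \<xi> j))"

definition cinner_vec :: "'g ell2 vec \<Rightarrow> 'g ell2 vec \<Rightarrow> complex" where
  "cinner_vec \<xi> \<eta> = (\<Sum>i<dim_vec \<xi>. cinner_ell2 (vec_index \<xi> i) (vec_index \<eta> i))"

text \<open>A module homomorphism \<open>h\<close> from the module in degree \<open>i\<close> to the Hilbert space of \<open>G\<close> corresponds
  to the column vector \<open>\<xi>\<close> whose \<open>j\<close>-th entry is the value of \<open>h\<close> at the \<open>j\<close>-th row of \<open>res_idem N i\<close>.
  The vectors arising this way are those fixed by \<open>res_idem N i\<close>, and precomposition with the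
  differential becomes application of the matrix \<open>res_diff N i\<close>.\<close>

definition cochain_space :: "'g proj_complex \<Rightarrow> nat \<Rightarrow> 'g ell2 vec set" where
  "cochain_space N i = {\<xi> \<in> carrier_vec (res_rank N i). mat_apply (res_idem N i) \<xi> = \<xi>}"

definition codiff :: "'g proj_complex \<Rightarrow> nat \<Rightarrow> 'g ell2 vec \<Rightarrow> 'g ell2 vec" where
  "codiff N i \<xi> = mat_apply (res_diff N i) \<xi>"

definition codiff_adjoint :: "'g proj_complex \<Rightarrow> nat \<Rightarrow> 'g ell2 vec \<Rightarrow> 'g ell2 vec" where
  "codiff_adjoint N i \<eta> = (THE \<zeta>. \<zeta> \<in> cochain_space N i \<and>
      (\<forall>\<xi> \<in> cochain_space N i. cinner_vec \<zeta> \<xi> = cinner_vec \<eta> (codiff N i \<xi>)))"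

fun laplacian :: "'g proj_complex \<Rightarrow> nat \<Rightarrow> 'g ell2 vec \<Rightarrow> 'g ell2 vec" where
  "laplacian N 0 \<xi> = codiff_adjoint N 0 (codiff N 0 \<xi>)"
| "laplacian N (Suc n) \<xi> =
    codiff_adjoint N (Suc n) (codiff N (Suc n) \<xi>) + codiff N n (codiff_adjoint N n \<xi>)"

definition harmonic_space :: "'g proj_complex \<Rightarrow> nat \<Rightarrow> 'g ell2 vec set" where
  "harmonic_space N n = {\<xi> \<in> cochain_space N n. laplacian N n \<xi> = 0\<^sub>v (res_rank N n)}"

definition kazhdan_projection :: "'g proj_complex \<Rightarrow> nat \<Rightarrow> 'g ell2_op mat" where
  "kazhdan_projection N n = (THE p. p \<in> carrier_mat (res_rank N n) (res_rank N n) \<and>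
      (\<forall>\<xi> \<in> carrier_vec (res_rank N n). mat_apply p \<xi> \<in> harmonic_space N n \<and>
        (\<forall>\<eta> \<in> harmonic_space N n. cinner_vec \<eta> (\<xi> - mat_apply p \<xi>) = 0)))"

definition deloc_betti ::
    "('g, 'm) monoid_scheme \<Rightarrow> 'g ell2_op set \<Rightarrow> ('g ell2_op \<Rightarrow> complex) \<Rightarrow> 'g proj_complex \<Rightarrow>
      nat \<Rightarrow> complex" where
  "deloc_betti G S t N n = K0_deloc_trace G S t (K0_class (Cred G) (kazhdan_projection N n))"

end

theory Submission
  imports Defs
begin

text \<open>The group acts properly and cocompactly on a subtree \<open>T\<close> of the given tree, so the oriented
  chain complex \<open>0 \<rightarrow> M\<^sub>1 \<rightarrow> M\<^sub>0 \<rightarrow> \<complex> \<rightarrow> 0\<close> of \<open>T\<close> is a projective resolution (inverted edges are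
  admitted: edges are counted as ordered pairs modulo a sign). By Schanuel's lemma, any other resolution
  \<open>N\<close> has an idempotent \<open>e\<close>, whose range is the kernel of the augmentation, with
  \<open>[e] + [M\<^sub>0] = [N\<^sub>0] + [M\<^sub>1]\<close>. Since \<open>G\<close> is not amenable, the first codifferential is bounded below, so
  its range is closed with complement the harmonic cochains inside the range of \<open>e\<close>, and
  \<open>[e] = [p\<^sub>1] + [N\<^sub>0]\<close> over the reduced C*-algebra. Therefore \<open>[p\<^sub>1] = [M\<^sub>1] - [M\<^sub>0]\<close>.

  No conjugate of \<open>g\<close> fixes an edge, so \<open>[M\<^sub>1]\<close> has delocalised trace \<open>0\<close>, whereas \<open>[M\<^sub>0]\<close> has
  delocalised trace the sum of \<open>|G\<^sub>v \<inter> \<langle>g\<rangle>| / |G\<^sub>v|\<close> over representatives \<open>v\<close> of the vertex orbits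
  of \<open>T\<close>, which is positive when \<open>T\<close> contains a vertex fixed by \<open>g\<close>. That a class in the K-group of the
  reduced C*-algebra has a unique preimage in that of the smooth subalgebra follows by approximation:
  closure under holomorphic calculus makes elements near the unit invertible in the subalgebra.\<close>

section \<open>Square-summable functions and their operators\<close>

text \<open>The resolution \<open>N\<close> is arbitrary and may be infinite, so its idempotents
  reveal nothing directly; only the tree resolution has computable traces, and it has length one.
  The comparison therefore runs through the kernel of the augmentation, which both resolutions see.
  The induced trace on the K-group is defined by inverting the inclusion map. A preimage comes for
  free, since both idempotents of the tree resolution have entries in the group ring, hence in
  \<open>S\<close>. Only its uniqueness needs analysis: idempotents over \<open>S\<close> that are
  equivalent over the reduced C*-algebra must be equivalent over \<open>S\<close>. Holomorphic
  closure is assumed for \<open>S\<close> itself and not for matrices over it, so it is applied to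
  single elements near the unit, with the one function \<open>1 / z\<close> on a circle about 1, and
  Schur complements carry invertibility over to matrices. The unit of all these rings is the
  projection \<open>lam G \<one>\<close>, hence the relative treatment of units, identity matrices
  and powers. The final value is minus the trace of the vertex module, a negative rational
  number.\<close>

lemma ell2_summable: "(\<lambda>x. (cmod (ell2_fun \<xi> x))\<^sup>2) summable_on UNIV"
  using ell2_fun by blast

lemma ell2_eqI: "(\<And>x. ell2_fun \<xi> x = ell2_fun \<eta> x) \<Longrightarrow> \<xi> = \<eta>"
  by (metis ell2_fun_inject ext)

lemma ell2_fun_simps [simp]:
  "ell2_fun 0 x = 0" "ell2_fun (- \<xi>) x = - ell2_fun \<xi> x"
  "ell2_fun (\<xi> + \<eta>) x = ell2_fun \<xi> x + ell2_fun \<eta> x"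
  "ell2_fun (\<xi> - \<eta>) x = ell2_fun \<xi> x - ell2_fun \<eta> x"
  "ell2_fun (r *\<^sub>R \<xi>) x = of_real r * ell2_fun \<xi> x"
  "ell2_fun (scaleC_ell2 c \<xi>) x = c * ell2_fun \<xi> x"
  "ell2_fun (delta_ell2 y) x = (if x = y then 1 else 0)"
  unfolding minus_ell2_def zero_ell2.rep_eq uminus_ell2.rep_eq plus_ell2.rep_eq
    scaleR_ell2.rep_eq scaleC_ell2.rep_eq delta_ell2.rep_eq by simp_all

lemma norm_ell2_sq: "(norm \<xi>)\<^sup>2 = (\<Sum>\<^sub>\<infinity>x. (cmod (ell2_fun \<xi> x))\<^sup>2)"
  unfolding norm_ell2_def inner_ell2_def cinner_ell2_self by (simp add: infsum_nonneg)

lemma ell2_sum_le_norm: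
  assumes "finite F"
  shows "(\<Sum>x\<in>F. (cmod (ell2_fun \<xi> x))\<^sup>2) \<le> (norm \<xi>)\<^sup>2"
  unfolding norm_ell2_sq by (intro finite_sum_le_infsum ell2_summable assms) auto

lemma cmod_ell2_fun_le: "cmod (ell2_fun \<xi> x) \<le> norm \<xi>"
  by (rule power2_le_imp_le) (use ell2_sum_le_norm[of "{x}" \<xi>] in auto)

text \<open>One bound on all finite partial sums yields square-summability and the norm estimate at
  once. Limits and truncations, which are given pointwise, enter the Hilbert space this way.\<close>

lemma Abs_ell2_props:
  assumes "\<And>F. finite F \<Longrightarrow> (\<Sum>x\<in>F. (cmod (f x))\<^sup>2) \<le> C\<^sup>2" "0 \<le> C"
  shows "ell2_fun (Abs_ell2 f) = f" "norm (Abs_ell2 f) \<le> C"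
proof -
  have "(\<lambda>x. (cmod (f x))\<^sup>2) summable_on UNIV"
    by (rule nonneg_bdd_above_summable_on) (auto intro!: bdd_aboveI2 assms)
  then show *: "ell2_fun (Abs_ell2 f) = f" by (simp add: Abs_ell2_inverse)
  have "(norm (Abs_ell2 f))\<^sup>2 \<le> C\<^sup>2"
    unfolding norm_ell2_sq * by (rule infsum_le_finite_sums) (use assms \<open>(\<lambda>x. _) summable_on _\<close> in auto)
  then show "norm (Abs_ell2 f) \<le> C" using assms(2) by (rule power2_le_imp_le)
qed

text \<open>Evaluation at a point is a contraction, so a Cauchy sequence converges pointwise; the
  bounds on finite sums survive this limit and turn it into norm convergence.\<close>

instance ell2 :: (type) banach
proof
  fix X :: "nat \<Rightarrow> 'a ell2"
  assume X: "Cauchy X"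
  have "Cauchy (\<lambda>n. ell2_fun (X n) x)" for x
    unfolding Cauchy_def dist_norm
  proof (intro allI impI)
    fix e :: real assume "e > 0"
    then obtain M where M: "\<forall>m\<ge>M. \<forall>n\<ge>M. norm (X m - X n) < e"
      using X unfolding Cauchy_def dist_norm by blast
    have "norm (ell2_fun (X m) x - ell2_fun (X n) x) \<le> norm (X m - X n)" for m n
      using cmod_ell2_fun_le[of "X m - X n" x] by simp
    then show "\<exists>M. \<forall>m\<ge>M. \<forall>n\<ge>M. norm (ell2_fun (X m) x - ell2_fun (X n) x) < e"
      using M by (meson le_less_trans)
  qed
  then have "\<forall>x. \<exists>l. (\<lambda>n. ell2_fun (X n) x) \<longlonglongrightarrow> l"
    by (simp add: Cauchy_convergent_iff convergent_def)
  then obtain f where f: "(\<lambda>n. ell2_fun (X n) x) \<longlonglongrightarrow> f x" for x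
    using choice by metis
  have tail: "(\<Sum>x\<in>F. (cmod (ell2_fun (X n) x - f x))\<^sup>2) \<le> e\<^sup>2"
    if "finite F" "n \<ge> M" and M: "\<forall>m\<ge>M. \<forall>n\<ge>M. norm (X m - X n) < e" and "e > 0" for F n M e
  proof (rule tendsto_upperbound)
    show "(\<lambda>m. \<Sum>x\<in>F. (cmod (ell2_fun (X n) x - ell2_fun (X m) x))\<^sup>2) \<longlonglongrightarrow>
        (\<Sum>x\<in>F. (cmod (ell2_fun (X n) x - f x))\<^sup>2)"
      by (intro tendsto_intros f)
    have "(\<Sum>x\<in>F. (cmod (ell2_fun (X n) x - ell2_fun (X m) x))\<^sup>2) \<le> e\<^sup>2" if "m \<ge> M" for m
    proof -
      have "(\<Sum>x\<in>F. (cmod (ell2_fun (X n - X m) x))\<^sup>2) \<le> (norm (X n - X m))\<^sup>2"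
        by (rule ell2_sum_le_norm) fact
      also have "\<dots> \<le> e\<^sup>2" using M that \<open>n \<ge> M\<close> \<open>e > 0\<close> by (intro power_mono) (auto intro: less_imp_le)
      finally show ?thesis by simp
    qed
    then show "\<forall>\<^sub>F m in sequentially. (\<Sum>x\<in>F. (cmod (ell2_fun (X n) x - ell2_fun (X m) x))\<^sup>2) \<le> e\<^sup>2"
      by (auto simp: eventually_sequentially)
  qed simp
  obtain M1 where M1: "\<forall>m\<ge>M1. \<forall>n\<ge>M1. norm (X m - X n) < 1"
    using CauchyD[OF X, of 1] by auto
  \<comment> \<open>The pointwise limit \<open>f\<close> has no evident bound, but its difference
    from \<open>X M1\<close> has norm at most 1 by \<open>tail\<close>; subtracting it from
    \<open>X M1\<close> puts \<open>f\<close> into the space.\<close>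
  define Y where "Y = Abs_ell2 (\<lambda>x. ell2_fun (X M1) x - f x)"
  have "ell2_fun Y = (\<lambda>x. ell2_fun (X M1) x - f x)"
    unfolding Y_def by (rule Abs_ell2_props(1)[where C = 1]) (use tail[OF _ _ M1] in auto)
  then have L: "ell2_fun (X M1 - Y) = f" by auto
  have "X \<longlonglongrightarrow> X M1 - Y"
  proof (rule LIMSEQ_I)
    fix e :: real assume "e > 0"
    then have "e / 2 > 0" by simp
    then obtain M where M: "\<forall>m\<ge>M. \<forall>n\<ge>M. norm (X m - X n) < e / 2"
      using X unfolding Cauchy_def dist_norm by blast
    have "norm (X n - (X M1 - Y)) < e" if "n \<ge> M" for n
    proof -
      have "ell2_fun (Abs_ell2 (\<lambda>x. ell2_fun (X n) x - f x)) = (\<lambda>x. ell2_fun (X n) x - f x)"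
        by (rule Abs_ell2_props(1)[where C = "e / 2"]) (use tail[OF _ that M] \<open>e / 2 > 0\<close> in auto)
      then have "X n - (X M1 - Y) = Abs_ell2 (\<lambda>x. ell2_fun (X n) x - f x)"
        using L by (intro ell2_eqI) (simp del: ell2_fun_simps(4) add: ell2_fun_simps(4)[of "X n"])
      also have "norm \<dots> \<le> e / 2"
        by (rule Abs_ell2_props(2)) (use tail[OF _ that M] \<open>e / 2 > 0\<close> in auto)
      finally show ?thesis using \<open>e > 0\<close> by simp
    qed
    then show "\<exists>no. \<forall>n\<ge>no. norm (X n - (X M1 - Y)) < e" by blast
  qed
  then show "convergent X" by (auto simp: convergent_def)
qed

lemma cinner_ell2_simps:
  "cinner_ell2 (\<xi> + \<eta>) \<zeta> = cinner_ell2 \<xi> \<zeta> + cinner_ell2 \<eta> \<zeta>"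
  "cinner_ell2 \<zeta> (\<xi> + \<eta>) = cinner_ell2 \<zeta> \<xi> + cinner_ell2 \<zeta> \<eta>"
  "cinner_ell2 (scaleC_ell2 c \<xi>) \<zeta> = cnj c * cinner_ell2 \<xi> \<zeta>"
  "cinner_ell2 \<zeta> (scaleC_ell2 c \<xi>) = c * cinner_ell2 \<zeta> \<xi>"
  "cinner_ell2 0 \<zeta> = 0" "cinner_ell2 \<zeta> 0 = 0"
proof -
  have l: "cinner_ell2 (scaleC_ell2 c \<xi>) \<zeta> = cnj c * cinner_ell2 \<xi> \<zeta>" for c :: complex and \<xi> \<zeta> :: "'a ell2"
    by (simp add: cinner_ell2.rep_eq mult.assoc infsum_cmult_right')
  show "cinner_ell2 (\<xi> + \<eta>) \<zeta> = cinner_ell2 \<xi> \<zeta> + cinner_ell2 \<eta> \<zeta>"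
    by (rule cinner_ell2_add_left)
  then show "cinner_ell2 \<zeta> (\<xi> + \<eta>) = cinner_ell2 \<zeta> \<xi> + cinner_ell2 \<zeta> \<eta>"
    by (metis cinner_ell2_commute complex_cnj_add)
  show "cinner_ell2 (scaleC_ell2 c \<xi>) \<zeta> = cnj c * cinner_ell2 \<xi> \<zeta>" by (rule l)
  show "cinner_ell2 \<zeta> (scaleC_ell2 c \<xi>) = c * cinner_ell2 \<zeta> \<xi>"
    by (metis cinner_ell2_commute complex_cnj_cnj complex_cnj_mult l)
  show "cinner_ell2 0 \<zeta> = 0" "cinner_ell2 \<zeta> 0 = 0"
    by (simp_all add: cinner_ell2.rep_eq)
qed

lemma cinner_ell2_minus:
  "cinner_ell2 (\<xi> - \<eta>) \<zeta> = cinner_ell2 \<xi> \<zeta> - cinner_ell2 \<eta> \<zeta>"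
  "cinner_ell2 \<zeta> (\<xi> - \<eta>) = cinner_ell2 \<zeta> \<xi> - cinner_ell2 \<zeta> \<eta>"
  by (metis cinner_ell2_simps(1) diff_add_cancel eq_diff_eq)
    (metis cinner_ell2_simps(2) diff_add_cancel eq_diff_eq)

lemma cinner_ell2_sum:
  "cinner_ell2 (\<Sum>i\<in>I. f i) \<zeta> = (\<Sum>i\<in>I. cinner_ell2 (f i) \<zeta>)"
  "cinner_ell2 \<zeta> (\<Sum>i\<in>I. f i) = (\<Sum>i\<in>I. cinner_ell2 \<zeta> (f i))"
  by (induction I rule: infinite_finite_induct) (auto simp: cinner_ell2_simps)

lemma cinner_ell2_self_norm: "cinner_ell2 \<xi> \<xi> = of_real ((norm \<xi>)\<^sup>2)"
  by (simp only: cinner_ell2_self norm_ell2_sq)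

lemma op_eqI: "(\<And>\<xi>. op_apply a \<xi> = op_apply b \<xi>) \<Longrightarrow> a = b"
  by (metis (no_types, lifting) blinfun_eqI blinfun_of_op_inject op_apply.rep_eq)

lemma op_apply_left [simp]:
  "op_apply 0 \<xi> = 0" "op_apply (- a) \<xi> = - op_apply a \<xi>"
  "op_apply (a + b) \<xi> = op_apply a \<xi> + op_apply b \<xi>"
  "op_apply (a - b) \<xi> = op_apply a \<xi> - op_apply b \<xi>"
  "op_apply (r *\<^sub>R a) \<xi> = r *\<^sub>R op_apply a \<xi>"
  "op_apply (a * b) \<xi> = op_apply a (op_apply b \<xi>)"
  by (simp_all add: op_apply.rep_eq zero_ell2_op.rep_eq uminus_ell2_op.rep_eq plus_ell2_op.rep_eq
      minus_ell2_op.rep_eq scaleR_ell2_op.rep_eq times_ell2_op.rep_eq blinfun.bilinear_simps)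

lemma op_apply_scaleC_op [simp]: "op_apply (scaleC_op c a) \<xi> = scaleC_ell2 c (op_apply a \<xi>)"
  by (simp add: op_apply.rep_eq scaleC_op.rep_eq bounded_linear_Blinfun_apply
      bounded_linear_scaleC_ell2)

lemma op_apply_sum_left: "op_apply (\<Sum>i\<in>I. f i) \<xi> = (\<Sum>i\<in>I. op_apply (f i) \<xi>)"
  by (induction I rule: infinite_finite_induct) auto

lemma op_apply_right [simp]:
  "op_apply a 0 = 0" "op_apply a (- \<xi>) = - op_apply a \<xi>"
  "op_apply a (\<xi> + \<eta>) = op_apply a \<xi> + op_apply a \<eta>"
  "op_apply a (\<xi> - \<eta>) = op_apply a \<xi> - op_apply a \<eta>"
  "op_apply a (r *\<^sub>R \<xi>) = r *\<^sub>R op_apply a \<xi>"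
  "op_apply a (sum f I) = (\<Sum>i\<in>I. op_apply a (f i))"
  by (simp_all add: op_apply.rep_eq blinfun.bilinear_simps blinfun.sum_right)

lemma op_apply_scaleC_right [simp]: "op_apply a (scaleC_ell2 c \<xi>) = scaleC_ell2 c (op_apply a \<xi>)"
  using blinfun_of_op[of a] by (simp add: op_apply.rep_eq)

lemma norm_op_apply_le: "norm (op_apply a \<xi>) \<le> norm a * norm \<xi>"
  by (simp add: op_apply.rep_eq norm_ell2_op.rep_eq norm_blinfun)

lemma norm_op_le:
  assumes "\<And>\<xi>. norm (op_apply a \<xi>) \<le> C * norm \<xi>" "0 \<le> C"
  shows "norm a \<le> C"
  unfolding norm_ell2_op.rep_eq using assms by (intro norm_blinfun_bound) (auto simp: op_apply.rep_eq)

lemma scaleC_op_simps: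
  "scaleC_op c (a + b) = scaleC_op c a + scaleC_op c b"
  "scaleC_op c (a - b) = scaleC_op c a - scaleC_op c b"
  "scaleC_op (c + d) a = scaleC_op c a + scaleC_op d a"
  "scaleC_op (c - d) a = scaleC_op c a - scaleC_op d a"
  "scaleC_op c (scaleC_op d a) = scaleC_op (c * d) a"
  "scaleC_op c a * b = scaleC_op c (a * b)"
  "a * scaleC_op c b = scaleC_op c (a * b)"
  "scaleC_op 1 a = a" "scaleC_op 0 a = 0" "scaleC_op c 0 = 0" "scaleC_op (-1) a = - a"
  "scaleC_op (of_real r) a = r *\<^sub>R a"
  by (auto intro!: op_eqI ell2_eqI simp: algebra_simps)

lemma norm_scaleC_op: "norm (scaleC_op c a) = cmod c * norm a"
proof -
  have le: "norm (scaleC_op c a) \<le> cmod c * norm a" for c and a :: "'a ell2_op"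
    by (rule norm_op_le) (auto simp: norm_scaleC_ell2 mult.assoc intro: mult_left_mono norm_op_apply_le)
  show ?thesis
  proof (cases "c = 0")
    case False
    have "norm a = norm (scaleC_op (1 / c) (scaleC_op c a))" using False by (simp add: scaleC_op_simps)
    also have "\<dots> \<le> cmod (1 / c) * norm (scaleC_op c a)" by (rule le)
    finally have "cmod c * norm a \<le> norm (scaleC_op c a)"
      using False by (simp add: norm_divide field_simps)
    with le[of c a] show ?thesis by simp
  qed (simp add: scaleC_op_simps)
qed

lemma bounded_linear_scaleC_op: "bounded_linear (scaleC_op c)"
  by (rule bounded_linear_intro[where K = "cmod c"])
    (auto simp: scaleC_op_simps norm_scaleC_op algebra_simps scaleR_conv_of_real
      intro!: op_eqI ell2_eqI)

lemma bounded_linear_scaleC_op_left: "bounded_linear (\<lambda>c. scaleC_op c a)"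
  by (rule bounded_linear_intro[where K = "norm a"])
    (auto simp: scaleC_op_simps norm_scaleC_op scaleR_conv_of_real algebra_simps
      intro!: op_eqI ell2_eqI)

text \<open>Commuting with complex scalars survives pointwise limits, so these operators are closed
  among the bounded real-linear ones. Completeness is what the Neumann series and the
  operator-valued integrals rest on.\<close>

instance ell2_op :: (type) banach
proof
  fix X :: "nat \<Rightarrow> 'a ell2_op"
  assume X: "Cauchy X"
  have "norm (blinfun_of_op a - blinfun_of_op b) = norm (a - b)" for a b :: "'a ell2_op"
    by (simp add: norm_ell2_op.rep_eq minus_ell2_op.rep_eq)
  then have dist: "dist (blinfun_of_op a) (blinfun_of_op b) = dist a b" for a b :: "'a ell2_op"
    by (simp add: dist_norm)
  have "Cauchy (\<lambda>n. blinfun_of_op (X n))" using X by (simp add: Cauchy_def dist)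
  then obtain T where T: "(\<lambda>n. blinfun_of_op (X n)) \<longlonglongrightarrow> T"
    by (metis Cauchy_convergent convergent_def)
  have app: "(\<lambda>n. op_apply (X n) \<xi>) \<longlonglongrightarrow> blinfun_apply T \<xi>" for \<xi>
    unfolding op_apply.rep_eq by (intro tendsto_intros T)
  have "blinfun_apply T (scaleC_ell2 c \<xi>) = scaleC_ell2 c (blinfun_apply T \<xi>)" for c \<xi>
  proof (rule LIMSEQ_unique[OF app])
    show "(\<lambda>n. op_apply (X n) (scaleC_ell2 c \<xi>)) \<longlonglongrightarrow> scaleC_ell2 c (blinfun_apply T \<xi>)"
      using bounded_linear.tendsto[OF bounded_linear_scaleC_ell2 app] by simp
  qed
  then have "blinfun_of_op (Abs_ell2_op T) = T" by (simp add: Abs_ell2_op_inverse)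
  then have "X \<longlonglongrightarrow> Abs_ell2_op T"
    using T by (simp add: tendsto_dist_iff[of _ T] tendsto_dist_iff[of _ "Abs_ell2_op T"] flip: dist)
  then show "convergent X" by (auto simp: convergent_def)
qed

section \<open>The group ring and its completion\<close>

text \<open>The group ring, its closure and the smooth subalgebra share the unit
  \<open>lam G \<one>\<close>, which is only a projection in the ambient algebra. Matrices and
  K-theory are developed relative to a set \<open>A\<close> with a unit \<open>e\<close> of its own,
  so that one development serves all three.\<close>

locale corner_ring =
  fixes A :: "'b::ring set" and e :: 'b
  assumes unit_mem: "e \<in> A"
    and unit_left: "a \<in> A \<Longrightarrow> e * a = a"
    and unit_right: "a \<in> A \<Longrightarrow> a * e = a"
    and add_mem: "a \<in> A \<Longrightarrow> b \<in> A \<Longrightarrow> a + b \<in> A"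
    and mult_mem: "a \<in> A \<Longrightarrow> b \<in> A \<Longrightarrow> a * b \<in> A"
    and uminus_mem: "a \<in> A \<Longrightarrow> - a \<in> A"
begin

lemma zero_mem: "0 \<in> A"
  using add_mem[OF unit_mem uminus_mem[OF unit_mem]] by simp

lemma minus_mem: "a \<in> A \<Longrightarrow> b \<in> A \<Longrightarrow> a - b \<in> A"
  using add_mem[of a "- b"] uminus_mem[of b] by simp

lemma sum_mem: "(\<And>i. i \<in> I \<Longrightarrow> f i \<in> A) \<Longrightarrow> sum f I \<in> A"
  by (induction I rule: infinite_finite_induct) (auto simp: zero_mem add_mem)

end

lemma coeff_fun_simps:
  "coeff_fun G (a + b) h = coeff_fun G a h + coeff_fun G b h"
  "coeff_fun G (a - b) h = coeff_fun G a h - coeff_fun G b h"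
  "coeff_fun G (scaleC_op c a) h = c * coeff_fun G a h"
  "coeff_fun G 0 h = 0"
  by (simp_all add: coeff_fun_def)

lemma coeff_fun_sum: "coeff_fun G (\<Sum>i\<in>I. f i) h = (\<Sum>i\<in>I. coeff_fun G (f i) h)"
  by (induction I rule: infinite_finite_induct) (auto simp: coeff_fun_simps)

context group
begin

section \<open>The group ring as an algebra of operators closed under adjoints\<close>

lemma lam_mult:
  assumes "h \<in> carrier G" "k \<in> carrier G"
  shows "lam G h * lam G k = lam G (h \<otimes> k)"
  by (intro op_eqI ell2_eqI)
    (use assms in \<open>simp add: lam_apply[OF is_group] inv_mult_group m_assoc\<close>)

lemma lam_one_apply: "ell2_fun (op_apply (lam G \<one>) \<xi>) x = (if x \<in> carrier G then ell2_fun \<xi> x else 0)"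
  by (simp add: lam_apply[OF is_group])

lemma norm_lam_one_apply_le: "norm (op_apply (lam G \<one>) \<xi>) \<le> norm \<xi>"
proof (rule power2_le_imp_le)
  show "(norm (op_apply (lam G \<one>) \<xi>))\<^sup>2 \<le> (norm \<xi>)\<^sup>2"
    unfolding norm_ell2_sq
    by (rule infsum_mono[OF ell2_summable ell2_summable]) (simp add: lam_one_apply)
qed simp

lemma cinner_lam:
  assumes h: "h \<in> carrier G"
  shows "cinner_ell2 (op_apply (lam G h) \<xi>) \<eta> = cinner_ell2 \<xi> (op_apply (lam G (inv h)) \<eta>)"
proof -
  have bij: "bij_betw (\<lambda>y. h \<otimes> y) (carrier G) (carrier G)"
    by (rule bij_betwI[where g = "\<lambda>y. inv h \<otimes> y"]) (use h in \<open>auto simp: m_assoc[symmetric]\<close>)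
  have "cinner_ell2 (op_apply (lam G h) \<xi>) \<eta> =
      (\<Sum>\<^sub>\<infinity>x\<in>carrier G. cnj (ell2_fun \<xi> (inv h \<otimes> x)) * ell2_fun \<eta> x)"
    unfolding cinner_ell2.rep_eq
    by (rule infsum_cong_neutral) (auto simp: lam_apply[OF is_group h])
  also have "\<dots> = (\<Sum>\<^sub>\<infinity>y\<in>carrier G. cnj (ell2_fun \<xi> (inv h \<otimes> (h \<otimes> y))) * ell2_fun \<eta> (h \<otimes> y))"
    by (rule infsum_reindex_bij_betw[OF bij, symmetric])
  also have "\<dots> = cinner_ell2 \<xi> (op_apply (lam G (inv h)) \<eta>)"
    unfolding cinner_ell2.rep_eq
    by (rule infsum_cong_neutral) (use h in \<open>auto simp: lam_apply[OF is_group] m_assoc[symmetric]\<close>)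
  finally show ?thesis .
qed

lemma group_ringI:
  "finite F \<Longrightarrow> F \<subseteq> carrier G \<Longrightarrow> (\<Sum>h\<in>F. scaleC_op (c h) (lam G h)) \<in> group_ring G"
  by (auto simp: group_ring_def)

lemma group_ring_lam: "h \<in> carrier G \<Longrightarrow> scaleC_op c (lam G h) \<in> group_ring G"
  using group_ringI[of "{h}" "\<lambda>_. c"] by simp

lemma group_ring_add:
  assumes "a \<in> group_ring G" "b \<in> group_ring G"
  shows "a + b \<in> group_ring G"
proof -
  obtain F c where F: "finite F" "F \<subseteq> carrier G" "a = (\<Sum>h\<in>F. scaleC_op (c h) (lam G h))"
    using assms(1) by (auto simp: group_ring_def)
  obtain F' c' where F': "finite F'" "F' \<subseteq> carrier G" "b = (\<Sum>h\<in>F'. scaleC_op (c' h) (lam G h))"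
    using assms(2) by (auto simp: group_ring_def)
  have "a = (\<Sum>h\<in>F\<union>F'. scaleC_op (if h \<in> F then c h else 0) (lam G h))"
    unfolding F(3) by (rule sum.mono_neutral_cong_left) (use F F' in \<open>auto simp: scaleC_op_simps\<close>)
  moreover have "b = (\<Sum>h\<in>F\<union>F'. scaleC_op (if h \<in> F' then c' h else 0) (lam G h))"
    unfolding F'(3) by (rule sum.mono_neutral_cong_left) (use F F' in \<open>auto simp: scaleC_op_simps\<close>)
  ultimately have "a + b = (\<Sum>h\<in>F\<union>F'. scaleC_op ((if h \<in> F then c h else 0) +
      (if h \<in> F' then c' h else 0)) (lam G h))"
    by (simp only: sum.distrib scaleC_op_simps)
  then show ?thesis using F F' by (auto intro!: group_ringI)
qed

text \<open>No freshness of \<open>h\<close> is demanded in the step, so linear statements reduce to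
  single multiples of \<open>lam G h\<close> without bookkeeping of supports.\<close>

lemma group_ring_induct [consumes 1, case_names zero add]:
  assumes "a \<in> group_ring G" and "P 0"
    and step: "\<And>a c h. a \<in> group_ring G \<Longrightarrow> h \<in> carrier G \<Longrightarrow> P a \<Longrightarrow> P (scaleC_op c (lam G h) + a)"
  shows "P a"
proof -
  obtain F c where F: "finite F" "F \<subseteq> carrier G" and a: "a = (\<Sum>h\<in>F. scaleC_op (c h) (lam G h))"
    using assms(1) by (auto simp: group_ring_def)
  from F have "P (\<Sum>h\<in>F. scaleC_op (c h) (lam G h))"
    by (induction F) (auto intro!: assms(2) step group_ringI)
  then show ?thesis by (simp add: a)
qed

lemma group_ring_zero: "0 \<in> group_ring G"
  using group_ringI[of "{}"] by simp

lemma group_ring_scaleC: "a \<in> group_ring G \<Longrightarrow> scaleC_op c a \<in> group_ring G"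
  by (induction rule: group_ring_induct)
    (auto simp: scaleC_op_simps group_ring_zero intro!: group_ring_add group_ring_lam)

lemma group_ring_uminus: "a \<in> group_ring G \<Longrightarrow> - a \<in> group_ring G"
  using group_ring_scaleC[of a "-1"] by (simp add: scaleC_op_simps)

lemma group_ring_lam_mult:
  assumes "b \<in> group_ring G" "h \<in> carrier G"
  shows "lam G h * b \<in> group_ring G"
  using assms(1) by (induction rule: group_ring_induct)
    (use assms(2) in \<open>auto simp: distrib_left scaleC_op_simps lam_mult group_ring_zero
       intro!: group_ring_add group_ring_lam\<close>)

lemma group_ring_mult: "a \<in> group_ring G \<Longrightarrow> b \<in> group_ring G \<Longrightarrow> a * b \<in> group_ring G"
  by (induction rule: group_ring_induct)
    (auto simp: distrib_right scaleC_op_simps group_ring_zero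
       intro!: group_ring_add group_ring_scaleC group_ring_lam_mult)

lemma group_ring_unit: "a \<in> group_ring G \<Longrightarrow> lam G \<one> * a = a \<and> a * lam G \<one> = a"
  by (induction rule: group_ring_induct) (auto simp: algebra_simps scaleC_op_simps lam_mult)

sublocale group_ring: corner_ring "group_ring G" "lam G \<one>"
  by unfold_locales (use group_ring_lam[of \<one> 1] in
    \<open>auto simp: group_ring_unit group_ring_add group_ring_mult group_ring_uminus scaleC_op_simps\<close>)

text \<open>Conjugating coefficients and inverting group elements preserves finite sums, and
  \<open>lam G (inv h)\<close> is the adjoint of \<open>lam G h\<close>.\<close>

lemma group_ring_adjoint:
  assumes "a \<in> group_ring G"
  shows "\<exists>b \<in> group_ring G. \<forall>\<xi> \<eta>. cinner_ell2 (op_apply a \<xi>) \<eta> = cinner_ell2 \<xi> (op_apply b \<eta>)"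
  using assms
proof (induction rule: group_ring_induct)
  case zero
  then show ?case by (intro bexI[of _ 0]) (auto simp: cinner_ell2_simps group_ring_zero)
next
  case (add a c h)
  then obtain b where b: "b \<in> group_ring G"
    "\<And>\<xi> \<eta>. cinner_ell2 (op_apply a \<xi>) \<eta> = cinner_ell2 \<xi> (op_apply b \<eta>)" by blast
  show ?case
    by (intro bexI[of _ "scaleC_op (cnj c) (lam G (inv h)) + b"])
      (use add b in \<open>auto simp: cinner_ell2_simps cinner_lam intro!: group_ring_add group_ring_lam\<close>)
qed

section \<open>The reduced C*-algebra as the closure of the group ring\<close>

lemma group_ring_Cred: "group_ring G \<subseteq> Cred G"
  by (simp add: Cred_def closure_subset)

lemma Cred_limit: "(\<And>n. x n \<in> Cred G) \<Longrightarrow> x \<longlonglongrightarrow> l \<Longrightarrow> l \<in> Cred G"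
  by (metis Cred_def closed_closure closed_sequentially)

lemma Cred_seq:
  assumes "a \<in> Cred G"
  obtains x where "\<And>n. x n \<in> group_ring G" "x \<longlonglongrightarrow> a"
  using assms unfolding Cred_def closure_sequential by blast

lemma Cred_scaleC:
  assumes "a \<in> Cred G"
  shows "scaleC_op c a \<in> Cred G"
proof -
  obtain x where x: "\<And>n. x n \<in> group_ring G" "x \<longlonglongrightarrow> a" using assms by (rule Cred_seq) blast
  show ?thesis
    by (rule Cred_limit[of "\<lambda>n. scaleC_op c (x n)"])
      (use x group_ring_Cred group_ring_scaleC bounded_linear.tendsto[OF bounded_linear_scaleC_op]
        in blast)+
qed

sublocale Cred: corner_ring "Cred G" "lam G \<one>"
proof
  show u: "lam G \<one> \<in> Cred G" using group_ring.unit_mem group_ring_Cred by blast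
  have "closed {a :: 'a ell2_op. lam G \<one> * a = a \<and> a * lam G \<one> = a}"
    by (intro closed_Collect_conj closed_Collect_eq continuous_intros)
  then have "Cred G \<subseteq> {a. lam G \<one> * a = a \<and> a * lam G \<one> = a}"
    unfolding Cred_def by (intro closure_minimal) (auto simp: group_ring_unit)
  then show "lam G \<one> * a = a" "a * lam G \<one> = a" if "a \<in> Cred G" for a using that by auto
  show "- a \<in> Cred G" if "a \<in> Cred G" for a
    using Cred_scaleC[OF that, of "-1"] by (simp add: scaleC_op_simps)
  fix a b assume "a \<in> Cred G" "b \<in> Cred G"
  then obtain x y where x: "\<And>n. x n \<in> group_ring G" "x \<longlonglongrightarrow> a"
    and y: "\<And>n. y n \<in> group_ring G" "y \<longlonglongrightarrow> b" by (meson Cred_seq)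
  show "a + b \<in> Cred G"
    by (rule Cred_limit[of "\<lambda>n. x n + y n"])
      (use x y group_ring_Cred group_ring_add in \<open>auto intro!: tendsto_add\<close>)
  show "a * b \<in> Cred G"
    by (rule Cred_limit[of "\<lambda>n. x n * y n"])
      (use x y group_ring_Cred group_ring_mult in \<open>auto intro!: tendsto_mult\<close>)
qed

section \<open>Coefficients, augmentation and trace on the group ring\<close>

lemma coeff_fun_lam: "k \<in> carrier G \<Longrightarrow> coeff_fun G (lam G k) h = (if h = k then 1 else 0)"
  unfolding coeff_fun_def by (auto simp: lam_apply[OF is_group] inv_equality)
    (metis inv_closed inv_inv inv_equality)

lemma coeff_fun_lam_mult:
  "k \<in> carrier G \<Longrightarrow> coeff_fun G (lam G k * b) h = (if h \<in> carrier G then coeff_fun G b (inv k \<otimes> h) else 0)"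
  by (simp add: coeff_fun_def lam_apply[OF is_group])

lemma coeff_fun_sum_lam:
  assumes "finite F" "F \<subseteq> carrier G"
  shows "coeff_fun G (\<Sum>h\<in>F. scaleC_op (c h) (lam G h)) k = (if k \<in> F then c k else 0)"
proof -
  have "coeff_fun G (\<Sum>h\<in>F. scaleC_op (c h) (lam G h)) k = (\<Sum>h\<in>F. if k = h then c h else 0)"
    unfolding coeff_fun_sum
    by (rule sum.cong) (use assms in \<open>auto simp: coeff_fun_simps coeff_fun_lam subset_iff\<close>)
  then show ?thesis using assms by simp
qed

text \<open>Applying an element to the delta function at the neutral element recovers its
  coefficients. Hence the left regular representation is faithful on the group ring, and elements
  may be compared coefficientwise.\<close>

lemma coeff_support:
  assumes "a \<in> group_ring G"
  shows "finite {h. coeff_fun G a h \<noteq> 0}" "{h. coeff_fun G a h \<noteq> 0} \<subseteq> carrier G"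
    "a = (\<Sum>h | coeff_fun G a h \<noteq> 0. scaleC_op (coeff_fun G a h) (lam G h))"
proof -
  obtain F c where F: "finite F" "F \<subseteq> carrier G" "a = (\<Sum>h\<in>F. scaleC_op (c h) (lam G h))"
    using assms by (auto simp: group_ring_def)
  have c: "coeff_fun G a h = (if h \<in> F then c h else 0)" for h
    using F coeff_fun_sum_lam by simp
  have sub: "{h. coeff_fun G a h \<noteq> 0} \<subseteq> F" using c by (auto split: if_splits)
  show "finite {h. coeff_fun G a h \<noteq> 0}" "{h. coeff_fun G a h \<noteq> 0} \<subseteq> carrier G"
    using sub F finite_subset by auto
  have "a = (\<Sum>h\<in>F. scaleC_op (coeff_fun G a h) (lam G h))"
    by (subst F(3), rule sum.cong) (auto simp: c)
  also have "\<dots> = (\<Sum>h | coeff_fun G a h \<noteq> 0. scaleC_op (coeff_fun G a h) (lam G h))"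
    by (rule sum.mono_neutral_right) (use F sub in \<open>auto simp: scaleC_op_simps\<close>)
  finally show "a = (\<Sum>h | coeff_fun G a h \<noteq> 0. scaleC_op (coeff_fun G a h) (lam G h))" .
qed

lemma group_ring_eqI:
  assumes "a \<in> group_ring G" "b \<in> group_ring G"
    "\<And>h. h \<in> carrier G \<Longrightarrow> coeff_fun G a h = coeff_fun G b h"
  shows "a = b"
proof -
  have "coeff_fun G a h = coeff_fun G b h" for h
    using assms coeff_support(2) by (metis (mono_tags, lifting) mem_Collect_eq subsetD)
  then show ?thesis
    using coeff_support(3)[OF assms(1)] coeff_support(3)[OF assms(2)] by simp
qed

text \<open>Inverse to \<open>coeff_fun\<close> on functions with finite support in the carrier;
  values outside the carrier are ignored.\<close>

definition gr :: "('a \<Rightarrow> complex) \<Rightarrow> 'a ell2_op" where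
  "gr f = (\<Sum>h | h \<in> carrier G \<and> f h \<noteq> 0. scaleC_op (f h) (lam G h))"

lemma gr:
  assumes "finite {h \<in> carrier G. f h \<noteq> 0}"
  shows "gr f \<in> group_ring G" "\<And>h. h \<in> carrier G \<Longrightarrow> coeff_fun G (gr f) h = f h"
  using assms coeff_fun_sum_lam[of "{h \<in> carrier G. f h \<noteq> 0}" f]
  by (auto simp: gr_def intro!: group_ringI)

lemma augmentation_eq_sum:
  assumes "finite F" "{h. coeff_fun G a h \<noteq> 0} \<subseteq> F" "a \<in> group_ring G"
  shows "augmentation G a = (\<Sum>h\<in>F. coeff_fun G a h)"
  unfolding augmentation_def using assms coeff_support(2)[OF assms(3)]
  by (intro sum.mono_neutral_left) auto

lemma augmentation_add:
  assumes "a \<in> group_ring G" "b \<in> group_ring G"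
  shows "augmentation G (a + b) = augmentation G a + augmentation G b"
proof -
  let ?F = "{h. coeff_fun G a h \<noteq> 0} \<union> {h. coeff_fun G b h \<noteq> 0}"
  have F: "finite ?F" using assms coeff_support(1) by auto
  have "{h. coeff_fun G (a + b) h \<noteq> 0} \<subseteq> ?F" by (auto simp: coeff_fun_simps)
  then show ?thesis
    using augmentation_eq_sum[OF F, of a] augmentation_eq_sum[OF F, of b]
      augmentation_eq_sum[OF F, of "a + b"] assms group_ring_add
    by (auto simp: coeff_fun_simps sum.distrib)
qed

lemma augmentation_zero [simp]: "augmentation G 0 = 0"
  by (simp add: augmentation_def coeff_fun_simps)

lemma augmentation_scaleC: "augmentation G (scaleC_op c a) = c * augmentation G a"
  by (cases "c = 0") (auto simp: augmentation_def coeff_fun_simps sum_distrib_left)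

lemma augmentation_lam_mult:
  assumes "b \<in> group_ring G" "k \<in> carrier G"
  shows "augmentation G (lam G k * b) = augmentation G b"
  unfolding augmentation_def
  by (rule sum.reindex_bij_witness[where i = "\<lambda>h. k \<otimes> h" and j = "\<lambda>h. inv k \<otimes> h"])
    (use assms coeff_support(2)[OF assms(1)] in
      \<open>auto simp: coeff_fun_lam_mult m_assoc[symmetric] split: if_splits\<close>)

lemma augmentation_lam: "k \<in> carrier G \<Longrightarrow> augmentation G (lam G k) = 1"
  using augmentation_eq_sum[of "{k}" "lam G k"] group_ring_lam[of k 1]
  by (auto simp: coeff_fun_lam scaleC_op_simps)

lemma augmentation_mult:
  assumes "a \<in> group_ring G" "b \<in> group_ring G"
  shows "augmentation G (a * b) = augmentation G a * augmentation G b"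
  using assms(1)
proof (induction rule: group_ring_induct)
  case (add a c h)
  then show ?case using assms(2)
    by (simp add: distrib_right augmentation_add group_ring_mult group_ring_lam scaleC_op_simps
        group_ring_scaleC group_ring_lam_mult augmentation_scaleC augmentation_lam_mult augmentation_lam)
qed simp

lemma augmentation_minus:
  "a \<in> group_ring G \<Longrightarrow> b \<in> group_ring G \<Longrightarrow> augmentation G (a - b) = augmentation G a - augmentation G b"
  by (metis augmentation_add diff_add_cancel eq_diff_eq group_ring.minus_mem)

lemma augmentation_sum:
  "(\<And>i. i \<in> I \<Longrightarrow> f i \<in> group_ring G) \<Longrightarrow> augmentation G (sum f I) = (\<Sum>i\<in>I. augmentation G (f i))"
  by (induction I rule: infinite_finite_induct) (auto simp: augmentation_add group_ring.sum_mem)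

text \<open>Finite support falls under the summable case of \<open>deloc_trace_extension\<close>. So
  every admissible \<open>t\<close> has the same values on the group ring, and only these enter the
  final computation.\<close>

lemma deloc_trace_group_ring:
  assumes "deloc_trace_extension G g S \<nu> t" "group_ring G \<subseteq> S" "a \<in> group_ring G"
  shows "t a = (\<Sum>h | h \<in> conj_class G g \<and> coeff_fun G a h \<noteq> 0. coeff_fun G a h)"
proof -
  note fin = coeff_support(1)[OF assms(3)]
  have "(\<lambda>h. cmod (coeff_fun G a h)) summable_on carrier G \<longleftrightarrow>
      (\<lambda>h. cmod (coeff_fun G a h)) summable_on {h \<in> carrier G. coeff_fun G a h \<noteq> 0}"
    by (rule summable_on_cong_neutral) auto
  then have "t a = deloc_trace G g (coeff_fun G a)"
    using assms fin by (auto simp: deloc_trace_extension_def)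
  also have "\<dots> = infsum (coeff_fun G a) {h. h \<in> conj_class G g \<and> coeff_fun G a h \<noteq> 0}"
    unfolding deloc_trace_def by (rule infsum_cong_neutral) auto
  finally show ?thesis using fin by (simp add: infsum_finite)
qed

end

section \<open>Matrices over a corner ring\<close>

lemma mat_mult_index:
  fixes A :: "'b::semiring_0 mat"
  assumes "i < dim_row A" "j < dim_col B" "dim_col A = dim_row B"
  shows "(A * B) $$ (i, j) = (\<Sum>k<dim_row B. A $$ (i, k) * B $$ (k, j))"
  using assms by (auto simp: scalar_prod_def atLeast0LessThan intro!: sum.cong)

lemma mat_mult_assoc:
  fixes A :: "'b::semiring_0 mat"
  assumes "dim_col A = dim_row B" "dim_col B = dim_row C"
  shows "A * B * C = A * (B * C)"
  by (rule assoc_mult_mat) (use assms in auto)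

lemma mat_distrib:
  fixes A :: "'b::ring mat"
  shows "dim_row A = dim_row B \<Longrightarrow> dim_col A = dim_col B \<Longrightarrow> dim_col B = dim_row C \<Longrightarrow> (A + B) * C = A * C + B * C"
    "dim_row A = dim_row B \<Longrightarrow> dim_col A = dim_col B \<Longrightarrow> dim_col B = dim_row C \<Longrightarrow> (A - B) * C = A * C - B * C"
    "dim_row B = dim_row C \<Longrightarrow> dim_col B = dim_col C \<Longrightarrow> dim_col A = dim_row C \<Longrightarrow> A * (B + C) = A * B + A * C"
    "dim_row B = dim_row C \<Longrightarrow> dim_col B = dim_col C \<Longrightarrow> dim_col A = dim_row C \<Longrightarrow> A * (B - C) = A * B - A * C"
    "dim_col A = dim_row B \<Longrightarrow> (- A) * B = - (A * B)"
    "dim_col A = dim_row B \<Longrightarrow> A * (- B) = - (A * B)"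
  by (rule eq_matI;
      simp add: mat_mult_index sum.distrib sum_subtractf sum_negf algebra_simps del: index_mult_mat(1))+

lemma mat_zero_mult:
  fixes A :: "'b::semiring_0 mat"
  shows "dim_row A = n \<Longrightarrow> 0\<^sub>m m n * A = 0\<^sub>m m (dim_col A)"
    "dim_col A = n \<Longrightarrow> A * 0\<^sub>m n m = 0\<^sub>m (dim_row A) m"
  by (rule eq_matI; simp add: mat_mult_index del: index_mult_mat(1))+

definition mats :: "'b set \<Rightarrow> nat \<Rightarrow> nat \<Rightarrow> 'b mat set" where
  "mats A m n = {p \<in> carrier_mat m n. elements_mat p \<subseteq> A}"

lemma mats_iff: "p \<in> mats A m n \<longleftrightarrow> dim_row p = m \<and> dim_col p = n \<and> (\<forall>i<m. \<forall>j<n. p $$ (i, j) \<in> A)"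
  unfolding mats_def elements_mat_def by (fastforce simp: subset_iff image_iff)

lemma mats_dim: "p \<in> mats A m n \<Longrightarrow> dim_row p = m" "p \<in> mats A m n \<Longrightarrow> dim_col p = n"
  by (auto simp: mats_iff)

lemma mats_mono: "A \<subseteq> B \<Longrightarrow> mats A m n \<subseteq> mats B m n"
  by (auto simp: mats_iff subset_iff)

text \<open>Elements of the chain modules are rows, so a module homomorphism is found one row at a
  time and then assembled into a matrix.\<close>

lemma mat_of_rows_exists:
  assumes "\<And>i. i < k \<Longrightarrow> \<exists>y \<in> mats A 1 n. P i y"
  shows "\<exists>b \<in> mats A k n. \<forall>i<k. P i (mat 1 n (\<lambda>(_, j). b $$ (i, j)))"
proof -
  obtain y where y: "y i \<in> mats A 1 n" "P i (y i)" if "i < k" for i using assms by metis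
  have "mat 1 n (\<lambda>(_, j). mat k n (\<lambda>(i, j). y i $$ (0, j)) $$ (i, j)) = y i" if "i < k" for i
    using y(1)[OF that] that by (intro eq_matI) (auto simp: mats_iff)
  then show ?thesis
    using y by (intro bexI[of _ "mat k n (\<lambda>(i, j). y i $$ (0, j))"]) (auto simp: mats_iff)
qed

abbreviation mat_row :: "'b mat \<Rightarrow> nat \<Rightarrow> 'b mat" where
  "mat_row p i \<equiv> mat 1 (dim_col p) (\<lambda>(_, j). p $$ (i, j))"

lemma mat_row_mult:
  fixes p :: "'b::semiring_0 mat"
  assumes "dim_col p = dim_row q" "i < dim_row p"
  shows "mat_row p i * q = mat_row (p * q) i"
  using assms by (intro eq_matI) (auto simp: mat_mult_index simp del: index_mult_mat(1))

lemma mat_eq_rowsI: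
  assumes "dim_row p = dim_row q" "dim_col p = dim_col q"
    "\<And>i. i < dim_row q \<Longrightarrow> mat_row p i = mat_row q i"
  shows "p = q"
proof (rule eq_matI)
  fix i j assume ij: "i < dim_row q" "j < dim_col q"
  have "mat_row p i $$ (0, j) = mat_row q i $$ (0, j)" using assms(3)[OF ij(1)] by simp
  then show "p $$ (i, j) = q $$ (i, j)" using ij assms by simp
qed (use assms in auto)

text \<open>The identity matrix relative to a corner: \<open>e\<close> is the unit of
  \<open>A\<close>, not of the ambient ring.\<close>

definition unit_mat :: "'b::zero \<Rightarrow> nat \<Rightarrow> 'b mat" where
  "unit_mat e n = mat n n (\<lambda>(i, j). if i = j then e else 0)"

lemma unit_mat_simps [simp]:
  "dim_row (unit_mat e n) = n" "dim_col (unit_mat e n) = n"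
  "i < n \<Longrightarrow> j < n \<Longrightarrow> unit_mat e n $$ (i, j) = (if i = j then e else 0)"
  by (auto simp: unit_mat_def)

context corner_ring
begin

lemma mats_closed:
  "p \<in> mats A m n \<Longrightarrow> q \<in> mats A n k \<Longrightarrow> p * q \<in> mats A m k"
  "p \<in> mats A m n \<Longrightarrow> q \<in> mats A m n \<Longrightarrow> p + q \<in> mats A m n"
  "p \<in> mats A m n \<Longrightarrow> q \<in> mats A m n \<Longrightarrow> p - q \<in> mats A m n"
  "p \<in> mats A m n \<Longrightarrow> - p \<in> mats A m n"
  "0\<^sub>m m n \<in> mats A m n"
  "unit_mat e n \<in> mats A n n"
  by (auto simp: mats_iff mat_mult_index add_mem mult_mem minus_mem uminus_mem zero_mem unit_mem
      intro!: sum_mem simp del: index_mult_mat(1))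

lemma unit_mat_mult:
  assumes "p \<in> mats A m n"
  shows "unit_mat e m * p = p" "p * unit_mat e n = p"
proof -
  have "(\<Sum>k<m. (if i = k then e else 0) * p $$ (k, j)) = p $$ (i, j)" if "i < m" "j < n" for i j
  proof -
    have "(\<Sum>k<m. (if i = k then e else 0) * p $$ (k, j)) = (\<Sum>k<m. if k = i then e * p $$ (i, j) else 0)"
      by (rule sum.cong) auto
    then show ?thesis using assms that by (auto simp: mats_iff unit_left)
  qed
  then show "unit_mat e m * p = p"
    using assms by (intro eq_matI) (auto simp: mats_iff mat_mult_index simp del: index_mult_mat(1))
  have "(\<Sum>k<n. p $$ (i, k) * (if k = j then e else 0)) = p $$ (i, j)" if "i < m" "j < n" for i j
  proof -
    have "(\<Sum>k<n. p $$ (i, k) * (if k = j then e else 0)) = (\<Sum>k<n. if k = j then p $$ (i, j) * e else 0)"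
      by (rule sum.cong) auto
    then show ?thesis using assms that by (auto simp: mats_iff unit_right)
  qed
  then show "p * unit_mat e n = p"
    using assms by (intro eq_matI) (auto simp: mats_iff mat_mult_index simp del: index_mult_mat(1))
qed

end

section \<open>Operator matrices on vectors of square-summable functions\<close>

definition sqnorm_vec :: "'g ell2 vec \<Rightarrow> real" where
  "sqnorm_vec \<xi> = (\<Sum>i<dim_vec \<xi>. (norm (vec_index \<xi> i))\<^sup>2)"

lemma sqnorm_vec_nonneg [simp]: "0 \<le> sqnorm_vec \<xi>"
  by (simp add: sqnorm_vec_def sum_nonneg)

lemma sqnorm_vec_index_le: "i < dim_vec \<xi> \<Longrightarrow> (norm (vec_index \<xi> i))\<^sup>2 \<le> sqnorm_vec \<xi>"
  unfolding sqnorm_vec_def by (rule member_le_sum) auto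

lemma sqnorm_vec_eq_0: "sqnorm_vec \<xi> = 0 \<longleftrightarrow> \<xi> = 0\<^sub>v (dim_vec \<xi>)"
  unfolding sqnorm_vec_def by (subst sum_nonneg_eq_0_iff) (auto simp: vec_eq_iff)

lemma cinner_vec_self: "cinner_vec \<xi> \<xi> = of_real (sqnorm_vec \<xi>)"
  by (simp add: cinner_vec_def sqnorm_vec_def cinner_ell2_self_norm)

lemma Re_cinner_vec: "Re (cinner_vec \<xi> \<eta>) = (\<Sum>i<dim_vec \<xi>. inner (vec_index \<xi> i) (vec_index \<eta> i))"
  by (simp add: cinner_vec_def inner_ell2_def)

lemma sqnorm_vec_add_le:
  assumes "dim_vec \<xi> = dim_vec \<eta>"
  shows "sqnorm_vec (\<xi> + \<eta>) \<le> 2 * sqnorm_vec \<xi> + 2 * sqnorm_vec \<eta>"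
proof -
  have "(norm (x + y))\<^sup>2 \<le> 2 * (norm x)\<^sup>2 + 2 * (norm y)\<^sup>2" for x y :: "'a ell2"
  proof -
    have "(norm (x + y))\<^sup>2 \<le> (norm x + norm y)\<^sup>2" by (intro power_mono norm_triangle_ineq) simp
    also have "\<dots> \<le> 2 * (norm x)\<^sup>2 + 2 * (norm y)\<^sup>2"
      using zero_le_power2[of "norm x - norm y"] by (simp add: power2_sum power2_diff)
    finally show ?thesis .
  qed
  then show ?thesis
    using assms unfolding sqnorm_vec_def sum_distrib_left
    by (simp flip: sum.distrib) (intro sum_mono, simp)
qed

lemma cinner_vec_simps:
  "dim_vec \<xi> = dim_vec \<eta> \<Longrightarrow> cinner_vec (\<xi> + \<eta>) \<zeta> = cinner_vec \<xi> \<zeta> + cinner_vec \<eta> \<zeta>"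
  "dim_vec \<xi> = dim_vec \<zeta> \<Longrightarrow> dim_vec \<eta> = dim_vec \<zeta> \<Longrightarrow> cinner_vec \<zeta> (\<xi> + \<eta>) = cinner_vec \<zeta> \<xi> + cinner_vec \<zeta> \<eta>"
  "dim_vec \<xi> = dim_vec \<eta> \<Longrightarrow> cinner_vec (\<xi> - \<eta>) \<zeta> = cinner_vec \<xi> \<zeta> - cinner_vec \<eta> \<zeta>"
  "dim_vec \<xi> = dim_vec \<zeta> \<Longrightarrow> dim_vec \<eta> = dim_vec \<zeta> \<Longrightarrow> cinner_vec \<zeta> (\<xi> - \<eta>) = cinner_vec \<zeta> \<xi> - cinner_vec \<zeta> \<eta>"
  by (auto simp: cinner_vec_def cinner_ell2_simps cinner_ell2_minus sum.distrib sum_subtractf)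

lemma cinner_vec_commute: "dim_vec \<xi> = dim_vec \<eta> \<Longrightarrow> cinner_vec \<eta> \<xi> = cnj (cinner_vec \<xi> \<eta>)"
  by (simp add: cinner_vec_def cinner_ell2_commute[of "vec_index \<xi> _"])

lemma cinner_vec_zero [simp]: "cinner_vec \<xi> (0\<^sub>v (dim_vec \<xi>)) = 0" "cinner_vec (0\<^sub>v n) \<xi> = 0"
  by (simp_all add: cinner_vec_def cinner_ell2_simps)

lemma vec_eq_if_cinner_vec_diff:
  assumes "dim_vec \<xi> = dim_vec \<eta>" "cinner_vec (\<xi> - \<eta>) (\<xi> - \<eta>) = 0"
  shows "\<xi> = \<eta>"
proof -
  have "\<xi> - \<eta> = 0\<^sub>v (dim_vec \<eta>)"
    using assms(2) unfolding cinner_vec_self of_real_eq_0_iff sqnorm_vec_eq_0 by simp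
  then show ?thesis using assms(1) by (auto simp: vec_eq_iff)
qed

lemma mat_apply_dim [simp]: "dim_vec (mat_apply p \<xi>) = dim_row p"
  by (simp add: mat_apply_def)

lemma mat_apply_index:
  "i < dim_row p \<Longrightarrow> vec_index (mat_apply p \<xi>) i = (\<Sum>j<dim_col p. op_apply (p $$ (i, j)) (vec_index \<xi> j))"
  by (simp add: mat_apply_def)

lemma mat_apply_mult:
  assumes "dim_col p = dim_row q"
  shows "mat_apply (p * q) \<xi> = mat_apply p (mat_apply q \<xi>)"
proof (rule eq_vecI)
  fix i assume "i < dim_vec (mat_apply p (mat_apply q \<xi>))"
  then show "vec_index (mat_apply (p * q) \<xi>) i = vec_index (mat_apply p (mat_apply q \<xi>)) i"
    using assms
    by (simp add: mat_apply_index mat_mult_index op_apply_sum_left del: index_mult_mat(1))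
      (rule sum.swap)
qed simp

lemma mat_apply_simps:
  "dim_row p = dim_row q \<Longrightarrow> dim_col p = dim_col q \<Longrightarrow> mat_apply (p + q) \<xi> = mat_apply p \<xi> + mat_apply q \<xi>"
  "dim_row p = dim_row q \<Longrightarrow> dim_col p = dim_col q \<Longrightarrow> mat_apply (p - q) \<xi> = mat_apply p \<xi> - mat_apply q \<xi>"
  "dim_vec \<xi> = dim_col p \<Longrightarrow> dim_vec \<eta> = dim_col p \<Longrightarrow> mat_apply p (\<xi> + \<eta>) = mat_apply p \<xi> + mat_apply p \<eta>"
  "dim_vec \<xi> = dim_col p \<Longrightarrow> dim_vec \<eta> = dim_col p \<Longrightarrow> mat_apply p (\<xi> - \<eta>) = mat_apply p \<xi> - mat_apply p \<eta>"
  "mat_apply (0\<^sub>m m n) \<xi> = 0\<^sub>v m"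
  by (rule eq_vecI; simp add: mat_apply_index sum.distrib sum_subtractf)+

lemma mat_apply_zero: "mat_apply p (0\<^sub>v (dim_col p)) = 0\<^sub>v (dim_row p)"
  by (rule eq_vecI) (simp_all add: mat_apply_index)

lemma mat_apply_unit_vec:
  assumes "i < dim_row p" "j < dim_col p"
  shows "vec_index (mat_apply p (vec (dim_col p) (\<lambda>l. if l = j then \<eta> else 0))) i = op_apply (p $$ (i, j)) \<eta>"
proof -
  have "(\<Sum>l<dim_col p. op_apply (p $$ (i, l)) (if l = j then \<eta> else 0)) =
      (\<Sum>l<dim_col p. if l = j then op_apply (p $$ (i, j)) \<eta> else 0)"
    by (rule sum.cong) auto
  then show ?thesis using assms by (simp add: mat_apply_index)
qed

lemma mat_eq_if_mat_apply_eq: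
  assumes "dim_row p = dim_row q" "dim_col p = dim_col q"
    "\<And>\<xi>. \<xi> \<in> carrier_vec (dim_col q) \<Longrightarrow> mat_apply p \<xi> = mat_apply q \<xi>"
  shows "p = q"
proof (rule eq_matI)
  fix i j assume ij: "i < dim_row q" "j < dim_col q"
  show "p $$ (i, j) = q $$ (i, j)"
  proof (rule op_eqI)
    fix \<eta>
    show "op_apply (p $$ (i, j)) \<eta> = op_apply (q $$ (i, j)) \<eta>"
      using assms(3)[of "vec (dim_col q) (\<lambda>l. if l = j then \<eta> else 0)"]
        mat_apply_unit_vec[of i p j \<eta>] mat_apply_unit_vec[of i q j \<eta>] ij assms(1,2) by simp
  qed
qed (use assms in auto)

text \<open>Cauchy-Schwarz in each row allows the sum of the squared norms of all entries as
  constant.\<close>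

lemma mat_apply_bounded: "\<exists>K\<ge>0. \<forall>\<xi>\<in>carrier_vec (dim_col p). sqnorm_vec (mat_apply p \<xi>) \<le> K * sqnorm_vec \<xi>"
proof (intro exI conjI ballI)
  let ?K = "\<Sum>i<dim_row p. \<Sum>j<dim_col p. (norm (p $$ (i, j)))\<^sup>2"
  show "0 \<le> ?K" by (intro sum_nonneg) simp
  fix \<xi> :: "'a ell2 vec" assume \<xi>: "\<xi> \<in> carrier_vec (dim_col p)"
  have "(norm (vec_index (mat_apply p \<xi>) i))\<^sup>2 \<le> (\<Sum>j<dim_col p. (norm (p $$ (i, j)))\<^sup>2) * sqnorm_vec \<xi>"
    if "i < dim_row p" for i
  proof -
    have "norm (vec_index (mat_apply p \<xi>) i) \<le> (\<Sum>j<dim_col p. norm (p $$ (i, j)) * norm (vec_index \<xi> j))"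
      unfolding mat_apply_index[OF that] by (intro sum_norm_le norm_op_apply_le)
    then have "(norm (vec_index (mat_apply p \<xi>) i))\<^sup>2 \<le> (\<Sum>j<dim_col p. norm (p $$ (i, j)) * norm (vec_index \<xi> j))\<^sup>2"
      by (intro power_mono) auto
    also have "\<dots> \<le> (\<Sum>j<dim_col p. (norm (p $$ (i, j)))\<^sup>2) * (\<Sum>j<dim_col p. (norm (vec_index \<xi> j))\<^sup>2)"
      by (rule Cauchy_Schwarz_ineq_sum)
    finally show ?thesis using \<xi> by (simp add: sqnorm_vec_def)
  qed
  then have "(\<Sum>i<dim_row p. (norm (vec_index (mat_apply p \<xi>) i))\<^sup>2) \<le>
      (\<Sum>i<dim_row p. (\<Sum>j<dim_col p. (norm (p $$ (i, j)))\<^sup>2) * sqnorm_vec \<xi>)"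
    by (intro sum_mono) auto
  then show "sqnorm_vec (mat_apply p \<xi>) \<le> ?K * sqnorm_vec \<xi>"
    unfolding sum_distrib_right by (simp add: sqnorm_vec_def[of "mat_apply p \<xi>"])
qed

section \<open>Inverting positive operator matrices\<close>

context group
begin

abbreviation U :: "nat \<Rightarrow> 'a ell2_op mat" where
  "U n \<equiv> unit_mat (lam G \<one>) n"

lemma mat_apply_U_index:
  assumes "i < n"
  shows "vec_index (mat_apply (U n) \<xi>) i = op_apply (lam G \<one>) (vec_index \<xi> i)"
proof -
  have "(\<Sum>j<n. op_apply (if i = j then lam G \<one> else 0) (vec_index \<xi> j)) =
      (\<Sum>j<n. if j = i then op_apply (lam G \<one>) (vec_index \<xi> i) else 0)"
    by (rule sum.cong) auto
  then show ?thesis using assms by (simp add: mat_apply_index)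
qed

lemma sqnorm_mat_apply_U_le: "\<xi> \<in> carrier_vec n \<Longrightarrow> sqnorm_vec (mat_apply (U n) \<xi>) \<le> sqnorm_vec \<xi>"
  unfolding sqnorm_vec_def
  by (auto intro!: sum_mono power_mono simp: mat_apply_U_index norm_lam_one_apply_le)

lemma mats_Cred_unit:
  assumes "p \<in> mats (Cred G) m n"
  shows "mat_apply (U m) (mat_apply p \<xi>) = mat_apply p \<xi>"
    "mat_apply p (mat_apply (U n) \<xi>) = mat_apply p \<xi>"
  using assms Cred.unit_mat_mult[OF assms] by (metis mat_apply_mult mats_dim unit_mat_simps(1,2))+

lemma mats_group_ring_Cred: "p \<in> mats (group_ring G) m n \<Longrightarrow> p \<in> mats (Cred G) m n"
  using mats_mono[OF group_ring_Cred] by blast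

text \<open>A Neumann series in \<open>U n - \<epsilon> A\<close>, whose operator norm is below \<open>1\<close> for small \<open>\<epsilon>\<close>.\<close>

lemma Cred_mat_invertible:
  assumes A: "A \<in> mats (Cred G) n n" and "c > 0"
    and pos: "\<And>\<xi>. \<xi> \<in> carrier_vec n \<Longrightarrow> mat_apply (U n) \<xi> = \<xi> \<Longrightarrow> c * sqnorm_vec \<xi> \<le> Re (cinner_vec \<xi> (mat_apply A \<xi>))"
  obtains B where "B \<in> mats (Cred G) n n" "A * B = U n" "B * A = U n"
proof -
  note dA = mats_dim[OF A]
  obtain K where K: "K \<ge> 0" "\<And>\<xi>. \<xi> \<in> carrier_vec n \<Longrightarrow> sqnorm_vec (mat_apply A \<xi>) \<le> K * sqnorm_vec \<xi>"
    using mat_apply_bounded[of A] dA by auto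
  \<comment> \<open>The squared norm of \<open>\<xi> - \<epsilon> A \<xi>\<close> is at most
    \<open>1 - 2 \<epsilon> c + \<epsilon>\<^sup>2 K\<close> times that of \<open>\<xi>\<close>,
    which is a contraction once \<open>\<epsilon> K < 2 c\<close>. The summand 1 in the denominator
    guards against \<open>K = 0\<close>.\<close>
  define \<epsilon> where "\<epsilon> = c / (K + 1)"
  have \<epsilon>: "\<epsilon> > 0" using \<open>c > 0\<close> K by (simp add: \<epsilon>_def)
  \<comment> \<open>The maximum with 0 lets \<open>sqrt r\<close> serve as the ratio of the
    dominating geometric series.\<close>
  define r where "r = max 0 (1 - 2 * \<epsilon> * c + \<epsilon>\<^sup>2 * K)"
  have "\<epsilon>\<^sup>2 * K < 2 * \<epsilon> * c"
  proof -
    have "\<epsilon> * K \<le> \<epsilon> * (K + 1)" using \<epsilon> by simp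
    also have "\<dots> = c" using K by (simp add: \<epsilon>_def)
    finally have "\<epsilon> * (\<epsilon> * K) \<le> \<epsilon> * c" using \<epsilon> by simp
    then show ?thesis using \<epsilon> \<open>c > 0\<close> by (simp add: power2_eq_square)
  qed
  then have r: "0 \<le> r" "r < 1" by (auto simp: r_def)
  define T where "T = mat n n (\<lambda>(i, j). U n $$ (i, j) - \<epsilon> *\<^sub>R A $$ (i, j))"
  have scR: "\<epsilon> *\<^sub>R a \<in> Cred G" if "a \<in> Cred G" for a
    using Cred_scaleC[OF that, of "of_real \<epsilon>"] by (simp add: scaleC_op_simps)
  have T: "T \<in> mats (Cred G) n n"
    using A by (auto simp: T_def mats_iff intro!: Cred.minus_mem Cred.uminus_mem scR Cred.unit_mem Cred.zero_mem)
  note dT = mats_dim[OF T]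
  have T_apply: "vec_index (mat_apply T \<xi>) i = vec_index \<xi> i - \<epsilon> *\<^sub>R vec_index (mat_apply A \<xi>) i"
    if "i < n" "mat_apply (U n) \<xi> = \<xi>" for \<xi> i
  proof -
    have "vec_index (mat_apply T \<xi>) i = vec_index (mat_apply (U n) \<xi>) i - \<epsilon> *\<^sub>R vec_index (mat_apply A \<xi>) i"
      using that(1) dA by (simp add: T_def mat_apply_index sum_subtractf scaleR_sum_right del: unit_mat_simps(3))
    then show ?thesis using that by simp
  qed
  have T_contr: "sqnorm_vec (mat_apply T \<xi>) \<le> r * sqnorm_vec \<xi>"
    if \<xi>: "\<xi> \<in> carrier_vec n" "mat_apply (U n) \<xi> = \<xi>" for \<xi>
  proof -
    have expand: "(norm (x - \<epsilon> *\<^sub>R y))\<^sup>2 = (norm x)\<^sup>2 - 2 * \<epsilon> * inner x y + \<epsilon>\<^sup>2 * (norm y)\<^sup>2"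
      for x y :: "'a ell2"
      unfolding power2_norm_eq_inner by (simp add: inner_diff inner_commute power2_eq_square algebra_simps)
    have "sqnorm_vec (mat_apply T \<xi>) = (\<Sum>i<n. (norm (vec_index \<xi> i))\<^sup>2
        - 2 * \<epsilon> * inner (vec_index \<xi> i) (vec_index (mat_apply A \<xi>) i)
        + \<epsilon>\<^sup>2 * (norm (vec_index (mat_apply A \<xi>) i))\<^sup>2)"
      unfolding sqnorm_vec_def using dT that
      by (auto intro!: sum.cong simp: T_apply expand)
    also have "\<dots> = sqnorm_vec \<xi> - 2 * \<epsilon> * Re (cinner_vec \<xi> (mat_apply A \<xi>)) + \<epsilon>\<^sup>2 * sqnorm_vec (mat_apply A \<xi>)"
      using that dA by (simp add: sqnorm_vec_def Re_cinner_vec sum.distrib sum_subtractf sum_distrib_left)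
    also have "\<dots> \<le> sqnorm_vec \<xi> - 2 * \<epsilon> * (c * sqnorm_vec \<xi>) + \<epsilon>\<^sup>2 * (K * sqnorm_vec \<xi>)"
      using pos[OF \<xi>] K(2)[OF \<xi>(1)] \<epsilon> by (intro add_mono diff_mono mult_left_mono) auto
    also have "\<dots> = (1 - 2 * \<epsilon> * c + \<epsilon>\<^sup>2 * K) * sqnorm_vec \<xi>" by (simp add: algebra_simps)
    also have "\<dots> \<le> r * sqnorm_vec \<xi>" by (intro mult_right_mono) (auto simp: r_def)
    finally show ?thesis .
  qed
  define P where "P k = ((\<lambda>X. T * X) ^^ k) (U n)" for k
  have P0: "P 0 = U n" and PS: "P (Suc k) = T * P k" for k by (auto simp: P_def)
  have P: "P k \<in> mats (Cred G) n n" for k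
    by (induction k) (auto simp: P0 PS intro!: Cred.mats_closed T)
  note dP = mats_dim[OF P]
  have PS': "P (Suc k) = P k * T" for k
  proof (induction k)
    case 0
    then show ?case by (simp add: PS P0 Cred.unit_mat_mult[OF T])
  next
    case (Suc k)
    then show ?case by (metis PS mat_mult_assoc dP dT)
  qed
  \<comment> \<open>\<open>T\<close> is known to contract only vectors fixed by \<open>U n\<close>,
    but every \<open>P k\<close> takes its values among these, so the estimate holds for all
    \<open>\<xi>\<close>.\<close>
  have P_contr: "sqnorm_vec (mat_apply (P k) \<xi>) \<le> r ^ k * sqnorm_vec \<xi>" if "\<xi> \<in> carrier_vec n" for \<xi> k
  proof (induction k)
    case 0
    then show ?case using sqnorm_mat_apply_U_le[OF that] by (simp add: P0)
  next
    case (Suc k)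
    have "sqnorm_vec (mat_apply (P (Suc k)) \<xi>) \<le> r * sqnorm_vec (mat_apply (P k) \<xi>)"
      unfolding PS using mats_Cred_unit(1)[OF P] dP
      by (subst mat_apply_mult) (auto intro!: T_contr simp: dT carrier_vecI)
    also have "\<dots> \<le> r * (r ^ k * sqnorm_vec \<xi>)" using Suc r by (intro mult_left_mono)
    finally show ?case by (simp add: mult.assoc)
  qed
  have P_norm: "norm (P k $$ (i, j)) \<le> sqrt r ^ k" if "i < n" "j < n" for i j k
  proof (rule norm_op_le)
    fix \<eta> :: "'a ell2"
    let ?\<xi> = "vec n (\<lambda>l. if l = j then \<eta> else 0)"
    have "sqnorm_vec ?\<xi> = (\<Sum>l<n. (norm (if l = j then \<eta> else 0))\<^sup>2)" by (simp add: sqnorm_vec_def)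
    also have "\<dots> = (\<Sum>l<n. if l = j then (norm \<eta>)\<^sup>2 else 0)" by (rule sum.cong) auto
    finally have nrm: "sqnorm_vec ?\<xi> = (norm \<eta>)\<^sup>2" using that by simp
    have "(norm (op_apply (P k $$ (i, j)) \<eta>))\<^sup>2 \<le> sqnorm_vec (mat_apply (P k) ?\<xi>)"
      using sqnorm_vec_index_le[of i "mat_apply (P k) ?\<xi>"] mat_apply_unit_vec[of i "P k" j \<eta>] that dP
      by simp
    also have "\<dots> \<le> r ^ k * (norm \<eta>)\<^sup>2" using P_contr[of ?\<xi> k] nrm by simp
    also have "\<dots> = (sqrt r ^ k * norm \<eta>)\<^sup>2"
      using r by (simp add: power_mult_distrib power2_eq_square flip: real_sqrt_mult real_sqrt_power)
    finally show "norm (op_apply (P k $$ (i, j)) \<eta>) \<le> sqrt r ^ k * norm \<eta>"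
      by (rule power2_le_imp_le) (use r in auto)
  qed (use r in auto)
  have sr: "norm (sqrt r) < 1" using r by simp
  have summ: "summable (\<lambda>k. P k $$ (i, j))" if "i < n" "j < n" for i j
    by (rule summable_comparison_test[OF _ summable_geometric[OF sr]]) (use P_norm[OF that] in auto)
  have tozero: "(\<lambda>k. P k $$ (i, j)) \<longlonglongrightarrow> 0" if "i < n" "j < n" for i j
    by (rule summable_LIMSEQ_zero[OF summ[OF that]])
  \<comment> \<open>Since \<open>T = U n - \<epsilon> A\<close>, the sum of the powers of
    \<open>T\<close> inverts \<open>\<epsilon> A\<close>; one more factor \<open>\<epsilon>\<close>
    gives the inverse of \<open>A\<close>.\<close>
  define B where "B = mat n n (\<lambda>(i, j). \<epsilon> *\<^sub>R (\<Sum>k. P k $$ (i, j)))"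
  have B: "B \<in> mats (Cred G) n n"
  proof -
    have "(\<Sum>k. P k $$ (i, j)) \<in> Cred G" if "i < n" "j < n" for i j
      by (rule Cred_limit[OF _ summable_LIMSEQ[OF summ[OF that]]])
        (use P that in \<open>auto intro!: Cred.sum_mem simp: mats_iff\<close>)
    then show ?thesis by (auto simp: B_def mats_iff intro!: scR)
  qed
  have tele: "(\<lambda>k. P k $$ (i, j) - P (Suc k) $$ (i, j)) sums (U n $$ (i, j))" if "i < n" "j < n" for i j
    using telescope_sums'[OF tozero[OF that]] by (simp add: P0)
  have "A * B = U n"
  proof (rule eq_matI)
    fix i j assume "i < dim_row (U n)" "j < dim_col (U n)"
    then have ij: "i < n" "j < n" by auto
    have "(\<lambda>k. \<Sum>l<n. A $$ (i, l) * (\<epsilon> *\<^sub>R P k $$ (l, j))) sums (\<Sum>l<n. A $$ (i, l) * (\<epsilon> *\<^sub>R (\<Sum>k. P k $$ (l, j))))"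
      using summ ij by (intro sums_sum sums_mult sums_scaleR_right summable_sums) auto
    moreover have "(\<Sum>l<n. A $$ (i, l) * (\<epsilon> *\<^sub>R P k $$ (l, j))) = P k $$ (i, j) - P (Suc k) $$ (i, j)" for k
    proof -
      have "P (Suc k) $$ (i, j) = (\<Sum>l<n. U n $$ (i, l) * P k $$ (l, j)) - (\<Sum>l<n. A $$ (i, l) * (\<epsilon> *\<^sub>R P k $$ (l, j)))"
        unfolding PS using ij dP dT
        by (simp add: mat_mult_index T_def left_diff_distrib sum_subtractf del: index_mult_mat(1) unit_mat_simps(3))
      also have "(\<Sum>l<n. U n $$ (i, l) * P k $$ (l, j)) = P k $$ (i, j)"
        using Cred.unit_mat_mult(1)[OF P, of k] mat_mult_index[of i "U n" j "P k"] ij dP by simp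
      finally show ?thesis by simp
    qed
    ultimately show "(A * B) $$ (i, j) = U n $$ (i, j)"
      using sums_unique2[OF _ tele[OF ij]] ij dA
      by (simp add: mat_mult_index B_def del: index_mult_mat(1) unit_mat_simps(3))
  qed (use dA in \<open>auto simp: B_def\<close>)
  moreover have "B * A = U n"
  proof (rule eq_matI)
    fix i j assume "i < dim_row (U n)" "j < dim_col (U n)"
    then have ij: "i < n" "j < n" by auto
    have "(\<lambda>k. \<Sum>l<n. (\<epsilon> *\<^sub>R P k $$ (i, l)) * A $$ (l, j)) sums (\<Sum>l<n. (\<epsilon> *\<^sub>R (\<Sum>k. P k $$ (i, l))) * A $$ (l, j))"
      using summ ij by (intro sums_sum sums_mult2 sums_scaleR_right summable_sums) auto
    moreover have "(\<Sum>l<n. (\<epsilon> *\<^sub>R P k $$ (i, l)) * A $$ (l, j)) = P k $$ (i, j) - P (Suc k) $$ (i, j)" for k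
    proof -
      have "P (Suc k) $$ (i, j) = (\<Sum>l<n. P k $$ (i, l) * U n $$ (l, j)) - (\<Sum>l<n. (\<epsilon> *\<^sub>R P k $$ (i, l)) * A $$ (l, j))"
        unfolding PS' using ij dP dT
        by (simp add: mat_mult_index T_def right_diff_distrib sum_subtractf del: index_mult_mat(1) unit_mat_simps(3))
      also have "(\<Sum>l<n. P k $$ (i, l) * U n $$ (l, j)) = P k $$ (i, j)"
        using Cred.unit_mat_mult(2)[OF P, of k] mat_mult_index[of i "P k" j "U n"] ij dP by simp
      finally show ?thesis by simp
    qed
    ultimately show "(B * A) $$ (i, j) = U n $$ (i, j)"
      using sums_unique2[OF _ tele[OF ij]] ij dA
      by (simp add: mat_mult_index B_def del: index_mult_mat(1) unit_mat_simps(3))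
  qed (use dA in \<open>auto simp: B_def\<close>)
  ultimately show thesis using B that by blast
qed

lemma mats_group_ring_adjoint:
  assumes "a \<in> mats (group_ring G) m n"
  obtains b where "b \<in> mats (group_ring G) n m"
    "\<And>\<xi> \<eta>. \<xi> \<in> carrier_vec n \<Longrightarrow> \<eta> \<in> carrier_vec m \<Longrightarrow>
      cinner_vec (mat_apply a \<xi>) \<eta> = cinner_vec \<xi> (mat_apply b \<eta>)"
proof -
  define b where "b i j = (SOME b. b \<in> group_ring G \<and>
      (\<forall>\<xi> \<eta>. cinner_ell2 (op_apply (a $$ (i, j)) \<xi>) \<eta> = cinner_ell2 \<xi> (op_apply b \<eta>)))" for i j
  have "\<exists>b. b \<in> group_ring G \<and>
      (\<forall>\<xi> \<eta>. cinner_ell2 (op_apply (a $$ (i, j)) \<xi>) \<eta> = cinner_ell2 \<xi> (op_apply b \<eta>))"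
    if "i < m" "j < n" for i j
    using group_ring_adjoint[of "a $$ (i, j)"] assms that by (auto simp: mats_iff)
  from someI_ex[OF this] have b: "i < m \<Longrightarrow> j < n \<Longrightarrow> b i j \<in> group_ring G"
    "i < m \<Longrightarrow> j < n \<Longrightarrow> cinner_ell2 (op_apply (a $$ (i, j)) \<xi>) \<eta> = cinner_ell2 \<xi> (op_apply (b i j) \<eta>)"
    for i j \<xi> \<eta> unfolding b_def by blast+
  show thesis
  proof (rule that[of "mat n m (\<lambda>(j, i). b i j)"])
    show "mat n m (\<lambda>(j, i). b i j) \<in> mats (group_ring G) n m" using b by (auto simp: mats_iff)
    fix \<xi> \<eta> :: "'a ell2 vec" assume "\<xi> \<in> carrier_vec n" "\<eta> \<in> carrier_vec m"
    then have "cinner_vec (mat_apply a \<xi>) \<eta> = (\<Sum>i<m. \<Sum>j<n. cinner_ell2 (vec_index \<xi> j) (op_apply (b i j) (vec_index \<eta> i)))"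
      using mats_dim[OF assms] by (simp add: cinner_vec_def mat_apply_index cinner_ell2_sum b)
    also have "\<dots> = (\<Sum>j<n. \<Sum>i<m. cinner_ell2 (vec_index \<xi> j) (op_apply (b i j) (vec_index \<eta> i)))"
      by (rule sum.swap)
    also have "\<dots> = cinner_vec \<xi> (mat_apply (mat n m (\<lambda>(j, i). b i j)) \<eta>)"
      using \<open>\<xi> \<in> _\<close> by (simp add: cinner_vec_def mat_apply_index cinner_ell2_sum)
    finally show "cinner_vec (mat_apply a \<xi>) \<eta> = cinner_vec \<xi> (mat_apply (mat n m (\<lambda>(j, i). b i j)) \<eta>)" .
  qed
qed

text \<open>With \<open>A = d\<^sup>* d + (1 - q)\<^sup>* (1 - q)\<close>, which is bounded below, \<open>A q = d\<^sup>* d\<close>, so \<open>q A\<^sup>-\<^sup>1 d\<^sup>*\<close> works.\<close>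

lemma pseudo_inverse:
  assumes d: "d \<in> mats (group_ring G) m n" and q: "q \<in> mats (group_ring G) n n"
    and qq: "q * q = q" and dq: "d * q = d" and "c > 0"
    and low: "\<And>\<xi>. \<xi> \<in> carrier_vec n \<Longrightarrow> mat_apply q \<xi> = \<xi> \<Longrightarrow> c * sqnorm_vec \<xi> \<le> sqnorm_vec (mat_apply d \<xi>)"
  obtains s where "s \<in> mats (Cred G) n m" "s * d = q" "q * s = s"
    "\<And>\<xi> \<eta>. \<xi> \<in> carrier_vec m \<Longrightarrow> \<eta> \<in> carrier_vec m \<Longrightarrow>
      cinner_vec (mat_apply (d * s) \<xi>) \<eta> = cinner_vec \<xi> (mat_apply (d * s) \<eta>)"
proof -
  obtain d' where d': "d' \<in> mats (group_ring G) n m" and adj_d: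
    "\<And>\<xi> \<eta>. \<xi> \<in> carrier_vec n \<Longrightarrow> \<eta> \<in> carrier_vec m \<Longrightarrow> cinner_vec (mat_apply d \<xi>) \<eta> = cinner_vec \<xi> (mat_apply d' \<eta>)"
    using mats_group_ring_adjoint[OF d] by blast
  \<comment> \<open>\<open>q\<close> may be an oblique idempotent, so the part of a vector outside
    its range is measured by \<open>U n - q\<close> and the adjoint of that matrix.\<close>
  define q1 where "q1 = U n - q"
  have q1: "q1 \<in> mats (group_ring G) n n" unfolding q1_def by (intro group_ring.mats_closed q)
  obtain q' where q': "q' \<in> mats (group_ring G) n n" and adj_q:
    "\<And>\<xi> \<eta>. \<xi> \<in> carrier_vec n \<Longrightarrow> \<eta> \<in> carrier_vec n \<Longrightarrow> cinner_vec (mat_apply q1 \<xi>) \<eta> = cinner_vec \<xi> (mat_apply q' \<eta>)"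
    using mats_group_ring_adjoint[OF q1] by blast
  note dims [simp] = mats_dim[OF d] mats_dim[OF q] mats_dim[OF d'] mats_dim[OF q1] mats_dim[OF q']
  define A where "A = d' * d + q' * q1"
  have A: "A \<in> mats (group_ring G) n n"
    unfolding A_def by (intro group_ring.mats_closed(2) group_ring.mats_closed(1)[OF d' d] group_ring.mats_closed(1)[OF q' q1])
  have A': "A \<in> mats (Cred G) n n" by (rule mats_group_ring_Cred[OF A])
  note dA [simp] = mats_dim[OF A]
  have A_apply: "mat_apply A \<xi> = mat_apply d' (mat_apply d \<xi>) + mat_apply q' (mat_apply q1 \<xi>)" for \<xi>
    by (simp add: A_def mat_apply_simps mat_apply_mult)
  have A_inner: "cinner_vec \<xi> (mat_apply A \<eta>) = cinner_vec (mat_apply d \<xi>) (mat_apply d \<eta>) + cinner_vec (mat_apply q1 \<xi>) (mat_apply q1 \<eta>)"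
    if "\<xi> \<in> carrier_vec n" "\<eta> \<in> carrier_vec n" for \<xi> \<eta>
  proof -
    have "cinner_vec \<xi> (mat_apply A \<eta>) = cinner_vec \<xi> (mat_apply d' (mat_apply d \<eta>)) +
        cinner_vec \<xi> (mat_apply q' (mat_apply q1 \<eta>))"
      unfolding A_apply by (rule cinner_vec_simps(2)) (use that in auto)
    then show ?thesis
      using adj_d[OF that(1), of "mat_apply d \<eta>"] adj_q[OF that(1), of "mat_apply q1 \<eta>"]
      by (simp add: carrier_vecI)
  qed
  have A_self: "cinner_vec (mat_apply A \<xi>) \<eta> = cinner_vec \<xi> (mat_apply A \<eta>)"
    if "\<xi> \<in> carrier_vec n" "\<eta> \<in> carrier_vec n" for \<xi> \<eta>
  proof -
    have "cinner_vec (mat_apply A \<xi>) \<eta> = cnj (cinner_vec \<eta> (mat_apply A \<xi>))"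
      by (rule cinner_vec_commute) (use that in auto)
    also have "\<dots> = cinner_vec (mat_apply d \<xi>) (mat_apply d \<eta>) + cinner_vec (mat_apply q1 \<xi>) (mat_apply q1 \<eta>)"
      unfolding A_inner[OF that(2,1)]
      by (simp add: cinner_vec_commute[of "mat_apply d \<eta>" "mat_apply d \<xi>"]
          cinner_vec_commute[of "mat_apply q1 \<eta>" "mat_apply q1 \<xi>"])
    finally show ?thesis using A_inner[OF that] by simp
  qed
  \<comment> \<open>The half pays for the factor 2 in \<open>sqnorm_vec_add_le\<close> when a vector
    is split by \<open>q\<close> and \<open>q1\<close>; the minimum with 1 matches the second term
    of \<open>A\<close>, whose constant is 1.\<close>
  define c' where "c' = min c 1 / 2"
  have c': "c' > 0" using \<open>c > 0\<close> by (simp add: c'_def)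
  obtain B where B: "B \<in> mats (Cred G) n n" "A * B = U n" "B * A = U n"
  proof (rule Cred_mat_invertible[OF A' c'])
    fix \<xi> :: "'a ell2 vec" assume \<xi>: "\<xi> \<in> carrier_vec n" "mat_apply (U n) \<xi> = \<xi>"
    let ?\<zeta> = "mat_apply q \<xi>"
    have 1: "c * sqnorm_vec ?\<zeta> \<le> sqnorm_vec (mat_apply d \<xi>)"
      using low[of ?\<zeta>] by (simp add: carrier_vecI qq dq flip: mat_apply_mult)
    have 2: "\<xi> = ?\<zeta> + mat_apply q1 \<xi>"
      using \<xi> by (intro eq_vecI) (auto simp: q1_def mat_apply_simps)
    have "c' * sqnorm_vec \<xi> \<le> c' * (2 * sqnorm_vec ?\<zeta> + 2 * sqnorm_vec (mat_apply q1 \<xi>))"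
      using c' sqnorm_vec_add_le[of ?\<zeta> "mat_apply q1 \<xi>"] 2 by (intro mult_left_mono) auto
    also have "\<dots> = min c 1 * sqnorm_vec ?\<zeta> + min c 1 * sqnorm_vec (mat_apply q1 \<xi>)"
      by (simp add: c'_def algebra_simps)
    also have "\<dots> \<le> c * sqnorm_vec ?\<zeta> + 1 * sqnorm_vec (mat_apply q1 \<xi>)"
      by (intro add_mono mult_right_mono) auto
    also have "\<dots> \<le> Re (cinner_vec \<xi> (mat_apply A \<xi>))"
      using 1 by (simp add: A_inner[OF \<xi>(1) \<xi>(1)] cinner_vec_self)
    finally show "c' * sqnorm_vec \<xi> \<le> Re (cinner_vec \<xi> (mat_apply A \<xi>))" .
  qed blast
  note dB [simp] = mats_dim[OF B(1)]
  have d'c: "d' \<in> mats (Cred G) n m" and qc: "q \<in> mats (Cred G) n n"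
    by (auto intro: mats_group_ring_Cred d' q)
  define s where "s = q * (B * d')"
  have s: "s \<in> mats (Cred G) n m" unfolding s_def by (intro Cred.mats_closed(1)[OF qc] Cred.mats_closed(1)[OF B(1) d'c])
  have "q1 * q = q - q"
    unfolding q1_def by (subst mat_distrib) (auto simp: group_ring.unit_mat_mult(1)[OF q] qq)
  then have q1q: "q1 * q = 0\<^sub>m n n" by (auto simp: mat_eq_iff)
  have "A * q = d' * d"
    unfolding A_def
    by (subst mat_distrib) (auto simp: mat_mult_assoc dq q1q mat_zero_mult mat_eq_iff)
  then have "B * (d' * d) = q"
    using B by (metis Cred.unit_mat_mult(1) dA dB(2) dims(3) mat_mult_assoc qc)
  then have sd: "s * d = q" by (simp add: s_def mat_mult_assoc qq)
  have qs: "q * s = s" by (simp add: s_def qq flip: mat_mult_assoc)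
  \<comment> \<open>With \<open>B\<close> inverse to the symmetric \<open>A\<close> and
    \<open>d'\<close> adjoint to \<open>d\<close>, the right-hand side is visibly symmetric.\<close>
  have ds: "d * s = d * (B * d')" by (simp add: s_def dq flip: mat_mult_assoc)
  have "cinner_vec (mat_apply (d * s) \<xi>) \<eta> = cinner_vec \<xi> (mat_apply (d * s) \<eta>)"
    if \<xi>: "\<xi> \<in> carrier_vec m" and \<eta>: "\<eta> \<in> carrier_vec m" for \<xi> \<eta>
  proof -
    define x where "x = mat_apply (B * d') \<xi>"
    define y where "y = mat_apply (B * d') \<eta>"
    have xy: "x \<in> carrier_vec n" "y \<in> carrier_vec n" by (auto simp: x_def y_def carrier_vecI)
    have ABd: "A * (B * d') = d'"
      using B d'c by (simp add: Cred.unit_mat_mult flip: mat_mult_assoc)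
    have A_xy: "mat_apply A x = mat_apply d' \<xi>" "mat_apply A y = mat_apply d' \<eta>"
      unfolding x_def y_def by (simp_all add: ABd flip: mat_apply_mult)
    have "cinner_vec (mat_apply (d * s) \<xi>) \<eta> = cinner_vec (mat_apply d x) \<eta>"
      by (simp add: ds x_def mat_apply_mult)
    also have "\<dots> = cinner_vec x (mat_apply A y)" using adj_d[OF xy(1) \<eta>] A_xy by simp
    also have "\<dots> = cinner_vec (mat_apply A x) y" using A_self[OF xy] by simp
    also have "\<dots> = cnj (cinner_vec y (mat_apply d' \<xi>))"
      unfolding A_xy using xy by (intro cinner_vec_commute) auto
    also have "\<dots> = cnj (cinner_vec (mat_apply d y) \<xi>)" using adj_d[OF xy(2) \<xi>] by simp
    also have "\<dots> = cinner_vec \<xi> (mat_apply d y)"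
      by (rule cinner_vec_commute[symmetric]) (use \<xi> in auto)
    also have "mat_apply d y = mat_apply (d * s) \<eta>" by (simp add: ds y_def mat_apply_mult)
    finally show ?thesis .
  qed
  then show thesis using that s sd qs by blast
qed

end

section \<open>Classes of idempotent matrices\<close>

lemma four_block_mult:
  fixes A1 :: "'b::ring mat"
  assumes "dim_row B1 = dim_row A1" "dim_col C1 = dim_col A1" "dim_row D1 = dim_row C1" "dim_col D1 = dim_col B1"
    "dim_row A2 = dim_col A1" "dim_row B2 = dim_col A1" "dim_row C2 = dim_col B1" "dim_row D2 = dim_col B1"
    "dim_col C2 = dim_col A2" "dim_col D2 = dim_col B2"
  shows "four_block_mat A1 B1 C1 D1 * four_block_mat A2 B2 C2 D2 =
    four_block_mat (A1 * A2 + B1 * C2) (A1 * B2 + B1 * D2) (C1 * A2 + D1 * C2) (C1 * B2 + D1 * D2)"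
  by (rule mult_four_block_mat[of _ "dim_row A1" "dim_col A1" _ "dim_col B1" _ "dim_row C1" _ _
      "dim_col A2" _ "dim_col B2"])
    (use assms in \<open>auto intro!: carrier_matI\<close>)

lemma diag_sum_dim [simp]:
  "dim_row (diag_sum p q) = dim_row p + dim_row q" "dim_col (diag_sum p q) = dim_col p + dim_col q"
  by (simp_all add: diag_sum_def)

lemma diag_sum_index:
  "i < dim_row p + dim_row q \<Longrightarrow> j < dim_col p + dim_col q \<Longrightarrow> diag_sum p q $$ (i, j) =
    (if i < dim_row p then if j < dim_col p then p $$ (i, j) else 0
     else if j < dim_col p then 0 else q $$ (i - dim_row p, j - dim_col p))"
  by (auto simp: diag_sum_def)

lemma mat_add_zero:
  fixes p :: "'b::ring mat"
  shows "dim_row p = m \<Longrightarrow> dim_col p = n \<Longrightarrow> p + 0\<^sub>m m n = p"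
    "dim_row p = m \<Longrightarrow> dim_col p = n \<Longrightarrow> 0\<^sub>m m n + p = p"
  by (auto simp: mat_eq_iff)

lemma diag_sum_mult:
  assumes "dim_col p = dim_row p'" "dim_col q = dim_row q'"
  shows "diag_sum p q * diag_sum p' q' = diag_sum (p * p') (q * q')"
  using assms unfolding diag_sum_def
  by (subst four_block_mult) (simp_all add: mat_zero_mult mat_add_zero)

lemma diag_sum_assoc: "diag_sum (diag_sum p q) r = diag_sum p (diag_sum q r)"
  using assoc_four_block_mat[of p q r] by (simp add: diag_sum_def)

lemma diag_sum_empty [simp]: "diag_sum p (0\<^sub>m 0 0) = p" "diag_sum (0\<^sub>m 0 0) p = p"
  by (rule eq_matI; simp add: diag_sum_index)+

text \<open>Both traces expand into the same double sum. The map \<open>t\<close> is additive only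
  on \<open>A\<close>, so every partial sum has to stay in \<open>A\<close>.\<close>

lemma mat_trace_mult_commute:
  fixes x :: "'b::ring mat"
  assumes t: "\<And>a b. a \<in> A \<Longrightarrow> b \<in> A \<Longrightarrow> t (a + b) = t a + t b" "\<And>a b. a \<in> A \<Longrightarrow> b \<in> A \<Longrightarrow> t (a * b) = t (b * a)"
    and A: "corner_ring A e" and x: "x \<in> mats A m n" and y: "y \<in> mats A n m"
  shows "mat_trace t (x * y) = mat_trace t (y * x)"
proof -
  interpret corner_ring A e by fact
  have "t 0 = 0" using t(1)[OF zero_mem zero_mem] by simp
  then have t_sum: "t (sum f I) = (\<Sum>i\<in>I. t (f i))" if "\<And>i. i \<in> I \<Longrightarrow> f i \<in> A" for f :: "nat \<Rightarrow> 'b" and I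
    using that by (induction I rule: infinite_finite_induct) (auto simp: t sum_mem)
  have expand: "mat_trace t (x * y) = (\<Sum>i<m. \<Sum>k<n. t (x $$ (i, k) * y $$ (k, i)))"
    if x: "x \<in> mats A m n" and y: "y \<in> mats A n m" for x y m n
  proof -
    have "t ((x * y) $$ (i, i)) = (\<Sum>k<n. t (x $$ (i, k) * y $$ (k, i)))" if "i < m" for i
      unfolding mat_mult_index[of i x i y, unfolded mats_dim[OF x] mats_dim[OF y], OF that that HOL.refl]
      by (rule t_sum) (use x y that in \<open>auto simp: mats_iff mult_mem\<close>)
    then show ?thesis using mats_dim[OF x] by (simp add: mat_trace_def del: index_mult_mat(1))
  qed
  show ?thesis unfolding expand[OF x y] expand[OF y x]
    by (subst sum.swap) (use x y t(2) in \<open>auto simp: mats_iff intro!: sum.cong\<close>)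
qed

lemma mat_trace_diag_sum:
  assumes "square_mat p" "square_mat q"
  shows "mat_trace t (diag_sum p q) = mat_trace t p + mat_trace t q"
proof -
  have split: "(\<Sum>i<m + n. f i) = (\<Sum>i<m. f i) + (\<Sum>i<n. f (m + i))" for m n :: nat and f :: "nat \<Rightarrow> complex"
    by (induction n) (auto simp: add.assoc)
  have "mat_trace t (diag_sum p q) = (\<Sum>i<dim_row p + dim_row q. t (diag_sum p q $$ (i, i)))"
    by (simp add: mat_trace_def)
  also have "\<dots> = (\<Sum>i<dim_row p. t (diag_sum p q $$ (i, i))) + (\<Sum>i<dim_row q. t (diag_sum p q $$ (dim_row p + i, dim_row p + i)))"
    by (rule split)
  also have "\<dots> = mat_trace t p + mat_trace t q"
    unfolding mat_trace_def using assms
    by (intro arg_cong2[where f = "(+)"] sum.cong) (auto simp: diag_sum_index)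
  finally show ?thesis .
qed

lemma idem_mats_iff: "p \<in> idem_mats A \<longleftrightarrow> p \<in> mats A (dim_row p) (dim_row p) \<and> p * p = p"
  unfolding idem_mats_def mats_def by (auto intro: carrier_matI)

lemma idem_matsD:
  assumes "p \<in> idem_mats A"
  shows "p \<in> mats A (dim_row p) (dim_row p)" "p * p = p" "dim_col p = dim_row p"
  using assms by (auto simp: idem_mats_iff mats_iff)

lemma idem_matsI: "p \<in> mats A n n \<Longrightarrow> p * p = p \<Longrightarrow> p \<in> idem_mats A"
  by (auto simp: idem_mats_iff mats_iff)

lemma idem_equiv_iff: "idem_equiv A p q \<longleftrightarrow>
    (\<exists>x \<in> mats A (dim_row p) (dim_row q). \<exists>y \<in> mats A (dim_row q) (dim_row p). p = x * y \<and> q = y * x)"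
  unfolding idem_equiv_def mats_def by blast

lemma idem_mats_mono: "A \<subseteq> B \<Longrightarrow> idem_mats A \<subseteq> idem_mats B"
  by (auto simp: idem_mats_def)

lemma idem_equiv_mono: "A \<subseteq> B \<Longrightarrow> idem_equiv A p q \<Longrightarrow> idem_equiv B p q"
  unfolding idem_equiv_def by blast

lemma idem_equiv_sym: "idem_equiv A p q \<Longrightarrow> idem_equiv A q p"
  unfolding idem_equiv_def by blast

lemma idem_equiv_refl: "p \<in> idem_mats A \<Longrightarrow> idem_equiv A p p"
  unfolding idem_equiv_iff using idem_matsD[of p A] by (intro bexI[of _ p]) auto

context corner_ring
begin

lemma four_block_mats:
  "a \<in> mats A m n \<Longrightarrow> b \<in> mats A m n' \<Longrightarrow> c \<in> mats A m' n \<Longrightarrow> d \<in> mats A m' n' \<Longrightarrow>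
    four_block_mat a b c d \<in> mats A (m + m') (n + n')"
  by (auto simp: mats_iff)

lemma diag_sum_mats: "p \<in> mats A m n \<Longrightarrow> q \<in> mats A m' n' \<Longrightarrow> diag_sum p q \<in> mats A (m + m') (n + n')"
  unfolding diag_sum_def by (intro four_block_mats) (auto simp: mats_iff zero_mem)

lemma diag_sum_idem:
  assumes "p \<in> idem_mats A" "q \<in> idem_mats A"
  shows "diag_sum p q \<in> idem_mats A"
  using idem_matsD[OF assms(1)] idem_matsD[OF assms(2)]
  by (intro idem_matsI[OF diag_sum_mats]) (simp_all add: diag_sum_mult)

lemma empty_idem: "0\<^sub>m 0 0 \<in> idem_mats A"
  by (rule idem_matsI[of _ _ 0]) (auto simp: mats_iff)

lemma idem_equiv_trans:
  assumes "p \<in> idem_mats A" "r \<in> idem_mats A" "idem_equiv A p q" "idem_equiv A q r"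
  shows "idem_equiv A p r"
proof -
  obtain x y where xy: "x \<in> mats A (dim_row p) (dim_row q)" "y \<in> mats A (dim_row q) (dim_row p)"
    "p = x * y" "q = y * x" using assms(3) unfolding idem_equiv_iff by blast
  obtain z w where zw: "z \<in> mats A (dim_row q) (dim_row r)" "w \<in> mats A (dim_row r) (dim_row q)"
    "q = z * w" "r = w * z" using assms(4) unfolding idem_equiv_iff by blast
  note dims [simp] = mats_dim[OF xy(1)] mats_dim[OF xy(2)] mats_dim[OF zw(1)] mats_dim[OF zw(2)]
  have "(x * z) * (w * y) = x * (z * w) * y" by (simp add: mat_mult_assoc)
  also have "\<dots> = x * (y * x) * y" by (simp only: zw(3)[symmetric] xy(4)[symmetric])
  also have "\<dots> = (x * y) * (x * y)" by (simp add: mat_mult_assoc)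
  also have "\<dots> = p" using xy(3) idem_matsD(2)[OF assms(1)] by simp
  finally have 1: "p = (x * z) * (w * y)" by simp
  have "(w * y) * (x * z) = w * (y * x) * z" by (simp add: mat_mult_assoc)
  also have "\<dots> = w * (z * w) * z" by (simp only: zw(3)[symmetric] xy(4)[symmetric])
  also have "\<dots> = (w * z) * (w * z)" by (simp add: mat_mult_assoc)
  also have "\<dots> = r" using zw(4) idem_matsD(2)[OF assms(2)] by simp
  finally have "r = (w * y) * (x * z)" by simp
  with 1 show ?thesis unfolding idem_equiv_iff using mats_closed(1)[OF xy(1) zw(1)] mats_closed(1)[OF zw(2) xy(2)]
    by blast
qed

lemma idem_equiv_diag_sum:
  assumes "idem_equiv A p p'" "idem_equiv A q q'"
  shows "idem_equiv A (diag_sum p q) (diag_sum p' q')"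
proof -
  obtain x y where xy: "x \<in> mats A (dim_row p) (dim_row p')" "y \<in> mats A (dim_row p') (dim_row p)"
    "p = x * y" "p' = y * x" using assms(1) unfolding idem_equiv_iff by blast
  obtain z w where zw: "z \<in> mats A (dim_row q) (dim_row q')" "w \<in> mats A (dim_row q') (dim_row q)"
    "q = z * w" "q' = w * z" using assms(2) unfolding idem_equiv_iff by blast
  have "diag_sum p q = diag_sum x z * diag_sum y w" "diag_sum p' q' = diag_sum y w * diag_sum x z"
    using mats_dim[OF xy(1)] mats_dim[OF xy(2)] mats_dim[OF zw(1)] mats_dim[OF zw(2)]
    by (simp_all add: diag_sum_mult flip: xy(3,4) zw(3,4))
  then show ?thesis
    unfolding idem_equiv_iff diag_sum_dim
    using diag_sum_mats[OF xy(1) zw(1)] diag_sum_mats[OF xy(2) zw(2)] by blast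
qed

text \<open>The witnesses are the block flips, with \<open>p\<close> and \<open>q\<close> in place
  of identity blocks so that the products are the idempotents themselves.\<close>

lemma idem_equiv_diag_sum_commute:
  assumes p: "p \<in> idem_mats A" and q: "q \<in> idem_mats A"
  shows "idem_equiv A (diag_sum p q) (diag_sum q p)"
proof -
  note pq = idem_matsD[OF p] idem_matsD[OF q]
  let ?x = "four_block_mat (0\<^sub>m (dim_row p) (dim_row q)) p q (0\<^sub>m (dim_row q) (dim_row p))"
  let ?y = "four_block_mat (0\<^sub>m (dim_row q) (dim_row p)) q p (0\<^sub>m (dim_row p) (dim_row q))"
  have x: "?x \<in> mats A (dim_row p + dim_row q) (dim_row q + dim_row p)"
    by (intro four_block_mats mats_closed pq)
  have y: "?y \<in> mats A (dim_row q + dim_row p) (dim_row p + dim_row q)"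
    by (intro four_block_mats mats_closed pq)
  have "diag_sum p q = ?x * ?y"
    by (subst four_block_mult) (use pq in \<open>auto simp: mat_zero_mult mat_add_zero diag_sum_def\<close>)
  moreover have "diag_sum q p = ?y * ?x"
    by (subst four_block_mult) (use pq in \<open>auto simp: mat_zero_mult mat_add_zero diag_sum_def\<close>)
  ultimately show ?thesis unfolding idem_equiv_iff diag_sum_dim using x y by blast
qed

text \<open>The column with blocks \<open>r\<close> and \<open>1 - r\<close> times the row with the
  same blocks is the diagonal sum, and in the other order the blocks add up to the identity. This
  allows an arbitrary stabilising idempotent to be traded for an identity matrix.\<close>

lemma idem_equiv_complement:
  assumes r: "r \<in> idem_mats A"
  defines "n \<equiv> dim_row r"
  shows "unit_mat e n - r \<in> idem_mats A" "idem_equiv A (diag_sum r (unit_mat e n - r)) (unit_mat e n)"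
proof -
  have rm: "r \<in> mats A n n" and rr: "r * r = r" using idem_matsD[OF r] by (auto simp: n_def)
  note dr [simp] = mats_dim[OF rm]
  define r' where "r' = unit_mat e n - r"
  have r': "r' \<in> mats A n n" unfolding r'_def by (intro mats_closed rm)
  note dr' [simp] = mats_dim[OF r']
  have r_r': "r * r' = 0\<^sub>m n n"
    unfolding r'_def by (subst mat_distrib) (auto simp: unit_mat_mult[OF rm] rr mat_eq_iff)
  have r'_r: "r' * r = 0\<^sub>m n n"
    unfolding r'_def by (subst mat_distrib) (auto simp: unit_mat_mult[OF rm] rr mat_eq_iff)
  have "r' * r' = r' * unit_mat e n - r' * r"
    by (subst r'_def(1)) (subst (2) r'_def, subst mat_distrib, auto simp: r'_def)
  then have r'r': "r' * r' = r'" by (auto simp: unit_mat_mult[OF r'] r'_r mat_eq_iff)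
  show "unit_mat e n - r \<in> idem_mats A" using r' r'r' by (auto simp flip: r'_def intro: idem_matsI)
  \<comment> \<open>A block column and a block row, padded with empty blocks so that multiplication
    of four-block matrices applies.\<close>
  let ?x = "four_block_mat r (0\<^sub>m n 0) r' (0\<^sub>m n 0)"
  let ?y = "four_block_mat r r' (0\<^sub>m 0 n) (0\<^sub>m 0 n)"
  have x: "?x \<in> mats A (n + n) (n + 0)" by (intro four_block_mats mats_closed rm r')
  have y: "?y \<in> mats A (n + 0) (n + n)" by (intro four_block_mats mats_closed rm r')
  have "diag_sum r r' = ?x * ?y"
    by (subst four_block_mult) (auto simp: mat_zero_mult mat_add_zero diag_sum_def rr r'r' r_r' r'_r)
  moreover have "?y * ?x = diag_sum (r + r') (0\<^sub>m 0 0)"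
    by (subst four_block_mult) (auto simp: mat_zero_mult mat_add_zero diag_sum_def rr r'r' r_r' r'_r)
  moreover have "r + r' = unit_mat e n" by (rule eq_matI) (auto simp: r'_def)
  ultimately show "idem_equiv A (diag_sum r (unit_mat e n - r)) (unit_mat e n)"
    unfolding idem_equiv_iff diag_sum_dim r'_def[symmetric] using x y
    by (intro bexI[of _ ?x] bexI[of _ ?y]) auto
qed

section \<open>The commutative semigroup of classes of idempotents\<close>

definition idem_class :: "'b mat \<Rightarrow> 'b mat set" where
  "idem_class p = {z \<in> idem_mats A. idem_equiv A z p}"

text \<open>Defined for arbitrary sets of matrices, intersected with the idempotents, so that
  associativity and commutativity hold without side conditions.\<close>

definition class_sum :: "'b mat set \<Rightarrow> 'b mat set \<Rightarrow> 'b mat set" where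
  "class_sum X Y = {z \<in> idem_mats A. \<exists>p \<in> X \<inter> idem_mats A. \<exists>q \<in> Y \<inter> idem_mats A. idem_equiv A z (diag_sum p q)}"

lemma idem_class_eq_iff:
  assumes "p \<in> idem_mats A" "q \<in> idem_mats A"
  shows "idem_class p = idem_class q \<longleftrightarrow> idem_equiv A p q"
  using assms unfolding idem_class_def
  by (auto intro: idem_equiv_refl dest: idem_equiv_trans idem_equiv_sym)

lemma idem_class_diag_sum:
  assumes "p \<in> idem_mats A" "q \<in> idem_mats A"
  shows "idem_class (diag_sum p q) = class_sum (idem_class p) (idem_class q)"
proof (intro equalityI subsetI)
  fix z assume "z \<in> idem_class (diag_sum p q)"
  then show "z \<in> class_sum (idem_class p) (idem_class q)"
    using assms idem_equiv_refl unfolding idem_class_def class_sum_def by blast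
next
  fix z assume "z \<in> class_sum (idem_class p) (idem_class q)"
  then obtain p' q' where z: "z \<in> idem_mats A" "idem_equiv A z (diag_sum p' q')"
    "idem_equiv A p' p" "idem_equiv A q' q" by (auto simp: idem_class_def class_sum_def)
  have "idem_equiv A z (diag_sum p q)"
    by (rule idem_equiv_trans[OF z(1) diag_sum_idem[OF assms] z(2) idem_equiv_diag_sum[OF z(3,4)]])
  then show "z \<in> idem_class (diag_sum p q)" using z(1) by (simp add: idem_class_def)
qed

sublocale class_sum: abel_semigroup class_sum
proof
  fix X Y Z
  show "class_sum X Y = class_sum Y X"
  proof -
    have "class_sum X Y \<subseteq> class_sum Y X" for X Y
    proof
      fix z assume "z \<in> class_sum X Y"
      then obtain p q where z: "z \<in> idem_mats A" "p \<in> X \<inter> idem_mats A" "q \<in> Y \<inter> idem_mats A"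
        "idem_equiv A z (diag_sum p q)" unfolding class_sum_def by blast
      then have "idem_equiv A z (diag_sum q p)"
        using idem_equiv_trans[OF _ _ _ idem_equiv_diag_sum_commute] diag_sum_idem by blast
      then show "z \<in> class_sum Y X" using z unfolding class_sum_def by blast
    qed
    then show ?thesis by blast
  qed
  show "class_sum (class_sum X Y) Z = class_sum X (class_sum Y Z)"
  proof (intro equalityI subsetI)
    fix z assume "z \<in> class_sum (class_sum X Y) Z"
    then obtain w p q r where z: "z \<in> idem_mats A" "w \<in> idem_mats A" "r \<in> idem_mats A" "p \<in> idem_mats A"
      "q \<in> idem_mats A" "p \<in> X" "q \<in> Y" "r \<in> Z" "idem_equiv A z (diag_sum w r)" "idem_equiv A w (diag_sum p q)"
      by (auto simp: class_sum_def)
    have "idem_equiv A z (diag_sum (diag_sum p q) r)"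
      using z by (meson diag_sum_idem idem_equiv_diag_sum idem_equiv_refl idem_equiv_trans)
    moreover have "diag_sum q r \<in> class_sum Y Z" "diag_sum q r \<in> idem_mats A"
      using z diag_sum_idem idem_equiv_refl unfolding class_sum_def by blast+
    ultimately show "z \<in> class_sum X (class_sum Y Z)"
      using z unfolding diag_sum_assoc class_sum_def[of X] by blast
  next
    fix z assume "z \<in> class_sum X (class_sum Y Z)"
    then obtain w p q r where z: "z \<in> idem_mats A" "w \<in> idem_mats A" "r \<in> idem_mats A" "p \<in> idem_mats A"
      "q \<in> idem_mats A" "p \<in> X" "q \<in> Y" "r \<in> Z" "idem_equiv A z (diag_sum p w)" "idem_equiv A w (diag_sum q r)"
      by (auto simp: class_sum_def)
    have "idem_equiv A z (diag_sum p (diag_sum q r))"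
      using z by (meson diag_sum_idem idem_equiv_diag_sum idem_equiv_refl idem_equiv_trans)
    moreover have "diag_sum p q \<in> class_sum X Y" "diag_sum p q \<in> idem_mats A"
      using z diag_sum_idem idem_equiv_refl unfolding class_sum_def by blast+
    ultimately show "z \<in> class_sum (class_sum X Y) Z"
      using z unfolding diag_sum_assoc[symmetric] class_sum_def[of _ Z] by blast
  qed
qed

text \<open>Equality in a commutative semigroup replaces chains of matrix equivalences; the
  simplifier can then rearrange summands.\<close>

lemma K0_rel_iff: "((p, q), (p', q')) \<in> K0_rel A \<longleftrightarrow>
    p \<in> idem_mats A \<and> q \<in> idem_mats A \<and> p' \<in> idem_mats A \<and> q' \<in> idem_mats A \<and>
    (\<exists>r \<in> idem_mats A. class_sum (class_sum (idem_class p) (idem_class q')) (idem_class r) =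
      class_sum (class_sum (idem_class p') (idem_class q)) (idem_class r))"
proof -
  have "idem_equiv A (diag_sum (diag_sum p q') r) (diag_sum (diag_sum p' q) r) \<longleftrightarrow>
      class_sum (class_sum (idem_class p) (idem_class q')) (idem_class r) =
      class_sum (class_sum (idem_class p') (idem_class q)) (idem_class r)"
    if "p \<in> idem_mats A" "q \<in> idem_mats A" "p' \<in> idem_mats A" "q' \<in> idem_mats A" "r \<in> idem_mats A" for r
    using that by (simp add: diag_sum_idem idem_class_eq_iff[symmetric] idem_class_diag_sum)
  then show ?thesis unfolding K0_rel_def by auto
qed

lemma equiv_K0_rel: "equiv (idem_mats A \<times> idem_mats A) (K0_rel A)"
proof (rule equivI)
  show "K0_rel A \<subseteq> (idem_mats A \<times> idem_mats A) \<times> (idem_mats A \<times> idem_mats A)"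
    by (auto simp: K0_rel_def)
  show "refl_on (idem_mats A \<times> idem_mats A) (K0_rel A)"
    by (auto simp: refl_on_def K0_rel_iff empty_idem)
  show "sym (K0_rel A)" unfolding sym_def by (auto simp: K0_rel_iff)
  show "trans (K0_rel A)"
  proof (rule transI, clarify)
    fix p q p' q' p'' q'' assume 1: "((p, q), (p', q')) \<in> K0_rel A" and 2: "((p', q'), (p'', q'')) \<in> K0_rel A"
    obtain r where r: "r \<in> idem_mats A" "class_sum (class_sum (idem_class p) (idem_class q')) (idem_class r) =
      class_sum (class_sum (idem_class p') (idem_class q)) (idem_class r)" using 1 unfolding K0_rel_iff by blast
    obtain s where s: "s \<in> idem_mats A" "class_sum (class_sum (idem_class p') (idem_class q'')) (idem_class s) =
      class_sum (class_sum (idem_class p'') (idem_class q')) (idem_class s)" using 2 unfolding K0_rel_iff by blast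
    have m: "p' \<in> idem_mats A" "q' \<in> idem_mats A" using 2 by (auto simp: K0_rel_iff)
    \<comment> \<open>The sum of the two given equations contains the middle pair on both sides; it
      is absorbed, together with both stabilising summands, into the new stabilising
      summand.\<close>
    let ?t = "diag_sum (diag_sum p' q') (diag_sum r s)"
    have "class_sum (class_sum (idem_class p) (idem_class q'')) (idem_class ?t) =
      class_sum (class_sum (class_sum (idem_class p) (idem_class q')) (idem_class r))
        (class_sum (class_sum (idem_class p') (idem_class q'')) (idem_class s))"
      using m r(1) s(1) by (simp add: idem_class_diag_sum diag_sum_idem class_sum.assoc class_sum.commute class_sum.left_commute)
    also have "\<dots> = class_sum (class_sum (idem_class p'') (idem_class q)) (idem_class ?t)"
      unfolding r(2) s(2)
      using m r(1) s(1) by (simp add: idem_class_diag_sum diag_sum_idem class_sum.assoc class_sum.commute class_sum.left_commute)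
    finally show "((p, q), (p'', q'')) \<in> K0_rel A"
      using 1 2 m r(1) s(1) by (auto simp: K0_rel_iff intro!: bexI[of _ ?t] diag_sum_idem)
  qed
qed

text \<open>Adding the complement of the stabilising idempotent \<open>r\<close> turns it into an
  identity matrix. Unlike \<open>r\<close>, this matrix has entries in every subring with the same
  unit, so the relation can be tested in the subring.\<close>

lemma K0_rel_unit:
  assumes "((p, q), (p', q')) \<in> K0_rel A"
  shows "\<exists>n. idem_equiv A (diag_sum (diag_sum p q') (unit_mat e n)) (diag_sum (diag_sum p' q) (unit_mat e n))"
proof -
  have idem: "p \<in> idem_mats A" "q \<in> idem_mats A" "p' \<in> idem_mats A" "q' \<in> idem_mats A"
    using assms by (auto simp: K0_rel_iff)
  obtain r where r: "r \<in> idem_mats A" and eq: "class_sum (class_sum (idem_class p) (idem_class q')) (idem_class r) =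
      class_sum (class_sum (idem_class p') (idem_class q)) (idem_class r)"
    using assms unfolding K0_rel_iff by blast
  let ?n = "dim_row r"
  note c = idem_equiv_complement[OF r]
  have u: "unit_mat e ?n \<in> idem_mats A"
    by (rule idem_matsI) (auto intro: mats_closed unit_mat_mult)
  have cl: "idem_class (unit_mat e ?n) = class_sum (idem_class r) (idem_class (unit_mat e ?n - r))"
    using idem_class_eq_iff[OF diag_sum_idem[OF r c(1)] u] c(2) idem_class_diag_sum[OF r c(1)] by simp
  have "idem_class (diag_sum (diag_sum p q') (unit_mat e ?n)) = idem_class (diag_sum (diag_sum p' q) (unit_mat e ?n))"
    (is "idem_class ?x = idem_class ?y")
    by (simp only: idem_class_diag_sum[OF diag_sum_idem u] idem_class_diag_sum idem cl eq
        flip: class_sum.assoc)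
  moreover have "?x \<in> idem_mats A" "?y \<in> idem_mats A" by (intro diag_sum_idem idem u)+
  ultimately have "idem_equiv A ?x ?y" by (simp add: idem_class_eq_iff)
  then show ?thesis by blast
qed

text \<open>Equivalent idempotents have equal traces, diagonal sums have additive traces, and the
  contribution of the stabilising idempotent cancels in the complex numbers; so the constant in
  \<open>K0_trace\<close> exists and is unique.\<close>

lemma K0_trace_class:
  assumes t: "\<And>a b. a \<in> A \<Longrightarrow> b \<in> A \<Longrightarrow> t (a + b) = t a + t b" "\<And>a b. a \<in> A \<Longrightarrow> b \<in> A \<Longrightarrow> t (a * b) = t (b * a)"
    and p: "p \<in> idem_mats A" "q \<in> idem_mats A"
  shows "K0_trace t (K0_rel A `` {(p, q)}) = mat_trace t p - mat_trace t q"
proof -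
  have sq: "square_mat z" if "z \<in> idem_mats A" for z using that by (simp add: idem_mats_def)
  have eq: "mat_trace t x = mat_trace t y" if xy: "idem_equiv A x y" for x y
  proof -
    obtain a b where "a \<in> mats A (dim_row x) (dim_row y)" "b \<in> mats A (dim_row y) (dim_row x)" "x = a * b" "y = b * a"
      using xy unfolding idem_equiv_iff by blast
    then show ?thesis using mat_trace_mult_commute[OF t corner_ring_axioms] by blast
  qed
  have eqs: "mat_trace t p' - mat_trace t q' = mat_trace t p - mat_trace t q" if "((p, q), (p', q')) \<in> K0_rel A" for p' q'
  proof -
    obtain r where r: "r \<in> idem_mats A" "p' \<in> idem_mats A" "q' \<in> idem_mats A"
      "idem_equiv A (diag_sum (diag_sum p q') r) (diag_sum (diag_sum p' q) r)"
      using \<open>_ \<in> K0_rel A\<close> by (auto simp: K0_rel_def)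
    have "mat_trace t p + mat_trace t q' + mat_trace t r = mat_trace t p' + mat_trace t q + mat_trace t r"
      using eq[OF r(4)] r p sq diag_sum_idem by (simp only: mat_trace_diag_sum)
    then show ?thesis by (simp add: algebra_simps)
  qed
  have self: "((p, q), (p, q)) \<in> K0_rel A"
    using equiv_K0_rel p unfolding equiv_def refl_on_def by blast
  show ?thesis
    unfolding K0_trace_def
  proof (rule the_equality)
    show "\<forall>(p', q') \<in> K0_rel A `` {(p, q)}. mat_trace t p' - mat_trace t q' = mat_trace t p - mat_trace t q"
      by (clarify, rule eqs)
    show "c = mat_trace t p - mat_trace t q"
      if "\<forall>(p', q') \<in> K0_rel A `` {(p, q)}. mat_trace t p' - mat_trace t q' = c" for c
      using bspec[OF that, of "(p, q)"] self by simp
  qed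
qed

end

section \<open>Comparing the K-groups of a ring and a subring\<close>

lemma K0_rel_mono:
  assumes "A \<subseteq> B"
  shows "K0_rel A \<subseteq> K0_rel B"
proof -
  have "idem_mats A \<subseteq> idem_mats B" by (rule idem_mats_mono[OF assms])
  then show ?thesis
    using idem_equiv_mono[OF assms] unfolding K0_rel_def by (clarsimp simp: subset_iff) blast
qed

lemma K0_trace_the_inv_into:
  fixes S C :: "'b::ring set"
  assumes S: "corner_ring S e" and C: "corner_ring C e" and "S \<subseteq> C"
    and refl: "\<And>p q. p \<in> idem_mats S \<Longrightarrow> q \<in> idem_mats S \<Longrightarrow> idem_equiv C p q \<Longrightarrow> idem_equiv S p q"
    and t: "\<And>a b. a \<in> S \<Longrightarrow> b \<in> S \<Longrightarrow> t (a + b) = t a + t b" "\<And>a b. a \<in> S \<Longrightarrow> b \<in> S \<Longrightarrow> t (a * b) = t (b * a)"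
    and a: "a \<in> idem_mats S" "b \<in> idem_mats S" and p: "((p, 0\<^sub>m 0 0), (a, b)) \<in> K0_rel C"
  shows "K0_trace t (the_inv_into (K0 S) (K0_incl C) (K0_class C p)) = mat_trace t a - mat_trace t b"
proof -
  interpret S: corner_ring S e by fact
  interpret C: corner_ring C e by fact
  note eqS = S.equiv_K0_rel and eqC = C.equiv_K0_rel
  have idem: "x \<in> idem_mats C" if "x \<in> idem_mats S" for x using that idem_mats_mono[OF \<open>S \<subseteq> C\<close>] by blast
  have incl: "K0_incl C (K0_rel S `` {(x, y)}) = K0_rel C `` {(x, y)}" if "x \<in> idem_mats S" "y \<in> idem_mats S" for x y
  proof -
    have "((x, y), (x, y)) \<in> K0_rel S" using eqS that unfolding equiv_def refl_on_def by blast
    then have "K0_rel C `` {(x, y)} \<subseteq> K0_incl C (K0_rel S `` {(x, y)})" unfolding K0_incl_def by blast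
    moreover have "K0_incl C (K0_rel S `` {(x, y)}) \<subseteq> K0_rel C `` {(x, y)}"
      unfolding K0_incl_def using K0_rel_mono[OF \<open>S \<subseteq> C\<close>] eqC unfolding equiv_def trans_def by blast
    ultimately show ?thesis by blast
  qed
  have pa: "K0_class C p = K0_rel C `` {(a, b)}"
    unfolding K0_class_def by (rule equiv_class_eq[OF eqC p])
  have "the_inv_into (K0 S) (K0_incl C) (K0_class C p) = K0_rel S `` {(a, b)}"
    unfolding the_inv_into_def
  proof (rule the_equality)
    show "K0_rel S `` {(a, b)} \<in> K0 S \<and> K0_incl C (K0_rel S `` {(a, b)}) = K0_class C p"
      using a incl pa by (auto simp: K0_def quotient_def)
    fix X assume X: "X \<in> K0 S \<and> K0_incl C X = K0_class C p"
    then obtain x y where xy: "x \<in> idem_mats S" "y \<in> idem_mats S" "X = K0_rel S `` {(x, y)}"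
      by (auto simp: K0_def quotient_def)
    then have "K0_rel C `` {(x, y)} = K0_rel C `` {(a, b)}" using X incl pa by simp
    then have "((x, y), (a, b)) \<in> K0_rel C"
      using eq_equiv_class[OF _ eqC] idem a by blast
    from C.K0_rel_unit[OF this] obtain n where
      n: "idem_equiv C (diag_sum (diag_sum x b) (unit_mat e n)) (diag_sum (diag_sum a y) (unit_mat e n))" by blast
    have u: "unit_mat e n \<in> idem_mats S"
      by (rule idem_matsI) (auto intro: S.mats_closed S.unit_mat_mult)
    have "idem_equiv S (diag_sum (diag_sum x b) (unit_mat e n)) (diag_sum (diag_sum a y) (unit_mat e n))"
      by (rule refl[OF _ _ n]) (intro S.diag_sum_idem u xy a)+
    then have "((x, y), (a, b)) \<in> K0_rel S" using u xy a by (auto simp: K0_rel_def)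
    then show "X = K0_rel S `` {(a, b)}" unfolding xy(3) by (rule equiv_class_eq[OF eqS])
  qed
  then show ?thesis using S.K0_trace_class[OF t a] by simp
qed

section \<open>Inverses in a smooth subalgebra\<close>

text \<open>The integrands for \<open>k\<close> and \<open>Suc k\<close> add up to
  \<open>1 / (z - 1) ^ Suc (Suc k)\<close>, whose integral vanishes; so the value only changes sign
  with \<open>k\<close>. This replaces computing the higher derivatives of
  \<open>1 / z\<close>.\<close>

lemma has_contour_integral_inverse_circlepath:
  "((\<lambda>z. (1 / z) / (z - 1) ^ Suc k) has_contour_integral (2 * of_real pi * \<i> * (-1) ^ k)) (circlepath 1 (3 / 4))"
proof -
  have nz: "z \<noteq> 0" if "dist 1 z \<le> 3 / 4" for z :: complex using that by auto
  define C where "C k = (2 * pi * \<i>) / fact k * (deriv ^^ k) (\<lambda>z. 1 / z) 1" for k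
  have C: "((\<lambda>z. (1 / z) / (z - 1) ^ Suc k) has_contour_integral C k) (circlepath 1 (3 / 4))" for k
    unfolding C_def
    by (rule Cauchy_has_contour_integral_higher_derivative_circlepath)
      (auto intro!: continuous_intros holomorphic_intros dest: nz[OF less_imp_le] nz)
  have "C (Suc k) + C k = 0" for k
  proof -
    have "((\<lambda>z. (1 / z) / (z - 1) ^ Suc (Suc k) + (1 / z) / (z - 1) ^ Suc k) has_contour_integral
        (C (Suc k) + C k)) (circlepath 1 (3 / 4))"
      by (intro has_contour_integral_add C)
    then have "((\<lambda>z. 1 / (z - 1) ^ Suc (Suc k)) has_contour_integral (C (Suc k) + C k)) (circlepath 1 (3 / 4))"
    proof (rule has_contour_integral_eq)
      fix z assume "z \<in> path_image (circlepath (1::complex) (3 / 4))"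
      then have "z \<noteq> 0" "z \<noteq> 1" by (auto simp: sphere_def dest!: nz[OF eq_refl])
      then show "1 / z / (z - 1) ^ Suc (Suc k) + 1 / z / (z - 1) ^ Suc k = 1 / (z - 1) ^ Suc (Suc k)"
        by (simp add: divide_simps)
    qed
    moreover have "((\<lambda>z. 1 / (z - 1) ^ Suc (Suc k)) has_contour_integral
        (2 * pi * \<i>) / fact (Suc k) * (deriv ^^ Suc k) (\<lambda>_. 1) 1) (circlepath (1::complex) (3 / 4))"
      by (rule Cauchy_has_contour_integral_higher_derivative_circlepath) auto
    ultimately show ?thesis
      unfolding higher_deriv_const by (auto dest: has_contour_integral_unique)
  qed
  then have step: "C (Suc k) = - C k" for k by (simp only: eq_neg_iff_add_eq_0)
  have "C k = 2 * of_real pi * \<i> * (-1) ^ k"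
  proof (induction k)
    case 0
    then show ?case by (simp add: C_def)
  next
    case (Suc k)
    then show ?case by (simp only: step) simp
  qed
  with C[of k] show ?thesis by simp
qed

context group
begin

section \<open>Powers and Neumann series relative to the unit of the corner\<close>

lemma norm_lam_one_le: "norm (lam G \<one>) \<le> 1"
  by (rule norm_op_le) (auto simp: norm_lam_one_apply_le)

definition cred_power :: "'a ell2_op \<Rightarrow> nat \<Rightarrow> 'a ell2_op" where
  "cred_power c k = ((\<lambda>x. c * x) ^^ k) (lam G \<one>)"

lemma cred_power:
  assumes c: "c \<in> Cred G"
  shows "cred_power c 0 = lam G \<one>" "cred_power c (Suc k) = c * cred_power c k"
    "cred_power c k \<in> Cred G" "cred_power c (Suc k) = cred_power c k * c" "norm (cred_power c k) \<le> norm c ^ k"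
proof -
  show 0: "cred_power c 0 = lam G \<one>" and S: "cred_power c (Suc k) = c * cred_power c k" for k
    by (simp_all add: cred_power_def)
  show mem: "cred_power c k \<in> Cred G" for k
    by (induction k) (auto simp: 0 S Cred.unit_mem Cred.mult_mem c)
  show "cred_power c (Suc k) = cred_power c k * c"
    by (induction k) (auto simp: 0 S Cred.unit_left Cred.unit_right c mult.assoc[symmetric] simp del: mult.assoc)
  show "norm (cred_power c k) \<le> norm c ^ k"
  proof (induction k)
    case (Suc k)
    have "norm (cred_power c (Suc k)) \<le> norm c * norm (cred_power c k)" by (simp add: S norm_mult_ineq)
    also have "\<dots> \<le> norm c * norm c ^ k" by (intro mult_left_mono Suc) simp
    finally show ?case by simp
  qed (simp add: 0 norm_lam_one_le)
qed

text \<open>The geometric expansion of the inverse of \<open>w - c\<close> in powers of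
  \<open>c / w\<close>; the exponent \<open>Suc k\<close> contains the factor \<open>1 / w\<close>
  in front of it.\<close>

definition neumann_term :: "'a ell2_op \<Rightarrow> complex \<Rightarrow> nat \<Rightarrow> 'a ell2_op" where
  "neumann_term c w k = scaleC_op (1 / w ^ Suc k) (cred_power c k)"

definition neumann_sum :: "'a ell2_op \<Rightarrow> complex \<Rightarrow> 'a ell2_op" where
  "neumann_sum c w = (\<Sum>k. neumann_term c w k)"

lemma norm_neumann_term:
  assumes c: "c \<in> Cred G" and w: "r \<le> cmod w" "0 < r"
  shows "norm (neumann_term c w k) \<le> (norm c / r) ^ k / r"
proof -
  have "norm (neumann_term c w k) = norm (cred_power c k) / cmod w ^ Suc k"
    by (simp add: neumann_term_def norm_scaleC_op norm_divide norm_power norm_mult)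
  also have "\<dots> \<le> norm c ^ k / r ^ Suc k"
    by (intro frac_le cred_power(5)[OF c] power_mono) (use w in auto)
  also have "\<dots> = (norm c / r) ^ k / r" by (simp add: power_divide)
  finally show ?thesis .
qed

text \<open>Multiplying a term by \<open>w - c\<close> gives a difference of consecutive
  \<open>v k\<close>, where \<open>v k\<close> is the \<open>k\<close>-th power of
  \<open>c / w\<close>; the sum telescopes to \<open>v 0\<close>, the unit.\<close>

lemma neumann_sum_inverse:
  assumes c: "c \<in> Cred G" and w: "norm c < cmod w"
  shows "op_inverse G (scaleC_op w (lam G \<one>) - c) (neumann_sum c w)"
proof -
  have w0: "w \<noteq> 0" "0 < cmod w" using w norm_ge_zero[of c] by (auto simp del: norm_ge_zero)
  have ratio: "norm (norm c / cmod w) < 1" using w w0 by simp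
  have summ: "summable (neumann_term c w)"
    by (rule summable_comparison_test[OF _ summable_divide[OF summable_geometric[OF ratio], of "cmod w"]])
      (use norm_neumann_term[OF c order_refl w0(2)] in auto)
  have sums: "neumann_term c w sums neumann_sum c w"
    unfolding neumann_sum_def by (rule summable_sums[OF summ])
  have mem: "neumann_sum c w \<in> Cred G"
    by (rule Cred_limit[OF _ sums[unfolded sums_def]])
      (auto intro!: Cred.sum_mem Cred_scaleC cred_power c simp: neumann_term_def)
  define v where "v k = scaleC_op (1 / w ^ k) (cred_power c k)" for k
  have v: "v k = scaleC_op w (neumann_term c w k)" for k
    using w0 by (simp add: v_def neumann_term_def scaleC_op_simps)
  have "v \<longlonglongrightarrow> scaleC_op w 0"
    unfolding v by (rule bounded_linear.tendsto[OF bounded_linear_scaleC_op summable_LIMSEQ_zero[OF summ]])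
  then have tele: "(\<lambda>k. v k - v (Suc k)) sums lam G \<one>"
    using telescope_sums'[of v 0] cred_power(1)[OF c] by (simp add: scaleC_op_simps v_def)
  have "(scaleC_op w (lam G \<one>) - c) * neumann_term c w k = v k - v (Suc k)" for k
    using cred_power(2)[OF c, of k] Cred.unit_left[OF cred_power(3)[OF c, of k]] w0
    by (simp add: left_diff_distrib scaleC_op_simps neumann_term_def v_def)
  then have "(\<lambda>k. v k - v (Suc k)) sums ((scaleC_op w (lam G \<one>) - c) * neumann_sum c w)"
    using sums_mult[OF sums, of "scaleC_op w (lam G \<one>) - c"] by simp
  then have 1: "(scaleC_op w (lam G \<one>) - c) * neumann_sum c w = lam G \<one>"
    using tele sums_unique2 by blast
  have "neumann_term c w k * (scaleC_op w (lam G \<one>) - c) = v k - v (Suc k)" for k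
    using cred_power(4)[OF c, of k] Cred.unit_right[OF cred_power(3)[OF c, of k]] w0
    by (simp add: right_diff_distrib scaleC_op_simps neumann_term_def v_def)
  then have "(\<lambda>k. v k - v (Suc k)) sums (neumann_sum c w * (scaleC_op w (lam G \<one>) - c))"
    using sums_mult2[OF sums, of "scaleC_op w (lam G \<one>) - c"] by simp
  then have "neumann_sum c w * (scaleC_op w (lam G \<one>) - c) = lam G \<one>"
    using tele sums_unique2 by blast
  with 1 mem show ?thesis by (simp add: op_inverse_def)
qed

lemma op_inverse_unique:
  assumes "op_inverse G a b" "op_inverse G a b'"
  shows "b = b'"
  using assms Cred.unit_left Cred.unit_right unfolding op_inverse_def by (metis mult.assoc)

text \<open>The Riesz-Dunford integral of \<open>1 / z\<close>, evaluated by expanding the resolvent in powers of \<open>a - 1\<close>.\<close>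

lemma smooth_subalgebra_inverse:
  assumes S: "smooth_subalgebra G S \<nu>" and a: "a \<in> S" and near: "norm (a - lam G \<one>) < 1 / 2"
  shows "\<exists>b \<in> S. op_inverse G a b"
proof -
  have "S \<subseteq> Cred G" and hol: "hol_calculus_closed G S" using S by (auto simp: smooth_subalgebra_def)
  define c where "c = a - lam G \<one>"
  have c: "c \<in> Cred G" using a \<open>S \<subseteq> _\<close> by (auto simp: c_def Cred.minus_mem Cred.unit_mem)
  have nc: "norm c < 1 / 2" using near by (simp add: c_def)
  have za: "scaleC_op z (lam G \<one>) - a = scaleC_op (z - 1) (lam G \<one>) - c" for z
    by (simp add: c_def scaleC_op_simps)
  have inv: "op_inverse G (scaleC_op z (lam G \<one>) - a) (neumann_sum c (z - 1))" if "1 / 2 \<le> dist 1 z" for z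
    unfolding za using that nc by (intro neumann_sum_inverse c) (auto simp: dist_norm norm_minus_commute)
  have resolvent: "resolvent G a z = neumann_sum c (z - 1)" if "1 / 2 \<le> dist 1 z" for z
    unfolding resolvent_def using inv[OF that] op_inverse_unique by blast
  have spec: "op_spectrum G a \<subseteq> ball 1 (1 / 2)"
    using inv by (force simp: op_spectrum_def not_le[symmetric])
  \<comment> \<open>The radius lies strictly between 1/2, within which the spectrum stays around 1,
    and 1, the distance from 1 to the pole of \<open>1 / z\<close>.\<close>
  define \<gamma> where "\<gamma> = circlepath (1::complex) (3 / 4)"
  have \<gamma>_dist: "dist 1 (\<gamma> s) = 3 / 4" for s by (simp add: \<gamma>_def circlepath dist_norm norm_mult)
  have "surrounding_cycle (op_spectrum G a) (ball 1 1) [\<gamma>]"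
    unfolding surrounding_cycle_def
  proof (intro conjI ballI allI impI)
    fix p assume "p \<in> set [\<gamma>]"
    then have p: "p = circlepath 1 (3 / 4)" by (simp add: \<gamma>_def)
    show "valid_path p" "pathfinish p = pathstart p" by (simp_all add: p)
    show "path_image p \<subseteq> ball 1 1 - op_spectrum G a" using spec by (auto simp: p sphere_def)
  next
    fix z assume "z \<in> op_spectrum G a"
    then have "norm (z - 1) < 3 / 4" using spec by (auto simp: dist_norm norm_minus_commute)
    then show "(\<Sum>\<gamma>\<leftarrow>[\<gamma>]. winding_number \<gamma> z) = 1" by (simp add: \<gamma>_def winding_number_circlepath)
  next
    fix z :: complex assume z: "z \<notin> ball 1 1"
    have "winding_number \<gamma> z = 0"
      unfolding \<gamma>_def using z
      by (intro winding_number_zero_outside[where s = "ball 1 1"]) (auto simp: sphere_def)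
    then show "(\<Sum>\<gamma>\<leftarrow>[\<gamma>]. winding_number \<gamma> z) = 0" by simp
  qed
  moreover have "(\<lambda>z. 1 / z) holomorphic_on ball 1 1" by (intro holomorphic_intros) auto
  moreover have "op_spectrum G a \<subseteq> ball 1 1"
    using spec subset_ball[of "1 / 2" 1 "1 :: complex"] by simp
  ultimately have mem: "riesz_dunford G a (\<lambda>z. 1 / z) [\<gamma>] \<in> S"
    using hol a open_ball unfolding hol_calculus_closed_def by blast
  define h where "h s = 1 / \<gamma> s * vector_derivative \<gamma> (at s within {0..1})" for s
  define F where "F n s = (\<Sum>k<n. scaleC_op (h s) (neumann_term c (\<gamma> s - 1) k))" for n s
  define g where "g s = scaleC_op (h s) (resolvent G a (\<gamma> s))" for s
  have h_eq: "h s = 1 / \<gamma> s * (2 * pi * \<i> * (3 / 4) * exp (2 * pi * \<i> * s))" if "s \<in> {0..1}" for s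
    using that by (simp add: h_def \<gamma>_def vector_derivative_circlepath01)
  have \<gamma>_ne: "\<gamma> s \<noteq> 1" for s using \<gamma>_dist[of s] by auto
  have \<gamma>_nz: "\<gamma> s \<noteq> 0" for s using \<gamma>_dist[of s] by auto
  have h_le: "cmod (h s) \<le> 4 * (2 * pi)" if "s \<in> {0..1}" for s
  proof -
    have "1 - 3 / 4 \<le> cmod (\<gamma> s)" using \<gamma>_dist[of s] norm_triangle_ineq2[of 1 "1 - \<gamma> s"] by (simp add: dist_norm)
    then have inv_le: "1 / cmod (\<gamma> s) \<le> 4" using \<gamma>_nz[of s] by (simp add: field_simps)
    have "cmod (h s) = 1 / cmod (\<gamma> s) * (2 * pi * (3 / 4))"
      by (simp add: h_eq[OF that] norm_mult norm_divide)
    also have "\<dots> \<le> 4 * (2 * pi * (3 / 4))" by (intro mult_right_mono inv_le) simp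
    also have "\<dots> \<le> 4 * (2 * pi)" by simp
    finally show ?thesis .
  qed
  have cont_\<gamma>: "continuous_on {0..1} \<gamma>" by (auto simp: \<gamma>_def circlepath intro!: continuous_intros)
  have cont_h: "continuous_on {0..1} h"
  proof (rule continuous_on_eq)
    show "continuous_on {0..1} (\<lambda>s. 1 / \<gamma> s * (2 * pi * \<i> * (3 / 4) * exp (2 * pi * \<i> * s)))"
      by (intro continuous_intros cont_\<gamma>) (simp_all add: \<gamma>_nz)
  qed (simp add: h_eq)
  have scal: "scaleC_op (h s) (neumann_term c (\<gamma> s - 1) k) = scaleC_op (h s / (\<gamma> s - 1) ^ Suc k) (cred_power c k)" for s k
    by (simp add: neumann_term_def scaleC_op_simps)
  have contF: "continuous_on {0..1} (F n)" for n
    unfolding F_def scal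
    by (intro continuous_on_sum bounded_linear.continuous_on[OF bounded_linear_scaleC_op_left]
        continuous_intros cont_h cont_\<gamma>) (auto simp: \<gamma>_ne)
  have intF: "(F n has_integral (\<Sum>k<n. scaleC_op (2 * of_real pi * \<i> * (-1) ^ k) (cred_power c k))) {0..1}" for n
    unfolding F_def scal
  proof (intro has_integral_sum)
    fix k
    have "((\<lambda>s. h s / (\<gamma> s - 1) ^ Suc k) has_integral (2 * of_real pi * \<i> * (-1) ^ k)) {0..1}"
      using has_contour_integral_inverse_circlepath[of k] unfolding has_contour_integral_def \<gamma>_def[symmetric] h_def
      by (simp add: mult.commute)
    from has_integral_linear[OF this bounded_linear_scaleC_op_left[of "cred_power c k"]]
    show "((\<lambda>s. scaleC_op (h s / (\<gamma> s - 1) ^ Suc k) (cred_power c k)) has_integral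
        scaleC_op (2 * of_real pi * \<i> * (-1) ^ k) (cred_power c k)) {0..1}" by (simp add: o_def)
  qed simp
  have ratio: "norm (norm c / (3 / 4)) < 1" using nc by simp
  have bl: "bounded_linear (scaleC_op (h s))" for s by (rule bounded_linear_scaleC_op)
  have unif: "uniform_limit {0..1} F g sequentially"
  proof -
    \<comment> \<open>On the circle \<open>\<gamma> s - 1\<close> has modulus 3/4, and
      \<open>norm c\<close> is below 1/2, so the ratio is below 2/3; the factor in front is the
      bound on \<open>h\<close>.\<close>
    define M where "M k = 4 * (2 * pi) * ((norm c / (3 / 4)) ^ k / (3 / 4))" for k
    have "uniform_limit {0..1} (\<lambda>n s. \<Sum>k<n. scaleC_op (h s) (neumann_term c (\<gamma> s - 1) k))
        (\<lambda>s. \<Sum>k. scaleC_op (h s) (neumann_term c (\<gamma> s - 1) k)) sequentially"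
    proof (rule Weierstrass_m_test)
      show "norm (scaleC_op (h s) (neumann_term c (\<gamma> s - 1) k)) \<le> M k" if "s \<in> {0..1}" for s k
        unfolding M_def norm_scaleC_op
        using h_le[OF that] norm_neumann_term[OF c, of "3 / 4" "\<gamma> s - 1" k] \<gamma>_dist[of s]
        by (intro mult_mono) (auto simp: dist_norm norm_minus_commute)
      show "summable M" unfolding M_def
        by (intro summable_mult summable_divide summable_geometric ratio)
    qed
    moreover have "(\<Sum>k. scaleC_op (h s) (neumann_term c (\<gamma> s - 1) k)) = g s" for s
    proof -
      have "summable (neumann_term c (\<gamma> s - 1))"
      proof (rule summable_comparison_test)
        show "\<exists>N. \<forall>k\<ge>N. norm (neumann_term c (\<gamma> s - 1) k) \<le> (norm c / (3 / 4)) ^ k / (3 / 4)"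
          using norm_neumann_term[OF c, of "3 / 4" "\<gamma> s - 1"] \<gamma>_dist[of s]
          by (auto simp: dist_norm norm_minus_commute)
      qed (intro summable_divide summable_geometric ratio)
      from bounded_linear.suminf[OF bl this, of s]
      show ?thesis using resolvent[of "\<gamma> s"] \<gamma>_dist[of s] by (simp add: g_def neumann_sum_def)
    qed
    ultimately show ?thesis by (simp add: F_def[abs_def])
  qed
  obtain I J where IJ: "\<And>n. (F n has_integral I n) {0..1}" "(g has_integral J) {0..1}" "I \<longlonglongrightarrow> J"
    using uniform_limit_integral[OF unif contF] by auto
  have I: "I n = (\<Sum>k<n. scaleC_op (2 * of_real pi * \<i> * (-1) ^ k) (cred_power c k))" for n
    using has_integral_unique[OF IJ(1) intF] .
  have "(\<lambda>k. scaleC_op (2 * of_real pi * \<i> * (-1) ^ k) (cred_power c k)) sums J"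
    using IJ(3) unfolding I sums_def .
  then have "(\<lambda>k. scaleC_op (- 1 / (2 * of_real pi * \<i>)) (scaleC_op (2 * of_real pi * \<i> * (-1) ^ k) (cred_power c k))) sums
      scaleC_op (- 1 / (2 * of_real pi * \<i>)) J"
    by (rule bounded_linear.sums[OF bounded_linear_scaleC_op])
  \<comment> \<open>Integrating termwise gives the alternating series in \<open>c\<close>, which up
    to sign is the Neumann series at \<open>w = -1\<close>; and \<open>-1 - c\<close> stands for
    \<open>- a\<close>.\<close>
  moreover have "scaleC_op (- 1 / (2 * of_real pi * \<i>)) (scaleC_op (2 * of_real pi * \<i> * (-1) ^ k) (cred_power c k)) =
      neumann_term c (-1) k" for k
    by (cases "even k") (simp_all add: scaleC_op_simps neumann_term_def)
  ultimately have "neumann_sum c (-1) = scaleC_op (- 1 / (2 * of_real pi * \<i>)) J"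
    unfolding neumann_sum_def by (simp add: sums_iff)
  moreover have "riesz_dunford G a (\<lambda>z. 1 / z) [\<gamma>] = scaleC_op (1 / (2 * of_real pi * \<i>)) J"
    using integral_unique[OF IJ(2)] by (simp add: riesz_dunford_def g_def[abs_def] h_def)
  ultimately have rd: "riesz_dunford G a (\<lambda>z. 1 / z) [\<gamma>] = - neumann_sum c (-1)"
    by (simp add: scaleC_op_simps flip: scaleC_op_simps(11))
  have ma: "scaleC_op (-1) (lam G \<one>) - c = - a" by (simp add: c_def scaleC_op_simps)
  have "op_inverse G (- a) (neumann_sum c (-1))"
    using neumann_sum_inverse[OF c, of "-1"] nc unfolding ma by simp
  then have "op_inverse G a (- neumann_sum c (-1))"
    by (auto simp: op_inverse_def Cred.uminus_mem)
  then show ?thesis using mem rd by auto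
qed

end

section \<open>Equivalence of idempotents in a smooth subalgebra\<close>

text \<open>Entrywise convergence with fixed dimensions suffices, so no norm on matrices is
  introduced.\<close>

definition mat_tendsto :: "(nat \<Rightarrow> 'b::real_normed_algebra mat) \<Rightarrow> 'b mat \<Rightarrow> bool" where
  "mat_tendsto X L \<longleftrightarrow> (\<forall>k. dim_row (X k) = dim_row L \<and> dim_col (X k) = dim_col L) \<and>
    (\<forall>i<dim_row L. \<forall>j<dim_col L. (\<lambda>k. X k $$ (i, j)) \<longlonglongrightarrow> L $$ (i, j))"

lemma mat_tendsto_const: "mat_tendsto (\<lambda>_. L) L"
  by (simp add: mat_tendsto_def)

lemma mat_tendsto_mult:
  assumes "mat_tendsto X L" "mat_tendsto Y M" "dim_col L = dim_row M"
  shows "mat_tendsto (\<lambda>k. X k * Y k) (L * M)"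
  using assms unfolding mat_tendsto_def
  by (auto simp: mat_mult_index simp del: index_mult_mat(1) intro!: tendsto_intros)

lemma mat_tendsto_add:
  assumes "mat_tendsto X L" "mat_tendsto Y M" "dim_row L = dim_row M" "dim_col L = dim_col M"
  shows "mat_tendsto (\<lambda>k. X k + Y k) (L + M)"
  using assms unfolding mat_tendsto_def by (auto intro!: tendsto_intros)

lemma mat_split_first:
  assumes "dim_row A = Suc n" "dim_col A = Suc m"
  shows "A = four_block_mat (mat 1 1 (\<lambda>_. A $$ (0, 0))) (mat 1 m (\<lambda>(_, j). A $$ (0, Suc j)))
    (mat n 1 (\<lambda>(i, _). A $$ (Suc i, 0))) (mat n m (\<lambda>(i, j). A $$ (Suc i, Suc j)))"
  using assms by (intro eq_matI) auto

context corner_ring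
begin

text \<open>By the Schur complement \<open>s = d - c a\<^sup>-\<^sup>1 b\<close>.\<close>

lemma block_inverse:
  assumes m: "a \<in> mats A m m" "b \<in> mats A m n" "c \<in> mats A n m" "d \<in> mats A n n"
    and a': "a' \<in> mats A m m" "a * a' = unit_mat e m" "a' * a = unit_mat e m"
    and s': "s' \<in> mats A n n" "(d - c * (a' * b)) * s' = unit_mat e n" "s' * (d - c * (a' * b)) = unit_mat e n"
  shows "\<exists>Y \<in> mats A (m + n) (m + n). four_block_mat a b c d * Y = unit_mat e (m + n) \<and>
    Y * four_block_mat a b c d = unit_mat e (m + n)"
proof -
  note [simp] = mats_dim[OF m(1)] mats_dim[OF m(2)] mats_dim[OF m(3)] mats_dim[OF m(4)]
    mats_dim[OF a'(1)] mats_dim[OF s'(1)]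
  let ?u = "unit_mat e"
  have one: "four_block_mat (?u m) (0\<^sub>m m n) (0\<^sub>m n m) (?u n) = ?u (m + n)"
    by (rule eq_matI) auto
  note cl = mats_closed(1)[OF a'(1) m(2)] mats_closed(1)[OF m(3) a'(1)]
  note unit = unit_mat_mult[OF m(1)] unit_mat_mult[OF m(2)] unit_mat_mult[OF m(3)] unit_mat_mult[OF m(4)]
    unit_mat_mult[OF a'(1)] unit_mat_mult[OF s'(1)] unit_mat_mult[OF cl(1)] unit_mat_mult[OF cl(2)]
    unit_mat_mult[OF mats_closed(6), of m] unit_mat_mult[OF mats_closed(6), of n]
    unit_mat_mult[OF mats_closed(4)[OF cl(1)]] unit_mat_mult[OF mats_closed(4)[OF cl(2)]]
  define s where "s = d - c * (a' * b)"
  have s: "s \<in> mats A n n" unfolding s_def by (intro mats_closed(3) m mats_closed(1)[OF m(3) cl(1)])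
  note [simp] = mats_dim[OF s]
  note unit_s = unit_mat_mult[OF s]
  \<comment> \<open>The block matrix factors as \<open>L * D * R\<close>, lower triangular times
    block diagonal times upper triangular; the primed matrices invert the three factors.\<close>
  define L where "L = four_block_mat (?u m) (0\<^sub>m m n) (c * a') (?u n)"
  define L' where "L' = four_block_mat (?u m) (0\<^sub>m m n) (- (c * a')) (?u n)"
  define R where "R = four_block_mat (?u m) (a' * b) (0\<^sub>m n m) (?u n)"
  define R' where "R' = four_block_mat (?u m) (- (a' * b)) (0\<^sub>m n m) (?u n)"
  define D where "D = four_block_mat a (0\<^sub>m m n) (0\<^sub>m n m) s"
  define D' where "D' = four_block_mat a' (0\<^sub>m m n) (0\<^sub>m n m) s'"
  note defs = L_def L'_def R_def R'_def D_def D'_def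
  have dims [simp]: "dim_row L = m + n" "dim_col L = m + n" "dim_row L' = m + n" "dim_col L' = m + n"
    "dim_row R = m + n" "dim_col R = m + n" "dim_row R' = m + n" "dim_col R' = m + n"
    "dim_row D = m + n" "dim_col D = m + n" "dim_row D' = m + n" "dim_col D' = m + n"
    by (simp_all add: defs)
  have cancel: "x + - x = 0\<^sub>m (dim_row x) (dim_col x)" "- x + x = 0\<^sub>m (dim_row x) (dim_col x)" for x :: "'b mat"
    by (auto simp: mat_eq_iff)
  have neg0: "- 0\<^sub>m i j = (0\<^sub>m i j :: 'b mat)" for i j by (auto simp: mat_eq_iff)
  have LL: "L * L' = ?u (m + n)" "L' * L = ?u (m + n)"
    unfolding defs by (subst four_block_mult; simp add: unit mat_zero_mult mat_add_zero cancel neg0 flip: one)+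
  have RR: "R * R' = ?u (m + n)" "R' * R = ?u (m + n)"
    unfolding defs by (subst four_block_mult; simp add: unit mat_zero_mult mat_add_zero cancel neg0 flip: one)+
  have DD: "D * D' = ?u (m + n)" "D' * D = ?u (m + n)"
    unfolding defs using a'(2,3) s'(2,3) unfolding s_def[symmetric]
    by (subst four_block_mult; simp add: mat_zero_mult mat_add_zero flip: one)+
  have caa: "c * a' * a = c" using a'(3) by (simp add: mat_mult_assoc unit)
  have aab: "a * (a' * b) = b" using a'(2) by (simp add: unit flip: mat_mult_assoc)
  have LD: "L * D = four_block_mat a (0\<^sub>m m n) c s"
    unfolding defs by (subst four_block_mult) (simp_all add: unit unit_s mat_zero_mult mat_add_zero caa)
  have "L * D * R = four_block_mat a b c (c * (a' * b) + s)"
    unfolding LD R_def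
    by (subst four_block_mult) (simp_all add: unit unit_s mat_zero_mult mat_add_zero aab)
  moreover have "c * (a' * b) + s = d" unfolding s_def by (auto simp: mat_eq_iff)
  ultimately have X: "four_block_mat a b c d = L * D * R" by simp
  have mem: "R' * D' * L' \<in> mats A (m + n) (m + n)"
    unfolding defs
    by (intro mats_closed(1)[of _ _ "m + n"] four_block_mats mats_closed(4,5,6) cl a' s')
  have u: "?u (m + n) * L' = L'" "R' * ?u (m + n) = R'" "D' * ?u (m + n) = D'" "?u (m + n) * R = R" "?u (m + n) * D = D" "L * ?u (m + n) = L" "D * ?u (m + n) = D"
    "?u (m + n) * D' = D'"
  proof -
    have "L' \<in> mats A (m + n) (m + n)" "R' \<in> mats A (m + n) (m + n)" "D' \<in> mats A (m + n) (m + n)"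
      "R \<in> mats A (m + n) (m + n)" "D \<in> mats A (m + n) (m + n)" "L \<in> mats A (m + n) (m + n)"
      unfolding defs by (intro four_block_mats mats_closed(4,5,6) cl a' s' m s)+
    then show "?u (m + n) * L' = L'" "R' * ?u (m + n) = R'" "D' * ?u (m + n) = D'" "?u (m + n) * R = R"
      "?u (m + n) * D = D" "L * ?u (m + n) = L" "D * ?u (m + n) = D"
      "?u (m + n) * D' = D'"
      by (auto simp: unit_mat_mult)
  qed
  have "(L * D * R) * (R' * D' * L') = L * (D * ((R * R') * D')) * L'" by (simp add: mat_mult_assoc)
  also have "\<dots> = ?u (m + n)"
    by (simp add: RR DD u LL)
  finally have 1: "(L * D * R) * (R' * D' * L') = ?u (m + n)" .
  have "(R' * D' * L') * (L * D * R) = R' * (D' * ((L' * L) * D)) * R" by (simp add: mat_mult_assoc)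
  also have "\<dots> = ?u (m + n)" by (simp add: LL u DD RR)
  finally show ?thesis unfolding X using 1 mem by blast
qed

end

context group
begin

section \<open>Invertibility and equivalence over a fixed smooth subalgebra\<close>

context
  fixes S :: "'a ell2_op set" and \<nu> :: "'a ell2_op \<Rightarrow> real"
  assumes smooth: "smooth_subalgebra G S \<nu>"
begin

lemma smooth_group_ring: "group_ring G \<subseteq> S" and smooth_Cred: "S \<subseteq> Cred G"
  using smooth by (auto simp: smooth_subalgebra_def)

lemma smooth_corner_ring: "corner_ring S (lam G \<one>)"
proof
  show "lam G \<one> \<in> S" using smooth_group_ring group_ring.unit_mem by blast
  show "lam G \<one> * a = a" "a * lam G \<one> = a" if "a \<in> S" for a
    using that smooth_Cred Cred.unit_left Cred.unit_right by blast+
  show "a + b \<in> S" "a * b \<in> S" if "a \<in> S" "b \<in> S" for a b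
    using that smooth by (auto simp: smooth_subalgebra_def)
  show "- a \<in> S" if "a \<in> S" for a
  proof -
    have "scaleC_op (-1) a \<in> S" using that smooth by (auto simp: smooth_subalgebra_def)
    then show ?thesis by (simp add: scaleC_op_simps)
  qed
qed

interpretation S: corner_ring S "lam G \<one>" by (rule smooth_corner_ring)

text \<open>Induction on the size, splitting off the first row and column: the corner entry is
  eventually invertible in \<open>S\<close>, and the Schur complement again tends to an identity
  matrix, because the off-diagonal blocks tend to 0 while the inverses of the corner entries stay
  bounded.\<close>

lemma eventually_invertible:
  assumes "\<And>k. X k \<in> mats S n n" "mat_tendsto X (U n)"
  shows "\<forall>\<^sub>F k in sequentially. \<exists>Y \<in> mats S n n. X k * Y = U n \<and> Y * X k = U n"
  using assms
proof (induction n arbitrary: X)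
  case 0
  have "\<exists>Y \<in> mats S 0 0. X k * Y = U 0 \<and> Y * X k = U 0" for k
    using mats_dim[OF 0(1)[of k]] by (intro bexI[of _ "U 0"]) (auto simp: mats_iff mat_eq_iff)
  then show ?case by simp
next
  case (Suc n)
  define \<alpha> where "\<alpha> k = X k $$ (0, 0)" for k
  define b where "b k = mat 1 n (\<lambda>(_, j). X k $$ (0, Suc j))" for k
  define c where "c k = mat n 1 (\<lambda>(i, _). X k $$ (Suc i, 0))" for k
  define d where "d k = mat n n (\<lambda>(i, j). X k $$ (Suc i, Suc j))" for k
  have X: "X k = four_block_mat (mat 1 1 (\<lambda>_. \<alpha> k)) (b k) (c k) (d k)" for k
    unfolding \<alpha>_def b_def c_def d_def using mats_dim[OF Suc(2)[of k]] by (rule mat_split_first)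
  have mem: "\<alpha> k \<in> S" "b k \<in> mats S 1 n" "c k \<in> mats S n 1" "d k \<in> mats S n n" for k
    using Suc(2)[of k] by (auto simp: mats_iff \<alpha>_def b_def c_def d_def)
  have lim: "(\<lambda>k. X k $$ (i, j)) \<longlonglongrightarrow> (if i = j then lam G \<one> else 0)" if "i < Suc n" "j < Suc n" for i j
  proof -
    have "(\<lambda>k. X k $$ (i, j)) \<longlonglongrightarrow> U (Suc n) $$ (i, j)"
      using Suc(3) that unfolding mat_tendsto_def by simp
    then show ?thesis using that by simp
  qed
  have \<alpha>_lim: "\<alpha> \<longlonglongrightarrow> lam G \<one>" using lim[of 0 0] by (simp add: \<alpha>_def[abs_def])
  define near where "near k \<longleftrightarrow> norm (\<alpha> k - lam G \<one>) < 1 / 2" for k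
  have ev_near: "\<forall>\<^sub>F k in sequentially. near k"
    using tendstoD[OF \<alpha>_lim, of "1 / 2"] by (simp add: near_def dist_norm)
  define a1 where "a1 k = (SOME a. a \<in> S \<and> op_inverse G (\<alpha> k) a)" for k
  have "\<exists>a. a \<in> S \<and> op_inverse G (\<alpha> k) a" if "near k" for k
    using smooth_subalgebra_inverse[OF smooth mem(1)[of k]] that by (auto simp: near_def)
  from someI_ex[OF this] have a1: "a1 k \<in> S \<and> op_inverse G (\<alpha> k) (a1 k)" if "near k" for k
    using that unfolding a1_def by blast
  \<comment> \<open>The default 0 keeps \<open>a k\<close> in \<open>S\<close> and within the bound
    2 for every \<open>k\<close>, so that \<open>s\<close> is a sequence to which the induction
    hypothesis applies.\<close>
  define a where "a k = (if near k then a1 k else 0)" for k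
  have a: "a k \<in> S" for k using a1 by (auto simp: a_def S.zero_mem)
  have a_inv: "\<alpha> k * a k = lam G \<one>" "a k * \<alpha> k = lam G \<one>" if "near k" for k
    using a1[OF that] that by (auto simp: a_def op_inverse_def)
  have a_le: "norm (a k) \<le> 2" for k
  proof (cases "near k")
    case True
    \<comment> \<open>With \<open>\<alpha> k\<close> within 1/2 of the unit this identity bounds
      \<open>norm (a k)\<close> by \<open>1 + norm (a k) / 2\<close>, hence by 2.\<close>
    have "a k = lam G \<one> - (\<alpha> k - lam G \<one>) * a k"
      using a_inv(1)[OF True] S.unit_left[OF a] by (simp add: left_diff_distrib)
    then have "norm (a k) \<le> norm (lam G \<one>) + norm ((\<alpha> k - lam G \<one>) * a k)"
      by (metis norm_triangle_ineq4)
    also have "\<dots> \<le> 1 + norm (\<alpha> k - lam G \<one>) * norm (a k)"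
      by (intro add_mono norm_lam_one_le norm_mult_ineq)
    also have "\<dots> \<le> 1 + 1 / 2 * norm (a k)"
      using True by (intro add_mono mult_right_mono) (auto simp: near_def)
    finally show ?thesis by simp
  qed (simp add: a_def)
  define A1 where "A1 k = mat 1 1 (\<lambda>_. a k)" for k
  have A1: "A1 k \<in> mats S 1 1" for k using a by (auto simp: A1_def mats_iff)
  define s where "s k = d k - c k * (A1 k * b k)" for k
  have s: "s k \<in> mats S n n" for k
    unfolding s_def by (intro S.mats_closed(3) mem S.mats_closed(1)[OF mem(3) S.mats_closed(1)[OF A1 mem(2)]])
  have "mat_tendsto s (U n)"
    unfolding mat_tendsto_def
  proof (intro conjI allI impI)
    show "dim_row (s k) = dim_row (U n)" "dim_col (s k) = dim_col (U n)" for k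
      using mats_dim[OF s[of k]] by auto
    fix i j assume "i < dim_row (U n)" "j < dim_col (U n)"
    then have ij: "i < n" "j < n" by auto
    have s_eq: "s k $$ (i, j) = X k $$ (Suc i, Suc j) - X k $$ (Suc i, 0) * (a k * X k $$ (0, Suc j))" for k
      using ij by (simp add: s_def d_def c_def b_def A1_def mat_mult_index del: index_mult_mat(1))
    have lims: "(\<lambda>k. X k $$ (Suc i, 0)) \<longlonglongrightarrow> 0" "(\<lambda>k. X k $$ (0, Suc j)) \<longlonglongrightarrow> 0"
      using lim[of "Suc i" 0] lim[of 0 "Suc j"] ij by auto
    have "(\<lambda>k. X k $$ (Suc i, 0) * (a k * X k $$ (0, Suc j))) \<longlonglongrightarrow> 0"
    proof (rule Lim_null_comparison)
      show "\<forall>\<^sub>F k in sequentially. norm (X k $$ (Suc i, 0) * (a k * X k $$ (0, Suc j))) \<le>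
          norm (X k $$ (Suc i, 0)) * (2 * norm (X k $$ (0, Suc j)))"
        by (intro always_eventually allI order_trans[OF norm_mult_ineq] mult_left_mono mult_right_mono a_le) auto
      show "(\<lambda>k. norm (X k $$ (Suc i, 0)) * (2 * norm (X k $$ (0, Suc j)))) \<longlonglongrightarrow> 0"
        by (rule tendsto_eq_intros refl lims | simp)+
    qed
    from tendsto_diff[OF lim[of "Suc i" "Suc j"] this] ij
    show "(\<lambda>k. s k $$ (i, j)) \<longlonglongrightarrow> U n $$ (i, j)" by (simp add: s_eq)
  qed
  with Suc(1)[of s] s have "\<forall>\<^sub>F k in sequentially. \<exists>Y \<in> mats S n n. s k * Y = U n \<and> Y * s k = U n" by blast
  then show ?case using ev_near
  proof eventually_elim
    case (elim k)
    then obtain s' where s': "s' \<in> mats S n n" "s k * s' = U n" "s' * s k = U n" by blast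
    have "mat 1 1 (\<lambda>_. \<alpha> k) * A1 k = U 1" "A1 k * mat 1 1 (\<lambda>_. \<alpha> k) = U 1"
      using a_inv[OF elim(2)] by (auto simp: A1_def mat_eq_iff mat_mult_index simp del: index_mult_mat(1))
    then have "\<exists>Y \<in> mats S (1 + n) (1 + n). X k * Y = U (1 + n) \<and> Y * X k = U (1 + n)"
      unfolding X using s' unfolding s_def
      by (intro S.block_inverse[OF _ mem(2,3,4) A1]) (auto simp: mats_iff mem)
    then show ?case by simp
  qed
qed

lemma mats_approx:
  assumes "x \<in> mats (Cred G) m n"
  obtains X where "\<And>k. X k \<in> mats S m n" "mat_tendsto X x"
proof -
  define Y where "Y p = (SOME X. (\<forall>k. X k \<in> group_ring G) \<and> X \<longlonglongrightarrow> x $$ p)" for p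
  have "\<exists>X. (\<forall>k. X k \<in> group_ring G) \<and> X \<longlonglongrightarrow> x $$ p" if "fst p < m" "snd p < n" for p
  proof -
    have "x $$ p \<in> Cred G" using assms that by (cases p) (auto simp: mats_iff)
    from Cred_seq[OF this] show ?thesis by blast
  qed
  from someI_ex[OF this] have Y: "(\<forall>k. Y p k \<in> group_ring G) \<and> Y p \<longlonglongrightarrow> x $$ p"
    if "fst p < m" "snd p < n" for p
    using that unfolding Y_def by blast
  show thesis
  proof (rule that[of "\<lambda>k. mat m n (\<lambda>p. Y p k)"])
    show "mat m n (\<lambda>p. Y p k) \<in> mats S m n" for k
      using Y smooth_group_ring by (auto simp: mats_iff)
    show "mat_tendsto (\<lambda>k. mat m n (\<lambda>p. Y p k)) x"
      using Y mats_dim[OF assms] by (auto simp: mat_tendsto_def)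
  qed
qed

text \<open>Approximate an equivalence by matrices over \<open>S\<close> and correct it with inverses of elements
  close to the units of the two corners.\<close>

lemma idem_equiv_smooth:
  assumes P: "P \<in> idem_mats S" and Q: "Q \<in> idem_mats S" and equiv: "idem_equiv (Cred G) P Q"
  shows "idem_equiv S P Q"
proof -
  define m where "m = dim_row P"
  define n where "n = dim_row Q"
  have Pm: "P \<in> mats S m m" "P * P = P" and Qm: "Q \<in> mats S n n" "Q * Q = Q"
    using idem_matsD[OF P] idem_matsD[OF Q] by (auto simp: m_def n_def)
  obtain x y where xy: "x \<in> mats (Cred G) m n" "y \<in> mats (Cred G) n m" "P = x * y" "Q = y * x"
    using equiv unfolding idem_equiv_iff m_def n_def by blast
  obtain x' where x': "\<And>k. x' k \<in> mats S m n" "mat_tendsto x' x" using mats_approx[OF xy(1)] by blast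
  obtain y' where y': "\<And>k. y' k \<in> mats S n m" "mat_tendsto y' y" using mats_approx[OF xy(2)] by blast
  \<comment> \<open>Compressing by \<open>P\<close> and \<open>Q\<close> puts the approximations
    into the right corners; their products still converge to \<open>P\<close> and
    \<open>Q\<close>.\<close>
  define X where "X k = P * (x' k * Q)" for k
  define Y where "Y k = Q * (y' k * P)" for k
  have X: "X k \<in> mats S m n" and Y: "Y k \<in> mats S n m" for k
    unfolding X_def Y_def by (intro S.mats_closed(1)[OF Pm(1)] S.mats_closed(1)[OF Qm(1)]
        S.mats_closed(1)[OF x'(1) Qm(1)] S.mats_closed(1)[OF y'(1) Pm(1)])+
  note dims [simp] = mats_dim[OF Pm(1)] mats_dim[OF Qm(1)] mats_dim[OF X] mats_dim[OF Y]
    mats_dim[OF xy(1)] mats_dim[OF xy(2)] mats_dim[OF x'(1)] mats_dim[OF y'(1)]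
  have X_lim: "mat_tendsto X (P * (x * Q))" and Y_lim: "mat_tendsto Y (Q * (y * P))"
    unfolding X_def[abs_def] Y_def[abs_def]
    by (intro mat_tendsto_mult mat_tendsto_const x' y'; simp)+
  have QyP: "Q * (y * P) = y * P * P"
  proof -
    have "Q * (y * P) = y * x * (y * P)" by (simp only: xy(4)[symmetric])
    also have "\<dots> = y * (x * y) * P" by (simp add: mat_mult_assoc)
    also have "\<dots> = y * P * P" by (simp only: xy(3)[symmetric])
    finally show ?thesis .
  qed
  have PxQ: "P * (x * Q) = P * P * x"
  proof -
    have "P * (x * Q) = P * (x * (y * x))" by (simp only: xy(4)[symmetric])
    also have "\<dots> = P * (x * y) * x" by (simp add: mat_mult_assoc)
    also have "\<dots> = P * P * x" by (simp only: xy(3)[symmetric])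
    finally show ?thesis .
  qed
  have XY_lim: "mat_tendsto (\<lambda>k. X k * Y k) P"
  proof -
    have "P * (x * Q) * (Q * (y * P)) = P * x * (y * P)"
      unfolding QyP PxQ by (simp add: Pm(2) mat_mult_assoc)
    also have "\<dots> = P * (x * y) * P" by (simp add: mat_mult_assoc)
    also have "\<dots> = P" by (simp add: Pm(2) flip: xy(3))
    finally show ?thesis using mat_tendsto_mult[OF X_lim Y_lim] by simp
  qed
  have YX_lim: "mat_tendsto (\<lambda>k. Y k * X k) Q"
  proof -
    have "Q * (y * P) * (P * (x * Q)) = y * P * (P * x)"
      unfolding QyP PxQ by (simp add: Pm(2) mat_mult_assoc)
    also have "\<dots> = y * (P * P) * x" by (simp add: mat_mult_assoc)
    also have "\<dots> = y * P * x" by (simp only: Pm(2))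
    also have "\<dots> = y * (x * y) * x" by (simp only: xy(3)[symmetric])
    also have "\<dots> = (y * x) * (y * x)" by (simp add: mat_mult_assoc)
    also have "\<dots> = Q" by (simp add: Qm(2) flip: xy(4))
    finally show ?thesis using mat_tendsto_mult[OF Y_lim X_lim] by simp
  qed
  \<comment> \<open>Adding the complementary idempotent turns convergence to the unit of a corner
    into convergence to the identity matrix, where \<open>eventually_invertible\<close>
    applies.\<close>
  have to_unit: "mat_tendsto (\<lambda>k. Z k + (U l - R)) (U l)" if "mat_tendsto Z R" "R \<in> mats S l l" for Z R l
  proof -
    have "R + (U l - R) = U l" using mats_dim[OF that(2)] by (auto simp: mat_eq_iff)
    then show ?thesis
      using mat_tendsto_add[OF that(1) mat_tendsto_const, of "U l - R"] mats_dim[OF that(2)] by simp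
  qed
  have "\<forall>\<^sub>F k in sequentially. (\<exists>v \<in> mats S m m. (X k * Y k + (U m - P)) * v = U m \<and> v * (X k * Y k + (U m - P)) = U m) \<and>
     (\<exists>v \<in> mats S n n. (Y k * X k + (U n - Q)) * v = U n \<and> v * (Y k * X k + (U n - Q)) = U n)"
    by (intro eventually_conj eventually_invertible to_unit XY_lim YX_lim S.mats_closed(2,3,6) Pm(1) Qm(1)
        S.mats_closed(1)[OF X Y] S.mats_closed(1)[OF Y X])
  then obtain k v v' where v: "v \<in> mats S m m" "(X k * Y k + (U m - P)) * v = U m" "v * (X k * Y k + (U m - P)) = U m"
    and v': "v' \<in> mats S n n" "(Y k * X k + (U n - Q)) * v' = U n"
    by (auto simp: eventually_sequentially)
  note [simp] = mats_dim[OF v(1)] mats_dim[OF v'(1)]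
  define w where "w = X k * Y k + (U m - P)"
  define w' where "w' = Y k * X k + (U n - Q)"
  have dw [simp]: "dim_row w = m" "dim_col w = m" "dim_row w' = n" "dim_col w' = n" by (auto simp: w_def w'_def)
  have PX: "P * X k = X k" and YP: "Y k * P = Y k" and XQ: "X k * Q = X k" and QY: "Q * Y k = Y k"
    unfolding X_def Y_def by (simp_all add: Pm(2) Qm(2) mat_mult_assoc) (simp_all add: Pm(2) Qm(2) flip: mat_mult_assoc)
  have zero: "A - A = 0\<^sub>m (dim_row A) (dim_col A)" for A :: "'a ell2_op mat" by (auto simp: mat_eq_iff)
  have wP: "w * P = X k * Y k"
    unfolding w_def by (simp add: mat_distrib mat_mult_assoc YP S.unit_mat_mult[OF Pm(1)] Pm(2) zero mat_add_zero)
  have Pw: "P * w = X k * Y k"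
    unfolding w_def by (simp add: mat_distrib S.unit_mat_mult[OF Pm(1)] Pm(2) zero mat_add_zero PX flip: mat_mult_assoc)
  have Qw': "Q * w' = Y k * X k"
    unfolding w'_def by (simp add: mat_distrib S.unit_mat_mult[OF Qm(1)] Qm(2) zero mat_add_zero QY flip: mat_mult_assoc)
  have wv: "w * v = U m" "v * w = U m" "w' * v' = U n" using v v' by (simp_all add: w_def w'_def)
  have "P * v = v * w * (P * v)"
    unfolding wv by (rule S.unit_mat_mult[OF S.mats_closed(1)[OF Pm(1) v(1)], symmetric])
  also have "\<dots> = v * (w * P) * v" by (simp add: mat_mult_assoc)
  also have "\<dots> = v * P * (w * v)" unfolding wP Pw[symmetric] by (simp add: mat_mult_assoc)
  also have "\<dots> = v * P"
    unfolding wv by (rule S.unit_mat_mult[OF S.mats_closed(1)[OF v(1) Pm(1)]])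
  finally have Pv: "P * v = v * P" .
  \<comment> \<open>\<open>v\<close> inverts \<open>X k * Y k\<close> on the corner of
    \<open>P\<close>, so \<open>Z\<close> corrects \<open>Y k\<close> to an exact right inverse of
    \<open>X k\<close> there.\<close>
  define Z where "Z = Y k * (v * P)"
  have Z: "Z \<in> mats S n m" unfolding Z_def by (intro S.mats_closed(1)[OF Y] S.mats_closed(1)[OF v(1) Pm(1)])
  have dZ [simp]: "dim_row Z = n" "dim_col Z = m" using mats_dim[OF Z] by auto
  have "X k * Z = (X k * Y k) * (v * P)" unfolding Z_def by (simp add: mat_mult_assoc)
  also have "\<dots> = w * (P * v) * P" unfolding wP[symmetric] by (simp add: mat_mult_assoc)
  also have "\<dots> = (w * v) * (P * P)" unfolding Pv by (simp add: mat_mult_assoc)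
  also have "\<dots> = P" unfolding wv Pm(2) by (rule S.unit_mat_mult[OF Pm(1)])
  finally have XZ: "P = X k * Z" by simp
  define f where "f = Z * X k"
  have f: "f \<in> mats S n n" unfolding f_def by (rule S.mats_closed(1)[OF Z X])
  have df [simp]: "dim_row f = n" "dim_col f = n" using mats_dim[OF f] by auto
  have "f * Y k = Y k * v * (P * (X k * Y k))" by (simp add: f_def Z_def mat_mult_assoc)
  also have "\<dots> = Y k * v * (X k * Y k)" by (simp add: PX flip: mat_mult_assoc)
  also have "\<dots> = Y k * (v * w) * P" unfolding wP[symmetric] by (simp add: mat_mult_assoc)
  also have "\<dots> = Y k" unfolding wv S.unit_mat_mult(2)[OF Y] by (rule YP)
  finally have fY: "f * Y k = Y k" .
  have fQ: "f * Q = f" by (simp add: f_def mat_mult_assoc XQ)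
  have fw: "f * w' = Y k * X k"
    unfolding w'_def
    by (simp add: mat_distrib fQ S.unit_mat_mult[OF f] zero mat_add_zero fY flip: mat_mult_assoc)
  \<comment> \<open>\<open>f\<close> and \<open>Q\<close> agree after multiplication by
    \<open>w'\<close>, which has the right inverse \<open>v'\<close>; so \<open>Z * X k\<close> is
    \<open>Q\<close> exactly.\<close>
  have "f = f * (w' * v')" unfolding wv by (rule S.unit_mat_mult(2)[OF f, symmetric])
  also have "\<dots> = Q * w' * v'" using fw Qw' by (simp flip: mat_mult_assoc)
  also have "\<dots> = Q" unfolding mat_mult_assoc[of Q w' v', simplified] wv by (rule S.unit_mat_mult(2)[OF Qm(1)])
  finally have "Q = Z * X k" by (simp add: f_def)
  with XZ X Z show ?thesis unfolding idem_equiv_iff m_def n_def by blast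
qed

end

end

section \<open>Comparing projective resolutions\<close>

context group
begin

section \<open>Chain modules, augmentation and exactness in terms of rows\<close>

lemma chain_module_iff:
  "x \<in> chain_module G N i \<longleftrightarrow> x \<in> mats (group_ring G) 1 (res_rank N i) \<and> x * res_idem N i = x"
  by (auto simp: chain_module_def mats_def)

text \<open>The augmentation is multiplicative on the group ring, so it turns combinations of rows
  over the group ring into complex combinations of their augmentations.\<close>

lemma chain_aug_row_mult:
  assumes "y \<in> mats (group_ring G) k l" "x \<in> mats (group_ring G) l (res_rank N 0)" "r < k"
  shows "chain_aug G N (mat_row (y * x) r) = (\<Sum>j<l. augmentation G (y $$ (r, j)) * chain_aug G N (mat_row x j))"
proof -
  note [simp] = mats_dim[OF assms(1)] mats_dim[OF assms(2)]
  have mem: "j < l \<Longrightarrow> y $$ (r, j) \<in> group_ring G" "j < l \<Longrightarrow> i < res_rank N 0 \<Longrightarrow> x $$ (j, i) \<in> group_ring G" for i j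
    using assms by (auto simp: mats_iff)
  have "chain_aug G N (mat_row (y * x) r) =
      (\<Sum>i<res_rank N 0. \<Sum>j<l. augmentation G (y $$ (r, j)) * augmentation G (x $$ (j, i)) * res_aug N i)"
  proof -
    have "augmentation G ((y * x) $$ (r, i)) = (\<Sum>j<l. augmentation G (y $$ (r, j)) * augmentation G (x $$ (j, i)))"
      if "i < res_rank N 0" for i
    proof -
      have "augmentation G ((y * x) $$ (r, i)) = augmentation G (\<Sum>j<l. y $$ (r, j) * x $$ (j, i))"
        using \<open>r < k\<close> that by (simp add: mat_mult_index del: index_mult_mat(1))
      also have "\<dots> = (\<Sum>j<l. augmentation G (y $$ (r, j) * x $$ (j, i)))"
        by (rule augmentation_sum) (use that mem in \<open>auto intro: group_ring_mult\<close>)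
      also have "\<dots> = (\<Sum>j<l. augmentation G (y $$ (r, j)) * augmentation G (x $$ (j, i)))"
        by (rule sum.cong) (use that mem in \<open>auto simp: augmentation_mult\<close>)
      finally show ?thesis .
    qed
    then show ?thesis
      unfolding chain_aug_def sum_distrib_right[symmetric]
      by (auto intro!: sum.cong simp del: index_mult_mat(1))
  qed
  also have "\<dots> = (\<Sum>j<l. augmentation G (y $$ (r, j)) * chain_aug G N (mat_row x j))"
    by (subst sum.swap) (simp add: chain_aug_def sum_distrib_left mult.assoc)
  finally show ?thesis .
qed

lemma chain_aug_row_diff:
  assumes "x \<in> mats (group_ring G) k (res_rank N 0)" "y \<in> mats (group_ring G) k (res_rank N 0)" "r < k"
  shows "chain_aug G N (mat_row (x - y) r) = chain_aug G N (mat_row x r) - chain_aug G N (mat_row y r)"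
  unfolding chain_aug_def sum_subtractf[symmetric]
  using assms by (auto simp: mats_iff augmentation_minus left_diff_distrib intro!: sum.cong)

lemma resolution_mats:
  assumes "proj_resolution G N"
  shows "res_idem N i \<in> mats (group_ring G) (res_rank N i) (res_rank N i)" "res_idem N i * res_idem N i = res_idem N i"
    "res_diff N i \<in> mats (group_ring G) (res_rank N (Suc i)) (res_rank N i)"
    "res_idem N (Suc i) * res_diff N i = res_diff N i" "res_diff N i * res_idem N i = res_diff N i"
  using assms by (simp_all add: proj_resolution_def mats_def)

lemma resolution_exact:
  assumes "proj_resolution G N"
  shows "x \<in> chain_module G N 0 \<Longrightarrow> chain_aug G N x = 0 \<Longrightarrow> \<exists>y \<in> chain_module G N 1. y * res_diff N 0 = x"
    "y \<in> chain_module G N 1 \<Longrightarrow> chain_aug G N (y * res_diff N 0) = 0"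
    "x \<in> chain_module G N 1 \<Longrightarrow> x * res_diff N 0 = 0\<^sub>m 1 (res_rank N 0) \<Longrightarrow> \<exists>y \<in> chain_module G N 2. y * res_diff N 1 = x"
    "y \<in> chain_module G N 2 \<Longrightarrow> y * res_diff N 1 * res_diff N 0 = 0\<^sub>m 1 (res_rank N 0)"
    "\<exists>x \<in> chain_module G N 0. chain_aug G N x = z"
proof -
  have 1: "(\<lambda>x. x * res_diff N 0) ` chain_module G N 1 = {x \<in> chain_module G N 0. chain_aug G N x = 0}"
    and 2: "(\<lambda>x. x * res_diff N (Suc 0)) ` chain_module G N (Suc (Suc 0)) =
      {x \<in> chain_module G N (Suc 0). x * res_diff N 0 = 0\<^sub>m 1 (res_rank N 0)}"
    and 3: "chain_aug G N ` chain_module G N 0 = UNIV"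
    using assms unfolding proj_resolution_def by blast+
  show "\<exists>y \<in> chain_module G N 1. y * res_diff N 0 = x" if "x \<in> chain_module G N 0" "chain_aug G N x = 0"
  proof -
    have "x \<in> (\<lambda>x. x * res_diff N 0) ` chain_module G N 1" unfolding 1 using that by simp
    then show ?thesis by auto
  qed
  show "\<exists>y \<in> chain_module G N 2. y * res_diff N 1 = x"
    if "x \<in> chain_module G N 1" "x * res_diff N 0 = 0\<^sub>m 1 (res_rank N 0)"
  proof -
    have "x \<in> (\<lambda>x. x * res_diff N (Suc 0)) ` chain_module G N (Suc (Suc 0))" unfolding 2 using that by simp
    then show ?thesis by (auto simp: numeral_2_eq_2)
  qed
  show "y \<in> chain_module G N 1 \<Longrightarrow> chain_aug G N (y * res_diff N 0) = 0"
    "y \<in> chain_module G N 2 \<Longrightarrow> y * res_diff N 1 * res_diff N 0 = 0\<^sub>m 1 (res_rank N 0)"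
    using 1 2 by (auto simp: set_eq_iff image_iff numeral_2_eq_2)
  show "\<exists>x \<in> chain_module G N 0. chain_aug G N x = z" using 3 by (metis UNIV_I imageE)
qed

lemma row_chain_module:
  assumes "x \<in> mats (group_ring G) k (res_rank N i)" "x * res_idem N i = x" "r < k"
    and "res_idem N i \<in> mats (group_ring G) (res_rank N i) (res_rank N i)"
  shows "mat_row x r \<in> chain_module G N i"
proof -
  have "mat_row x r * res_idem N i = mat_row (x * res_idem N i) r"
    by (rule mat_row_mult) (use assms in \<open>auto simp: mats_iff\<close>)
  then have "mat_row x r * res_idem N i = mat_row x r" by (simp only: assms(2))
  moreover have "mat_row x r \<in> mats (group_ring G) 1 (res_rank N i)" using assms by (auto simp: mats_iff)
  ultimately show ?thesis by (simp add: chain_module_iff)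
qed

text \<open>Projectivity in matrix form: the rows are lifted separately, and multiplying the result
  by \<open>p\<close> makes it a map on the range of \<open>p\<close> without disturbing the
  factorisation, as \<open>p * x = x\<close>.\<close>

lemma lift_rows:
  assumes N: "proj_resolution G N" and d: "d \<in> mats (group_ring G) (res_rank N i) m"
    and x: "x \<in> mats (group_ring G) k m" and p: "p \<in> mats (group_ring G) k k" "p * p = p" "p * x = x"
    and rows: "\<And>r. r < k \<Longrightarrow> \<exists>y \<in> chain_module G N i. y * d = mat_row x r"
  obtains b where "b \<in> mats (group_ring G) k (res_rank N i)" "b * res_idem N i = b" "b * d = x" "p * b = b"
proof -
  have q: "res_idem N i \<in> mats (group_ring G) (res_rank N i) (res_rank N i)" by (rule resolution_mats[OF N])
  have "\<exists>y \<in> mats (group_ring G) 1 (res_rank N i). y * res_idem N i = y \<and> y * d = mat_row x r" if "r < k" for r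
    using rows[OF that] by (auto simp: chain_module_iff)
  from mat_of_rows_exists[of k "group_ring G" _ "\<lambda>r y. y * res_idem N i = y \<and> y * d = mat_row x r", OF this]
  obtain c where c: "c \<in> mats (group_ring G) k (res_rank N i)"
    and crows: "\<And>r. r < k \<Longrightarrow> mat_row c r * res_idem N i = mat_row c r" "\<And>r. r < k \<Longrightarrow> mat_row c r * d = mat_row x r"
    using mats_dim by metis
  note [simp] = mats_dim[OF c] mats_dim[OF d] mats_dim[OF x] mats_dim[OF p(1)] mats_dim[OF q]
  have cq: "c * res_idem N i = c"
  proof (rule mat_eq_rowsI)
    fix r assume "r < dim_row c"
    then show "mat_row (c * res_idem N i) r = mat_row c r"
      using crows(1)[of r] mat_row_mult[of c "res_idem N i" r] by simp
  qed auto
  have cd: "c * d = x"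
  proof (rule mat_eq_rowsI)
    fix r assume "r < dim_row x"
    then show "mat_row (c * d) r = mat_row x r"
      using crows(2)[of r] mat_row_mult[of c d r] by simp
  qed auto
  show thesis
  proof (rule that[of "p * c"])
    show "p * c \<in> mats (group_ring G) k (res_rank N i)" by (rule group_ring.mats_closed(1)[OF p(1) c])
    show "p * c * res_idem N i = p * c" by (simp add: mat_mult_assoc cq)
    show "p * c * d = x" by (simp add: mat_mult_assoc cd p)
    show "p * (p * c) = p * c" by (simp add: p flip: mat_mult_assoc)
  qed
qed

lemma lift_boundary:
  assumes N: "proj_resolution G N" and x: "x \<in> mats (group_ring G) k (res_rank N 0)" "x * res_idem N 0 = x"
    and p: "p \<in> mats (group_ring G) k k" "p * p = p" "p * x = x"
    and aug: "\<And>r. r < k \<Longrightarrow> chain_aug G N (mat_row x r) = 0"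
  obtains b where "b \<in> mats (group_ring G) k (res_rank N 1)" "b * res_idem N 1 = b" "b * res_diff N 0 = x" "p * b = b"
proof (rule lift_rows[OF N _ x(1) p])
  show "res_diff N 0 \<in> mats (group_ring G) (res_rank N 1) (res_rank N 0)" using resolution_mats[OF N, of 0] by simp
  show "\<exists>y \<in> chain_module G N 1. y * res_diff N 0 = mat_row x r" if "r < k" for r
    by (rule resolution_exact(1)[OF N row_chain_module aug[OF that]])
      (use x that resolution_mats[OF N] in auto)
qed blast

lemma lift_cycle:
  assumes N: "proj_resolution G N" and x: "x \<in> mats (group_ring G) k (res_rank N 1)" "x * res_idem N 1 = x"
    and xd: "x * res_diff N 0 = 0\<^sub>m k (res_rank N 0)"
  obtains b where "b \<in> mats (group_ring G) k (res_rank N 2)" "b * res_diff N 1 = x"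
proof (rule lift_rows[OF N _ x(1)])
  show "res_diff N 1 \<in> mats (group_ring G) (res_rank N 2) (res_rank N 1)"
    using resolution_mats(3)[OF N, of 1] by (simp add: numeral_2_eq_2)
  show "U k \<in> mats (group_ring G) k k" "U k * U k = U k" "U k * x = x"
    by (auto intro: group_ring.mats_closed group_ring.unit_mat_mult x(1))
  have d: "res_diff N 0 \<in> mats (group_ring G) (res_rank N 1) (res_rank N 0)" using resolution_mats[OF N, of 0] by simp
  show "\<exists>y \<in> chain_module G N 2. y * res_diff N 1 = mat_row x r" if "r < k" for r
  proof (rule resolution_exact(3)[OF N row_chain_module])
    have "mat_row x r * res_diff N 0 = mat_row (x * res_diff N 0) r"
      by (rule mat_row_mult) (use x d that in \<open>auto simp: mats_iff\<close>)
    then show "mat_row x r * res_diff N 0 = 0\<^sub>m 1 (res_rank N 0)"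
      using xd that by (auto simp: mat_eq_iff)
  qed (use x that resolution_mats[OF N, of 1] in auto)
qed blast

lemma resolution_diff_aug:
  assumes N: "proj_resolution G N" and "r < res_rank N 1"
  shows "chain_aug G N (mat_row (res_diff N 0) r) = 0"
proof -
  note m = resolution_mats[OF N]
  have d: "res_diff N 0 \<in> mats (group_ring G) (res_rank N 1) (res_rank N 0)"
    and q: "res_idem N 1 \<in> mats (group_ring G) (res_rank N 1) (res_rank N 1)"
    and qd: "res_idem N 1 * res_diff N 0 = res_diff N 0" using m[of 0] m[of 1] by auto
  have eq: "mat_row (res_idem N 1) r * res_diff N 0 = mat_row (res_idem N 1 * res_diff N 0) r"
    by (rule mat_row_mult) (use assms(2) mats_dim[OF d] mats_dim[OF q] in auto)
  have "mat_row (res_idem N 1) r \<in> chain_module G N 1"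
    by (rule row_chain_module[OF q]) (use m(2)[of 1] assms(2) q in auto)
  from resolution_exact(2)[OF N this] show ?thesis by (simp only: eq qd)
qed

lemma resolution_diff_diff:
  assumes N: "proj_resolution G N"
  shows "res_diff N 1 * res_diff N 0 = 0\<^sub>m (res_rank N 2) (res_rank N 0)"
proof -
  note m = resolution_mats[OF N]
  have d: "res_diff N 0 \<in> mats (group_ring G) (res_rank N 1) (res_rank N 0)"
    and d1: "res_diff N 1 \<in> mats (group_ring G) (res_rank N 2) (res_rank N 1)"
    and q: "res_idem N 2 \<in> mats (group_ring G) (res_rank N 2) (res_rank N 2)"
    and qd: "res_idem N 2 * res_diff N 1 = res_diff N 1"
    using m[of 0] m[of 1] m[of 2] by (auto simp: numeral_2_eq_2)
  note [simp] = mats_dim[OF d] mats_dim[OF d1] mats_dim[OF q]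
  show ?thesis
  proof (rule mat_eq_rowsI)
    fix r assume "r < dim_row (0\<^sub>m (res_rank N 2) (res_rank N 0) :: 'a ell2_op mat)"
    then have r: "r < res_rank N 2" by simp
    have "mat_row (res_idem N 2) r \<in> chain_module G N 2"
      by (rule row_chain_module[OF q]) (use m(2)[of 2] r q in auto)
    then have "mat_row (res_idem N 2) r * res_diff N 1 * res_diff N 0 = 0\<^sub>m 1 (res_rank N 0)"
      by (rule resolution_exact(4)[OF N])
    moreover have "mat_row (res_idem N 2) r * res_diff N 1 = mat_row (res_diff N 1) r"
      by (subst mat_row_mult) (use r in \<open>simp_all del: One_nat_def add: qd\<close>)
    moreover have "mat_row (res_diff N 1) r * res_diff N 0 = mat_row (res_diff N 1 * res_diff N 0) r"
      by (rule mat_row_mult) (use r in \<open>simp_all del: One_nat_def\<close>)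
    ultimately have "mat_row (res_diff N 1 * res_diff N 0) r = 0\<^sub>m 1 (res_rank N 0)"
      by (simp only:)
    then show "mat_row (res_diff N 1 * res_diff N 0) r =
        mat_row (0\<^sub>m (res_rank N 2) (res_rank N 0) :: 'a ell2_op mat) r"
      using r by (auto simp: mat_eq_iff simp del: index_mult_mat(1) One_nat_def)
  qed (auto simp del: One_nat_def)
qed

text \<open>Surjectivity of the augmentation of \<open>M\<close> suffices: each generator of the
  module of \<open>N\<close> in degree 0 is sent to an element with the same augmentation. This is
  the degree-0 part of a chain map over the identity of the trivial module.\<close>

lemma chain_map_degree_zero:
  assumes N: "proj_resolution G N" and M: "proj_resolution G M"
  obtains f where "f \<in> mats (group_ring G) (res_rank N 0) (res_rank M 0)"
    "res_idem N 0 * f = f" "f * res_idem M 0 = f"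
    "\<And>x k r. x \<in> mats (group_ring G) k (res_rank N 0) \<Longrightarrow> x * res_idem N 0 = x \<Longrightarrow> r < k \<Longrightarrow>
      chain_aug G M (mat_row (x * f) r) = chain_aug G N (mat_row x r)"
proof -
  note q = resolution_mats(1,2)[OF N, of 0] and p = resolution_mats(1,2)[OF M, of 0]
  have "\<exists>y \<in> mats (group_ring G) 1 (res_rank M 0). y * res_idem M 0 = y \<and>
      chain_aug G M y = chain_aug G N (mat_row (res_idem N 0) r)" for r
    using resolution_exact(5)[OF M] by (metis chain_module_iff)
  from mat_of_rows_exists[of "res_rank N 0" "group_ring G" _ "\<lambda>r y. y * res_idem M 0 = y \<and>
      chain_aug G M y = chain_aug G N (mat_row (res_idem N 0) r)", OF this]
  obtain F where F: "F \<in> mats (group_ring G) (res_rank N 0) (res_rank M 0)"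
    and rows: "\<And>r. r < res_rank N 0 \<Longrightarrow> mat_row F r * res_idem M 0 = mat_row F r"
      "\<And>r. r < res_rank N 0 \<Longrightarrow> chain_aug G M (mat_row F r) = chain_aug G N (mat_row (res_idem N 0) r)"
    using mats_dim by metis
  note [simp] = mats_dim[OF F] mats_dim[OF q(1)] mats_dim[OF p(1)]
  have Fp: "F * res_idem M 0 = F"
  proof (rule mat_eq_rowsI)
    fix r assume "r < dim_row F"
    then show "mat_row (F * res_idem M 0) r = mat_row F r"
      using rows(1)[of r] mat_row_mult[of F "res_idem M 0" r] by simp
  qed auto
  show thesis
  proof (rule that[of "res_idem N 0 * F"])
    show "res_idem N 0 * F \<in> mats (group_ring G) (res_rank N 0) (res_rank M 0)"
      by (rule group_ring.mats_closed(1)[OF q(1) F])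
    show "res_idem N 0 * (res_idem N 0 * F) = res_idem N 0 * F" by (simp add: q flip: mat_mult_assoc)
    show "res_idem N 0 * F * res_idem M 0 = res_idem N 0 * F" by (simp add: mat_mult_assoc Fp)
    fix x k r assume x: "x \<in> mats (group_ring G) k (res_rank N 0)" "x * res_idem N 0 = x" "r < k"
    note [simp] = mats_dim[OF x(1)]
    have "x * (res_idem N 0 * F) = x * F" by (simp add: x flip: mat_mult_assoc)
    then have "chain_aug G M (mat_row (x * (res_idem N 0 * F)) r) =
        (\<Sum>j<res_rank N 0. augmentation G (x $$ (r, j)) * chain_aug G M (mat_row F j))"
      using chain_aug_row_mult[OF x(1) F x(3)] by simp
    also have "\<dots> = (\<Sum>j<res_rank N 0. augmentation G (x $$ (r, j)) * chain_aug G N (mat_row (res_idem N 0) j))"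
      by (rule sum.cong) (auto simp: rows(2)[simplified])
    also have "\<dots> = chain_aug G N (mat_row (x * res_idem N 0) r)"
      by (rule chain_aug_row_mult[OF x(1) q(1) x(3), symmetric])
    finally show "chain_aug G M (mat_row (x * (res_idem N 0 * F)) r) = chain_aug G N (mat_row x r)"
      by (simp only: x(2))
  qed
qed

text \<open>Schanuel's lemma: the idempotent \<open>e\<close> projects the module in degree \<open>1\<close> of \<open>N\<close> onto a copy of
  the kernel of the augmentation, and the mapping cone of a comparison map is contractible.\<close>

lemma schanuel:
  assumes N: "proj_resolution G N" and M: "proj_resolution G M" and M2: "res_rank M 2 = 0"
  obtains e y where "e \<in> mats (group_ring G) (res_rank N 1) (res_rank N 1)" "e * e = e"
    "e * res_diff N 0 = res_diff N 0" "res_diff N 1 * e = 0\<^sub>m (res_rank N 2) (res_rank N 1)"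
    "y \<in> mats (group_ring G) (res_rank N 1) (res_rank N 2)" "res_idem N 1 - e = y * res_diff N 1"
    "res_idem N 1 * e = e"
    "idem_equiv (group_ring G) (diag_sum e (res_idem M 0)) (diag_sum (res_idem N 0) (res_idem M 1))"
proof -
  define q0 q1 d d1 where "q0 = res_idem N 0" and "q1 = res_idem N 1" and "d = res_diff N 0" and "d1 = res_diff N 1"
  define p0 p1 b where "p0 = res_idem M 0" and "p1 = res_idem M 1" and "b = res_diff M 0"
  define n0 n1 n2 m0 m1 where "n0 = res_rank N 0" and "n1 = res_rank N 1" and "n2 = res_rank N 2"
    and "m0 = res_rank M 0" and "m1 = res_rank M 1"
  note defs = q0_def q1_def d_def d1_def p0_def p1_def b_def n0_def n1_def n2_def m0_def m1_def
  have q0: "q0 \<in> mats (group_ring G) n0 n0" "q0 * q0 = q0" and q1: "q1 \<in> mats (group_ring G) n1 n1" "q1 * q1 = q1"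
    and d: "d \<in> mats (group_ring G) n1 n0" "q1 * d = d" "d * q0 = d"
    and d1: "d1 \<in> mats (group_ring G) n2 n1" "d1 * q1 = d1"
    using resolution_mats[OF N, of 0] resolution_mats[OF N, of 1] by (auto simp: defs numeral_2_eq_2)
  have p0: "p0 \<in> mats (group_ring G) m0 m0" "p0 * p0 = p0" and p1: "p1 \<in> mats (group_ring G) m1 m1" "p1 * p1 = p1"
    and b: "b \<in> mats (group_ring G) m1 m0" "p1 * b = b" "b * p0 = b"
    using resolution_mats[OF M, of 0] resolution_mats[OF M, of 1] by (auto simp: defs)
  note cl = group_ring.mats_closed
  obtain f0 where f0: "f0 \<in> mats (group_ring G) n0 m0" "q0 * f0 = f0" "f0 * p0 = f0" and
    f0_aug: "\<And>x k r. x \<in> mats (group_ring G) k n0 \<Longrightarrow> x * q0 = x \<Longrightarrow> r < k \<Longrightarrow>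
      chain_aug G M (mat_row (x * f0) r) = chain_aug G N (mat_row x r)"
    using chain_map_degree_zero[OF N M] unfolding defs by blast
  obtain g0 where g0: "g0 \<in> mats (group_ring G) m0 n0" "p0 * g0 = g0" "g0 * q0 = g0" and
    g0_aug: "\<And>x k r. x \<in> mats (group_ring G) k m0 \<Longrightarrow> x * p0 = x \<Longrightarrow> r < k \<Longrightarrow>
      chain_aug G N (mat_row (x * g0) r) = chain_aug G M (mat_row x r)"
    using chain_map_degree_zero[OF M N] unfolding defs by blast
  note [simp] = mats_dim[OF q0(1)] mats_dim[OF q1(1)] mats_dim[OF d(1)] mats_dim[OF d1(1)]
    mats_dim[OF p0(1)] mats_dim[OF p1(1)] mats_dim[OF b(1)] mats_dim[OF f0(1)] mats_dim[OF g0(1)]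
  note fg = cl(1)[OF f0(1) g0(1)] and gf = cl(1)[OF g0(1) f0(1)]
  \<comment> \<open>\<open>hN\<close> and \<open>hM\<close> are the degree-0 parts of the homotopies
    from the composites to the identities; they exist because the composites preserve the
    augmentation.\<close>
  obtain hN where hN: "hN \<in> mats (group_ring G) n0 n1" "hN * q1 = hN" "hN * d = q0 - f0 * g0" "q0 * hN = hN"
  proof (rule lift_boundary[OF N, folded defs])
    show "q0 - f0 * g0 \<in> mats (group_ring G) n0 n0" by (intro cl(3) q0 fg)
    show "(q0 - f0 * g0) * q0 = q0 - f0 * g0" by (simp add: mat_distrib q0 mat_mult_assoc g0)
    show "q0 * (q0 - f0 * g0) = q0 - f0 * g0" by (simp add: mat_distrib q0 f0 flip: mat_mult_assoc)
    show "chain_aug G N (mat_row (q0 - f0 * g0) r) = 0" if "r < n0" for r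
    proof -
      have "chain_aug G N (mat_row (f0 * g0) r) = chain_aug G M (mat_row f0 r)"
        by (rule g0_aug[OF f0(1,3) that])
      also have "\<dots> = chain_aug G N (mat_row q0 r)" using f0_aug[OF q0 that] by (simp only: f0)
      finally show ?thesis
        using chain_aug_row_diff[of q0 n0 N "f0 * g0" r] q0 fg that unfolding defs by simp
    qed
  qed (use q0 in auto)
  obtain hM where hM: "hM \<in> mats (group_ring G) m0 m1" "hM * p1 = hM" "hM * b = p0 - g0 * f0" "p0 * hM = hM"
  proof (rule lift_boundary[OF M, folded defs])
    show "p0 - g0 * f0 \<in> mats (group_ring G) m0 m0" by (intro cl(3) p0 gf)
    show "(p0 - g0 * f0) * p0 = p0 - g0 * f0" by (simp add: mat_distrib p0 mat_mult_assoc f0)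
    show "p0 * (p0 - g0 * f0) = p0 - g0 * f0" by (simp add: mat_distrib p0 g0 flip: mat_mult_assoc)
    show "chain_aug G M (mat_row (p0 - g0 * f0) r) = 0" if "r < m0" for r
    proof -
      have "chain_aug G M (mat_row (g0 * f0) r) = chain_aug G N (mat_row g0 r)"
        by (rule f0_aug[OF g0(1,3) that])
      also have "\<dots> = chain_aug G M (mat_row p0 r)" using g0_aug[OF p0 that] by (simp only: g0)
      finally show ?thesis
        using chain_aug_row_diff[of p0 m0 M "g0 * f0" r] p0 gf that unfolding defs by simp
    qed
  qed (use p0 in auto)
  obtain f1 where f1: "f1 \<in> mats (group_ring G) n1 m1" "f1 * p1 = f1" "f1 * b = d * f0" "q1 * f1 = f1"
  proof (rule lift_boundary[OF M, folded defs])
    show "d * f0 \<in> mats (group_ring G) n1 m0" by (rule cl(1)[OF d(1) f0(1)])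
    show "d * f0 * p0 = d * f0" by (simp add: mat_mult_assoc f0)
    show "q1 * (d * f0) = d * f0" by (simp add: d flip: mat_mult_assoc)
    show "chain_aug G M (mat_row (d * f0) r) = 0" if "r < n1" for r
      using f0_aug[OF d(1,3) that] resolution_diff_aug[OF N, folded defs, OF that] by simp
  qed (use q1 in auto)
  obtain g1 where g1: "g1 \<in> mats (group_ring G) m1 n1" "g1 * q1 = g1" "g1 * d = b * g0" "p1 * g1 = g1"
  proof (rule lift_boundary[OF N, folded defs])
    show "b * g0 \<in> mats (group_ring G) m1 n0" by (rule cl(1)[OF b(1) g0(1)])
    show "b * g0 * q0 = b * g0" by (simp add: mat_mult_assoc g0)
    show "p1 * (b * g0) = b * g0" by (simp add: b flip: mat_mult_assoc)
    show "chain_aug G N (mat_row (b * g0) r) = 0" if "r < m1" for r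
      using g0_aug[OF b(1,3) that] resolution_diff_aug[OF M, folded defs, OF that] by simp
  qed (use p1 in auto)
  note [simp] = mats_dim[OF hN(1)] mats_dim[OF hM(1)] mats_dim[OF f1(1)] mats_dim[OF g1(1)]
  have zero: "A - A = 0\<^sub>m (dim_row A) (dim_col A)" for A :: "'a ell2_op mat" by (auto simp: mat_eq_iff)
  have diff_eq: "A = B" if "A - B = 0\<^sub>m k l" "dim_row A = k" "dim_col A = l" "dim_row B = k" "dim_col B = l"
    for A B :: "'a ell2_op mat" and k l
    using that by (auto simp: mat_eq_iff)
  \<comment> \<open>\<open>M\<close> vanishes in degree 2, so its differential out of degree 1 is
    injective; identities between maps into that module are checked after multiplication by
    \<open>b\<close>.\<close>
  have inj: "z = 0\<^sub>m k m1" if z: "z \<in> mats (group_ring G) k m1" "z * p1 = z" "z * b = 0\<^sub>m k m0" for z k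
  proof -
    have b2: "res_diff M 1 \<in> mats (group_ring G) 0 m1"
      using resolution_mats(3)[OF M, of 1] M2 by (simp add: defs numeral_2_eq_2)
    obtain c where "c \<in> mats (group_ring G) k 0" "c * res_diff M 1 = z"
      using lift_cycle[OF M, folded defs, OF z] M2 by auto
    then show ?thesis
      using mats_dim[OF b2] by (auto simp: mats_iff mat_eq_iff mat_mult_index simp del: index_mult_mat(1))
  qed
  \<comment> \<open>The degree-1 homotopy formula reads
    \<open>q1 = f1 * g1 + d * hN + y * d1\<close>. Leaving out the last term, which comes from
    degree 2, gives an idempotent that kills exactly the image of \<open>d1\<close>.\<close>
  define e where "e = f1 * g1 + d * hN"
  note fg1 = cl(1)[OF f1(1) g1(1)] and dh = cl(1)[OF d(1) hN(1)]
  have e: "e \<in> mats (group_ring G) n1 n1" unfolding e_def by (rule cl(2)[OF fg1 dh])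
  note [simp] = mats_dim[OF e]
  have "e * d = f1 * b * g0 + d * (q0 - f0 * g0)"
    by (simp add: e_def mat_distrib mat_mult_assoc g1 hN)
  also have "\<dots> = d * (f0 * g0) + (d - d * (f0 * g0))"
    by (simp add: f1 mat_distrib d mat_mult_assoc)
  also have "\<dots> = d" by (intro eq_matI) (simp_all del: index_mult_mat(1))
  finally have ed: "e * d = d" .
  have q1e: "q1 * e = e"
    unfolding e_def by (simp add: mat_distrib f1 d flip: mat_mult_assoc)
  have eq1: "e * q1 = e"
    unfolding e_def by (simp add: mat_distrib mat_mult_assoc g1 hN)
  have d1d: "d1 * d = 0\<^sub>m n2 n0" using resolution_diff_diff[OF N] by (simp add: defs)
  have d1f1: "d1 * f1 = 0\<^sub>m n2 m1"
  proof (rule inj)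
    show "d1 * f1 \<in> mats (group_ring G) n2 m1" by (rule cl(1)[OF d1(1) f1(1)])
    show "d1 * f1 * p1 = d1 * f1" by (simp add: mat_mult_assoc f1)
    have "d1 * f1 * b = d1 * d * f0" by (simp add: mat_mult_assoc f1)
    then show "d1 * f1 * b = 0\<^sub>m n2 m0" by (simp add: d1d mat_zero_mult)
  qed
  have "d1 * e = d1 * f1 * g1 + d1 * d * hN" by (simp add: e_def mat_distrib mat_mult_assoc)
  then have d1e: "d1 * e = 0\<^sub>m n2 n1" by (simp add: d1f1 d1d mat_zero_mult mat_add_zero)
  obtain y where y: "y \<in> mats (group_ring G) n1 n2" "y * d1 = q1 - e"
  proof (rule lift_cycle[OF N, folded defs])
    show "q1 - e \<in> mats (group_ring G) n1 n1" by (intro cl(3) q1 e)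
    show "(q1 - e) * q1 = q1 - e" by (simp add: mat_distrib q1 eq1)
    show "(q1 - e) * d = 0\<^sub>m n1 n0" by (simp add: mat_distrib d ed zero)
  qed blast
  note [simp] = mats_dim[OF y(1)]
  have "(q1 - e) * e = y * (d1 * e)" by (simp add: mat_mult_assoc flip: y(2))
  then have "q1 * e - e * e = 0\<^sub>m n1 n1" by (simp add: mat_distrib d1e mat_zero_mult)
  then have ee: "e * e = e" unfolding q1e by (rule diff_eq[symmetric]) auto
  have "(q1 - e) * f1 = y * (d1 * f1)" by (simp add: mat_mult_assoc flip: y(2))
  then have "q1 * f1 - e * f1 = 0\<^sub>m n1 m1" by (simp add: mat_distrib d1f1 mat_zero_mult)
  then have ef1: "e * f1 = f1" unfolding f1(4) by (rule diff_eq[symmetric]) auto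
  \<comment> \<open>Cycles of \<open>N\<close> in degree 1 are images of \<open>d1\<close>, and
    \<open>d1 * e\<close> is 0; so identities into the range of \<open>e\<close> are checked after
    multiplication by \<open>d\<close>.\<close>
  have kill: "z * e = 0\<^sub>m k n1" if z: "z \<in> mats (group_ring G) k n1" "z * q1 = z" "z * d = 0\<^sub>m k n0" for z k
  proof -
    obtain w where w: "w \<in> mats (group_ring G) k n2" "w * d1 = z"
      using lift_cycle[OF N, folded defs, OF z] by blast
    have "z * e = w * (d1 * e)" using mats_dim[OF w(1)] by (simp add: mat_mult_assoc flip: w(2))
    then show ?thesis using mats_dim[OF w(1)] by (simp add: d1e mat_zero_mult)
  qed
  note gh = cl(1)[OF g0(1) hN(1)] and hg = cl(1)[OF hM(1) g1(1)]
    and hf = cl(1)[OF hN(1) f1(1)] and fh = cl(1)[OF f0(1) hM(1)] and gf1 = cl(1)[OF g1(1) f1(1)] and bh = cl(1)[OF b(1) hM(1)]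
  have "(g0 * hN - hM * g1) * e = 0\<^sub>m m0 n1"
  proof (rule kill)
    show "g0 * hN - hM * g1 \<in> mats (group_ring G) m0 n1" by (intro cl(3) gh hg)
    show "(g0 * hN - hM * g1) * q1 = g0 * hN - hM * g1"
      by (simp add: mat_distrib mat_mult_assoc hN g1)
    have "(g0 * hN - hM * g1) * d = g0 * (q0 - f0 * g0) - (hM * b) * g0"
      by (simp add: mat_distrib mat_mult_assoc hN(3) g1(3))
    also have "\<dots> = (g0 - g0 * (f0 * g0)) - (g0 - g0 * (f0 * g0))"
      by (simp add: mat_distrib mat_mult_assoc hM(3) g0)
    finally show "(g0 * hN - hM * g1) * d = 0\<^sub>m m0 n0" by (simp add: zero)
  qed
  then have xy21: "g0 * (hN * e) + - hM * (g1 * e) = 0\<^sub>m m0 n1"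
    by (auto simp: mat_distrib mat_mult_assoc mat_eq_iff simp del: index_mult_mat(1))
  have yx12: "hN * (e * f1) + f0 * (- hM) = 0\<^sub>m n0 m1"
  proof -
    have "hN * f1 - f0 * hM = 0\<^sub>m n0 m1"
    proof (rule inj)
      show "hN * f1 - f0 * hM \<in> mats (group_ring G) n0 m1" by (intro cl(3) hf fh)
      show "(hN * f1 - f0 * hM) * p1 = hN * f1 - f0 * hM"
        by (simp add: mat_distrib mat_mult_assoc hM f1)
      have "(hN * f1 - f0 * hM) * b = (hN * d) * f0 - f0 * (p0 - g0 * f0)"
        by (simp add: mat_distrib mat_mult_assoc hM(3) f1(3))
      also have "\<dots> = (f0 - f0 * (g0 * f0)) - (f0 - f0 * (g0 * f0))"
        by (simp add: mat_distrib mat_mult_assoc hN(3) f0)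
      finally show "(hN * f1 - f0 * hM) * b = 0\<^sub>m n0 m0" by (simp add: zero)
    qed
    then show ?thesis by (auto simp: ef1 mat_distrib mat_eq_iff simp del: index_mult_mat(1))
  qed
  have "g1 * f1 + b * hM - p1 = 0\<^sub>m m1 m1"
  proof (rule inj)
    show "g1 * f1 + b * hM - p1 \<in> mats (group_ring G) m1 m1" by (intro cl(2,3) gf1 bh p1)
    show "(g1 * f1 + b * hM - p1) * p1 = g1 * f1 + b * hM - p1"
      by (simp add: mat_distrib mat_mult_assoc hM f1 p1)
    have "(g1 * f1 + b * hM - p1) * b = (g1 * d) * f0 + b * (p0 - g0 * f0) - b"
      by (simp add: mat_distrib mat_mult_assoc hM(3) f1(3) b(2))
    also have "\<dots> = b * (g0 * f0) + (b - b * (g0 * f0)) - b"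
      by (simp add: mat_distrib mat_mult_assoc g1(3) b(3))
    also have "\<dots> = 0\<^sub>m m1 m0" by (intro eq_matI) (simp_all del: index_mult_mat(1))
    finally show "(g1 * f1 + b * hM - p1) * b = 0\<^sub>m m1 m0" .
  qed
  then have "g1 * f1 + b * hM = p1" by (rule diff_eq) auto
  then have yx22: "g1 * (e * f1) + - b * (- hM) = p1"
    by (auto simp: ef1 mat_distrib mat_eq_iff simp del: index_mult_mat(1))
  \<comment> \<open>The differential of the mapping cone of the comparison map, split into its two
    halves by a contraction; the signs make the mixed terms cancel.\<close>
  define X where "X = four_block_mat d f1 g0 (- hM)"
  define Y where "Y = four_block_mat (hN * e) f0 (g1 * e) (- b)"
  have X: "X \<in> mats (group_ring G) (n1 + m0) (n0 + m1)" and Y: "Y \<in> mats (group_ring G) (n0 + m1) (n1 + m0)"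
    unfolding X_def Y_def
    by (intro group_ring.four_block_mats cl(4) d f1 g0 hM f0 b cl(1)[OF hN(1) e] cl(1)[OF g1(1) e])+
  have "X * Y = four_block_mat (d * (hN * e) + f1 * (g1 * e)) (d * f0 + f1 * (- b))
      (g0 * (hN * e) + - hM * (g1 * e)) (g0 * f0 + - hM * (- b))"
    unfolding X_def Y_def by (rule four_block_mult) simp_all
  also have "d * (hN * e) + f1 * (g1 * e) = e * e"
    unfolding e_def[symmetric]
    by (subst (3) e_def) (auto simp: mat_distrib mat_mult_assoc mat_eq_iff add.commute simp del: index_mult_mat(1))
  also have "d * f0 + f1 * (- b) = 0\<^sub>m n1 m0"
    by (auto simp: mat_distrib f1(3) mat_eq_iff simp del: index_mult_mat(1))
  also have "g0 * f0 + - hM * (- b) = p0"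
    by (auto simp: mat_distrib hM(3) mat_eq_iff simp del: index_mult_mat(1))
  finally have XY: "diag_sum e p0 = X * Y" unfolding xy21 ee by (simp add: diag_sum_def)
  have "Y * X = four_block_mat (hN * e * d + f0 * g0) (hN * e * f1 + f0 * (- hM))
      (g1 * e * d + - b * g0) (g1 * e * f1 + - b * (- hM))"
    unfolding X_def Y_def by (rule four_block_mult) simp_all
  also have "hN * e * d + f0 * g0 = q0"
    by (auto simp: mat_mult_assoc ed hN(3) mat_eq_iff simp del: index_mult_mat(1))
  also have "g1 * e * d + - b * g0 = 0\<^sub>m m1 n0"
    by (auto simp: mat_mult_assoc ed g1(3) mat_distrib mat_eq_iff simp del: index_mult_mat(1))
  also have "hN * e * f1 + f0 * (- hM) = 0\<^sub>m n0 m1" using yx12 by (simp add: mat_mult_assoc)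
  also have "g1 * e * f1 + - b * (- hM) = p1" using yx22 by (simp add: mat_mult_assoc)
  finally have YX: "diag_sum q0 p1 = Y * X" by (simp add: diag_sum_def)
  have "idem_equiv (group_ring G) (diag_sum e p0) (diag_sum q0 p1)"
    unfolding idem_equiv_iff diag_sum_dim using X Y XY YX by (intro bexI[of _ X] bexI[of _ Y]) simp_all
  then show thesis
    by (rule that[of e y, folded defs, OF e ee ed d1e y(1) y(2)[symmetric] q1e])
qed

end

section \<open>Permutation modules as projective modules over the group ring\<close>

definition supp_sum :: "('x \<Rightarrow> complex) \<Rightarrow> complex" where
  "supp_sum c = (\<Sum>x | c x \<noteq> 0. c x)"

lemma supp_sum_superset:
  assumes "finite F" "{x. c x \<noteq> 0} \<subseteq> F"
  shows "supp_sum c = sum c F"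
  unfolding supp_sum_def using assms by (intro sum.mono_neutral_left) auto

lemma supp_sum_add:
  assumes "finite {x. c x \<noteq> 0}" "finite {x. c' x \<noteq> 0}"
  shows "supp_sum (\<lambda>x. c x + c' x) = supp_sum c + supp_sum c'"
proof -
  let ?F = "{x. c x \<noteq> 0} \<union> {x. c' x \<noteq> 0}"
  have F: "finite ?F" using assms by simp
  have "supp_sum c = sum c ?F" "supp_sum c' = sum c' ?F" "supp_sum (\<lambda>x. c x + c' x) = (\<Sum>x\<in>?F. c x + c' x)"
    by (rule supp_sum_superset[OF F]; force)+
  then show ?thesis by (simp only: sum.distrib)
qed

context group
begin

section \<open>Module homomorphisms between free modules as matrices\<close>

definition unit_row :: "nat \<Rightarrow> nat \<Rightarrow> 'a ell2_op" where
  "unit_row i k = (if k = i then lam G \<one> else 0)"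

lemma unit_row_mem: "unit_row i k \<in> group_ring G"
  by (simp add: unit_row_def group_ring.unit_mem group_ring_zero)

text \<open>Equivariance extends by additivity to the whole group ring, and a row is a combination
  of unit rows. The action \<open>act\<close> is kept abstract, since the lemma serves both maps
  into the group ring and complex functionals on which the ring acts through the
  augmentation.\<close>

lemma group_ring_linear:
  fixes L :: "(nat \<Rightarrow> 'a ell2_op) \<Rightarrow> 'w::ab_group_add" and act :: "'a ell2_op \<Rightarrow> 'w \<Rightarrow> 'w"
  assumes add: "\<And>r r'. (\<And>i. r i \<in> group_ring G) \<Longrightarrow> (\<And>i. r' i \<in> group_ring G) \<Longrightarrow> L (\<lambda>i. r i + r' i) = L r + L r'"
    and hom: "\<And>s z r. s \<in> carrier G \<Longrightarrow> (\<And>i. r i \<in> group_ring G) \<Longrightarrow>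
      L (\<lambda>i. scaleC_op z (lam G s) * r i) = act (scaleC_op z (lam G s)) (L r)"
    and act: "\<And>a b v. a \<in> group_ring G \<Longrightarrow> b \<in> group_ring G \<Longrightarrow> act (a + b) v = act a v + act b v"
    and dep: "\<And>r r'. (\<And>i. i < n \<Longrightarrow> r i = r' i) \<Longrightarrow> L r = L r'"
    and r: "\<And>i. r i \<in> group_ring G"
  shows "L r = (\<Sum>i<n. act (r i) (L (unit_row i)))"
proof -
  have L0: "L (\<lambda>_. 0) = 0" using add[of "\<lambda>_. 0" "\<lambda>_. 0"] by (simp add: group_ring_zero)
  have act0: "act 0 v = 0" for v using act[of 0 0 v] by (simp add: group_ring_zero)
  have hom': "L (\<lambda>i. a * r i) = act a (L r)" if "a \<in> group_ring G" and r: "\<And>i. r i \<in> group_ring G" for a r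
    using that(1)
  proof (induction rule: group_ring_induct)
    case zero
    then show ?case by (simp add: L0 act0)
  next
    case (add a c h)
    have "L (\<lambda>i. (scaleC_op c (lam G h) + a) * r i) = L (\<lambda>i. scaleC_op c (lam G h) * r i) + L (\<lambda>i. a * r i)"
      unfolding distrib_right
      by (rule assms(1)) (auto intro: group_ring_mult group_ring_lam add r)
    then show ?case using add by (simp add: hom r act group_ring_lam)
  qed
  have "m \<le> n \<Longrightarrow> L (\<lambda>k. if k < m then r k else 0) = (\<Sum>i<m. act (r i) (L (unit_row i)))" for m
  proof (induction m)
    case 0
    then show ?case by (simp add: L0)
  next
    case (Suc m)
    \<comment> \<open>The row is built up coordinate by coordinate, each one being a multiple of a
      unit row.\<close>
    have "(\<lambda>k. if k < Suc m then r k else 0) = (\<lambda>k. (if k < m then r k else 0) + r m * unit_row m k)"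
      using group_ring.unit_right[OF r[of m]] by (auto simp: unit_row_def less_Suc_eq)
    then have "L (\<lambda>k. if k < Suc m then r k else 0) = L (\<lambda>k. if k < m then r k else 0) + L (\<lambda>k. r m * unit_row m k)"
      by (simp only:) (rule add, auto simp: group_ring_zero r group_ring_mult unit_row_mem)
    also have "L (\<lambda>k. r m * unit_row m k) = act (r m) (L (unit_row m))"
      by (rule hom'[OF r unit_row_mem])
    finally show ?case using Suc by simp
  qed
  from this[of n] show ?thesis using dep[of r "\<lambda>k. if k < n then r k else 0"] by simp
qed

text \<open>Rows are total functions on the naturals, hence the clause that only the first
  \<open>n\<close> entries matter.\<close>

definition row_map :: "nat \<Rightarrow> nat \<Rightarrow> ((nat \<Rightarrow> 'a ell2_op) \<Rightarrow> nat \<Rightarrow> 'a ell2_op) \<Rightarrow> bool" where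
  "row_map n m F \<longleftrightarrow>
    (\<forall>r j. (\<forall>i. r i \<in> group_ring G) \<longrightarrow> j < m \<longrightarrow> F r j \<in> group_ring G) \<and>
    (\<forall>r r' j. (\<forall>i. r i \<in> group_ring G) \<longrightarrow> (\<forall>i. r' i \<in> group_ring G) \<longrightarrow> j < m \<longrightarrow> F (\<lambda>i. r i + r' i) j = F r j + F r' j) \<and>
    (\<forall>s z r j. s \<in> carrier G \<longrightarrow> (\<forall>i. r i \<in> group_ring G) \<longrightarrow> j < m \<longrightarrow>
      F (\<lambda>i. scaleC_op z (lam G s) * r i) j = scaleC_op z (lam G s) * F r j) \<and>
    (\<forall>r r'. (\<forall>i<n. r i = r' i) \<longrightarrow> F r = F r')"

definition map_matrix :: "nat \<Rightarrow> nat \<Rightarrow> ((nat \<Rightarrow> 'a ell2_op) \<Rightarrow> nat \<Rightarrow> 'a ell2_op) \<Rightarrow> 'a ell2_op mat" where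
  "map_matrix n m F = mat n m (\<lambda>(i, j). F (unit_row i) j)"

definition row_fun :: "'a ell2_op mat \<Rightarrow> nat \<Rightarrow> nat \<Rightarrow> 'a ell2_op" where
  "row_fun x r i = (if i < dim_col x then x $$ (r, i) else 0)"

lemma row_fun_mem: "x \<in> mats (group_ring G) k n \<Longrightarrow> r < k \<Longrightarrow> row_fun x r i \<in> group_ring G"
  by (auto simp: row_fun_def mats_iff group_ring_zero)

lemma map_matrix_mats: "row_map n m F \<Longrightarrow> map_matrix n m F \<in> mats (group_ring G) n m"
  by (simp add: map_matrix_def mats_iff row_map_def unit_row_mem)

lemma map_matrix_mult:
  assumes F: "row_map n m F" and x: "x \<in> mats (group_ring G) k n" and rj: "r < k" "j < m"
  shows "(x * map_matrix n m F) $$ (r, j) = F (row_fun x r) j"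
proof -
  note F' = F[unfolded row_map_def]
  have "F (row_fun x r) j = (\<Sum>i<n. row_fun x r i * F (unit_row i) j)"
    by (rule group_ring_linear[where L = "\<lambda>r. F r j" and act = "(*)"])
      (use F' rj row_fun_mem[OF x rj(1)] in \<open>auto simp: distrib_right\<close>, metis)
  then show ?thesis
    using rj mats_dim[OF x] by (simp add: map_matrix_def mat_mult_index row_fun_def del: index_mult_mat(1))
qed

text \<open>Matrices act on rows from the right, so the product lists the maps in their order of
  application.\<close>

lemma map_matrix_comp:
  assumes F: "row_map n m F" and F': "row_map m k F'"
  shows "map_matrix n m F * map_matrix m k F' = map_matrix n k (\<lambda>r. F' (F r))"
proof (rule eq_matI)
  fix i j assume "i < dim_row (map_matrix n k (\<lambda>r. F' (F r)))" "j < dim_col (map_matrix n k (\<lambda>r. F' (F r)))"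
  then have ij: "i < n" "j < k" by (auto simp: map_matrix_def)
  have "F' (row_fun (map_matrix n m F) i) = F' (F (unit_row i))"
    using F' ij unfolding row_map_def by (auto simp: row_fun_def map_matrix_def)
  then show "(map_matrix n m F * map_matrix m k F') $$ (i, j) = map_matrix n k (\<lambda>r. F' (F r)) $$ (i, j)"
    unfolding map_matrix_mult[OF F' map_matrix_mats[OF F] ij] using ij by (simp add: map_matrix_def)
qed (auto simp: map_matrix_def)

end

text \<open>A \<open>G\<close>-set \<open>X\<close> with an equivariant involution \<open>\<iota>\<close>; its module consists of the finitely supported
  functions \<open>c\<close> with \<open>c (\<iota> x) = sg * c x\<close>. The points \<open>D i\<close>, \<open>i < n\<close>, meet all orbits up to \<open>\<iota>\<close>.\<close>

locale signed_gset = group G for G :: "('g, 'm) monoid_scheme" (structure) +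
  fixes X :: "'x set" and \<psi> :: "'g \<Rightarrow> 'x \<Rightarrow> 'x" and \<iota> :: "'x \<Rightarrow> 'x" and sg :: complex
    and D :: "nat \<Rightarrow> 'x" and n :: nat
  assumes psi_mem: "h \<in> carrier G \<Longrightarrow> x \<in> X \<Longrightarrow> \<psi> h x \<in> X"
    and psi_one: "x \<in> X \<Longrightarrow> \<psi> \<one> x = x"
    and psi_mult: "h \<in> carrier G \<Longrightarrow> k \<in> carrier G \<Longrightarrow> x \<in> X \<Longrightarrow> \<psi> (h \<otimes> k) x = \<psi> h (\<psi> k x)"
    and iota_mem: "x \<in> X \<Longrightarrow> \<iota> x \<in> X"
    and iota_iota: "x \<in> X \<Longrightarrow> \<iota> (\<iota> x) = x"
    and iota_psi: "h \<in> carrier G \<Longrightarrow> x \<in> X \<Longrightarrow> \<iota> (\<psi> h x) = \<psi> h (\<iota> x)"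
    and sg: "sg * sg = 1"
    and D_mem: "i < n \<Longrightarrow> D i \<in> X"
    and cover: "x \<in> X \<Longrightarrow> \<exists>i<n. \<exists>h\<in>carrier G. \<psi> h (D i) = x \<or> \<psi> h (D i) = \<iota> x"
    and fin: "x \<in> X \<Longrightarrow> y \<in> X \<Longrightarrow> finite {h \<in> carrier G. \<psi> h x = y}"
begin

section \<open>The module of a signed set with group action as a retract of a free module\<close>

lemma psi_inv [simp]:
  assumes "h \<in> carrier G" "x \<in> X"
  shows "\<psi> (inv h) (\<psi> h x) = x" "\<psi> h (\<psi> (inv h) x) = x"
  using assms psi_mult[of "inv h" h x] psi_mult[of h "inv h" x] psi_one by auto

definition fiber :: "nat \<Rightarrow> 'x \<Rightarrow> 'g set" where
  "fiber i y = {h \<in> carrier G. \<psi> h (D i) = y}"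

definition weight :: "'x \<Rightarrow> nat" where
  "weight y = (\<Sum>i<n. card (fiber i y))"

definition chains :: "('x \<Rightarrow> complex) set" where
  "chains = {c. finite {x. c x \<noteq> 0} \<and> (\<forall>x. c x \<noteq> 0 \<longrightarrow> x \<in> X) \<and> (\<forall>x\<in>X. c (\<iota> x) = sg * c x)}"

definition translate :: "'g \<Rightarrow> ('x \<Rightarrow> complex) \<Rightarrow> 'x \<Rightarrow> complex" where
  "translate h c x = (if x \<in> X then c (\<psi> (inv h) x) else 0)"

text \<open>Pulling back along the orbit maps \<open>h \<mapsto> \<psi> h (D i)\<close> embeds the
  chains into the free module; finiteness of the fibers keeps the supports finite.\<close>

definition to_row :: "('x \<Rightarrow> complex) \<Rightarrow> nat \<Rightarrow> 'g ell2_op" where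
  "to_row c i = gr (\<lambda>h. c (\<psi> h (D i)))"

definition push :: "(nat \<Rightarrow> 'g ell2_op) \<Rightarrow> 'x \<Rightarrow> complex" where
  "push r y = (\<Sum>i<n. \<Sum>h\<in>fiber i y. coeff_fun G (r i) h)"

text \<open>Summing over fibers and symmetrising with \<open>\<iota>\<close> and \<open>sg\<close>
  lands in the chains; dividing by the number of all preimages makes this a left inverse of
  \<open>to_row\<close>. The points \<open>D i\<close> may have stabilizers and may share
  orbits.\<close>

definition of_row :: "(nat \<Rightarrow> 'g ell2_op) \<Rightarrow> 'x \<Rightarrow> complex" where
  "of_row r y = (if y \<in> X then (push r y + sg * push r (\<iota> y)) / of_nat (weight y + weight (\<iota> y)) else 0)"

lemma finite_fiber: "i < n \<Longrightarrow> y \<in> X \<Longrightarrow> finite (fiber i y)"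
  unfolding fiber_def by (rule fin[OF D_mem])

lemma weight_pos:
  assumes "x \<in> X"
  shows "0 < weight x + weight (\<iota> x)"
proof -
  obtain i h where i: "i < n" "h \<in> carrier G" "\<psi> h (D i) = x \<or> \<psi> h (D i) = \<iota> x" using cover[OF assms] by blast
  have "0 < weight y" if "y \<in> X" "\<psi> h (D i) = y" for y
  proof -
    have "0 < card (fiber i y)" using i that finite_fiber[of i y] by (auto simp: card_gt_0_iff fiber_def)
    also have "\<dots> \<le> weight y" unfolding weight_def by (rule member_le_sum) (use i in auto)
    finally show ?thesis .
  qed
  from this[OF assms] this[OF iota_mem[OF assms]] show ?thesis using i(3) by auto
qed

lemma finite_row_support:
  assumes "c \<in> chains" "i < n"
  shows "finite {h \<in> carrier G. c (\<psi> h (D i)) \<noteq> 0}"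
proof (rule finite_subset)
  show "{h \<in> carrier G. c (\<psi> h (D i)) \<noteq> 0} \<subseteq> (\<Union>y\<in>{x. c x \<noteq> 0}. fiber i y)" by (auto simp: fiber_def)
  show "finite (\<Union>y\<in>{x. c x \<noteq> 0}. fiber i y)"
    using assms finite_fiber by (intro finite_UN_I) (auto simp: chains_def)
qed

lemma to_row:
  assumes "c \<in> chains" "i < n"
  shows "to_row c i \<in> group_ring G" "h \<in> carrier G \<Longrightarrow> coeff_fun G (to_row c i) h = c (\<psi> h (D i))"
  unfolding to_row_def using gr[OF finite_row_support[OF assms]] by auto

lemma chains_add:
  assumes "c \<in> chains" "c' \<in> chains"
  shows "(\<lambda>x. c x + c' x) \<in> chains"
proof -
  have "{x. c x + c' x \<noteq> 0} \<subseteq> {x. c x \<noteq> 0} \<union> {x. c' x \<noteq> 0}" by auto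
  then have "finite {x. c x + c' x \<noteq> 0}" using assms by (auto simp: chains_def intro: finite_subset)
  then show ?thesis using assms unfolding chains_def by (auto simp: distrib_left) (metis add.right_neutral)
qed

lemma chains_translate:
  assumes "c \<in> chains" "h \<in> carrier G"
  shows "(\<lambda>x. z * translate h c x) \<in> chains"
proof -
  have "{x. z * translate h c x \<noteq> 0} \<subseteq> \<psi> h ` {x. c x \<noteq> 0}"
  proof
    fix x assume "x \<in> {x. z * translate h c x \<noteq> 0}"
    then have "x \<in> X" "c (\<psi> (inv h) x) \<noteq> 0" by (auto simp: translate_def split: if_splits)
    then show "x \<in> \<psi> h ` {x. c x \<noteq> 0}" using assms(2) by (intro image_eqI[of _ _ "\<psi> (inv h) x"]) auto
  qed
  then have "finite {x. z * translate h c x \<noteq> 0}" using assms finite_subset by (fastforce simp: chains_def)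
  then show ?thesis
    using assms psi_mem iota_mem by (auto simp: chains_def translate_def iota_psi[symmetric])
qed

lemma to_row_add:
  assumes "c \<in> chains" "c' \<in> chains" "i < n"
  shows "to_row (\<lambda>x. c x + c' x) i = to_row c i + to_row c' i"
  by (rule group_ring_eqI)
    (use assms chains_add in \<open>auto simp: to_row coeff_fun_simps group_ring_add\<close>)

lemma to_row_translate:
  assumes "c \<in> chains" "s \<in> carrier G" "i < n"
  shows "to_row (\<lambda>x. z * translate s c x) i = scaleC_op z (lam G s) * to_row c i"
proof (rule group_ring_eqI)
  note m = chains_translate[OF assms(1,2), of z]
  show "to_row (\<lambda>x. z * translate s c x) i \<in> group_ring G" by (rule to_row(1)[OF m assms(3)])
  show "scaleC_op z (lam G s) * to_row c i \<in> group_ring G"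
    by (intro group_ring_mult group_ring_lam assms to_row(1))
  fix h assume h: "h \<in> carrier G"
  have "\<psi> (inv s) (\<psi> h (D i)) = \<psi> (inv s \<otimes> h) (D i)" using assms h D_mem by (simp add: psi_mult)
  moreover have "coeff_fun G (to_row (\<lambda>x. z * translate s c x) i) h = z * translate s c (\<psi> h (D i))"
    by (rule to_row(2)[OF m assms(3) h])
  ultimately show "coeff_fun G (to_row (\<lambda>x. z * translate s c x) i) h = coeff_fun G (scaleC_op z (lam G s) * to_row c i) h"
    using assms h D_mem psi_mem
    by (simp add: scaleC_op_simps coeff_fun_simps coeff_fun_lam_mult to_row(2) translate_def)
qed

lemma fiber_translate:
  assumes s: "s \<in> carrier G" and "i < n" "y \<in> X"
  shows "bij_betw (\<lambda>h. inv s \<otimes> h) (fiber i y) (fiber i (\<psi> (inv s) y))"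
proof (rule bij_betwI[where g = "\<lambda>h. s \<otimes> h"])
  show "(\<lambda>h. inv s \<otimes> h) \<in> fiber i y \<rightarrow> fiber i (\<psi> (inv s) y)"
    using s D_mem[OF assms(2)] by (auto simp: fiber_def psi_mult)
  show "(\<lambda>h. s \<otimes> h) \<in> fiber i (\<psi> (inv s) y) \<rightarrow> fiber i y"
    using s D_mem[OF assms(2)] assms(3) by (auto simp: fiber_def psi_mult)
qed (use s in \<open>auto simp: fiber_def m_assoc[symmetric]\<close>)

lemma weight_translate: "s \<in> carrier G \<Longrightarrow> y \<in> X \<Longrightarrow> weight (\<psi> (inv s) y) = weight y"
  unfolding weight_def by (rule sum.cong) (auto intro!: bij_betw_same_card[OF fiber_translate, symmetric])

lemma push_translate:
  assumes "s \<in> carrier G" "y \<in> X"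
  shows "push (\<lambda>i. scaleC_op z (lam G s) * r i) y = z * push r (\<psi> (inv s) y)"
proof -
  have "(\<Sum>h\<in>fiber i y. coeff_fun G (scaleC_op z (lam G s) * r i) h) =
      z * (\<Sum>h\<in>fiber i (\<psi> (inv s) y). coeff_fun G (r i) h)" if "i < n" for i
  proof -
    have "(\<Sum>h\<in>fiber i (\<psi> (inv s) y). coeff_fun G (r i) h) = (\<Sum>h\<in>fiber i y. coeff_fun G (r i) (inv s \<otimes> h))"
      by (rule sum.reindex_bij_betw[OF fiber_translate[OF assms(1) that assms(2)], symmetric])
    moreover have "(\<Sum>h\<in>fiber i y. coeff_fun G (scaleC_op z (lam G s) * r i) h) =
        (\<Sum>h\<in>fiber i y. z * coeff_fun G (r i) (inv s \<otimes> h))"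
      by (rule sum.cong) (use assms in \<open>auto simp: fiber_def scaleC_op_simps coeff_fun_simps coeff_fun_lam_mult\<close>)
    ultimately show ?thesis by (simp add: sum_distrib_left)
  qed
  then show ?thesis by (simp add: push_def sum_distrib_left)
qed

lemma of_row_translate:
  assumes "s \<in> carrier G"
  shows "of_row (\<lambda>i. scaleC_op z (lam G s) * r i) = (\<lambda>y. z * translate s (of_row r) y)"
proof
  fix y
  show "of_row (\<lambda>i. scaleC_op z (lam G s) * r i) y = z * translate s (of_row r) y"
  proof (cases "y \<in> X")
    case True
    have "\<iota> (\<psi> (inv s) y) = \<psi> (inv s) (\<iota> y)" using iota_psi[OF _ True] assms by simp
    then show ?thesis
      using True psi_mem[OF inv_closed[OF assms] True] weight_translate[OF assms True]
        weight_translate[OF assms iota_mem[OF True]]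
      by (simp add: of_row_def translate_def push_translate[OF assms True]
          push_translate[OF assms iota_mem[OF True]] distrib_left mult.left_commute)
  qed (simp add: of_row_def translate_def)
qed

lemma of_row_add: "of_row (\<lambda>i. r i + r' i) = (\<lambda>y. of_row r y + of_row r' y)"
proof
  have "push (\<lambda>i. r i + r' i) y = push r y + push r' y" for y
    by (simp add: push_def coeff_fun_simps sum.distrib)
  moreover have "(a + b + sg * (c + d)) / w = (a + sg * c) / w + (b + sg * d) / w" for a b c d w
    unfolding add_divide_distrib[symmetric] by (simp add: distrib_left)
  ultimately show "of_row (\<lambda>i. r i + r' i) y = of_row r y + of_row r' y" for y
    by (simp add: of_row_def)
qed

lemma of_row_cong: "(\<And>i. i < n \<Longrightarrow> r i = r' i) \<Longrightarrow> of_row r = of_row r'"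
  by (auto simp: of_row_def push_def fun_eq_iff)

lemma of_row_mem:
  assumes r: "\<And>i. r i \<in> group_ring G"
  shows "of_row r \<in> chains"
proof -
  let ?T = "\<Union>i\<in>{..<n}. (\<lambda>h. \<psi> h (D i)) ` {h. coeff_fun G (r i) h \<noteq> 0}"
  have T: "finite ?T" using coeff_support(1)[OF r] by auto
  have push0: "push r y = 0" if "y \<notin> ?T" for y
    unfolding push_def using that by (intro sum.neutral ballI) (auto simp: fiber_def)
  have "{y. of_row r y \<noteq> 0} \<subseteq> ?T \<union> \<iota> ` ?T"
  proof
    fix y assume "y \<in> {y. of_row r y \<noteq> 0}"
    then have y: "y \<in> X" "push r y \<noteq> 0 \<or> push r (\<iota> y) \<noteq> 0" by (auto simp: of_row_def split: if_splits)
    then have "y \<in> ?T \<or> \<iota> y \<in> ?T" using push0 by blast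
    then show "y \<in> ?T \<union> \<iota> ` ?T"
    proof
      assume "\<iota> y \<in> ?T"
      then have "\<iota> (\<iota> y) \<in> \<iota> ` ?T" by (rule imageI)
      then show ?thesis unfolding iota_iota[OF y(1)] by (rule UnI2)
    qed (rule UnI1)
  qed
  then have "finite {y. of_row r y \<noteq> 0}" by (rule finite_subset) (intro finite_UnI finite_imageI T)
  moreover have "of_row r (\<iota> y) = sg * of_row r y" if "y \<in> X" for y
  proof -
    have "push r (\<iota> y) + sg * push r y = sg * (push r y + sg * push r (\<iota> y))"
      using sg by (simp add: distrib_left mult.assoc[symmetric])
    then show ?thesis using that iota_mem by (simp add: of_row_def iota_iota add.commute)
  qed
  ultimately show ?thesis by (auto simp: chains_def of_row_def)
qed

text \<open>A pulled-back chain is constant on fibers, so \<open>push\<close> multiplies it by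
  \<open>weight\<close>. The contribution through \<open>\<iota>\<close> carries the sign twice, and
  \<open>weight_pos\<close> permits the division.\<close>

lemma of_row_to_row:
  assumes c: "c \<in> chains"
  shows "of_row (to_row c) = c"
proof
  fix y
  show "of_row (to_row c) y = c y"
  proof (cases "y \<in> X")
    case True
    have push: "push (to_row c) x = of_nat (weight x) * c x" for x
      unfolding push_def weight_def of_nat_sum sum_distrib_right
      by (intro sum.cong refl) (auto simp: fiber_def to_row(2)[OF c])
    have "push (to_row c) y + sg * push (to_row c) (\<iota> y) = of_nat (weight y) * c y + of_nat (weight (\<iota> y)) * (sg * sg) * c y"
      using c True by (simp add: push chains_def)
    then have "push (to_row c) y + sg * push (to_row c) (\<iota> y) = of_nat (weight y + weight (\<iota> y)) * c y"
      by (simp add: sg distrib_right)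
    moreover have "of_nat (weight y + weight (\<iota> y)) \<noteq> (0 :: complex)"
      using weight_pos[OF True] by (metis of_nat_eq_0_iff less_numeral_extra(3))
    ultimately show ?thesis using True by (simp add: of_row_def)
  next
    case False
    then show ?thesis using c by (auto simp: of_row_def chains_def)
  qed
qed

lemma of_row_unit:
  assumes "i < n"
  shows "of_row (unit_row i) y = (if y \<in> X then ((if y = D i then 1 else 0) + sg * (if \<iota> y = D i then 1 else 0)) /
    of_nat (weight y + weight (\<iota> y)) else 0)"
proof -
  have "push (unit_row i) y = (if y = D i then 1 else 0)" if "y \<in> X" for y
  proof -
    have "push (unit_row i) y = (\<Sum>k<n. if k = i then \<Sum>h\<in>fiber i y. coeff_fun G (lam G \<one>) h else 0)"
      unfolding push_def by (rule sum.cong) (auto simp: unit_row_def coeff_fun_simps)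
    also have "\<dots> = (\<Sum>h\<in>fiber i y. if h = \<one> then 1 else 0)" using assms by (simp add: coeff_fun_lam)
    also have "\<dots> = (if y = D i then 1 else 0)"
      using finite_fiber[OF assms that] D_mem[OF assms] by (auto simp: fiber_def psi_one)
    finally show ?thesis .
  qed
  then show ?thesis using iota_mem by (auto simp: of_row_def)
qed

text \<open>The idempotent attached to the retraction: its range is the embedded copy of the
  chains.\<close>

definition idem :: "'g ell2_op mat" where
  "idem = map_matrix n n (\<lambda>r. to_row (of_row r))"

lemma row_map_idem: "row_map n n (\<lambda>r. to_row (of_row r))"
  unfolding row_map_def
  by (auto simp: of_row_add of_row_translate to_row_add to_row_translate of_row_mem to_row intro: of_row_cong arg_cong[where f = to_row])

lemma idem_mats: "idem \<in> mats (group_ring G) n n"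
  unfolding idem_def by (rule map_matrix_mats[OF row_map_idem])

lemma idem_idem: "idem * idem = idem"
proof -
  have "idem * idem = map_matrix n n (\<lambda>r. to_row (of_row (to_row (of_row r))))"
    unfolding idem_def by (rule map_matrix_comp[OF row_map_idem row_map_idem])
  also have "\<dots> = idem"
    unfolding idem_def map_matrix_def
    by (rule cong_mat) (auto simp: of_row_to_row[OF of_row_mem] unit_row_mem)
  finally show ?thesis .
qed

definition row_mat :: "('x \<Rightarrow> complex) \<Rightarrow> 'g ell2_op mat" where
  "row_mat c = mat 1 n (\<lambda>(_, j). to_row c j)"

lemma row_mat:
  assumes "c \<in> chains"
  shows "row_mat c \<in> mats (group_ring G) 1 n" "row_mat c * idem = row_mat c" "of_row (row_fun (row_mat c) 0) = c"
proof -
  show m: "row_mat c \<in> mats (group_ring G) 1 n" using assms by (auto simp: row_mat_def mats_iff to_row)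
  have "of_row (row_fun (row_mat c) 0) = of_row (to_row c)"
    by (rule of_row_cong) (simp add: row_fun_def row_mat_def)
  then show eq: "of_row (row_fun (row_mat c) 0) = c" by (simp add: of_row_to_row[OF assms])
  show "row_mat c * idem = row_mat c"
    unfolding idem_def
  proof (rule eq_matI)
    fix i j assume "i < dim_row (row_mat c)" "j < dim_col (row_mat c)"
    then have ij: "i = 0" "j < n" by (auto simp: row_mat_def)
    then show "(row_mat c * map_matrix n n (\<lambda>r. to_row (of_row r))) $$ (i, j) = row_mat c $$ (i, j)"
      unfolding ij(1) by (subst map_matrix_mult[OF row_map_idem m]) (auto simp: eq, simp add: row_mat_def)
  qed (auto simp: row_mat_def map_matrix_def)
qed

text \<open>With \<open>row_mat\<close> this identifies the chains with the rows fixed by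
  \<open>idem\<close>, so exactness can be checked on chains.\<close>

lemma fixed_row:
  assumes x: "x \<in> mats (group_ring G) 1 n" "x * idem = x"
  shows "of_row (row_fun x 0) \<in> chains" "x = row_mat (of_row (row_fun x 0))"
proof -
  show "of_row (row_fun x 0) \<in> chains" by (rule of_row_mem) (rule row_fun_mem[OF x(1)], simp)
  show "x = row_mat (of_row (row_fun x 0))"
  proof (rule eq_matI)
    fix i j assume "i < dim_row (row_mat (of_row (row_fun x 0)))" "j < dim_col (row_mat (of_row (row_fun x 0)))"
    then have ij: "i = 0" "j < n" by (auto simp: row_mat_def)
    have "(x * idem) $$ (0, j) = to_row (of_row (row_fun x 0)) j"
      unfolding idem_def by (rule map_matrix_mult[OF row_map_idem x(1)]) (use ij in auto)
    then show "x $$ (i, j) = row_mat (of_row (row_fun x 0)) $$ (i, j)"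
      using ij by (simp add: x(2) row_mat_def)
  qed (use mats_dim[OF x(1)] in \<open>auto simp: row_mat_def\<close>)
qed

text \<open>Only elements that fix \<open>D i\<close>, up to \<open>\<iota>\<close>, contribute to a
  diagonal entry; the traces of the tree modules are read off from this formula.\<close>

lemma coeff_idem_diag:
  assumes "i < n" "h \<in> carrier G"
  shows "coeff_fun G (idem $$ (i, i)) h = ((if \<psi> h (D i) = D i then 1 else 0) + sg * (if \<iota> (\<psi> h (D i)) = D i then 1 else 0)) /
    of_nat (weight (\<psi> h (D i)) + weight (\<iota> (\<psi> h (D i))))"
  using assms to_row(2)[OF of_row_mem[where r = "unit_row i", OF unit_row_mem] assms] psi_mem[OF assms(2) D_mem[OF assms(1)]]
  by (simp add: idem_def map_matrix_def of_row_unit)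

end

section \<open>The chain complex of a tree\<close>

text \<open>A chain is antisymmetric on ordered pairs, so each edge appears in both directions and
  summing over incoming pairs alone gives end minus start.\<close>

definition boundary :: "('v \<times> 'v \<Rightarrow> complex) \<Rightarrow> 'v \<Rightarrow> complex" where
  "boundary c v = supp_sum (\<lambda>u. c (u, v))"

lemma finite_incoming: "finite {p. c p \<noteq> 0} \<Longrightarrow> finite {u. c (u, v) \<noteq> 0}"
  by (rule finite_subset[of _ "fst ` {p. c p \<noteq> 0}"]) force+

lemma boundary_eq_sum:
  assumes "finite F" "{p. c p \<noteq> 0} \<subseteq> F \<times> UNIV"
  shows "boundary c v = (\<Sum>u\<in>F. c (u, v))"
  unfolding boundary_def by (rule supp_sum_superset) (use assms in auto)

lemma boundary_add:
  assumes "finite {p. c p \<noteq> 0}" "finite {p. c' p \<noteq> 0}"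
  shows "boundary (\<lambda>p. c p + c' p) = (\<lambda>v. boundary c v + boundary c' v)"
  unfolding boundary_def by (intro ext supp_sum_add finite_incoming assms)

text \<open>The total is a double sum over ordered pairs; exchanging the two indices negates
  it.\<close>

lemma supp_sum_boundary:
  assumes fin: "finite {p. c p \<noteq> 0}" and anti: "\<And>u w. c (u, w) = - c (w, u)"
  shows "supp_sum (boundary c) = 0"
proof -
  define F where "F = fst ` {p. c p \<noteq> 0} \<union> snd ` {p. c p \<noteq> 0}"
  have F: "finite F" using fin by (simp add: F_def)
  have sub: "{p. c p \<noteq> 0} \<subseteq> F \<times> F" unfolding F_def by force
  have b: "boundary c v = (\<Sum>u\<in>F. c (u, v))" for v by (rule boundary_eq_sum[OF F]) (use sub in auto)
  have "boundary c v = 0" if "v \<notin> F" for v unfolding b using sub that by (intro sum.neutral) auto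
  then have "{v. boundary c v \<noteq> 0} \<subseteq> F" by blast
  from supp_sum_superset[OF F this] have total: "supp_sum (boundary c) = (\<Sum>v\<in>F. \<Sum>u\<in>F. c (u, v))"
    by (rule trans) (intro sum.cong refl b)
  have swap: "(\<Sum>v\<in>F. \<Sum>u\<in>F. c (u, v)) = (\<Sum>v\<in>F. \<Sum>u\<in>F. c (v, u))" by (rule sum.swap)
  have neg: "(\<Sum>v\<in>F. \<Sum>u\<in>F. c (v, u)) = - (\<Sum>v\<in>F. \<Sum>u\<in>F. c (u, v))"
    unfolding sum_negf[symmetric] by (intro sum.cong refl anti)
  show ?thesis unfolding total using trans[OF swap neg] by simp
qed

text \<open>The support of a cycle is a finite graph without leaves; the end of a longest path in it
  has a second neighbour on the path, which closes a circuit.\<close>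

lemma tree_boundary_injective:
  assumes tree: "is_tree V E" and fin: "finite {p. c p \<noteq> 0}" and anti: "\<And>u w. c (u, w) = - c (w, u)"
    and edge: "\<And>u w. c (u, w) \<noteq> 0 \<Longrightarrow> {u, w} \<in> E" and zero: "\<And>v. boundary c v = 0"
  shows "c p = 0"
proof (rule ccontr)
  assume "c p \<noteq> 0"
  define A where "A u w \<longleftrightarrow> c (u, w) \<noteq> 0" for u w
  have sym: "A u w \<Longrightarrow> A w u" for u w unfolding A_def using anti[of u w] by auto
  have irr: "A u w \<Longrightarrow> u \<noteq> w" for u w
    using edge[of u w] tree by (auto simp: A_def is_tree_def)
  \<comment> \<open>If \<open>u\<close> were the only neighbour of \<open>w\<close>, the boundary at
    \<open>w\<close> would be the single nonzero term \<open>c (u, w)\<close>.\<close>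
  have second: "\<exists>u'. u' \<noteq> u \<and> A w u'" if "A u w" for u w
  proof (rule ccontr)
    assume "\<not> (\<exists>u'. u' \<noteq> u \<and> A w u')"
    then have "{x. c (x, w) \<noteq> 0} \<subseteq> {u}" using sym by (auto simp: A_def)
    then have "boundary c w = c (u, w)" unfolding boundary_def by (subst supp_sum_superset[of "{u}"]) auto
    then show False using zero that by (simp add: A_def)
  qed
  define F where "F = fst ` {p. c p \<noteq> 0}"
  have F: "finite F" using fin by (simp add: F_def)
  have inF: "u \<in> F" if "A u w" for u w using that by (force simp: F_def A_def)
  define path where "path vs \<longleftrightarrow> distinct vs \<and> 2 \<le> length vs \<and> set vs \<subseteq> F \<and> (\<forall>i. Suc i < length vs \<longrightarrow> A (vs ! i) (vs ! Suc i))" for vs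
  obtain a b where ab: "A a b" using \<open>c p \<noteq> 0\<close> by (cases p) (auto simp: A_def)
  have "path [a, b]" using ab irr[OF ab] inF[OF ab] inF[OF sym[OF ab]] by (auto simp: path_def less_Suc_eq)
  moreover have "\<forall>vs. path vs \<longrightarrow> length vs < Suc (card F)"
    using F by (auto simp: path_def less_Suc_eq_le) (metis card_mono distinct_card)
  ultimately obtain vs where vs: "path vs" and max: "\<And>ws. path ws \<Longrightarrow> length ws \<le> length vs"
    using ex_has_greatest_nat[of path "[a, b]" length "Suc (card F)"] by blast
  have adj: "A (vs ! i) (vs ! Suc i)" if "Suc i < length vs" for i using vs that by (simp add: path_def)
  have len: "2 \<le> length vs" and dist: "distinct vs" using vs by (auto simp: path_def)
  obtain z where z: "z \<noteq> vs ! 1" "A (vs ! 0) z"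
    using second[OF sym[OF adj[of 0]]] len by auto
  show False
  proof (cases "z \<in> set vs")
    case False
    have "path (z # vs)"
      unfolding path_def using vs False z sym[OF z(2)] inF[OF sym[OF z(2)]] adj
      by (auto simp: path_def nth_Cons split: nat.splits)
    from max[OF this] show False by simp
  next
    case True
    then obtain i where i: "i < length vs" "vs ! i = z" by (auto simp: in_set_conv_nth)
    have "i \<noteq> 0" using irr[OF z(2)] i(2) by (cases i) auto
    moreover have "i \<noteq> 1" using z(1) i(2) by auto
    ultimately have i2: "2 \<le> i" by simp
    \<comment> \<open>\<open>z\<close> is neither the first vertex of the path nor its successor, so
      the segment up to \<open>z\<close> has at least three vertices, and the edge from
      \<open>z\<close> to the start closes it.\<close>
    let ?ws = "take (Suc i) vs"
    have l: "length ?ws = Suc i" using i by simp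
    have "adj_walk E ?ws"
      unfolding adj_walk_def l using adj edge i by (auto simp: A_def)
    moreover have "hd ?ws = vs ! 0" using len by (cases vs) auto
    moreover have "last ?ws = z" by (subst last_conv_nth) (use i l in auto)
    ultimately have "adj_walk E ?ws" "hd ?ws = vs ! 0" "last ?ws = z" by auto
    moreover from this have "{last ?ws, hd ?ws} \<in> E" using edge[of z "vs ! 0"] sym[OF z(2)] by (simp add: A_def)
    ultimately have "3 \<le> length ?ws \<and> distinct ?ws \<and> adj_walk E ?ws \<and> {last ?ws, hd ?ws} \<in> E"
      using i2 l dist by simp
    then show False using tree unfolding is_tree_def by blast
  qed
qed

text \<open>Finitely many vertices and edges whose translates form an invariant cocompact subgraph;
  \<open>ends\<close> makes it contain the end points of its edges. Connectedness is a separate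
  matter, proved for a particular choice later.\<close>

locale tree_orbits = group G for G :: "('g, 'm) monoid_scheme" (structure) +
  fixes V :: "'v set" and E :: "'v set set" and \<phi> :: "'g \<Rightarrow> 'v \<Rightarrow> 'v"
    and DV :: "nat \<Rightarrow> 'v" and nV :: nat and DE :: "nat \<Rightarrow> 'v \<times> 'v" and nE :: nat
  assumes action: "tree_action G V E \<phi>" and proper: "proper_action G V \<phi>"
    and DV: "i < nV \<Longrightarrow> DV i \<in> V"
    and DE: "i < nE \<Longrightarrow> {fst (DE i), snd (DE i)} \<in> E"
    and ends: "i < nE \<Longrightarrow> v \<in> {fst (DE i), snd (DE i)} \<Longrightarrow> \<exists>j<nV. \<exists>h\<in>carrier G. \<phi> h (DV j) = v"
begin

lemma tree: "is_tree V E" and edge_image: "h \<in> carrier G \<Longrightarrow> e \<in> E \<Longrightarrow> \<phi> h ` e \<in> E"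
  using action by (auto simp: tree_action_def)

sublocale act: group_action G V \<phi>
  using action by (simp add: tree_action_def)

lemma act_mem: "h \<in> carrier G \<Longrightarrow> v \<in> V \<Longrightarrow> \<phi> h v \<in> V"
  using act.element_image by blast

lemma act_one: "v \<in> V \<Longrightarrow> \<phi> \<one> v = v"
  using act.id_eq_one by (metis restrict_apply')

lemma act_mult: "h \<in> carrier G \<Longrightarrow> k \<in> carrier G \<Longrightarrow> v \<in> V \<Longrightarrow> \<phi> (h \<otimes> k) v = \<phi> h (\<phi> k v)"
  by (rule act.composition_rule)

text \<open>The set is empty or a coset of a vertex stabilizer, which properness makes
  finite.\<close>

lemma finite_transporter:
  assumes "x \<in> V"
  shows "finite {h \<in> carrier G. \<phi> h x = y}"
proof (cases "\<exists>k \<in> carrier G. \<phi> k x = y")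
  case True
  then obtain k where k: "k \<in> carrier G" "\<phi> k x = y" by blast
  have "{h \<in> carrier G. \<phi> h x = y} \<subseteq> (\<lambda>s. k \<otimes> s) ` stabilizer G \<phi> x"
  proof
    fix h assume "h \<in> {h \<in> carrier G. \<phi> h x = y}"
    then have h: "h \<in> carrier G" "\<phi> h x = y" by auto
    have "\<phi> (inv k \<otimes> h) x = \<phi> (inv k) (\<phi> k x)" using h k assms by (simp add: act_mult)
    also have "\<dots> = x" using k(1) assms by (simp add: act_one flip: act_mult)
    finally have "inv k \<otimes> h \<in> stabilizer G \<phi> x" using h k by (simp add: stabilizer_def)
    moreover have "h = k \<otimes> (inv k \<otimes> h)" using h k by (simp flip: m_assoc)
    ultimately show "h \<in> (\<lambda>s. k \<otimes> s) ` stabilizer G \<phi> x" by blast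
  qed
  then show ?thesis
    using proper assms by (meson finite_imageI finite_subset proper_action_def)
next
  case False
  then have "{h \<in> carrier G. \<phi> h x = y} = {}" by blast
  then show ?thesis by (simp only: finite.emptyI)
qed

definition X0 :: "'v set" where
  "X0 = {\<phi> h (DV i) | h i. h \<in> carrier G \<and> i < nV}"

definition pair_act :: "'g \<Rightarrow> 'v \<times> 'v \<Rightarrow> 'v \<times> 'v" where
  "pair_act h p = (\<phi> h (fst p), \<phi> h (snd p))"

definition X1 :: "('v \<times> 'v) set" where
  "X1 = {pair_act h p | h p. h \<in> carrier G \<and> (\<exists>i<nE. p = DE i \<or> p = prod.swap (DE i))}"

lemma X0_V: "X0 \<subseteq> V" using DV act_mem by (auto simp: X0_def)

lemma X0_act:
  assumes "h \<in> carrier G" "v \<in> X0"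
  shows "\<phi> h v \<in> X0"
proof -
  obtain k i where k: "k \<in> carrier G" "i < nV" "v = \<phi> k (DV i)" using assms(2) by (auto simp: X0_def)
  then have "\<phi> h v = \<phi> (h \<otimes> k) (DV i)" using assms(1) DV by (simp add: act_mult)
  then show ?thesis using assms(1) k unfolding X0_def by blast
qed

lemma DE_V: "i < nE \<Longrightarrow> fst (DE i) \<in> V \<and> snd (DE i) \<in> V"
  using DE[of i] tree unfolding is_tree_def by blast

lemma X1E:
  assumes "p \<in> X1"
  obtains h i where "h \<in> carrier G" "i < nE"
    "fst p = \<phi> h (fst (DE i)) \<and> snd p = \<phi> h (snd (DE i)) \<or> fst p = \<phi> h (snd (DE i)) \<and> snd p = \<phi> h (fst (DE i))"
proof -
  obtain h q i where "h \<in> carrier G" "i < nE" "p = pair_act h q" "q = DE i \<or> q = prod.swap (DE i)"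
    using assms unfolding X1_def by blast
  then show thesis using that[of h i] by (cases "q = DE i") (simp_all add: pair_act_def)
qed

lemma X1_V: "p \<in> X1 \<Longrightarrow> fst p \<in> V \<and> snd p \<in> V"
  by (erule X1E) (use DE_V act_mem in auto)

lemma X1_X0: "p \<in> X1 \<Longrightarrow> fst p \<in> X0 \<and> snd p \<in> X0"
proof -
  have "v \<in> X0" if "i < nE" "v \<in> {fst (DE i), snd (DE i)}" for i v
    using ends[OF that] by (auto simp: X0_def)
  then show "p \<in> X1 \<Longrightarrow> fst p \<in> X0 \<and> snd p \<in> X0" by (elim X1E) (use X0_act in auto)
qed

lemma X1_E: "(u, w) \<in> X1 \<Longrightarrow> {u, w} \<in> E"
proof -
  assume "(u, w) \<in> X1"
  then obtain h i where h: "h \<in> carrier G" "i < nE" "{u, w} = \<phi> h ` {fst (DE i), snd (DE i)}"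
    by (elim X1E) (auto simp: insert_commute)
  show ?thesis using edge_image[OF h(1) DE[OF h(2)]] by (simp only: h(3))
qed

lemma pair_act_mult: "h \<in> carrier G \<Longrightarrow> k \<in> carrier G \<Longrightarrow> fst p \<in> V \<Longrightarrow> snd p \<in> V \<Longrightarrow> pair_act (h \<otimes> k) p = pair_act h (pair_act k p)"
  by (simp add: pair_act_def act_mult)

text \<open>Vertices carry the trivial involution with sign 1. Numerator and denominator of
  \<open>of_row\<close> are then both doubled, which leaves the ordinary permutation module.\<close>

sublocale VS: signed_gset G X0 \<phi> id 1 DV nV
proof
  show "finite {h \<in> carrier G. \<phi> h x = y}" if "x \<in> X0" for x y
    using that X0_V finite_transporter by blast
  show "DV i \<in> X0" if "i < nV" for i
    using that act_one[OF DV[OF that]] unfolding X0_def by (metis (mono_tags, lifting) mem_Collect_eq one_closed)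
  show "\<exists>i<nV. \<exists>h\<in>carrier G. \<phi> h (DV i) = x \<or> \<phi> h (DV i) = id x" if "x \<in> X0" for x
    using that by (auto simp: X0_def)
qed (use X0_V X0_act in \<open>auto simp: act_one act_mult subset_iff\<close>)

sublocale ES: signed_gset G X1 pair_act prod.swap "-1" DE nE
proof
  show "pair_act h p \<in> X1" if h: "h \<in> carrier G" and "p \<in> X1" for h p
  proof -
    obtain k q i where k: "k \<in> carrier G" "i < nE" "p = pair_act k q" "q = DE i \<or> q = prod.swap (DE i)"
      using \<open>p \<in> X1\<close> by (auto simp: X1_def)
    then have "pair_act h p = pair_act (h \<otimes> k) q" using pair_act_mult[OF h k(1), of q] DE_V[of i] by auto
    then show ?thesis using h k unfolding X1_def by blast
  qed
  show "finite {h \<in> carrier G. pair_act h p = q}" if "p \<in> X1" for p q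
    by (rule finite_subset[OF _ finite_transporter[of "fst p" "fst q"]]) (use X1_V[OF that] in \<open>auto simp: pair_act_def\<close>)
  show "pair_act \<one> p = p" if "p \<in> X1" for p using X1_V[OF that] by (simp add: pair_act_def act_one)
  show D: "DE i \<in> X1" if "i < nE" for i
  proof -
    have "DE i = pair_act \<one> (DE i)" using DE_V[OF that] by (simp add: pair_act_def act_one)
    then show ?thesis using that unfolding X1_def by blast
  qed
  show "prod.swap p \<in> X1" if "p \<in> X1" for p
  proof -
    obtain k q i where k: "k \<in> carrier G" "i < nE" "p = pair_act k q" "q = DE i \<or> q = prod.swap (DE i)"
      using \<open>p \<in> X1\<close> by (auto simp: X1_def)
    then have "prod.swap p = pair_act k (prod.swap q)" "prod.swap q = DE i \<or> prod.swap q = prod.swap (DE i)"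
      by (auto simp: pair_act_def)
    then show ?thesis using k unfolding X1_def by blast
  qed
  show "\<exists>i<nE. \<exists>h\<in>carrier G. pair_act h (DE i) = p \<or> pair_act h (DE i) = prod.swap p" if "p \<in> X1" for p
  proof -
    obtain k q i where k: "k \<in> carrier G" "i < nE" "p = pair_act k q" "q = DE i \<or> q = prod.swap (DE i)"
      using \<open>p \<in> X1\<close> by (auto simp: X1_def)
    then have "pair_act k (DE i) = p \<or> pair_act k (DE i) = prod.swap p" by (auto simp: pair_act_def)
    then show ?thesis using k by blast
  qed
qed (use X1_V in \<open>auto simp: pair_act_mult, auto simp: pair_act_def\<close>)

lemma edge_chain:
  assumes "c \<in> ES.chains"
  shows "finite {p. c p \<noteq> 0}" "c (u, w) = - c (w, u)" "c (u, w) \<noteq> 0 \<Longrightarrow> {u, w} \<in> E"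
proof -
  show "finite {p. c p \<noteq> 0}" using assms by (simp add: ES.chains_def)
  show "c (u, w) = - c (w, u)"
  proof (cases "(w, u) \<in> X1")
    case True
    then have "c (prod.swap (w, u)) = -1 * c (w, u)" using assms unfolding ES.chains_def by blast
    then show ?thesis by simp
  next
    case False
    then have "(u, w) \<notin> X1" using ES.iota_mem[of "(u, w)"] by auto
    then have "c (u, w) = 0" "c (w, u) = 0" using False assms unfolding ES.chains_def by blast+
    then show ?thesis by simp
  qed
  show "c (u, w) \<noteq> 0 \<Longrightarrow> {u, w} \<in> E" using assms X1_E by (auto simp: ES.chains_def)
qed

lemma boundary_mem:
  assumes "c \<in> ES.chains"
  shows "boundary c \<in> VS.chains"
proof -
  have ex: "\<exists>u. c (u, v) \<noteq> 0" if "boundary c v \<noteq> 0" for v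
    using that by (auto simp: boundary_def supp_sum_def intro: ccontr)
  have "{v. boundary c v \<noteq> 0} \<subseteq> snd ` {p. c p \<noteq> 0}" using ex by force
  then have "finite {v. boundary c v \<noteq> 0}" using edge_chain(1)[OF assms] finite_subset by blast
  moreover have "v \<in> X0" if "boundary c v \<noteq> 0" for v
    using ex[OF that] assms X1_X0 by (fastforce simp: ES.chains_def)
  ultimately show ?thesis by (auto simp: VS.chains_def)
qed

lemma boundary_translate:
  assumes c: "c \<in> ES.chains" and s: "s \<in> carrier G"
  shows "boundary (\<lambda>p. z * ES.translate s c p) = (\<lambda>v. z * VS.translate s (boundary c) v)"
proof
  fix v
  note supp = assms(1)[unfolded ES.chains_def]
  \<comment> \<open>For \<open>z = 0\<close> the supports of the two summands differ, so reindexing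
    by \<open>s\<close> needs a nonzero \<open>z\<close>; off \<open>X0\<close> both sides
    vanish.\<close>
  show "boundary (\<lambda>p. z * ES.translate s c p) v = z * VS.translate s (boundary c) v"
  proof (cases "v \<in> X0 \<and> z \<noteq> 0")
    case True
    then have v: "v \<in> X0" "v \<in> V" and z: "z \<noteq> 0" using X0_V by auto
    have "supp_sum (\<lambda>u. z * ES.translate s c (u, v)) = (\<Sum>u | c (u, \<phi> (inv s) v) \<noteq> 0. z * c (u, \<phi> (inv s) v))"
      unfolding supp_sum_def
    proof (rule sum.reindex_bij_witness[where i = "\<phi> s" and j = "\<phi> (inv s)"])
      fix u assume "u \<in> {u. z * ES.translate s c (u, v) \<noteq> 0}"
      then have u: "(u, v) \<in> X1" "c (\<phi> (inv s) u, \<phi> (inv s) v) \<noteq> 0"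
        by (auto simp: ES.translate_def pair_act_def split: if_splits)
      then have "u \<in> V" using X1_V by force
      then show "\<phi> s (\<phi> (inv s) u) = u" using s by (simp add: act_one flip: act_mult)
      show "\<phi> (inv s) u \<in> {u. c (u, \<phi> (inv s) v) \<noteq> 0}" using u by simp
      show "z * c (\<phi> (inv s) u, \<phi> (inv s) v) = z * ES.translate s c (u, v)"
        using u by (simp add: ES.translate_def pair_act_def)
    next
      fix u assume "u \<in> {u. c (u, \<phi> (inv s) v) \<noteq> 0}"
      then have u: "c (u, \<phi> (inv s) v) \<noteq> 0" "(u, \<phi> (inv s) v) \<in> X1" using supp by auto
      then have "u \<in> V" using X1_V by force
      then show 1: "\<phi> (inv s) (\<phi> s u) = u" using s by (simp add: act_one flip: act_mult)
      have "pair_act s (u, \<phi> (inv s) v) = (\<phi> s u, v)"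
        using s v by (simp add: pair_act_def act_one flip: act_mult)
      then have "(\<phi> s u, v) \<in> X1" using ES.psi_mem[OF s u(2)] by simp
      then show "\<phi> s u \<in> {u. z * ES.translate s c (u, v) \<noteq> 0}"
        using u z 1 by (simp add: ES.translate_def pair_act_def)
    qed
    then show ?thesis
      using v by (simp add: boundary_def supp_sum_def VS.translate_def sum_distrib_left)
  next
    case False
    have "z * ES.translate s c (u, v) = 0" for u
      using False X1_X0[of "(u, v)"] by (auto simp: ES.translate_def)
    moreover have "z * VS.translate s (boundary c) v = 0" using False by (auto simp: VS.translate_def)
    ultimately show ?thesis by (simp add: boundary_def supp_sum_def)
  qed
qed

lemma supp_sum_translate:
  assumes c: "c \<in> VS.chains" and s: "s \<in> carrier G"
  shows "supp_sum (\<lambda>v. z * VS.translate s c v) = z * supp_sum c"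
proof (cases "z = 0")
  case False
  have sub: "v \<in> X0 \<and> v \<in> V" if "c v \<noteq> 0" for v using that c X0_V by (auto simp: VS.chains_def)
  have "supp_sum (\<lambda>v. z * VS.translate s c v) = (\<Sum>v | c v \<noteq> 0. z * c v)"
    unfolding supp_sum_def
    by (rule sum.reindex_bij_witness[where i = "\<phi> s" and j = "\<phi> (inv s)"])
      (use s sub False X0_act in \<open>auto simp: VS.translate_def split: if_splits\<close>)
  then show ?thesis by (simp add: supp_sum_def sum_distrib_left)
qed (simp add: supp_sum_def)

section \<open>The resolution given by the invariant subgraph\<close>

definition diff_mat :: "'g ell2_op mat" where
  "diff_mat = map_matrix nE nV (\<lambda>r. VS.to_row (boundary (ES.of_row r)))"

lemma row_map_diff: "row_map nE nV (\<lambda>r. VS.to_row (boundary (ES.of_row r)))"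
  unfolding row_map_def
proof (intro conjI allI impI)
  fix r r' :: "nat \<Rightarrow> 'g ell2_op" and j s z
  assume r: "\<forall>i. r i \<in> group_ring G" and j: "j < nV"
  note m = ES.of_row_mem[of r, OF r[rule_format]]
  show "VS.to_row (boundary (ES.of_row r)) j \<in> group_ring G" by (intro VS.to_row boundary_mem m j)
  show "VS.to_row (boundary (ES.of_row (\<lambda>i. r i + r' i))) j =
      VS.to_row (boundary (ES.of_row r)) j + VS.to_row (boundary (ES.of_row r')) j"
    if r': "\<forall>i. r' i \<in> group_ring G"
  proof -
    note m' = ES.of_row_mem[of r', OF r'[rule_format]]
    show ?thesis
      unfolding ES.of_row_add boundary_add[OF edge_chain(1)[OF m] edge_chain(1)[OF m']]
      by (intro VS.to_row_add boundary_mem m m' j)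
  qed
  show "VS.to_row (boundary (ES.of_row (\<lambda>i. scaleC_op z (lam G s) * r i))) j =
      scaleC_op z (lam G s) * VS.to_row (boundary (ES.of_row r)) j" if s: "s \<in> carrier G"
    unfolding ES.of_row_translate[OF s] boundary_translate[OF m s]
    by (intro VS.to_row_translate boundary_mem m s j)
next
  fix r r' :: "nat \<Rightarrow> 'g ell2_op"
  assume "\<forall>i<nE. r i = r' i"
  then show "VS.to_row (boundary (ES.of_row r)) = VS.to_row (boundary (ES.of_row r'))"
    using ES.of_row_cong[of r r'] by simp
qed

lemma diff_mats: "diff_mat \<in> mats (group_ring G) nE nV"
  unfolding diff_mat_def by (rule map_matrix_mats[OF row_map_diff])

lemma idem_diff: "ES.idem * diff_mat = diff_mat"
proof -
  have "ES.idem * diff_mat = map_matrix nE nV (\<lambda>r. VS.to_row (boundary (ES.of_row (ES.to_row (ES.of_row r)))))"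
    unfolding ES.idem_def diff_mat_def by (rule map_matrix_comp[OF ES.row_map_idem row_map_diff])
  also have "\<dots> = diff_mat"
    unfolding diff_mat_def map_matrix_def
    by (rule cong_mat) (auto simp: ES.of_row_to_row[OF ES.of_row_mem] unit_row_mem)
  finally show ?thesis .
qed

lemma diff_idem: "diff_mat * VS.idem = diff_mat"
proof -
  have "diff_mat * VS.idem = map_matrix nE nV (\<lambda>r. VS.to_row (VS.of_row (VS.to_row (boundary (ES.of_row r)))))"
    unfolding VS.idem_def diff_mat_def by (rule map_matrix_comp[OF row_map_diff VS.row_map_idem])
  also have "\<dots> = diff_mat"
    unfolding diff_mat_def map_matrix_def
    by (rule cong_mat) (auto simp: VS.of_row_to_row[OF boundary_mem[OF ES.of_row_mem]] unit_row_mem)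
  finally show ?thesis .
qed

lemma row_diff:
  assumes x: "x \<in> mats (group_ring G) 1 nE"
  shows "x * diff_mat = VS.row_mat (boundary (ES.of_row (row_fun x 0)))"
proof (rule eq_matI)
  fix i j assume "i < dim_row (VS.row_mat (boundary (ES.of_row (row_fun x 0))))"
    "j < dim_col (VS.row_mat (boundary (ES.of_row (row_fun x 0))))"
  then have ij: "i = 0" "j < nV" by (auto simp: VS.row_mat_def)
  have "(x * diff_mat) $$ (0, j) = VS.to_row (boundary (ES.of_row (row_fun x 0))) j"
    unfolding diff_mat_def by (rule map_matrix_mult[OF row_map_diff x]) (use ij in auto)
  then show "(x * diff_mat) $$ (i, j) = VS.row_mat (boundary (ES.of_row (row_fun x 0))) $$ (i, j)"
    using ij by (simp add: VS.row_mat_def)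
qed (use mats_dim[OF x] mats_dim[OF diff_mats] in \<open>auto simp: VS.row_mat_def\<close>)

text \<open>The degrees from 2 on are zero. The augmentation of a vertex chain is the sum of its
  values, and \<open>res_aug\<close> records this sum for the chains of the unit rows.\<close>

definition tree_res :: "'g proj_complex" where
  "tree_res = \<lparr>res_rank = (\<lambda>i. if i = 0 then nV else if i = 1 then nE else 0),
    res_idem = (\<lambda>i. if i = 0 then VS.idem else if i = 1 then ES.idem else 0\<^sub>m 0 0),
    res_diff = (\<lambda>i. if i = 0 then diff_mat else if i = 1 then 0\<^sub>m 0 nE else 0\<^sub>m 0 0),
    res_aug = (\<lambda>j. supp_sum (VS.of_row (unit_row j)))\<rparr>"

lemma tree_res_simps [simp]:
  "res_rank tree_res 0 = nV" "res_rank tree_res (Suc 0) = nE" "res_rank tree_res (Suc (Suc i)) = 0"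
  "res_idem tree_res 0 = VS.idem" "res_idem tree_res (Suc 0) = ES.idem" "res_idem tree_res (Suc (Suc i)) = 0\<^sub>m 0 0"
  "res_diff tree_res 0 = diff_mat" "res_diff tree_res (Suc 0) = 0\<^sub>m 0 nE" "res_diff tree_res (Suc (Suc i)) = 0\<^sub>m 0 0"
  by (simp_all add: tree_res_def)

text \<open>Both sides are linear when the group ring acts on the complex numbers through the
  augmentation, and on unit rows they agree by the choice of \<open>res_aug\<close>.\<close>

lemma chain_aug_tree_res:
  assumes x: "x \<in> mats (group_ring G) 1 nV"
  shows "chain_aug G tree_res x = supp_sum (VS.of_row (row_fun x 0))"
proof -
  have fin: "finite {y. c y \<noteq> 0}" if "c \<in> VS.chains" for c using that by (simp add: VS.chains_def)
  have "supp_sum (VS.of_row (row_fun x 0)) = (\<Sum>i<nV. augmentation G (row_fun x 0 i) * supp_sum (VS.of_row (unit_row i)))"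
  proof (rule group_ring_linear[where L = "\<lambda>r. supp_sum (VS.of_row r)" and act = "\<lambda>a v. augmentation G a * v"])
    fix r r' :: "nat \<Rightarrow> 'g ell2_op" and s z
    assume r: "\<And>i. r i \<in> group_ring G"
    note m = VS.of_row_mem[of r, OF r]
    show "supp_sum (VS.of_row (\<lambda>i. r i + r' i)) = supp_sum (VS.of_row r) + supp_sum (VS.of_row r')"
      if r': "\<And>i. r' i \<in> group_ring G"
      unfolding VS.of_row_add by (intro supp_sum_add fin m VS.of_row_mem[of r', OF r'])
    show "supp_sum (VS.of_row (\<lambda>i. scaleC_op z (lam G s) * r i)) =
        augmentation G (scaleC_op z (lam G s)) * supp_sum (VS.of_row r)" if s: "s \<in> carrier G"
      unfolding VS.of_row_translate[OF s] supp_sum_translate[OF m s]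
      using s by (simp add: augmentation_scaleC augmentation_lam)
  next
    fix r r' :: "nat \<Rightarrow> 'g ell2_op" assume "\<And>i. i < nV \<Longrightarrow> r i = r' i"
    then show "supp_sum (VS.of_row r) = supp_sum (VS.of_row r')" using VS.of_row_cong[of r r'] by simp
  qed (auto simp: augmentation_add distrib_right intro: row_fun_mem[OF x])
  then show ?thesis using mats_dim[OF x] by (simp add: chain_aug_def row_fun_def tree_res_def)
qed

text \<open>Exactness in degree 1 is the absence of circuits in the tree. In degree 0 a chain with
  sum 0 is a combination of differences of a vertex and \<open>v0\<close>, each a boundary by
  \<open>conn\<close>.\<close>

lemma proj_resolution_tree_res:
  assumes v0: "v0 \<in> X0"
    and conn: "\<And>v. v \<in> X0 \<Longrightarrow> \<exists>k \<in> ES.chains. boundary k = (\<lambda>x. (if x = v then 1 else 0) - (if x = v0 then 1 else 0))"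
  shows "proj_resolution G tree_res"
proof -
  have exact: "\<exists>k \<in> ES.chains. boundary k = c" if c: "c \<in> VS.chains" and sum: "supp_sum c = 0" for c
  proof -
    define S where "S = {v. c v \<noteq> 0}"
    have S: "finite S" "S \<subseteq> X0" using c by (auto simp: S_def VS.chains_def)
    define f where "f v x = ((if x = v then 1 else 0) - (if x = v0 then 1 else 0) :: complex)" for v x
    have part: "\<exists>k \<in> ES.chains. boundary k = (\<lambda>x. \<Sum>v\<in>T. c v * f v x)" if "finite T" "T \<subseteq> X0" for T
      using that
    proof (induction T)
      case empty
      have "(\<lambda>_. 0) \<in> ES.chains" by (simp add: ES.chains_def)
      then show ?case by (intro bexI[of _ "\<lambda>_. 0"]) (auto simp: boundary_def supp_sum_def)
    next
      case (insert v T)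
      then obtain k where k: "k \<in> ES.chains" "boundary k = (\<lambda>x. \<Sum>v\<in>T. c v * f v x)" by auto
      obtain l where l: "l \<in> ES.chains" "boundary l = f v" using conn insert by (auto simp: f_def[abs_def])
      have tr: "ES.translate \<one> l = l" using l(1) unfolding ES.chains_def
        by (intro ext) (auto simp: ES.translate_def ES.psi_one)
      note m = ES.chains_translate[OF l(1) one_closed, of "c v", unfolded tr]
      have "boundary (\<lambda>p. c v * l p) = (\<lambda>x. c v * f v x)"
        using boundary_translate[OF l(1) one_closed, of "c v"] boundary_mem[OF l(1)] unfolding VS.chains_def
        by (intro ext) (auto simp: tr l(2) VS.translate_def VS.psi_one)
      then show ?case
        using boundary_add[OF edge_chain(1)[OF m] edge_chain(1)[OF k(1)]] k insert ES.chains_add[OF m k(1)]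
        by (intro bexI[of _ "\<lambda>p. c v * l p + k p"]) auto
    qed
    have "(\<Sum>v\<in>S. c v * f v x) = c x" for x
    proof -
      have "(\<Sum>v\<in>S. c v * f v x) = (\<Sum>v\<in>S. if x = v then c v else 0) - (\<Sum>v\<in>S. c v) * (if x = v0 then 1 else 0)"
        unfolding f_def sum_distrib_right sum_subtractf[symmetric] by (rule sum.cong) (auto simp: algebra_simps)
      also have "(\<Sum>v\<in>S. c v) = 0" using sum by (simp add: supp_sum_def S_def)
      finally show ?thesis using S by (simp add: S_def)
    qed
    then show ?thesis using part[OF S] by simp
  qed
  have inj: "y = 0\<^sub>m 1 nE" if y: "y \<in> mats (group_ring G) 1 nE" "y * ES.idem = y" "y * diff_mat = 0\<^sub>m 1 nV" for y
  proof -
    note c = ES.fixed_row[OF y(1,2)]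
    let ?c = "ES.of_row (row_fun y 0)"
    have "VS.of_row (row_fun (y * diff_mat) 0) = boundary ?c"
      unfolding row_diff[OF y(1)] by (rule VS.row_mat(3)[OF boundary_mem[OF c(1)]])
    moreover have "VS.of_row (row_fun (0\<^sub>m 1 nV) 0) = (\<lambda>_. 0)"
      by (auto simp: VS.of_row_def VS.push_def row_fun_def coeff_fun_simps)
    ultimately have zero: "boundary ?c v = 0" for v unfolding y(3) by metis
    have "?c p = 0" for p
      by (rule tree_boundary_injective[OF tree edge_chain[OF c(1)] zero])
    then have "?c = (\<lambda>_. 0)" by blast
    then have "y = ES.row_mat (\<lambda>_. 0)" using c(2) by simp
    then show ?thesis by (auto simp: ES.row_mat_def ES.to_row_def gr_def mat_eq_iff)
  qed
  note mV = VS.idem_mats and mE = ES.idem_mats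
  have mod0: "x \<in> chain_module G tree_res 0 \<longleftrightarrow> x \<in> mats (group_ring G) 1 nV \<and> x * VS.idem = x" for x
    by (simp add: chain_module_iff)
  have mod1: "x \<in> chain_module G tree_res (Suc 0) \<longleftrightarrow> x \<in> mats (group_ring G) 1 nE \<and> x * ES.idem = x" for x
    by (simp add: chain_module_iff)
  have mod2: "chain_module G tree_res (Suc (Suc i)) = {0\<^sub>m 1 0}" for i
    by (auto simp: chain_module_iff mats_iff mat_eq_iff)
  have z: "(0\<^sub>m a b :: 'g ell2_op mat) \<in> mats (group_ring G) a b" for a b by (rule group_ring.mats_closed)
  have zz: "0\<^sub>m a b * (x :: 'g ell2_op mat) = 0\<^sub>m a (dim_col x)" if "dim_row x = b" for a b x
    by (rule mat_zero_mult(1)[OF that])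
  have deg: "res_idem tree_res i \<in> mats (group_ring G) (res_rank tree_res i) (res_rank tree_res i) \<and>
      res_idem tree_res i * res_idem tree_res i = res_idem tree_res i \<and>
      res_diff tree_res i \<in> mats (group_ring G) (res_rank tree_res (Suc i)) (res_rank tree_res i) \<and>
      res_idem tree_res (Suc i) * res_diff tree_res i = res_diff tree_res i \<and>
      res_diff tree_res i * res_idem tree_res i = res_diff tree_res i" for i
  proof -
    consider "i = 0" | "i = Suc 0" | k where "i = Suc (Suc k)" by (metis not0_implies_Suc)
    then show ?thesis
      using mV mE VS.idem_idem ES.idem_idem diff_mats idem_diff diff_idem mats_dim[OF mE]
      by cases (auto simp: z zz)
  qed
  show ?thesis
    unfolding proj_resolution_def
  proof (intro conjI allI)
    show "res_idem tree_res i \<in> carrier_mat (res_rank tree_res i) (res_rank tree_res i)"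
      "elements_mat (res_idem tree_res i) \<subseteq> group_ring G"
      "res_idem tree_res i * res_idem tree_res i = res_idem tree_res i"
      "res_diff tree_res i \<in> carrier_mat (res_rank tree_res (Suc i)) (res_rank tree_res i)"
      "elements_mat (res_diff tree_res i) \<subseteq> group_ring G"
      "res_idem tree_res (Suc i) * res_diff tree_res i = res_diff tree_res i"
      "res_diff tree_res i * res_idem tree_res i = res_diff tree_res i" for i
      using deg[of i] by (auto simp: mats_def)
    show "chain_aug G tree_res ` chain_module G tree_res 0 = UNIV"
    proof (intro equalityI subsetI UNIV_I)
      fix w :: complex
      define c where "c x = (if x = v0 then w else 0)" for x
      have c: "c \<in> VS.chains" using v0 by (auto simp: c_def VS.chains_def)
      have "supp_sum c = w" by (subst supp_sum_superset[of "{v0}"]) (auto simp: c_def)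
      then have "chain_aug G tree_res (VS.row_mat c) = w"
        unfolding chain_aug_tree_res[OF VS.row_mat(1)[OF c]] VS.row_mat(3)[OF c] .
      then show "w \<in> chain_aug G tree_res ` chain_module G tree_res 0"
        using VS.row_mat(1,2)[OF c] mod0 by (metis imageI)
    qed
    show "(\<lambda>x. x * res_diff tree_res 0) ` chain_module G tree_res 1 =
        {x \<in> chain_module G tree_res 0. chain_aug G tree_res x = 0}"
    proof (intro equalityI subsetI)
      fix x assume "x \<in> (\<lambda>x. x * res_diff tree_res 0) ` chain_module G tree_res 1"
      then obtain y where y: "y \<in> mats (group_ring G) 1 nE" "y * ES.idem = y" "x = y * diff_mat"
        using mod1 by auto
      note c = ES.fixed_row(1)[OF y(1,2)]
      note x = VS.row_mat[OF boundary_mem[OF c], folded row_diff[OF y(1)]]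
      have "chain_aug G tree_res x = 0"
        unfolding y(3) chain_aug_tree_res[OF x(1)] x(3) by (rule supp_sum_boundary[OF edge_chain(1,2)[OF c]])
      then show "x \<in> {x \<in> chain_module G tree_res 0. chain_aug G tree_res x = 0}"
        using x y(3) mod0 by auto
    next
      fix x assume "x \<in> {x \<in> chain_module G tree_res 0. chain_aug G tree_res x = 0}"
      then have x: "x \<in> mats (group_ring G) 1 nV" "x * VS.idem = x" "chain_aug G tree_res x = 0" using mod0 by auto
      note c = VS.fixed_row[OF x(1,2)]
      obtain k where k: "k \<in> ES.chains" "boundary k = VS.of_row (row_fun x 0)"
        using exact[OF c(1)] x(3) chain_aug_tree_res[OF x(1)] by auto
      note y = ES.row_mat[OF k(1)]
      have "ES.row_mat k * diff_mat = x" unfolding row_diff[OF y(1)] y(3) k(2) using c(2) by simp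
      then show "x \<in> (\<lambda>x. x * res_diff tree_res 0) ` chain_module G tree_res 1"
        using y(1,2) mod1 by (auto intro!: image_eqI[of _ _ "ES.row_mat k"])
    qed
    fix i
    show "(\<lambda>x. x * res_diff tree_res (Suc i)) ` chain_module G tree_res (Suc (Suc i)) =
      {x \<in> chain_module G tree_res (Suc i). x * res_diff tree_res i = 0\<^sub>m 1 (res_rank tree_res i)}"
    proof (cases i)
      case 0
      have "{x \<in> chain_module G tree_res (Suc 0). x * diff_mat = 0\<^sub>m 1 nV} = {0\<^sub>m 1 nE}"
        using inj mod1 z mats_dim[OF mE] mats_dim[OF diff_mats] by (auto simp: zz)
      then show ?thesis unfolding 0 mod2 by (simp add: zz)
    next
      case (Suc k)
      have "dim_row (res_diff tree_res (Suc k)) = 0" "dim_col (res_diff tree_res (Suc k)) = res_rank tree_res (Suc k)"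
        using deg[of "Suc k"] by (auto simp: mats_iff)
      then show ?thesis unfolding Suc mod2 by (auto simp: zz)
    qed
  qed
qed

text \<open>Connectedness in homological form: translating, reversing and concatenating paths become
  linear operations on chains.\<close>

definition connected_by :: "'v \<Rightarrow> 'v \<Rightarrow> bool" where
  "connected_by u w \<longleftrightarrow> (\<exists>k \<in> ES.chains. boundary k = (\<lambda>x. (if x = w then 1 else 0) - (if x = u then 1 else 0)))"

lemma connected_by_refl: "connected_by u u"
  unfolding connected_by_def by (intro bexI[of _ "\<lambda>_. 0"]) (auto simp: boundary_def supp_sum_def ES.chains_def)

lemma connected_by_trans:
  assumes "connected_by u v" "connected_by v w"
  shows "connected_by u w"
proof -
  obtain k l where "k \<in> ES.chains" "boundary k = (\<lambda>x. (if x = v then 1 else 0) - (if x = u then 1 else 0))"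
    "l \<in> ES.chains" "boundary l = (\<lambda>x. (if x = w then 1 else 0) - (if x = v then 1 else 0))"
    using assms unfolding connected_by_def by blast
  then show ?thesis
    unfolding connected_by_def
    by (intro bexI[of _ "\<lambda>p. k p + l p"]) (auto simp: boundary_add edge_chain(1) ES.chains_add)
qed

text \<open>Scaling the translated chain by \<open>-1\<close> reverses the connection; the reversed
  form is the one needed for inverses of generators.\<close>

lemma connected_by_translate:
  assumes "connected_by u w" "u \<in> X0" "w \<in> X0" "h \<in> carrier G"
  shows "connected_by (\<phi> h u) (\<phi> h w)" "connected_by (\<phi> h w) (\<phi> h u)"
proof -
  obtain k where k: "k \<in> ES.chains" "boundary k = (\<lambda>x. (if x = w then 1 else 0) - (if x = u then 1 else 0))"
    using assms unfolding connected_by_def by blast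
  have iff: "\<phi> (inv h) x = v \<longleftrightarrow> x = \<phi> h v" if "x \<in> X0" "v \<in> X0" for x v
    using that assms(4) VS.psi_inv by metis
  have "VS.translate h (boundary k) = (\<lambda>x. (if x = \<phi> h w then 1 else 0) - (if x = \<phi> h u then 1 else 0))"
    unfolding VS.translate_def k(2) using iff assms X0_act by (intro ext) auto
  note b = boundary_translate[OF k(1) assms(4), unfolded this] and m = ES.chains_translate[OF k(1) assms(4)]
  show "connected_by (\<phi> h u) (\<phi> h w)"
    unfolding connected_by_def using b[of 1] by (intro bexI[OF _ m[of 1]]) simp
  show "connected_by (\<phi> h w) (\<phi> h u)"
    unfolding connected_by_def using b[of "-1"] by (intro bexI[OF _ m[of "-1"]]) simp
qed

lemma connected_by_edge:
  assumes "(u, w) \<in> X1"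
  shows "connected_by u w"
proof -
  have "u \<noteq> w" using X1_E[OF assms] tree by (auto simp: is_tree_def)
  define k where "k p = ((if p = (u, w) then 1 else 0) - (if p = (w, u) then 1 else 0) :: complex)" for p
  have wu: "(w, u) \<in> X1" using ES.iota_mem[OF assms] by simp
  have supp: "p \<in> {(u, w), (w, u)}" if "k p \<noteq> 0" for p
    by (rule ccontr) (use that in \<open>simp add: k_def\<close>)
  then have "{p. k p \<noteq> 0} \<subseteq> {(u, w), (w, u)}" by blast
  then have "finite {p. k p \<noteq> 0}" by (rule finite_subset) simp
  moreover have "k (prod.swap p) = - k p" for p
  proof -
    have "prod.swap p = (u, w) \<longleftrightarrow> p = (w, u)" "prod.swap p = (w, u) \<longleftrightarrow> p = (u, w)" by (cases p; auto)+
    then show ?thesis unfolding k_def by simp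
  qed
  moreover have "p \<in> X1" if "k p \<noteq> 0" for p using supp[OF that] assms wu by blast
  ultimately have "k \<in> ES.chains" unfolding ES.chains_def by simp
  moreover have "boundary k x = (if x = w then 1 else 0) - (if x = u then 1 else 0)" for x
  proof -
    have "boundary k x = (\<Sum>v\<in>{u, w}. k (v, x))" by (rule boundary_eq_sum) (use supp in auto)
    then show ?thesis using \<open>u \<noteq> w\<close> by (simp add: k_def)
  qed
  ultimately show ?thesis unfolding connected_by_def by blast
qed

section \<open>Traces of the edge and vertex idempotents\<close>

lemma conj_class_carrier: "g \<in> carrier G \<Longrightarrow> conj_class G g \<subseteq> carrier G"
  by (auto simp: conj_class_def)

text \<open>If a conjugate of \<open>g\<close> preserved an edge as a set, a translate of that edge
  would be preserved by \<open>g\<close>. The hypothesis speaks of sets, so inversions are excluded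
  too, and no element of the class occurs in a diagonal entry.\<close>

lemma mat_trace_edges:
  assumes t: "\<And>a. a \<in> group_ring G \<Longrightarrow> t a = (\<Sum>h | h \<in> conj_class G g \<and> coeff_fun G a h \<noteq> 0. coeff_fun G a h)"
    and g: "g \<in> carrier G" and no_edge: "\<forall>e \<in> E. \<phi> g ` e \<noteq> e"
  shows "mat_trace t ES.idem = 0"
proof -
  have "t (ES.idem $$ (i, i)) = 0" if i: "i < nE" for i
  proof -
    have "coeff_fun G (ES.idem $$ (i, i)) h = 0" if conj: "h \<in> conj_class G g" for h
    proof -
      obtain x where x: "x \<in> carrier G" "h = x \<otimes> g \<otimes> inv x" using conj by (auto simp: conj_class_def)
      have h: "h \<in> carrier G" using x g by simp
      obtain u w where uw: "DE i = (u, w)" by (cases "DE i")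
      have V: "u \<in> V" "w \<in> V" and e: "{u, w} \<in> E" using DE_V[OF i] DE[OF i] uw by auto
      have "\<phi> h ` {u, w} \<noteq> {u, w}"
      proof
        assume stable: "\<phi> h ` {u, w} = {u, w}"
        let ?e = "\<phi> (inv x) ` {u, w}"
        have "\<phi> g (\<phi> (inv x) v) = \<phi> (inv x) (\<phi> h v)" if "v \<in> V" for v
          using that x g h by (simp flip: act_mult add: m_assoc[symmetric])
        then have "\<phi> g ` ?e = \<phi> (inv x) ` (\<phi> h ` {u, w})" using V by (auto simp: image_iff)
        then have "\<phi> g ` ?e = ?e" unfolding stable .
        moreover have "?e \<in> E" using edge_image[OF _ e] x by simp
        ultimately show False using no_edge by blast
      qed
      then have "pair_act h (DE i) \<noteq> DE i" "prod.swap (pair_act h (DE i)) \<noteq> DE i"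
        by (auto simp: uw pair_act_def)
      then show ?thesis by (simp add: ES.coeff_idem_diag[OF i h])
    qed
    then have "{h. h \<in> conj_class G g \<and> coeff_fun G (ES.idem $$ (i, i)) h \<noteq> 0} = {}" by blast
    moreover have "ES.idem $$ (i, i) \<in> group_ring G" using ES.idem_mats i by (auto simp: mats_iff)
    ultimately show ?thesis using t by simp
  qed
  then show ?thesis using mats_dim[OF ES.idem_mats] by (simp add: mat_trace_def)
qed

text \<open>For a transversal the only nonempty fiber over \<open>DV i\<close> is its stabilizer, so
  the diagonal entry averages over the stabilizer as far as the class is concerned.\<close>

lemma mat_trace_vertices:
  assumes t: "\<And>a. a \<in> group_ring G \<Longrightarrow> t a = (\<Sum>h | h \<in> conj_class G g \<and> coeff_fun G a h \<noteq> 0. coeff_fun G a h)"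
    and g: "g \<in> carrier G"
    and transversal: "\<And>i j h. i < nV \<Longrightarrow> j < nV \<Longrightarrow> h \<in> carrier G \<Longrightarrow> \<phi> h (DV i) = DV j \<Longrightarrow> i = j"
  shows "mat_trace t VS.idem = (\<Sum>i<nV. of_nat (card (conj_class G g \<inter> stabilizer G \<phi> (DV i))) / of_nat (card (stabilizer G \<phi> (DV i))))"
proof -
  have "t (VS.idem $$ (i, i)) = of_nat (card (conj_class G g \<inter> stabilizer G \<phi> (DV i))) / of_nat (card (stabilizer G \<phi> (DV i)))"
    if i: "i < nV" for i
  proof -
    have fib: "VS.fiber k (DV i) = (if k = i then stabilizer G \<phi> (DV i) else {})" if "k < nV" for k
      using transversal[OF that i] by (auto simp: VS.fiber_def stabilizer_def)
    have "VS.weight (DV i) = (\<Sum>k<nV. if k = i then card (stabilizer G \<phi> (DV i)) else 0)"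
      unfolding VS.weight_def by (rule sum.cong) (auto simp: fib)
    then have w: "VS.weight (DV i) = card (stabilizer G \<phi> (DV i))" using i by simp
    have pos: "card (stabilizer G \<phi> (DV i)) > 0"
      using VS.weight_pos[OF VS.D_mem[OF i]] by (simp add: w)
    have coeff: "coeff_fun G (VS.idem $$ (i, i)) h =
        (if h \<in> stabilizer G \<phi> (DV i) then 1 / of_nat (card (stabilizer G \<phi> (DV i))) else 0)"
      if "h \<in> conj_class G g" for h
      using VS.coeff_idem_diag[OF i, of h] conj_class_carrier[OF g] that
      by (auto simp: w stabilizer_def field_simps)
    have "VS.idem $$ (i, i) \<in> group_ring G" using VS.idem_mats i by (auto simp: mats_iff)
    then have "t (VS.idem $$ (i, i)) = (\<Sum>h | h \<in> conj_class G g \<and> coeff_fun G (VS.idem $$ (i, i)) h \<noteq> 0. coeff_fun G (VS.idem $$ (i, i)) h)"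
      by (rule t)
    also have "\<dots> = (\<Sum>h\<in>conj_class G g \<inter> stabilizer G \<phi> (DV i). 1 / of_nat (card (stabilizer G \<phi> (DV i))))"
      by (rule sum.cong) (use pos in \<open>auto simp: coeff split: if_splits\<close>)
    finally show ?thesis by simp
  qed
  then show ?thesis using mats_dim[OF VS.idem_mats] by (simp add: mat_trace_def)
qed

end

context group
begin

text \<open>The orbit of a finite set of walks that join a base point to its translates under generators
  is a cocompact part of the tree that still carries a resolution.\<close>

lemma tree_resolution_exists:
  assumes fg: "fin_generated G" and act: "tree_action G V E \<phi>" and proper: "proper_action G V \<phi>"
    and g: "g \<in> carrier G" and fixed: "\<exists>v \<in> V. \<phi> g v = v" and no_edge: "\<forall>e \<in> E. \<phi> g ` e \<noteq> e"
  obtains M r where "proj_resolution G M" "res_rank M 2 = 0" "r \<in> fin_order_rats G" "r \<noteq> 0"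
    "\<And>t. (\<And>a. a \<in> group_ring G \<Longrightarrow> t a = (\<Sum>h | h \<in> conj_class G g \<and> coeff_fun G a h \<noteq> 0. coeff_fun G a h)) \<Longrightarrow>
      mat_trace t (res_idem M 1) = 0 \<and> mat_trace t (res_idem M 0) = of_rat r"
proof -
  obtain v0 where v0: "v0 \<in> V" "\<phi> g v0 = v0" using fixed by blast
  obtain B where B: "finite B" "B \<subseteq> carrier G" "generate G B = carrier G"
    using fg by (auto simp: fin_generated_def)
  have tree: "is_tree V E" and ga: "group_action G V \<phi>" using act by (auto simp: tree_action_def)
  interpret act: group_action G V \<phi> by (rule ga)
  have mem: "\<phi> h v \<in> V" if "h \<in> carrier G" "v \<in> V" for h v using act.element_image that by blast
  have mult: "\<phi> (h \<otimes> k) v = \<phi> h (\<phi> k v)" if "h \<in> carrier G" "k \<in> carrier G" "v \<in> V" for h k v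
    by (rule act.composition_rule[OF that(3,1,2)])
  have one: "\<phi> \<one> v = v" if "v \<in> V" for v using act.id_eq_one that by (metis restrict_apply')
  define walk where "walk b vs \<longleftrightarrow> vs \<noteq> [] \<and> hd vs = v0 \<and> last vs = \<phi> b v0 \<and> adj_walk E vs" for b vs
  define ws where "ws b = (SOME vs. walk b vs)" for b
  have "\<exists>vs. walk b vs" if "b \<in> carrier G" for b
    using tree v0(1) mem[OF that v0(1)] unfolding is_tree_def walk_def by blast
  from someI_ex[OF this] have ws: "walk b (ws b)" if "b \<in> carrier G" for b using that unfolding ws_def by blast
  have ws_edge: "{ws b ! i, ws b ! Suc i} \<in> E" if "b \<in> carrier G" "Suc i < length (ws b)" for b i
    using ws[OF that(1)] that(2) by (simp add: walk_def adj_walk_def)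
  have ws0: "ws b ! 0 = v0" if "b \<in> carrier G" for b
    using ws[OF that] by (simp add: walk_def flip: hd_conv_nth)
  have ws_V: "ws b ! i \<in> V" if "b \<in> carrier G" "i < length (ws b)" for b i
  proof (cases i)
    case 0
    then show ?thesis using ws0 that v0 by simp
  next
    case (Suc j)
    then show ?thesis using ws_edge[OF that(1), of j] that(2) tree by (auto simp: is_tree_def)
  qed
  \<comment> \<open>\<open>v0\<close> is inserted so that it belongs to \<open>W\<close> even for an
    empty generating set.\<close>
  define W where "W = insert v0 (\<Union>b\<in>B. set (ws b))"
  have "w \<in> V" if "b \<in> B" "w \<in> set (ws b)" for b w
    using ws_V[of b] B(2) that by (metis in_set_conv_nth subsetD)
  then have W: "finite W" "W \<subseteq> V" using B(1) v0 by (auto simp: W_def)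
  define orb where "orb w = {\<phi> h w | h. h \<in> carrier G}" for w
  have orb_eq: "orb (\<phi> h w) = orb w" if "h \<in> carrier G" "w \<in> V" for h w
  proof (intro equalityI subsetI)
    fix x assume "x \<in> orb (\<phi> h w)"
    then obtain k where "k \<in> carrier G" "x = \<phi> k (\<phi> h w)" by (auto simp: orb_def)
    then show "x \<in> orb w" using that by (auto simp: orb_def simp flip: mult intro!: exI[of _ "k \<otimes> h"])
  next
    fix x assume "x \<in> orb w"
    then obtain k where k: "k \<in> carrier G" "x = \<phi> k w" by (auto simp: orb_def)
    have "x = \<phi> (k \<otimes> inv h) (\<phi> h w)" using k that by (simp add: m_assoc flip: mult)
    then show "x \<in> orb (\<phi> h w)" using k that by (auto simp: orb_def)
  qed
  \<comment> \<open>The choice depends on \<open>w\<close> only through its orbit, so vertices of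
    one orbit share a representative; this makes \<open>xs\<close> a transversal.\<close>
  define rep where "rep w = (SOME x. x \<in> W \<and> x \<in> orb w)" for w
  have "w \<in> orb w" if "w \<in> V" for w using one[OF that] by (auto simp: orb_def intro!: exI[of _ \<one>])
  then have "\<exists>x. x \<in> W \<and> x \<in> orb w" if "w \<in> W" for w using that W by blast
  from someI_ex[OF this] have rep: "rep w \<in> W" "rep w \<in> orb w" if "w \<in> W" for w
    using that unfolding rep_def by blast+
  have rep_orb: "orb (rep w) = orb w" if w: "w \<in> W" for w
  proof -
    obtain h where h: "h \<in> carrier G" "rep w = \<phi> h w" using rep(2)[OF w] unfolding orb_def by blast
    show ?thesis unfolding h(2) by (rule orb_eq[OF h(1)]) (use w W in blast)
  qed
  obtain xs where xs: "set xs = rep ` W" "distinct xs" using finite_distinct_list[of "rep ` W"] W by auto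
  \<comment> \<open>Several of these edges may lie in one orbit; the division by
    \<open>weight\<close> compensates for it, and the edge trace vanishes anyway.\<close>
  define P where "P = (\<Union>b\<in>B. {(ws b ! i, ws b ! Suc i) | i. Suc i < length (ws b)})"
  have "finite {(ws b ! i, ws b ! Suc i) | i. Suc i < length (ws b)}" for b
    by (rule finite_image_set) (rule finite_subset[of _ "{..<length (ws b)}"], auto)
  then have "finite P" unfolding P_def using B(1) by (intro finite_UN_I)
  then obtain ps where ps: "set ps = P" using finite_list by blast
  have W_rep: "\<exists>j<length xs. \<exists>h\<in>carrier G. \<phi> h (xs ! j) = w" if w: "w \<in> W" for w
  proof -
    have "w \<in> orb (rep w)" unfolding rep_orb[OF w] using one W w by (auto simp: orb_def intro!: exI[of _ \<one>])
    have "rep w \<in> set xs" unfolding xs(1) using w by (rule imageI)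
    then obtain j where "j < length xs" "xs ! j = rep w" by (auto simp: in_set_conv_nth)
    moreover obtain h where "h \<in> carrier G" "\<phi> h (rep w) = w"
      using \<open>w \<in> orb (rep w)\<close> unfolding orb_def by auto
    ultimately show ?thesis by metis
  qed
  have xs_W: "xs ! i \<in> W" if "i < length xs" for i
    using nth_mem[OF that] rep(1) unfolding xs(1) by auto
  have PE: "{fst p, snd p} \<in> E \<and> fst p \<in> W \<and> snd p \<in> W" if p: "p \<in> P" for p
  proof -
    obtain b i where b: "b \<in> B" "Suc i < length (ws b)" "p = (ws b ! i, ws b ! Suc i)"
      using p unfolding P_def by blast
    have "ws b ! i \<in> W" "ws b ! Suc i \<in> W"
      unfolding W_def using b(2) by (intro insertI2 UN_I[OF b(1)] nth_mem; simp)+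
    then show ?thesis using b B(2) ws_edge[of b i] by auto
  qed
  interpret T: tree_orbits G V E \<phi> "\<lambda>i. xs ! i" "length xs" "\<lambda>i. ps ! i" "length ps"
  proof
    show "xs ! i \<in> V" if "i < length xs" for i using xs_W[OF that] W by blast
    show "{fst (ps ! i), snd (ps ! i)} \<in> E" if "i < length ps" for i using PE ps that nth_mem by blast
    show "\<exists>j<length xs. \<exists>h\<in>carrier G. \<phi> h (xs ! j) = v"
      if "i < length ps" "v \<in> {fst (ps ! i), snd (ps ! i)}" for i v
      using W_rep PE ps that nth_mem by blast
  qed (fact act proper)+
  have W_X0: "W \<subseteq> T.X0"
  proof
    fix w assume "w \<in> W"
    then show "w \<in> T.X0" using W_rep[of w] unfolding T.X0_def by blast
  qed
  then have v0_X0: "v0 \<in> T.X0" by (auto simp: W_def)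
  have along: "i < length (ws b) \<Longrightarrow> T.connected_by v0 (ws b ! i)" if b: "b \<in> B" for b i
  proof (induction i)
    case 0
    then show ?case using ws0 b B T.connected_by_refl by auto
  next
    case (Suc i)
    then have "(ws b ! i, ws b ! Suc i) \<in> P" using b by (auto simp: P_def)
    then obtain j where "j < length ps" "ps ! j = (ws b ! i, ws b ! Suc i)" using ps by (metis in_set_conv_nth)
    then have "(ws b ! i, ws b ! Suc i) \<in> T.X1" using T.ES.D_mem by metis
    then show ?case using Suc T.connected_by_edge T.connected_by_trans by (meson Suc_lessD)
  qed
  \<comment> \<open>Induction over the generated subgroup: products translate one connection and
    append it to another, inverses translate and reverse.\<close>
  have gen: "T.connected_by v0 (\<phi> h v0)" if "h \<in> generate G B" for h
    using that
  proof induction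
    case one
    then show ?case using T.connected_by_refl by (simp add: T.act_one v0)
  next
    case (incl h)
    then have "walk h (ws h)" using ws B by blast
    then have "ws h ! (length (ws h) - 1) = \<phi> h v0" "length (ws h) - 1 < length (ws h)"
      by (auto simp: walk_def last_conv_nth)
    then show ?case using along[OF incl, of "length (ws h) - 1"] by simp
  next
    case (inv h)
    then have h: "h \<in> carrier G" using B by blast
    then have "walk h (ws h)" using ws by blast
    then have "ws h ! (length (ws h) - 1) = \<phi> h v0" "length (ws h) - 1 < length (ws h)"
      by (auto simp: walk_def last_conv_nth)
    then have "T.connected_by v0 (\<phi> h v0)" using along[OF inv, of "length (ws h) - 1"] by simp
    from T.connected_by_translate(2)[OF this v0_X0 T.X0_act[OF h v0_X0] inv_closed[OF h]]
    show ?case using h v0 by (simp add: one flip: mult)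
  next
    case (eng h1 h2)
    then have h: "h1 \<in> carrier G" "h2 \<in> carrier G" using B(3) by auto
    from T.connected_by_translate(1)[OF eng(4) v0_X0 T.X0_act[OF h(2) v0_X0] h(1)]
    show ?case using T.connected_by_trans[OF eng(3)] h v0 by (simp add: mult)
  qed
  \<comment> \<open>From \<open>v0\<close> the connection runs to \<open>\<phi> h v0\<close> and
    then along the translate of a connection from \<open>v0\<close> to the representative.\<close>
  have conn: "T.connected_by v0 v" if v: "v \<in> T.X0" for v
  proof -
    obtain h i where h: "h \<in> carrier G" "i < length xs" "v = \<phi> h (xs ! i)" using v by (auto simp: T.X0_def)
    note w = xs_W[OF h(2)]
    have "T.connected_by v0 (xs ! i)"
    proof (cases "xs ! i = v0")
      case False
      then obtain b where "b \<in> B" "xs ! i \<in> set (ws b)" using w by (auto simp: W_def)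
      then show ?thesis using along by (metis in_set_conv_nth)
    qed (simp add: T.connected_by_refl)
    from T.connected_by_translate(1)[OF this v0_X0 _ h(1)] have "T.connected_by (\<phi> h v0) v"
      using w W_X0 h(3) by blast
    then show ?thesis using gen[of h] h(1) B(3) T.connected_by_trans by blast
  qed
  have res: "proj_resolution G T.tree_res"
    by (rule T.proj_resolution_tree_res[OF v0_X0]) (use conn in \<open>auto simp: T.connected_by_def\<close>)
  have transversal: "i = j" if "i < length xs" "j < length xs" "h \<in> carrier G" "\<phi> h (xs ! i) = xs ! j" for i j h
  proof -
    have "xs ! i \<in> rep ` W" "xs ! j \<in> rep ` W" using that(1,2) by (simp_all flip: xs(1))
    then obtain w w' where w: "w \<in> W" "xs ! i = rep w" "w' \<in> W" "xs ! j = rep w'" by blast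
    have "orb w = orb w'"
      using orb_eq[OF that(3), of "xs ! i"] rep_orb w that(4) xs_W[OF that(1)] W by auto
    then have "xs ! i = xs ! j" by (simp add: w rep_def)
    then show ?thesis using xs(2) that nth_eq_iff_index_eq by blast
  qed
  define A where "A i = conj_class G g \<inter> stabilizer G \<phi> (xs ! i)" for i
  define r where "r = (\<Sum>i<length xs. of_nat (card (A i)) * (1 / of_nat (card (stabilizer G \<phi> (xs ! i)))) :: rat)"
  have stab: "subgroup (stabilizer G \<phi> (xs ! i)) G" "finite (stabilizer G \<phi> (xs ! i))" if "i < length xs" for i
    using act.stabilizer_subgroup proper T.DV[OF that] by (auto simp: proper_action_def)
  have "(\<Sum>i\<in>I. of_nat (card (A i)) * (1 / of_nat (card (stabilizer G \<phi> (xs ! i)))) :: rat) \<in> fin_order_rats G"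
    if "I \<subseteq> {..<length xs}" for I
    unfolding fin_order_rats_def
    using that
  proof (induction I rule: infinite_finite_induct)
    case (insert i I)
    have "1 / of_nat (card (stabilizer G \<phi> (xs ! i))) \<in> group_closure {1 / of_nat (card F) | F. subgroup F G \<and> finite F}"
      using stab[of i] insert by (intro group_closure.base) auto
    then show ?case using insert by (auto intro!: group_closure_add group_closure_scalar_mult_left simp del: times_divide_eq_right)
  qed auto
  then have r_mem: "r \<in> fin_order_rats G" unfolding r_def by blast
  \<comment> \<open>A strictly positive summand: since \<open>g\<close> fixes \<open>v0\<close>, a
    conjugate of \<open>g\<close> fixes the representative of the orbit of
    \<open>v0\<close>.\<close>
  obtain i h where i: "i < length xs" "h \<in> carrier G" "\<phi> h (xs ! i) = v0" using W_rep[of v0] by (auto simp: W_def)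
  have xiV: "xs ! i \<in> V" by (rule T.DV[OF i(1)])
  have "inv h \<otimes> g \<otimes> inv (inv h) \<in> conj_class G g" using i g unfolding conj_class_def by blast
  moreover have "\<phi> (inv h \<otimes> g \<otimes> inv (inv h)) (xs ! i) = \<phi> (inv h) (\<phi> g (\<phi> h (xs ! i)))"
    using i g xiV mem v0(1) by (simp add: mult)
  moreover have "\<dots> = \<phi> (inv h) (\<phi> h (xs ! i))" using v0 i by simp
  moreover have "\<dots> = xs ! i" using mult[of "inv h" h "xs ! i"] i(2) xiV one[OF xiV] by simp
  ultimately have "inv h \<otimes> g \<otimes> inv (inv h) \<in> A i" using i g by (simp add: A_def stabilizer_def)
  moreover have "finite (A i)" using stab[OF i(1)] by (simp add: A_def)
  moreover have "stabilizer G \<phi> (xs ! i) \<noteq> {}" using calculation(1) by (auto simp: A_def)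
  ultimately have "0 < card (A i)" "0 < card (stabilizer G \<phi> (xs ! i))" using stab(2)[OF i(1)] by (auto simp: card_gt_0_iff)
  then have "0 < r" unfolding r_def
    by (intro sum_pos2[of _ i]) (use i in \<open>auto intro!: mult_pos_pos\<close>)
  have "mat_trace t (res_idem T.tree_res 1) = 0 \<and> mat_trace t (res_idem T.tree_res 0) = of_rat r"
    if t: "\<And>a. a \<in> group_ring G \<Longrightarrow> t a = (\<Sum>h | h \<in> conj_class G g \<and> coeff_fun G a h \<noteq> 0. coeff_fun G a h)" for t
    using T.mat_trace_edges[OF t g no_edge] T.mat_trace_vertices[OF t g transversal]
    by (simp add: r_def A_def of_rat_sum of_rat_mult of_rat_divide)
  then show thesis using that[OF res _ r_mem] \<open>0 < r\<close> by (simp add: numeral_2_eq_2)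
qed

end

section \<open>Almost invariant vectors and amenability\<close>

text \<open>Compactness of the space of functions on all subsets yields a cluster point but not a
  convergent subsequence in general; properties are therefore transferred through closed
  sets.\<close>

lemma cluster_point_closed:
  fixes \<mu> :: "'b::topological_space"
  assumes "inf (nhds \<mu>) F \<noteq> bot" "closed C" "eventually (\<lambda>x. x \<in> C) F"
  shows "\<mu> \<in> C"
proof (rule ccontr)
  assume "\<mu> \<notin> C"
  then have "eventually (\<lambda>x. x \<notin> C) (nhds \<mu>)"
    using assms(2) eventually_nhds_in_open[of "- C" \<mu>] by (simp add: open_Compl)
  then have "eventually (\<lambda>x. False) (inf (nhds \<mu>) F)"
    using assms(3) unfolding eventually_inf by blast
  then show False using assms(1) by (simp add: trivial_limit_def)
qed

context group
begin

text \<open>Moves the translation from the set to the vector, where almost invariance is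
  available.\<close>

lemma ell2_mass_translate:
  assumes h: "h \<in> carrier G" and A: "A \<subseteq> carrier G"
  shows "(\<Sum>\<^sub>\<infinity>x\<in>h <# A. (cmod (ell2_fun \<eta> x))\<^sup>2) = (\<Sum>\<^sub>\<infinity>x\<in>A. (cmod (ell2_fun (op_apply (lam G (inv h)) \<eta>) x))\<^sup>2)"
proof -
  have "h <# A = (\<lambda>x. h \<otimes> x) ` A" by (auto simp: l_coset_def)
  moreover have "inj_on (\<lambda>x. h \<otimes> x) A" using h A by (auto intro!: inj_onI simp: subset_iff)
  ultimately have "(\<Sum>\<^sub>\<infinity>x\<in>h <# A. (cmod (ell2_fun \<eta> x))\<^sup>2) = (\<Sum>\<^sub>\<infinity>x\<in>A. (cmod (ell2_fun \<eta> (h \<otimes> x)))\<^sup>2)"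
    by (simp add: infsum_reindex o_def)
  also have "\<dots> = (\<Sum>\<^sub>\<infinity>x\<in>A. (cmod (ell2_fun (op_apply (lam G (inv h)) \<eta>) x))\<^sup>2)"
    by (rule infsum_cong) (use h A in \<open>auto simp: lam_apply[OF is_group]\<close>)
  finally show ?thesis .
qed

text \<open>Restriction to \<open>A\<close> is linear and contracting, and a difference of squared
  norms factors.\<close>

lemma ell2_mass_diff:
  fixes \<xi> \<eta> :: "'e ell2"
  shows "\<bar>(\<Sum>\<^sub>\<infinity>x\<in>A. (cmod (ell2_fun \<xi> x))\<^sup>2) - (\<Sum>\<^sub>\<infinity>x\<in>A. (cmod (ell2_fun \<eta> x))\<^sup>2)\<bar> \<le> norm (\<xi> - \<eta>) * (norm \<xi> + norm \<eta>)"
proof -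
  define r where "r \<zeta> = Abs_ell2 (\<lambda>x. if x \<in> A then ell2_fun \<zeta> x else 0)" for \<zeta> :: "'e ell2"
  have le: "(\<Sum>x\<in>F. (cmod (if x \<in> A then ell2_fun \<zeta> x else 0))\<^sup>2) \<le> (norm \<zeta>)\<^sup>2" if "finite F" for F and \<zeta> :: "'e ell2"
    by (rule order_trans[OF sum_mono ell2_sum_le_norm[OF that]]) auto
  have r: "ell2_fun (r \<zeta>) = (\<lambda>x. if x \<in> A then ell2_fun \<zeta> x else 0)" "norm (r \<zeta>) \<le> norm \<zeta>" for \<zeta>
    unfolding r_def by (rule Abs_ell2_props[OF le]; simp)+
  have mass: "(\<Sum>\<^sub>\<infinity>x\<in>A. (cmod (ell2_fun \<zeta> x))\<^sup>2) = (norm (r \<zeta>))\<^sup>2" for \<zeta>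
    unfolding norm_ell2_sq r by (rule infsum_cong_neutral) auto
  have diff: "r \<xi> - r \<eta> = r (\<xi> - \<eta>)" by (rule ell2_eqI) (simp add: r)
  have "\<bar>(norm (r \<xi>))\<^sup>2 - (norm (r \<eta>))\<^sup>2\<bar> = \<bar>norm (r \<xi>) - norm (r \<eta>)\<bar> * (norm (r \<xi>) + norm (r \<eta>))"
  proof -
    have "(norm (r \<xi>))\<^sup>2 - (norm (r \<eta>))\<^sup>2 = (norm (r \<xi>) - norm (r \<eta>)) * (norm (r \<xi>) + norm (r \<eta>))"
      by (simp add: power2_eq_square algebra_simps)
    then show ?thesis by (simp only: abs_mult) simp
  qed
  also have "\<dots> \<le> norm (r \<xi> - r \<eta>) * (norm \<xi> + norm \<eta>)"
    by (intro mult_mono norm_triangle_ineq3 add_mono r) auto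
  also have "\<dots> \<le> norm (\<xi> - \<eta>) * (norm \<xi> + norm \<eta>)"
    unfolding diff by (intro mult_right_mono r) auto
  finally show ?thesis by (simp add: mass)
qed

text \<open>A cluster point, in the compact space of functions from sets to \<open>[0, 1]\<close>, of the measures with
  densities \<open>|\<eta> k|\<^sup>2\<close> is an invariant mean.\<close>

lemma amenable_if_almost_invariant:
  fixes \<eta> :: "nat \<Rightarrow> 'a ell2"
  assumes norm: "\<And>k. norm (\<eta> k) = 1" and supp: "\<And>k x. x \<notin> carrier G \<Longrightarrow> ell2_fun (\<eta> k) x = 0"
    and inv: "\<And>h. h \<in> carrier G \<Longrightarrow> (\<lambda>k. norm (op_apply (lam G h) (\<eta> k) - \<eta> k)) \<longlonglongrightarrow> 0"
  shows "amenable G"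
proof -
  define m where "m k A = (\<Sum>\<^sub>\<infinity>x\<in>A. (cmod (ell2_fun (\<eta> k) x))\<^sup>2)" for k A
  have summ: "(\<lambda>x. (cmod (ell2_fun (\<eta> k) x))\<^sup>2) summable_on A" for k A
    by (rule summable_on_subset_banach[OF ell2_summable subset_UNIV])
  have m_nonneg: "0 \<le> m k A" for k A unfolding m_def by (rule infsum_nonneg) simp
  have m_total: "m k (carrier G) = 1" for k
  proof -
    have "m k (carrier G) = (norm (\<eta> k))\<^sup>2"
      unfolding m_def norm_ell2_sq by (rule infsum_cong_neutral) (auto simp: supp)
    then show ?thesis by (simp add: norm)
  qed
  have m_le: "m k A \<le> 1" for k A
  proof -
    have "m k A \<le> (\<Sum>\<^sub>\<infinity>x. (cmod (ell2_fun (\<eta> k) x))\<^sup>2)"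
      unfolding m_def by (rule infsum_mono_neutral) (auto intro: summ)
    then show ?thesis using norm_ell2_sq[of "\<eta> k"] by (simp add: norm)
  qed
  have m_add: "m k (A \<union> B) = m k A + m k B" if "A \<inter> B = {}" for k A B
    unfolding m_def by (rule infsum_Un_disjoint[OF summ summ that])
  have "compactin (product_topology (\<lambda>_. euclidean) UNIV) (PiE UNIV (\<lambda>_ :: 'a set. {0..1::real}))"
    by (subst compactin_PiE) auto
  then have comp: "compact (PiE UNIV (\<lambda>_ :: 'a set. {0..1::real}))"
    by (simp add: euclidean_product_topology)
  have "eventually (\<lambda>f. f \<in> PiE UNIV (\<lambda>_ :: 'a set. {0..1::real})) (filtermap m sequentially)"
    unfolding eventually_filtermap using m_nonneg m_le by (intro always_eventually) auto
  then obtain \<mu> where \<mu>: "inf (nhds \<mu>) (filtermap m sequentially) \<noteq> bot"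
    using comp unfolding compact_filter by (metis filtermap_bot_iff trivial_limit_sequentially)
  note cluster = cluster_point_closed[OF \<mu>]
  have cont: "continuous_on UNIV (\<lambda>f :: 'a set \<Rightarrow> real. f A)" for A by simp
  have "0 \<le> \<mu> A" for A
    using cluster[of "{f. 0 \<le> f A}"] m_nonneg
    by (simp add: closed_Collect_le[OF continuous_on_const cont] eventually_filtermap)
  moreover have "\<mu> (carrier G) = 1"
    using cluster[of "{f. f (carrier G) = 1}"] m_total
    by (simp add: closed_Collect_eq[OF cont continuous_on_const] eventually_filtermap)
  moreover have "\<mu> (A \<union> B) = \<mu> A + \<mu> B" if "A \<inter> B = {}" for A B
    using cluster[of "{f. f (A \<union> B) = f A + f B}"] m_add[OF that]
    by (simp add: closed_Collect_eq[OF cont continuous_on_add[OF cont cont]] eventually_filtermap)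
  \<comment> \<open>Invariance holds along the sequence only approximately, so it is not itself a
    closed condition to transfer; instead a gap larger than \<open>e\<close> contradicts the closed
    condition with bound \<open>e\<close>.\<close>
  moreover have "\<mu> (h <# A) = \<mu> A" if h: "h \<in> carrier G" and A: "A \<subseteq> carrier G" for h A
  proof (rule ccontr)
    assume "\<mu> (h <# A) \<noteq> \<mu> A"
    then obtain e where e: "0 < e" "e < \<bar>\<mu> (h <# A) - \<mu> A\<bar>" by (meson dense right_minus_eq zero_less_abs_iff)
    have "\<forall>\<^sub>F k in sequentially. norm (op_apply (lam G (inv h)) (\<eta> k) - \<eta> k) < e / 3"
      using inv[of "inv h"] h e(1) by (auto dest!: order_tendstoD(2)[where a = "e / 3"])
    then have "\<forall>\<^sub>F k in sequentially. \<bar>m k (h <# A) - m k A\<bar> \<le> e"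
    proof eventually_elim
      case (elim k)
      let ?\<xi> = "op_apply (lam G (inv h)) (\<eta> k)"
      have "norm ?\<xi> \<le> 1"
      proof (rule power2_le_imp_le)
        have "(norm ?\<xi>)\<^sup>2 = (\<Sum>\<^sub>\<infinity>x\<in>carrier G. (cmod (ell2_fun ?\<xi> x))\<^sup>2)"
          unfolding norm_ell2_sq by (rule infsum_cong_neutral) (use h in \<open>auto simp: lam_apply[OF is_group]\<close>)
        also have "\<dots> = m k (h <# carrier G)" unfolding m_def using ell2_mass_translate[OF h, of "carrier G" "\<eta> k"] by simp
        finally show "(norm ?\<xi>)\<^sup>2 \<le> 1\<^sup>2" using m_le by simp
      qed simp
      then have "norm (?\<xi> - \<eta> k) * (norm ?\<xi> + norm (\<eta> k)) \<le> e / 3 * 2"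
        using elim norm e(1) by (intro mult_mono) auto
      moreover have "\<bar>m k (h <# A) - m k A\<bar> \<le> norm (?\<xi> - \<eta> k) * (norm ?\<xi> + norm (\<eta> k))"
        unfolding m_def ell2_mass_translate[OF h A] by (rule ell2_mass_diff)
      ultimately show ?case using e(1) by linarith
    qed
    moreover have "closed {f :: 'a set \<Rightarrow> real. \<bar>f (h <# A) - f A\<bar> \<le> e}"
      by (intro closed_Collect_le continuous_on_const continuous_on_rabs continuous_on_diff cont)
    ultimately have "\<bar>\<mu> (h <# A) - \<mu> A\<bar> \<le> e"
      using cluster[of "{f. \<bar>f (h <# A) - f A\<bar> \<le> e}"] by (simp add: eventually_filtermap)
    then show False using e(2) by simp
  qed
  ultimately show ?thesis unfolding amenable_def by (intro exI[of _ \<mu>]) simp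
qed

section \<open>The lower bound for the first codifferential\<close>

lemma mat_row_apply:
  assumes "r < dim_row x"
  shows "vec_index (mat_apply (mat_row x r) \<xi>) 0 = vec_index (mat_apply x \<xi>) r"
  using assms by (simp add: mat_apply_index)

lemma norm_mat_apply_row_le:
  fixes y :: "'e ell2_op mat"
  assumes "y \<in> mats A 1 n"
  obtains K where "0 \<le> K" "\<And>\<xi>. \<xi> \<in> carrier_vec n \<Longrightarrow> (norm (vec_index (mat_apply y \<xi>) 0))\<^sup>2 \<le> K * sqnorm_vec \<xi>"
proof -
  obtain K where K: "0 \<le> K" "\<And>\<xi>. \<xi> \<in> carrier_vec (dim_col y) \<Longrightarrow> sqnorm_vec (mat_apply y \<xi>) \<le> K * sqnorm_vec \<xi>"
    using mat_apply_bounded[of y] by blast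
  show thesis
  proof (rule that[OF K(1)])
    fix \<xi> :: "'e ell2 vec" assume "\<xi> \<in> carrier_vec n"
    then show "(norm (vec_index (mat_apply y \<xi>) 0))\<^sup>2 \<le> K * sqnorm_vec \<xi>"
      using K(2)[of \<xi>] sqnorm_vec_index_le[of 0 "mat_apply y \<xi>"] mats_dim[OF assms] by simp
  qed
qed

text \<open>If \<open>\<parallel>d \<xi>\<parallel>\<close> were small compared with \<open>\<parallel>\<xi>\<parallel>\<close>, then \<open>\<xi>\<close>, viewed as a homomorphism, would almost
  vanish on the kernel of the augmentation; its value at a chain of augmentation \<open>1\<close> would be
  almost invariant and would almost determine \<open>\<xi>\<close>.\<close>

lemma codiff_bounded_below:
  assumes N: "proj_resolution G N" and na: "\<not> amenable G"
  obtains c where "0 < c" "\<And>\<xi>. \<xi> \<in> carrier_vec (res_rank N 0) \<Longrightarrow> mat_apply (res_idem N 0) \<xi> = \<xi> \<Longrightarrow>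
    c * sqnorm_vec \<xi> \<le> sqnorm_vec (mat_apply (res_diff N 0) \<xi>)"
proof (rule ccontr)
  assume no: "\<not> thesis"
  define n q d where "n = res_rank N 0" and "q = res_idem N 0" and "d = res_diff N 0"
  have q: "q \<in> mats (group_ring G) n n" "q * q = q" and d: "d \<in> mats (group_ring G) (res_rank N 1) n"
    using resolution_mats[OF N, of 0] by (auto simp: q_def n_def d_def)
  note [simp] = mats_dim[OF q(1)] mats_dim[OF d]
  have "\<exists>\<xi>. \<xi> \<in> carrier_vec n \<and> mat_apply q \<xi> = \<xi> \<and> sqnorm_vec (mat_apply d \<xi>) < inverse (real (Suc k)) * sqnorm_vec \<xi>" for k
  proof (rule ccontr)
    assume "\<not> ?thesis"
    then have "thesis"
      by (intro that[of "inverse (real (Suc k))"]) (auto simp: q_def n_def d_def not_less)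
    then show False using no by blast
  qed
  then obtain \<xi> where \<xi>: "\<xi> k \<in> carrier_vec n" "mat_apply q (\<xi> k) = \<xi> k"
    "sqnorm_vec (mat_apply d (\<xi> k)) < inverse (real (Suc k)) * sqnorm_vec (\<xi> k)" for k by metis
  have \<xi>_dim [simp]: "dim_vec (\<xi> k) = n" for k using \<xi>(1)[of k] by simp
  have pos: "0 < sqnorm_vec (\<xi> k)" for k
  proof -
    have "sqnorm_vec (\<xi> k) \<noteq> 0"
    proof
      assume "sqnorm_vec (\<xi> k) = 0"
      then have "sqnorm_vec (mat_apply d (\<xi> k)) < 0" using \<xi>(3)[of k] by simp
      then show False using sqnorm_vec_nonneg[of "mat_apply d (\<xi> k)"] by linarith
    qed
    then show ?thesis using sqnorm_vec_nonneg[of "\<xi> k"] by linarith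
  qed
  obtain x0 where x0: "x0 \<in> chain_module G N 0" "chain_aug G N x0 = 1" using resolution_exact(5)[OF N] by blast
  have x0m: "x0 \<in> mats (group_ring G) 1 n" "x0 * q = x0" using x0(1) by (auto simp: chain_module_iff n_def q_def)
  note [simp] = mats_dim[OF x0m(1)]
  define \<eta> where "\<eta> k = vec_index (mat_apply x0 (\<xi> k)) 0" for k
  have small: "(\<lambda>k. norm (vec_index (mat_apply x (\<xi> k)) 0 ) ^ 2 / sqnorm_vec (\<xi> k)) \<longlonglongrightarrow> 0"
    if x: "x \<in> chain_module G N 0" "chain_aug G N x = 0" for x
  proof -
    obtain y where y: "y \<in> chain_module G N 1" "y * d = x"
      using resolution_exact(1)[OF N x] by (auto simp: d_def)
    have ym: "y \<in> mats (group_ring G) 1 (res_rank N 1)" using y(1) by (simp add: chain_module_iff)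
    obtain K where K: "0 \<le> K" "\<And>\<xi>. \<xi> \<in> carrier_vec (res_rank N 1) \<Longrightarrow> (norm (vec_index (mat_apply y \<xi>) 0))\<^sup>2 \<le> K * sqnorm_vec \<xi>"
      using norm_mat_apply_row_le[OF ym] by blast
    have "norm (vec_index (mat_apply x (\<xi> k)) 0) ^ 2 / sqnorm_vec (\<xi> k) \<le> K * inverse (real (Suc k))" for k
    proof -
      have "mat_apply x (\<xi> k) = mat_apply y (mat_apply d (\<xi> k))"
        unfolding y(2)[symmetric] by (rule mat_apply_mult) (use mats_dim[OF ym] in simp)
      then have "norm (vec_index (mat_apply x (\<xi> k)) 0) ^ 2 \<le> K * sqnorm_vec (mat_apply d (\<xi> k))"
        using K(2)[of "mat_apply d (\<xi> k)"] by (simp add: carrier_vecI)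
      also have "\<dots> \<le> K * (inverse (real (Suc k)) * sqnorm_vec (\<xi> k))"
        using K(1) \<xi>(3)[of k] by (intro mult_left_mono) auto
      finally show ?thesis using pos[of k] by (simp add: divide_le_eq mult.assoc)
    qed
    note upper = this
    have lim: "(\<lambda>k. K * inverse (real (Suc k))) \<longlonglongrightarrow> 0"
      using tendsto_mult_right_zero[OF LIMSEQ_inverse_real_of_nat] .
    have lower: "0 \<le> norm (vec_index (mat_apply x (\<xi> k)) 0) ^ 2 / sqnorm_vec (\<xi> k)" for k
      by (intro divide_nonneg_nonneg) auto
    show ?thesis
      by (rule tendsto_sandwich[OF always_eventually always_eventually tendsto_const lim])
        (use upper lower in blast)+
  qed
  have unit_app: "op_apply (lam G \<one>) (\<eta> k) = \<eta> k" for k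
    using mats_Cred_unit(1)[OF mats_group_ring_Cred[OF x0m(1)], of "\<xi> k"] mat_apply_U_index[of 0 1 "mat_apply x0 (\<xi> k)"]
    by (simp add: \<eta>_def)
  have scaled: "mat 1 1 (\<lambda>_. a) * x0 \<in> chain_module G N 0"
    "chain_aug G N (mat 1 1 (\<lambda>_. a) * x0) = augmentation G a"
    "vec_index (mat_apply (mat 1 1 (\<lambda>_. a) * x0) (\<xi> k)) 0 = op_apply a (\<eta> k)" if a: "a \<in> group_ring G" for a k
  proof -
    have am: "mat 1 1 (\<lambda>_. a) \<in> mats (group_ring G) 1 1" using a by (simp add: mats_iff)
    have "mat 1 1 (\<lambda>_. a) * x0 * q = mat 1 1 (\<lambda>_. a) * x0" by (simp add: mat_mult_assoc x0m(2))
    then show "mat 1 1 (\<lambda>_. a) * x0 \<in> chain_module G N 0"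
      using group_ring.mats_closed(1)[OF am x0m(1)] by (simp add: chain_module_iff n_def q_def)
    have row0: "mat_row y 0 = y" if "dim_row y = 1" for y :: "'a ell2_op mat" using that by (auto simp: mat_eq_iff)
    have r: "mat_row (mat 1 1 (\<lambda>_. a) * x0) 0 = mat 1 1 (\<lambda>_. a) * x0" "mat_row x0 0 = x0"
      by (rule row0, simp)+
    have "chain_aug G N (mat_row (mat 1 1 (\<lambda>_. a) * x0) 0) =
        (\<Sum>j<1. augmentation G (mat 1 1 (\<lambda>_. a) $$ (0, j)) * chain_aug G N (mat_row x0 j))"
      by (rule chain_aug_row_mult[OF am x0m(1)[unfolded n_def]]) simp
    also have "\<dots> = augmentation G a * chain_aug G N (mat_row x0 0)" by simp
    finally show "chain_aug G N (mat 1 1 (\<lambda>_. a) * x0) = augmentation G a"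
      by (simp only: r x0(2) mult_1_right)
    show "vec_index (mat_apply (mat 1 1 (\<lambda>_. a) * x0) (\<xi> k)) 0 = op_apply a (\<eta> k)"
      by (subst mat_apply_mult) (simp, subst mat_apply_index, simp_all add: \<eta>_def)
  qed
  have near_inv: "(\<lambda>k. (norm (op_apply (lam G h) (\<eta> k) - \<eta> k))\<^sup>2 / sqnorm_vec (\<xi> k)) \<longlonglongrightarrow> 0" if h: "h \<in> carrier G" for h
  proof -
    have a: "lam G h - lam G \<one> \<in> group_ring G"
      using group_ring_lam[OF h, of 1] by (simp add: scaleC_op_simps group_ring.minus_mem group_ring.unit_mem)
    have "augmentation G (lam G h - lam G \<one>) = 0"
      using group_ring_lam[OF h, of 1] h
      by (simp add: scaleC_op_simps augmentation_minus group_ring.unit_mem augmentation_lam)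
    then show ?thesis using small[OF scaled(1)[OF a]] scaled(2,3)[OF a] by (simp add: unit_app)
  qed
  define \<alpha> where "\<alpha> j = chain_aug G N (mat_row q j)" for j
  \<comment> \<open>Subtracting \<open>\<alpha> j\<close> times \<open>x0\<close> from the
    \<open>j\<close>-th row of \<open>q\<close> leaves augmentation 0. As \<open>q\<close> fixes
    \<open>\<xi> k\<close>, this compares the \<open>j\<close>-th entry of \<open>\<xi> k\<close>
    with \<open>\<alpha> j\<close> times \<open>\<eta> k\<close>.\<close>
  define z where "z j = mat_row q j - mat 1 1 (\<lambda>_. scaleC_op (\<alpha> j) (lam G \<one>)) * x0" for j
  have z: "(\<lambda>k. (norm (vec_index (\<xi> k) j - scaleC_ell2 (\<alpha> j) (\<eta> k)))\<^sup>2 / sqnorm_vec (\<xi> k)) \<longlonglongrightarrow> 0" if j: "j < n" for j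
  proof -
    have a: "scaleC_op (\<alpha> j) (lam G \<one>) \<in> group_ring G" by (rule group_ring_lam) simp
    have rowm: "mat_row q j \<in> chain_module G N 0"
      by (rule row_chain_module[of q n]) (use q j in \<open>auto simp: q_def n_def\<close>)
    note m = rowm[unfolded chain_module_iff, folded n_def q_def] scaled(1)[OF a, unfolded chain_module_iff, folded n_def q_def]
    have zm: "z j \<in> chain_module G N 0"
      unfolding z_def chain_module_iff n_def[symmetric] q_def[symmetric]
      using m by (simp add: group_ring.mats_closed(3) mat_distrib)
    have row0: "mat_row y 0 = y" if "dim_row y = 1" for y :: "'a ell2_op mat" using that by (auto simp: mat_eq_iff)
    have "chain_aug G N (z j) = chain_aug G N (mat_row q j) - chain_aug G N (mat 1 1 (\<lambda>_. scaleC_op (\<alpha> j) (lam G \<one>)) * x0)"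
    proof -
      have "chain_aug G N (mat_row (z j) 0) = chain_aug G N (mat_row (mat_row q j) 0) -
          chain_aug G N (mat_row (mat 1 1 (\<lambda>_. scaleC_op (\<alpha> j) (lam G \<one>)) * x0) 0)"
        unfolding z_def
        by (rule chain_aug_row_diff[OF m(1)[THEN conjunct1, unfolded n_def] m(2)[THEN conjunct1, unfolded n_def]]) simp
      moreover have "mat_row (z j) 0 = z j" "mat_row (mat_row q j) 0 = mat_row q j"
        "mat_row (mat 1 1 (\<lambda>_. scaleC_op (\<alpha> j) (lam G \<one>)) * x0) 0 = mat 1 1 (\<lambda>_. scaleC_op (\<alpha> j) (lam G \<one>)) * x0"
        by (rule row0, simp add: z_def)+
      ultimately show ?thesis by (simp only:)
    qed
    also have "\<dots> = 0" unfolding scaled(2)[OF a] by (simp add: augmentation_scaleC augmentation_lam \<alpha>_def)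
    finally have aug: "chain_aug G N (z j) = 0" .
    have "vec_index (mat_apply (z j) (\<xi> k)) 0 = vec_index (\<xi> k) j - scaleC_ell2 (\<alpha> j) (\<eta> k)" for k
    proof -
      have "mat_apply (z j) (\<xi> k) = mat_apply (mat_row q j) (\<xi> k) - mat_apply (mat 1 1 (\<lambda>_. scaleC_op (\<alpha> j) (lam G \<one>)) * x0) (\<xi> k)"
        unfolding z_def by (rule mat_apply_simps(2)) simp_all
      then show ?thesis
        using scaled(3)[OF a, of k] mat_row_apply[of j q "\<xi> k"] j \<xi>(2)[of k] by (simp add: unit_app)
    qed
    then show ?thesis using small[OF zm aug] by simp
  qed
  define C where "C = (\<Sum>j<n. (cmod (\<alpha> j))\<^sup>2)"
  define err where "err k = (\<Sum>j<n. (norm (vec_index (\<xi> k) j - scaleC_ell2 (\<alpha> j) (\<eta> k)))\<^sup>2 / sqnorm_vec (\<xi> k))" for k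
  have "err \<longlonglongrightarrow> 0" unfolding err_def[abs_def] using tendsto_sum[of "{..<n}"] z by (fastforce intro: tendsto_null_sum)
  then have "\<forall>\<^sub>F k in sequentially. err k < 1 / 4" by (rule order_tendstoD(2)) simp
  then obtain k0 where k0: "\<And>k. k \<ge> k0 \<Longrightarrow> err k < 1 / 4" by (auto simp: eventually_sequentially)
  have C: "0 \<le> C" by (simp add: C_def sum_nonneg)
  \<comment> \<open>With \<open>err k\<close> below 1/4 the error absorbs half of
    \<open>sqnorm_vec (\<xi> k)\<close>, which gives the factor 4; \<open>C + 1\<close> keeps the
    quotient defined when \<open>C\<close> is 0.\<close>
  have low: "1 / (4 * (C + 1)) \<le> (norm (\<eta> k))\<^sup>2 / sqnorm_vec (\<xi> k)" if "k \<ge> k0" for k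
  proof -
    have sq: "(norm x)\<^sup>2 \<le> 2 * (norm (x - y))\<^sup>2 + 2 * (norm y)\<^sup>2" for x y :: "'a ell2"
    proof -
      have "(norm x)\<^sup>2 \<le> (norm (x - y) + norm y)\<^sup>2"
        using norm_triangle_ineq[of "x - y" y] by (intro power_mono) auto
      also have "\<dots> \<le> 2 * (norm (x - y))\<^sup>2 + 2 * (norm y)\<^sup>2"
        using zero_le_power2[of "norm (x - y) - norm y"] by (simp add: power2_sum power2_diff)
      finally show ?thesis .
    qed
    have "sqnorm_vec (\<xi> k) \<le> (\<Sum>j<n. 2 * (norm (vec_index (\<xi> k) j - scaleC_ell2 (\<alpha> j) (\<eta> k)))\<^sup>2
        + 2 * ((cmod (\<alpha> j))\<^sup>2 * (norm (\<eta> k))\<^sup>2))"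
      unfolding sqnorm_vec_def \<xi>_dim
      using sq[of "vec_index (\<xi> k) _" "scaleC_ell2 (\<alpha> _) (\<eta> k)"]
      by (intro sum_mono) (simp add: norm_scaleC_ell2 power_mult_distrib)
    also have "\<dots> = 2 * (err k * sqnorm_vec (\<xi> k)) + 2 * (C * (norm (\<eta> k))\<^sup>2)"
      using pos[of k] by (simp add: err_def C_def sum.distrib sum_distrib_left sum_distrib_right)
    finally have "sqnorm_vec (\<xi> k) \<le> 2 * (err k * sqnorm_vec (\<xi> k)) + 2 * (C * (norm (\<eta> k))\<^sup>2)" .
    moreover have "err k * sqnorm_vec (\<xi> k) \<le> 1 / 4 * sqnorm_vec (\<xi> k)"
      using k0[OF that] pos[of k] by (intro mult_right_mono) auto
    moreover have "C * (norm (\<eta> k))\<^sup>2 \<le> (C + 1) * (norm (\<eta> k))\<^sup>2" by (intro mult_right_mono) auto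
    ultimately have "sqnorm_vec (\<xi> k) \<le> 4 * (C + 1) * (norm (\<eta> k))\<^sup>2" by linarith
    then show ?thesis using pos[of k] C by (simp add: field_simps)
  qed
  have \<eta>_pos: "norm (\<eta> k) > 0" if "k \<ge> k0" for k
  proof (rule ccontr)
    assume "\<not> 0 < norm (\<eta> k)"
    then have "1 / (4 * (C + 1)) \<le> 0" using low[OF that] by simp
    moreover have "0 < 1 / (4 * (C + 1))" using C by simp
    ultimately show False by linarith
  qed
  define \<zeta> where "\<zeta> k = (1 / norm (\<eta> (k + k0))) *\<^sub>R \<eta> (k + k0)" for k
  have "amenable G"
  proof (rule amenable_if_almost_invariant)
    show "norm (\<zeta> k) = 1" for k using \<eta>_pos[of "k + k0"] by (simp add: \<zeta>_def)
    show "ell2_fun (\<zeta> k) x = 0" if "x \<notin> carrier G" for k x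
      using lam_one_apply[of "\<eta> (k + k0)" x] that by (simp add: \<zeta>_def unit_app)
    fix h assume h: "h \<in> carrier G"
    have "(\<lambda>k. (norm (op_apply (lam G h) (\<zeta> k) - \<zeta> k))\<^sup>2) \<longlonglongrightarrow> 0"
    proof (rule tendsto_sandwich[OF _ _ tendsto_const])
      let ?e = "\<lambda>k. (norm (op_apply (lam G h) (\<eta> k) - \<eta> k))\<^sup>2 / sqnorm_vec (\<xi> k)"
      have "(norm (op_apply (lam G h) (\<zeta> k) - \<zeta> k))\<^sup>2 \<le> ?e (k + k0) * (4 * (C + 1))" for k
      proof -
        let ?k = "k + k0"
        have "op_apply (lam G h) (\<zeta> k) - \<zeta> k = (1 / norm (\<eta> ?k)) *\<^sub>R (op_apply (lam G h) (\<eta> ?k) - \<eta> ?k)"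
          by (simp add: \<zeta>_def scaleR_diff_right)
        then have "(norm (op_apply (lam G h) (\<zeta> k) - \<zeta> k))\<^sup>2 = (norm (op_apply (lam G h) (\<eta> ?k) - \<eta> ?k))\<^sup>2 / (norm (\<eta> ?k))\<^sup>2"
          by (simp add: power_divide)
        also have "\<dots> = ?e ?k * (sqnorm_vec (\<xi> ?k) / (norm (\<eta> ?k))\<^sup>2)" using pos[of ?k] by simp
        also have "\<dots> \<le> ?e ?k * (4 * (C + 1))"
          using low[of ?k] \<eta>_pos[of ?k] pos[of ?k] C by (intro mult_left_mono) (auto simp: field_simps)
        finally show ?thesis .
      qed
      then show "\<forall>\<^sub>F k in sequentially. (norm (op_apply (lam G h) (\<zeta> k) - \<zeta> k))\<^sup>2 \<le> ?e (k + k0) * (4 * (C + 1))"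
        by simp
      show "(\<lambda>k. ?e (k + k0) * (4 * (C + 1))) \<longlonglongrightarrow> 0"
        using tendsto_mult_left_zero[OF LIMSEQ_ignore_initial_segment[OF near_inv[OF h], of k0]] by simp
    qed simp
    from tendsto_real_sqrt[OF this] show "(\<lambda>k. norm (op_apply (lam G h) (\<zeta> k) - \<zeta> k)) \<longlonglongrightarrow> 0" by simp
  qed
  then show False using na by blast
qed

end

section \<open>The Kazhdan projection\<close>

context group
begin

text \<open>The pseudo-inverse of \<open>q\<close> itself, with constant 1: the symmetric idempotent
  with the same range as the possibly oblique \<open>q\<close>, at the price of entries in the
  reduced C*-algebra.\<close>

lemma range_projection:
  assumes "q \<in> mats (group_ring G) n n" "q * q = q"
  obtains f where "f \<in> mats (Cred G) n n" "f * q = q" "q * f = f"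
    "\<And>\<xi> \<eta>. \<xi> \<in> carrier_vec n \<Longrightarrow> \<eta> \<in> carrier_vec n \<Longrightarrow> cinner_vec (mat_apply f \<xi>) \<eta> = cinner_vec \<xi> (mat_apply f \<eta>)"
proof -
  have low: "1 * sqnorm_vec \<xi> \<le> sqnorm_vec (mat_apply q \<xi>)" if "mat_apply q \<xi> = \<xi>" for \<xi>
    using that by simp
  have "(0 :: real) < 1" by simp
  note P = pseudo_inverse[OF assms(1,1,2,2) this low]
  show thesis
  proof (rule P)
    fix s assume s: "s \<in> mats (Cred G) n n" "s * q = q" "q * s = s"
      "\<And>\<xi> \<eta>. \<xi> \<in> carrier_vec n \<Longrightarrow> \<eta> \<in> carrier_vec n \<Longrightarrow>
        cinner_vec (mat_apply (q * s) \<xi>) \<eta> = cinner_vec \<xi> (mat_apply (q * s) \<eta>)"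
    show thesis by (rule that[OF s(1,2,3) s(4)[unfolded s(3)]])
  qed
qed

section \<open>Adjoints and harmonic cochains\<close>

lemma cochain_space_iff: "\<xi> \<in> cochain_space N i \<longleftrightarrow> dim_vec \<xi> = res_rank N i \<and> mat_apply (res_idem N i) \<xi> = \<xi>"
  unfolding cochain_space_def carrier_vec_def by simp

lemma codiff_mem:
  assumes N: "proj_resolution G N"
  shows "codiff N i \<xi> \<in> cochain_space N (Suc i)"
proof -
  note m = resolution_mats[OF N]
  have "mat_apply (res_idem N (Suc i)) (mat_apply (res_diff N i) \<xi>) = mat_apply (res_idem N (Suc i) * res_diff N i) \<xi>"
    by (rule mat_apply_mult[symmetric]) (use mats_dim[OF m(1)[of "Suc i"]] mats_dim[OF m(3)[of i]] in simp)
  then show ?thesis using mats_dim[OF m(3)[of i]] by (simp add: cochain_space_iff codiff_def m(4))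
qed

text \<open>The adjoint matrix may lead out of the cochain space, so it is followed by the
  orthogonal projection onto that space; uniqueness then evaluates the description in
  \<open>codiff_adjoint\<close>.\<close>

lemma codiff_adjoint:
  assumes N: "proj_resolution G N" and \<eta>: "\<eta> \<in> carrier_vec (res_rank N (Suc i))"
  shows "codiff_adjoint N i \<eta> \<in> cochain_space N i"
    "\<And>\<xi>. \<xi> \<in> cochain_space N i \<Longrightarrow> cinner_vec (codiff_adjoint N i \<eta>) \<xi> = cinner_vec \<eta> (codiff N i \<xi>)"
proof -
  note m = resolution_mats[OF N, of i]
  obtain d' where d': "d' \<in> mats (group_ring G) (res_rank N i) (res_rank N (Suc i))" and adj:
    "\<And>\<xi> \<eta>. \<xi> \<in> carrier_vec (res_rank N i) \<Longrightarrow> \<eta> \<in> carrier_vec (res_rank N (Suc i)) \<Longrightarrow>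
      cinner_vec (mat_apply (res_diff N i) \<xi>) \<eta> = cinner_vec \<xi> (mat_apply d' \<eta>)"
    using mats_group_ring_adjoint[OF m(3)] by blast
  obtain f where f: "f \<in> mats (Cred G) (res_rank N i) (res_rank N i)" "f * res_idem N i = res_idem N i"
    "res_idem N i * f = f" and self: "\<And>\<xi> \<eta>. \<xi> \<in> carrier_vec (res_rank N i) \<Longrightarrow> \<eta> \<in> carrier_vec (res_rank N i) \<Longrightarrow>
      cinner_vec (mat_apply f \<xi>) \<eta> = cinner_vec \<xi> (mat_apply f \<eta>)"
    using range_projection[OF m(1,2)] by blast
  note [simp] = mats_dim[OF m(1)] mats_dim[OF m(3)] mats_dim[OF d'] mats_dim[OF f(1)]
  define \<zeta> where "\<zeta> = mat_apply f (mat_apply d' \<eta>)"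
  have \<zeta>: "\<zeta> \<in> cochain_space N i"
  proof -
    have "mat_apply (res_idem N i) \<zeta> = mat_apply (res_idem N i * f) (mat_apply d' \<eta>)"
      unfolding \<zeta>_def by (rule mat_apply_mult[symmetric]) simp
    then show ?thesis by (simp add: cochain_space_iff f(3) \<zeta>_def)
  qed
  have adjoint: "cinner_vec \<zeta> \<xi> = cinner_vec \<eta> (codiff N i \<xi>)" if "\<xi> \<in> cochain_space N i" for \<xi>
  proof -
    have \<xi>: "\<xi> \<in> carrier_vec (res_rank N i)" "mat_apply (res_idem N i) \<xi> = \<xi>" using that by (auto simp: cochain_space_def)
    have "mat_apply f \<xi> = mat_apply (f * res_idem N i) \<xi>" by (simp add: mat_apply_mult \<xi>(2))
    then have f\<xi>: "mat_apply f \<xi> = \<xi>" by (simp add: f(2) \<xi>(2))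
    have "cinner_vec \<zeta> \<xi> = cinner_vec (mat_apply d' \<eta>) (mat_apply f \<xi>)"
      unfolding \<zeta>_def by (rule self) (auto simp: carrier_vecI \<xi>)
    also have "\<dots> = cnj (cinner_vec \<xi> (mat_apply d' \<eta>))"
      unfolding f\<xi> using \<xi> by (intro cinner_vec_commute) auto
    also have "\<dots> = cnj (cinner_vec (mat_apply (res_diff N i) \<xi>) \<eta>)" using adj[OF \<xi>(1) \<eta>] by simp
    also have "\<dots> = cinner_vec \<eta> (mat_apply (res_diff N i) \<xi>)"
      by (rule cinner_vec_commute[symmetric]) (use \<eta> in auto)
    finally show ?thesis by (simp add: codiff_def)
  qed
  have "codiff_adjoint N i \<eta> = \<zeta>"
    unfolding codiff_adjoint_def
  proof (rule the_equality)
    show "\<zeta> \<in> cochain_space N i \<and> (\<forall>\<xi>\<in>cochain_space N i. cinner_vec \<zeta> \<xi> = cinner_vec \<eta> (codiff N i \<xi>))"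
      using \<zeta> adjoint by blast
    fix \<zeta>' assume \<zeta>': "\<zeta>' \<in> cochain_space N i \<and> (\<forall>\<xi>\<in>cochain_space N i. cinner_vec \<zeta>' \<xi> = cinner_vec \<eta> (codiff N i \<xi>))"
    have dims: "dim_vec \<zeta>' = res_rank N i" "dim_vec \<zeta> = res_rank N i" using \<zeta> \<zeta>' by (auto simp: cochain_space_iff)
    have mem: "\<zeta>' - \<zeta> \<in> cochain_space N i"
      using \<zeta> \<zeta>' by (simp add: cochain_space_iff mat_apply_simps)
    have "cinner_vec (\<zeta>' - \<zeta>) (\<zeta>' - \<zeta>) = cinner_vec \<zeta>' (\<zeta>' - \<zeta>) - cinner_vec \<zeta> (\<zeta>' - \<zeta>)"
      by (rule cinner_vec_simps(3)) (simp add: dims)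
    also have "\<dots> = 0" using adjoint[OF mem] \<zeta>' mem by simp
    finally show "\<zeta>' = \<zeta>" by (rule vec_eq_if_cinner_vec_diff[rotated]) (simp add: dims)
  qed
  then show "codiff_adjoint N i \<eta> \<in> cochain_space N i"
    "\<And>\<xi>. \<xi> \<in> cochain_space N i \<Longrightarrow> cinner_vec (codiff_adjoint N i \<eta>) \<xi> = cinner_vec \<eta> (codiff N i \<xi>)"
    using \<zeta> adjoint by auto
qed

text \<open>Pairing the Laplacian of \<open>\<xi>\<close> with \<open>\<xi>\<close> gives the sum of
  the squared norms of its codifferential and of its adjoint codifferential.\<close>

lemma harmonic_space_1_iff:
  assumes N: "proj_resolution G N"
  shows "\<xi> \<in> harmonic_space N 1 \<longleftrightarrow> \<xi> \<in> cochain_space N 1 \<and> codiff N 1 \<xi> = 0\<^sub>v (res_rank N 2) \<and>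
    (\<forall>\<zeta> \<in> cochain_space N 0. cinner_vec \<xi> (codiff N 0 \<zeta>) = 0)"
proof (cases "\<xi> \<in> cochain_space N 1")
  case True
  have \<xi>: "\<xi> \<in> carrier_vec (res_rank N (Suc 0))" using True by (auto simp: cochain_space_def)
  have d\<xi>: "codiff N 1 \<xi> \<in> carrier_vec (res_rank N (Suc 1))" using codiff_mem[OF N, of 1 \<xi>] by (simp add: cochain_space_def)
  note a = codiff_adjoint[OF N d\<xi>] and v = codiff_adjoint[OF N \<xi>]
  let ?a = "codiff_adjoint N 1 (codiff N 1 \<xi>)" and ?v = "codiff_adjoint N 0 \<xi>"
  have dims: "dim_vec ?a = res_rank N 1" "dim_vec (codiff N 0 ?v) = res_rank N 1" "dim_vec \<xi> = res_rank N 1"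
    "dim_vec ?v = res_rank N 0" "dim_vec (codiff N 1 \<xi>) = res_rank N 2"
    using a(1) codiff_mem[OF N, of 0 ?v] True v(1) d\<xi> by (auto simp: cochain_space_iff numeral_2_eq_2)
  have "cinner_vec (codiff N 0 ?v) \<xi> = cnj (cinner_vec \<xi> (codiff N 0 ?v))"
    by (rule cinner_vec_commute) (simp add: dims)
  also have "\<dots> = of_real (sqnorm_vec ?v)" unfolding v(2)[OF v(1), symmetric] cinner_vec_self by simp
  finally have inner: "cinner_vec (?a + codiff N 0 ?v) \<xi> = of_real (sqnorm_vec (codiff N 1 \<xi>) + sqnorm_vec ?v)"
    using a(2)[OF True] dims by (subst cinner_vec_simps) (simp_all add: cinner_vec_self)
  have lap: "laplacian N 1 \<xi> = ?a + codiff N 0 ?v" by simp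
  have v_iff: "?v = 0\<^sub>v (res_rank N 0) \<longleftrightarrow> (\<forall>\<zeta> \<in> cochain_space N 0. cinner_vec \<xi> (codiff N 0 \<zeta>) = 0)"
  proof
    assume "?v = 0\<^sub>v (res_rank N 0)"
    then show "\<forall>\<zeta> \<in> cochain_space N 0. cinner_vec \<xi> (codiff N 0 \<zeta>) = 0" using v(2) by simp
  next
    assume "\<forall>\<zeta> \<in> cochain_space N 0. cinner_vec \<xi> (codiff N 0 \<zeta>) = 0"
    then have "cinner_vec ?v ?v = 0" using v by simp
    then show "?v = 0\<^sub>v (res_rank N 0)" using dims by (simp add: cinner_vec_self sqnorm_vec_eq_0)
  qed
  have "laplacian N 1 \<xi> = 0\<^sub>v (res_rank N 1) \<longleftrightarrow> codiff N 1 \<xi> = 0\<^sub>v (res_rank N 2) \<and> ?v = 0\<^sub>v (res_rank N 0)"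
  proof
    assume "laplacian N 1 \<xi> = 0\<^sub>v (res_rank N 1)"
    then have "of_real (sqnorm_vec (codiff N 1 \<xi>) + sqnorm_vec ?v) = (0 :: complex)" using inner unfolding lap by simp
    then have "sqnorm_vec (codiff N 1 \<xi>) + sqnorm_vec ?v = 0" by (simp only: of_real_eq_0_iff)
    then have "sqnorm_vec (codiff N 1 \<xi>) = 0" "sqnorm_vec ?v = 0"
      using sqnorm_vec_nonneg[of "codiff N 1 \<xi>"] sqnorm_vec_nonneg[of ?v] by linarith+
    then show "codiff N 1 \<xi> = 0\<^sub>v (res_rank N 2) \<and> ?v = 0\<^sub>v (res_rank N 0)"
      unfolding sqnorm_vec_eq_0 dims by blast
  next
    assume z: "codiff N 1 \<xi> = 0\<^sub>v (res_rank N 2) \<and> ?v = 0\<^sub>v (res_rank N 0)"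
    have "cinner_vec ?a ?a = 0" using a(2)[OF a(1)] z by simp
    then have a0: "?a = 0\<^sub>v (res_rank N 1)" using dims by (simp add: cinner_vec_self sqnorm_vec_eq_0)
    have "dim_row (res_diff N 0) = res_rank N 1" "dim_col (res_diff N 0) = res_rank N 0"
      using mats_dim[OF resolution_mats(3)[OF N, of 0]] by auto
    then have "codiff N 0 ?v = 0\<^sub>v (res_rank N 1)"
      using z mat_apply_zero[of "res_diff N 0"] by (simp add: codiff_def)
    then show "laplacian N 1 \<xi> = 0\<^sub>v (res_rank N 1)" unfolding lap a0 by (simp add: vec_eq_iff)
  qed
  then show ?thesis using True v_iff by (simp add: harmonic_space_def)
qed (simp add: harmonic_space_def)

text \<open>With \<open>f\<close> the orthogonal projection onto the range of \<open>e\<close> and \<open>s\<close> the pseudo-inverse of the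
  differential \<open>d\<close>, the Kazhdan projection is \<open>f - d s\<close>, and \<open>e\<close> splits into it and \<open>d s\<close>.\<close>

lemma kazhdan_projection_class:
  assumes N: "proj_resolution G N" and na: "\<not> amenable G"
    and e: "e \<in> mats (group_ring G) (res_rank N 1) (res_rank N 1)" "e * e = e"
    and ed: "e * res_diff N 0 = res_diff N 0" and d1e: "res_diff N 1 * e = 0\<^sub>m (res_rank N 2) (res_rank N 1)"
    and y: "y \<in> mats (group_ring G) (res_rank N 1) (res_rank N 2)" "res_idem N 1 - e = y * res_diff N 1"
    and qe: "res_idem N 1 * e = e"
  shows "kazhdan_projection N 1 \<in> idem_mats (Cred G)"
    "idem_equiv (Cred G) e (diag_sum (kazhdan_projection N 1) (res_idem N 0))"
proof -
  define q0 q1 d d1 where "q0 = res_idem N 0" and "q1 = res_idem N 1" and "d = res_diff N 0" and "d1 = res_diff N 1"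
  define n0 n1 n2 where "n0 = res_rank N 0" and "n1 = res_rank N 1" and "n2 = res_rank N 2"
  note defs = q0_def q1_def d_def d1_def n0_def n1_def n2_def
  have q0: "q0 \<in> mats (group_ring G) n0 n0" "q0 * q0 = q0" and q1: "q1 \<in> mats (group_ring G) n1 n1" "q1 * q1 = q1"
    and d: "d \<in> mats (group_ring G) n1 n0" "q1 * d = d" "d * q0 = d"
    and d1: "d1 \<in> mats (group_ring G) n2 n1" "d1 * q1 = d1"
    using resolution_mats[OF N, of 0] resolution_mats[OF N, of 1] by (auto simp: defs numeral_2_eq_2)
  note e = e[folded defs] and ed = ed[folded defs] and d1e = d1e[folded defs] and y = y[folded defs] and qe = qe[folded defs]
  obtain c where c: "0 < c" "\<And>\<xi>. \<xi> \<in> carrier_vec n0 \<Longrightarrow> mat_apply q0 \<xi> = \<xi> \<Longrightarrow> c * sqnorm_vec \<xi> \<le> sqnorm_vec (mat_apply d \<xi>)"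
    using codiff_bounded_below[OF N na] unfolding defs by blast
  obtain s where s: "s \<in> mats (Cred G) n0 n1" "s * d = q0" "q0 * s = s" and ds_self:
    "\<And>\<xi> \<eta>. \<xi> \<in> carrier_vec n1 \<Longrightarrow> \<eta> \<in> carrier_vec n1 \<Longrightarrow> cinner_vec (mat_apply (d * s) \<xi>) \<eta> = cinner_vec \<xi> (mat_apply (d * s) \<eta>)"
    using pseudo_inverse[OF d(1) q0 d(3) c] by blast
  obtain f where f: "f \<in> mats (Cred G) n1 n1" "f * e = e" "e * f = f" and f_self:
    "\<And>\<xi> \<eta>. \<xi> \<in> carrier_vec n1 \<Longrightarrow> \<eta> \<in> carrier_vec n1 \<Longrightarrow> cinner_vec (mat_apply f \<xi>) \<eta> = cinner_vec \<xi> (mat_apply f \<eta>)"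
    using range_projection[OF e] by blast
  note [simp] = mats_dim[OF q0(1)] mats_dim[OF q1(1)] mats_dim[OF d(1)] mats_dim[OF d1(1)] mats_dim[OF e(1)]
    mats_dim[OF y(1)] mats_dim[OF s(1)] mats_dim[OF f(1)]
  have zero: "A - A = 0\<^sub>m (dim_row A) (dim_col A)" for A :: "'a ell2_op mat" by (auto simp: mat_eq_iff)
  have dC: "d \<in> mats (Cred G) n1 n0" and eC: "e \<in> mats (Cred G) n1 n1"
    by (auto intro: mats_group_ring_Cred d e)
  define p where "p = f - d * s"
  have p: "p \<in> mats (Cred G) n1 n1" unfolding p_def by (intro Cred.mats_closed(3) f Cred.mats_closed(1)[OF dC s(1)])
  note [simp] = mats_dim[OF p]
  have fd: "f * d = d"
  proof -
    have "f * d = f * e * d" by (simp add: mat_mult_assoc ed)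
    then show ?thesis by (simp add: f ed)
  qed
  have dsd: "d * (s * d) = d" by (simp add: s d)
  have pd: "p * d = 0\<^sub>m n1 n0" by (simp add: p_def mat_distrib fd mat_mult_assoc dsd zero)
  have ep: "e * p = p" by (simp add: p_def mat_distrib f ed flip: mat_mult_assoc)
  have p_self: "cinner_vec (mat_apply p \<xi>) \<eta> = cinner_vec \<xi> (mat_apply p \<eta>)"
    if "\<xi> \<in> carrier_vec n1" "\<eta> \<in> carrier_vec n1" for \<xi> \<eta>
  proof -
    have "cinner_vec (mat_apply p \<xi>) \<eta> = cinner_vec (mat_apply f \<xi>) \<eta> - cinner_vec (mat_apply (d * s) \<xi>) \<eta>"
      unfolding p_def by (subst mat_apply_simps, simp, simp, subst cinner_vec_simps, simp_all)
    also have "\<dots> = cinner_vec \<xi> (mat_apply f \<eta>) - cinner_vec \<xi> (mat_apply (d * s) \<eta>)"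
      by (simp only: f_self[OF that] ds_self[OF that])
    also have "\<dots> = cinner_vec \<xi> (mat_apply p \<eta>)"
      unfolding p_def using that by (subst mat_apply_simps, simp, simp, subst cinner_vec_simps(4), simp_all)
    finally show ?thesis .
  qed
  \<comment> \<open>From \<open>q1 - e = y * d1\<close> and \<open>d1 * e = 0\<close> the vectors
    fixed by \<open>e\<close> are exactly the cocycles in degree 1.\<close>
  have harmonic: "\<xi> \<in> harmonic_space N 1 \<longleftrightarrow> \<xi> \<in> carrier_vec n1 \<and> mat_apply e \<xi> = \<xi> \<and>
      (\<forall>\<zeta> \<in> carrier_vec n0. mat_apply q0 \<zeta> = \<zeta> \<longrightarrow> cinner_vec \<xi> (mat_apply d \<zeta>) = 0)" for \<xi> :: "'a ell2 vec"
  proof -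
    have "mat_apply q1 \<xi> = \<xi> \<and> mat_apply d1 \<xi> = 0\<^sub>v n2 \<longleftrightarrow> mat_apply e \<xi> = \<xi>" if \<xi>: "\<xi> \<in> carrier_vec n1"
    proof
      assume a: "mat_apply q1 \<xi> = \<xi> \<and> mat_apply d1 \<xi> = 0\<^sub>v n2"
      have "mat_apply q1 \<xi> - mat_apply e \<xi> = mat_apply (y * d1) \<xi>"
        unfolding y(2)[symmetric] by (rule mat_apply_simps(2)[symmetric]) simp_all
      also have "\<dots> = 0\<^sub>v n1" using a mat_apply_zero[of y] by (simp add: mat_apply_mult)
      finally show "mat_apply e \<xi> = \<xi>" using a \<xi> by (auto simp: vec_eq_iff)
    next
      assume a: "mat_apply e \<xi> = \<xi>"
      have "mat_apply q1 \<xi> = mat_apply (q1 * e) \<xi>" "mat_apply d1 \<xi> = mat_apply (d1 * e) \<xi>" by (simp_all add: mat_apply_mult a)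
      then show "mat_apply q1 \<xi> = \<xi> \<and> mat_apply d1 \<xi> = 0\<^sub>v n2"
        by (simp add: qe d1e a mat_apply_simps)
    qed
    then show ?thesis
      unfolding harmonic_space_1_iff[OF N] cochain_space_def codiff_def defs[symmetric] by auto
  qed
  have proj: "mat_apply p \<xi> \<in> harmonic_space N 1" if \<xi>: "\<xi> \<in> carrier_vec n1" for \<xi>
    unfolding harmonic
  proof (intro conjI ballI impI)
    show "mat_apply p \<xi> \<in> carrier_vec n1" by (simp add: carrier_vecI)
    show "mat_apply e (mat_apply p \<xi>) = mat_apply p \<xi>" by (simp add: ep flip: mat_apply_mult)
    fix \<zeta> :: "'a ell2 vec" assume "\<zeta> \<in> carrier_vec n0"
    have "cinner_vec (mat_apply p \<xi>) (mat_apply d \<zeta>) = cinner_vec \<xi> (mat_apply (p * d) \<zeta>)"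
      by (subst p_self[OF \<xi>]) (simp_all add: carrier_vecI mat_apply_mult)
    then show "cinner_vec (mat_apply p \<xi>) (mat_apply d \<zeta>) = 0"
      using \<xi> cinner_vec_zero(1)[of \<xi>] by (simp add: pd mat_apply_simps)
  qed
  have fixed: "mat_apply p \<eta> = \<eta>" if "\<eta> \<in> harmonic_space N 1" for \<eta>
  proof -
    have \<eta>: "\<eta> \<in> carrier_vec n1" "mat_apply e \<eta> = \<eta>" and orth:
      "\<And>\<zeta>. \<zeta> \<in> carrier_vec n0 \<Longrightarrow> mat_apply q0 \<zeta> = \<zeta> \<Longrightarrow> cinner_vec \<eta> (mat_apply d \<zeta>) = 0"
      using that unfolding harmonic by auto
    have "mat_apply f \<eta> = mat_apply (f * e) \<eta>" by (simp add: mat_apply_mult \<eta>(2))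
    then have f\<eta>: "mat_apply f \<eta> = \<eta>" by (simp add: f(2) \<eta>(2))
    let ?w = "mat_apply (d * s) \<eta>"
    have "cinner_vec ?w ?w = cinner_vec \<eta> (mat_apply (d * s) ?w)"
      by (rule ds_self[OF \<eta>(1)]) (simp add: carrier_vecI)
    also have "mat_apply (d * s) ?w = mat_apply d (mat_apply s ?w)" by (rule mat_apply_mult) simp
    also have "cinner_vec \<eta> \<dots> = 0"
    proof (rule orth)
      have "mat_apply q0 (mat_apply s ?w) = mat_apply (q0 * s) ?w" by (rule mat_apply_mult[symmetric]) simp
      then show "mat_apply q0 (mat_apply s ?w) = mat_apply s ?w" by (simp only: s(3))
    qed (simp add: carrier_vecI)
    finally have "?w = 0\<^sub>v n1" by (simp add: cinner_vec_self sqnorm_vec_eq_0)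
    moreover have "mat_apply p \<eta> = mat_apply f \<eta> - ?w" unfolding p_def by (rule mat_apply_simps(2)) simp_all
    ultimately show ?thesis using \<eta>(1) by (auto simp: f\<eta> vec_eq_iff)
  qed
  have orth: "cinner_vec \<eta> (\<xi> - mat_apply p \<xi>) = 0" if "\<eta> \<in> harmonic_space N 1" "\<xi> \<in> carrier_vec n1" for \<eta> \<xi>
  proof -
    have \<eta>: "\<eta> \<in> carrier_vec n1" using that(1) unfolding harmonic by blast
    have "cinner_vec \<eta> (\<xi> - mat_apply p \<xi>) = cinner_vec \<eta> \<xi> - cinner_vec \<eta> (mat_apply p \<xi>)"
      by (rule cinner_vec_simps(4)) (use \<eta> that(2) in auto)
    also have "cinner_vec \<eta> (mat_apply p \<xi>) = cinner_vec \<eta> \<xi>" using p_self[OF \<eta> that(2)] fixed[OF that(1)] by simp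
    finally show ?thesis by simp
  qed
  have kp: "kazhdan_projection N 1 = p"
    unfolding kazhdan_projection_def defs[symmetric]
  proof (rule the_equality)
    show "p \<in> carrier_mat n1 n1 \<and> (\<forall>\<xi>\<in>carrier_vec n1. mat_apply p \<xi> \<in> harmonic_space N 1 \<and>
        (\<forall>\<eta>\<in>harmonic_space N 1. cinner_vec \<eta> (\<xi> - mat_apply p \<xi>) = 0))"
      using p proj orth by (auto simp: mats_def)
    fix p' assume p': "p' \<in> carrier_mat n1 n1 \<and> (\<forall>\<xi>\<in>carrier_vec n1. mat_apply p' \<xi> \<in> harmonic_space N 1 \<and>
        (\<forall>\<eta>\<in>harmonic_space N 1. cinner_vec \<eta> (\<xi> - mat_apply p' \<xi>) = 0))"
    show "p' = p"
    proof (rule mat_eq_if_mat_apply_eq)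
      show "dim_row p' = dim_row p" "dim_col p' = dim_col p" using p' by auto
      fix \<xi> :: "'a ell2 vec" assume "\<xi> \<in> carrier_vec (dim_col p)"
      then have \<xi>: "\<xi> \<in> carrier_vec n1" by simp
      let ?w = "mat_apply p' \<xi> - mat_apply p \<xi>"
      have dims: "dim_row p' = n1" using p' by auto
      have h: "mat_apply p' \<xi> \<in> harmonic_space N 1" "mat_apply p \<xi> \<in> harmonic_space N 1" using p' proj \<xi> by auto
      have w: "?w \<in> harmonic_space N 1"
        unfolding harmonic
      proof (intro conjI ballI impI)
        show "?w \<in> carrier_vec n1" by (simp add: carrier_vecI)
        have "mat_apply e ?w = mat_apply e (mat_apply p' \<xi>) - mat_apply e (mat_apply p \<xi>)"
          by (rule mat_apply_simps(4)) (simp_all add: dims)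
        then show "mat_apply e ?w = ?w" using h unfolding harmonic by simp
        fix \<zeta> :: "'a ell2 vec" assume \<zeta>: "\<zeta> \<in> carrier_vec n0" "mat_apply q0 \<zeta> = \<zeta>"
        have "cinner_vec ?w (mat_apply d \<zeta>) = cinner_vec (mat_apply p' \<xi>) (mat_apply d \<zeta>) - cinner_vec (mat_apply p \<xi>) (mat_apply d \<zeta>)"
          by (rule cinner_vec_simps(3)) (simp add: dims)
        then show "cinner_vec ?w (mat_apply d \<zeta>) = 0" using h \<zeta> unfolding harmonic by simp
      qed
      have "?w = (\<xi> - mat_apply p \<xi>) - (\<xi> - mat_apply p' \<xi>)" using \<xi> dims by (auto simp: vec_eq_iff)
      then have "cinner_vec ?w ?w = cinner_vec ?w ((\<xi> - mat_apply p \<xi>) - (\<xi> - mat_apply p' \<xi>))" by simp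
      also have "\<dots> = cinner_vec ?w (\<xi> - mat_apply p \<xi>) - cinner_vec ?w (\<xi> - mat_apply p' \<xi>)"
        by (rule cinner_vec_simps(4)) (simp_all add: dims)
      also have "\<dots> = 0" using orth[OF w \<xi>] p' w \<xi> by simp
      finally show "mat_apply p' \<xi> = mat_apply p \<xi>"
        by (rule vec_eq_if_cinner_vec_diff[rotated]) (simp add: dims)
    qed
  qed
  have ff: "f * f = f"
  proof -
    have "f * e * f = f * (e * f)" by (rule mat_mult_assoc) simp_all
    then show ?thesis unfolding f(2,3) by simp
  qed
  \<comment> \<open>This is \<open>f * (d * s) = d * s\<close> with the order reversed by passing to
    adjoints, verified through inner products because \<open>f\<close> and \<open>d * s\<close> are
    symmetric.\<close>
  have "d * s * f = d * s"
  proof (rule mat_eq_if_mat_apply_eq)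
    fix \<xi> :: "'a ell2 vec" assume "\<xi> \<in> carrier_vec (dim_col (d * s))"
    then have \<xi>: "\<xi> \<in> carrier_vec n1" by simp
    let ?w = "mat_apply (d * s * f) \<xi> - mat_apply (d * s) \<xi>"
    have w: "?w \<in> carrier_vec n1" by (simp add: carrier_vecI)
    have "cinner_vec (mat_apply (d * s * f) \<xi>) ?w = cinner_vec (mat_apply (d * s) (mat_apply f \<xi>)) ?w"
      by (simp add: mat_apply_mult)
    also have "\<dots> = cinner_vec (mat_apply f \<xi>) (mat_apply (d * s) ?w)"
      by (rule ds_self[OF _ w]) (simp add: carrier_vecI)
    also have "\<dots> = cinner_vec \<xi> (mat_apply f (mat_apply (d * s) ?w))"
      by (rule f_self[OF \<xi>]) (simp add: carrier_vecI)
    also have "mat_apply f (mat_apply (d * s) ?w) = mat_apply (f * d * s) ?w" by (simp add: mat_apply_mult mat_mult_assoc)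
    also have "\<dots> = mat_apply (d * s) ?w" by (simp add: fd)
    also have "cinner_vec \<xi> \<dots> = cinner_vec (mat_apply (d * s) \<xi>) ?w" by (rule ds_self[OF \<xi> w, symmetric])
    finally have "cinner_vec ?w ?w = 0" by (subst cinner_vec_simps(3)) simp_all
    then show "mat_apply (d * s * f) \<xi> = mat_apply (d * s) \<xi>"
      by (rule vec_eq_if_cinner_vec_diff[rotated]) simp
  qed simp_all
  then have "s * (d * s * f) = s * (d * s)" by simp
  then have "s * d * (s * f) = s * d * s" by (simp add: mat_mult_assoc)
  then have "q0 * (s * f) = s" by (simp add: s)
  then have sf: "s * f = s" by (simp add: s flip: mat_mult_assoc)
  have sp: "s * p = 0\<^sub>m n0 n1"
  proof -
    have "s * (d * s) = s" by (simp add: s flip: mat_mult_assoc)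
    then show ?thesis by (simp add: p_def mat_distrib sf zero)
  qed
  have "p * p = f * p - d * (s * p)" by (subst p_def(1)) (simp add: mat_distrib mat_mult_assoc)
  also have "f * p = p" by (simp add: p_def mat_distrib ff fd flip: mat_mult_assoc)
  finally have pp: "p * p = p" by (auto simp: sp mat_zero_mult mat_eq_iff)
  have "p \<in> idem_mats (Cred G)" by (rule idem_matsI[OF p pp])
  then show "kazhdan_projection N 1 \<in> idem_mats (Cred G)" by (simp only: kp)
  \<comment> \<open>A block row and a block column. Their product is
    \<open>(p + d * s) * e = f * e = e\<close>; the factor \<open>e\<close> in \<open>X\<close> is
    needed because \<open>e\<close> need not be symmetric.\<close>
  define Y where "Y = four_block_mat p d (0\<^sub>m 0 n1) (0\<^sub>m 0 n0)"
  define X where "X = four_block_mat (p * e) (0\<^sub>m n1 0) (s * e) (0\<^sub>m n0 0)"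
  have Y: "Y \<in> mats (Cred G) (n1 + 0) (n1 + n0)" and X: "X \<in> mats (Cred G) (n1 + n0) (n1 + 0)"
    unfolding X_def Y_def
    by (intro Cred.four_block_mats Cred.mats_closed(5) p dC Cred.mats_closed(1)[OF p eC] Cred.mats_closed(1)[OF s(1) eC])+
  have YX: "Y * X = e"
  proof -
    have "Y * X = diag_sum (p * (p * e) + d * (s * e)) (0\<^sub>m 0 0)"
      unfolding X_def Y_def diag_sum_def
      by (subst four_block_mult) (simp_all add: mat_zero_mult mat_add_zero)
    also have "p * (p * e) + d * (s * e) = (p + d * s) * e"
      by (simp add: mat_distrib pp flip: mat_mult_assoc)
    also have "p + d * s = f" unfolding p_def by (auto simp: mat_eq_iff simp del: index_mult_mat(1))
    finally show ?thesis by (simp add: f)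
  qed
  have XY: "X * Y = diag_sum p q0"
  proof -
    have "p * e * p = p" "p * e * d = 0\<^sub>m n1 n0" "s * e * p = 0\<^sub>m n0 n1" "s * e * d = q0"
      by (simp_all add: mat_mult_assoc ep ed pp pd sp s)
    then show ?thesis
      unfolding X_def Y_def diag_sum_def
      by (subst four_block_mult) (simp_all add: mat_zero_mult mat_add_zero)
  qed
  show "idem_equiv (Cred G) e (diag_sum (kazhdan_projection N 1) (res_idem N 0))"
    unfolding kp q0_def[symmetric] idem_equiv_iff diag_sum_dim using X Y XY YX
    by (intro bexI[of _ Y] bexI[of _ X]) simp_all
qed

end

theorem corollaryC:
  fixes G :: "('g, 'm) monoid_scheme"
    and V :: "'v set" and E :: "'v set set" and \<phi> :: "'g \<Rightarrow> 'v \<Rightarrow> 'v" and g :: 'g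
    and S :: "'g ell2_op set" and \<nu> :: "'g ell2_op \<Rightarrow> real" and t :: "'g ell2_op \<Rightarrow> complex"
    and N :: "'g proj_complex"
  assumes "group G" and "fin_generated G" and "virtually_free G" and "\<not> amenable G"
    and "tree_action G V E \<phi>" and "proper_action G V \<phi>"
    and "g \<in> carrier G" and "\<exists>v \<in> V. \<phi> g v = v" and "\<forall>e \<in> E. \<phi> g ` e \<noteq> e"
    and "smooth_subalgebra G S \<nu>" and "deloc_trace_extension G g S \<nu> t"
    and "proj_resolution G N"
  shows "deloc_betti G S t N 1 \<noteq> 0 \<and> (\<exists>r \<in> fin_order_rats G. deloc_betti G S t N 1 = of_rat r)"
proof -
  interpret group G by fact
  note smooth = \<open>smooth_subalgebra G S \<nu>\<close> and N = \<open>proj_resolution G N\<close>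
  note S = smooth_corner_ring[OF smooth] and RS = smooth_group_ring[OF smooth] and SC = smooth_Cred[OF smooth]
  obtain M r where M: "proj_resolution G M" "res_rank M 2 = 0" and r: "r \<in> fin_order_rats G" "r \<noteq> 0"
    and tr: "\<And>t. (\<And>a. a \<in> group_ring G \<Longrightarrow> t a = (\<Sum>h | h \<in> conj_class G g \<and> coeff_fun G a h \<noteq> 0. coeff_fun G a h)) \<Longrightarrow>
      mat_trace t (res_idem M 1) = 0 \<and> mat_trace t (res_idem M 0) = of_rat r"
    using tree_resolution_exists[OF assms(2,5,6,7,8,9)] by blast
  obtain e y where e: "e \<in> mats (group_ring G) (res_rank N 1) (res_rank N 1)" "e * e = e"
    "e * res_diff N 0 = res_diff N 0" "res_diff N 1 * e = 0\<^sub>m (res_rank N 2) (res_rank N 1)"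
    "y \<in> mats (group_ring G) (res_rank N 1) (res_rank N 2)" "res_idem N 1 - e = y * res_diff N 1"
    "res_idem N 1 * e = e"
    and eq: "idem_equiv (group_ring G) (diag_sum e (res_idem M 0)) (diag_sum (res_idem N 0) (res_idem M 1))"
    using schanuel[OF N M] by blast
  let ?p = "kazhdan_projection N 1"
  note p = kazhdan_projection_class[OF N assms(4) e]
  have idem: "res_idem L i \<in> idem_mats (group_ring G)" if "proj_resolution G L" for L i
    using resolution_mats(1,2)[OF that] by (rule idem_matsI)
  have toC: "a \<in> idem_mats (Cred G)" if "a \<in> idem_mats (group_ring G)" for a
    using that idem_mats_mono[OF group_ring_Cred] by blast
  have toS: "a \<in> idem_mats S" if "a \<in> idem_mats (group_ring G)" for a
    using that idem_mats_mono[OF RS] by blast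
  have m0: "res_idem M 0 \<in> idem_mats (Cred G)" and m1: "res_idem M 1 \<in> idem_mats (Cred G)"
    and n0: "res_idem N 0 \<in> idem_mats (Cred G)" and eC: "e \<in> idem_mats (Cred G)"
    by (intro toC idem M N idem_matsI[OF e(1,2)])+
  note cl = Cred.idem_class_eq_iff and ds = Cred.idem_class_diag_sum and dsi = Cred.diag_sum_idem
  have 1: "Cred.idem_class e = Cred.class_sum (Cred.idem_class ?p) (Cred.idem_class (res_idem N 0))"
    using p cl[OF eC dsi[OF p(1) n0]] ds[OF p(1) n0] by simp
  have 2: "Cred.class_sum (Cred.idem_class e) (Cred.idem_class (res_idem M 0)) =
      Cred.class_sum (Cred.idem_class (res_idem N 0)) (Cred.idem_class (res_idem M 1))"
    using idem_equiv_mono[OF group_ring_Cred eq] cl[OF dsi[OF eC m0] dsi[OF n0 m1]] ds[OF eC m0] ds[OF n0 m1] by simp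
  \<comment> \<open>Classes cannot be cancelled in the semigroup in general;
    \<open>res_idem N 0\<close>, common to both sides, is kept as the stabilising idempotent of
    \<open>K0_rel\<close>.\<close>
  have "Cred.idem_class (diag_sum (diag_sum ?p (res_idem M 0)) (res_idem N 0)) =
      Cred.idem_class (diag_sum (res_idem M 1) (res_idem N 0))"
    using 2 by (simp only: ds dsi p(1) m0 m1 n0 1 Cred.class_sum.assoc Cred.class_sum.commute Cred.class_sum.left_commute)
  then have "idem_equiv (Cred G) (diag_sum (diag_sum ?p (res_idem M 0)) (res_idem N 0))
      (diag_sum (diag_sum (res_idem M 1) (0\<^sub>m 0 0)) (res_idem N 0))"
    by (simp add: cl dsi p(1) m0 m1 n0 del: One_nat_def)
  then have rel: "((?p, 0\<^sub>m 0 0), (res_idem M 1, res_idem M 0)) \<in> K0_rel (Cred G)"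
    unfolding K0_rel_def using p(1) m0 m1 n0 Cred.empty_idem by blast
  have t: "t (a + b) = t a + t b" "t (a * b) = t (b * a)" if "a \<in> S" "b \<in> S" for a b
    using assms(11) that by (auto simp: deloc_trace_extension_def)
  \<comment> \<open>The idempotents of the tree resolution have entries in \<open>S\<close>, so
    their formal difference represents the preimage under the inclusion of K-groups.\<close>
  have "deloc_betti G S t N 1 = mat_trace t (res_idem M 1) - mat_trace t (res_idem M 0)"
    unfolding deloc_betti_def K0_deloc_trace_def
    by (rule K0_trace_the_inv_into[OF S Cred.corner_ring_axioms SC idem_equiv_smooth[OF smooth] t _ _ rel])
      (use toS idem M in blast)+
  also have "\<dots> = of_rat (- r)"
    using tr[of t] deloc_trace_group_ring[OF assms(11) RS] by (simp add: of_rat_minus)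
  finally have b: "deloc_betti G S t N 1 = of_rat (- r)" .
  have "- r \<in> fin_order_rats G" using r(1) by (simp add: fin_order_rats_def)
  with b r(2) show ?thesis by auto
qed

end
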